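(* Let $A \in \mathcal{Q}$ be such that the hermitian matrix $As$ is positive definite. Then $$\lim_{\epsilon \to 0^+} \int_{PS} e^{-\operatorname{Tr}(Q^2) - 2i \operatorname{Tr}(QA)}\, \chi_\epsilon(Q)\, dQ \;=\; c\, e^{-\operatorname{Tr}(A^2)},$$ where $c \in \mathbb{C}\setminus\{0\}$ is a constant that does not depend on $A$. Here $dQ$ is a fixed constant volume form on $\mathcal{Q}$, and for $\epsilon>0$ the regulating function is $\chi_\epsilon(Q) = \exp\big(\tfrac{\epsilon}{4}\operatorname{Tr}[Q-\theta(Q)]^2\big)$, which satisfies $\chi_\epsilon(Q)\le 1$ on $\mathcal{Q}$.
   Context: Standing setting. Let $s \in \mathfrak{gl}(n,\mathbb{C})$ be hermitian with $s^2 = \mathbb{1}$. Define two involutive real Lie algebra automorphisms of $\mathfrak{gl}(n,\mathbb{C})$ by $\theta(X) = sXs^{-1}$ and $\gamma(X) = -sX^\dagger s^{-1}$. Further, let $\tau_1,\dots,\tau_r$ be (possibly zero in number) involutive Lie algebra automorphisms of $\mathfrak{gl}(n,\mathbb{C})$ such that all of $\theta,\gamma,\tau_1,\dots,\tau_r$ commute pairwise, and such that $s = \eta_i \tau_i(s)$ with $\eta_i \in \{\pm1\}$ for each $i$. Put $\mathfrak{g} = \{X : X = \gamma(X),\ X = \tau_i(X)\ \forall i\}$ (a real Lie algebra) and $\mathcal{Q} = \{Q : Q = -\gamma(Q),\ Q = \eta_i\tau_i(Q)\ \forall i\}$ (a real vector space). Decompose into $\pm1$ eigenspaces of $\theta$: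 $\mathfrak{g} = \mathfrak{k}\oplus\mathfrak{p}$ ($\mathfrak{k}$ antihermitian, $\mathfrak{p}$ hermitian matrices) and $\mathcal{Q} = \mathcal{Q}_+\oplus\mathcal{Q}_-$ ($\mathcal{Q}_+$ hermitian, $\mathcal{Q}_-$ antihermitian matrices). For $A\in\mathcal{Q}$, $As$ is hermitian; also $s\in\mathcal{Q}_+$. Assume that the Lie group $K=\exp(\mathfrak{k})$ is closed. The Pruisken–Schäfer (PS) domain is the oriented integration domain given by the smooth map $PS : \mathfrak{p}\oplus\mathcal{Q}_+ \to \mathcal{Q}$, $(Y,X)\mapsto e^{Y}Xe^{-Y}$. Fix once and for all orientations of the vector spaces $\mathcal{Q}_+$ and $\mathfrak{p}$; $\mathfrak{p}\oplus\mathcal{Q}_+$ gets the product orientation and $\int_{PS}\omega$ means $\int_{\mathfrak{p}\oplus\mathcal{Q}_+} PS^*\omega$ for a top-degree form $\omega$ on $\mathcal{Q}$. *)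

theory Defs
  imports "HOL-Analysis.Analysis" "HOL-Probability.Probability"
begin

definition adj :: "complex^'n^'n \<Rightarrow> complex^'n^'n" where
  "adj X = (\<chi> i j. cnj (X $ j $ i))"

definition mtrace :: "complex^'n^'n \<Rightarrow> complex" where
  "mtrace X = (\<Sum>i\<in>UNIV. X $ i $ i)"

fun mpow :: "complex^'n^'n \<Rightarrow> nat \<Rightarrow> complex^'n^'n" where
  "mpow X 0 = mat 1"
| "mpow X (Suc k) = X ** mpow X k"

definition mexp :: "complex^'n^'n \<Rightarrow> complex^'n^'n" where
  "mexp X = (\<Sum>k. (1 / fact k) *\<^sub>R mpow X k)"

definition hermitian :: "complex^'n^'n \<Rightarrow> bool" where
  "hermitian X \<longleftrightarrow> adj X = X"

definition pos_def :: "complex^'n^'n \<Rightarrow> bool" where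
  "pos_def M \<longleftrightarrow> hermitian M \<and>
     (\<forall>x::complex^'n. x \<noteq> 0 \<longrightarrow> 0 < Re (\<Sum>i\<in>UNIV. \<Sum>j\<in>UNIV. cnj (x $ i) * M $ i $ j * x $ j))"

definition inv_lie_aut :: "(complex^'n^'n \<Rightarrow> complex^'n^'n) \<Rightarrow> bool" where
  "inv_lie_aut f \<longleftrightarrow> linear f \<and> bij f \<and> (\<forall>X. f (f X) = X) \<and>
     (\<forall>X Y. f (X ** Y - Y ** X) = f X ** f Y - f Y ** f X)"

definition theta :: "complex^'n^'n \<Rightarrow> complex^'n^'n \<Rightarrow> complex^'n^'n" where
  "theta s X = s ** X ** matrix_inv s"

definition gamma :: "complex^'n^'n \<Rightarrow> complex^'n^'n \<Rightarrow> complex^'n^'n" where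
  "gamma s X = - (s ** adj X ** matrix_inv s)"

text \<open>The data \<tau>_1..\<tau>_r, \<eta>_1..\<eta>_r are given as a list of pairs (\<tau>_i, \<eta>_i).\<close>

definition gset :: "complex^'n^'n \<Rightarrow> ((complex^'n^'n \<Rightarrow> complex^'n^'n) \<times> real) list \<Rightarrow> (complex^'n^'n) set" where
  "gset s tes = {X. X = gamma s X \<and> (\<forall>(t,e)\<in>set tes. X = t X)}"

definition Qset :: "complex^'n^'n \<Rightarrow> ((complex^'n^'n \<Rightarrow> complex^'n^'n) \<times> real) list \<Rightarrow> (complex^'n^'n) set" where
  "Qset s tes = {Q. Q = - gamma s Q \<and> (\<forall>(t,e)\<in>set tes. Q = e *\<^sub>R t Q)}"

definition kset where "kset s tes = {X \<in> gset s tes. theta s X = X}"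
definition pset where "pset s tes = {X \<in> gset s tes. theta s X = - X}"
definition Qplus where "Qplus s tes = {X \<in> Qset s tes. theta s X = X}"
definition Qminus where "Qminus s tes = {X \<in> Qset s tes. theta s X = - X}"

text \<open>The group K = exp(k): the subgroup of GL(n,C) generated by exp of elements of k.\<close>
inductive_set Kgroup :: "(complex^'n^'n) set \<Rightarrow> (complex^'n^'n) set" for k where
  one: "mat 1 \<in> Kgroup k"
| step: "X \<in> k \<Longrightarrow> g \<in> Kgroup k \<Longrightarrow> mexp X ** g \<in> Kgroup k"

definition PS :: "complex^'n^'n \<Rightarrow> complex^'n^'n \<Rightarrow> complex^'n^'n" where
  "PS Y X = mexp Y ** X ** mexp (- Y)"

definition ordered_basis :: "'a::real_vector list \<Rightarrow> 'a set \<Rightarrow> bool" where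
  "ordered_basis b V \<longleftrightarrow> distinct b \<and> independent (set b) \<and> span (set b) = V"

definition coords :: "'a::real_vector list \<Rightarrow> 'a \<Rightarrow> nat \<Rightarrow> real" where
  "coords b v = (THE c. (\<forall>j. length b \<le> j \<longrightarrow> c j = 0) \<and> v = (\<Sum>j<length b. c j *\<^sub>R b ! j))"

definition ndet :: "nat \<Rightarrow> (nat \<Rightarrow> nat \<Rightarrow> real) \<Rightarrow> real" where
  "ndet m M = (\<Sum>p | p permutes {..<m}. of_int (sign p) * (\<Prod>i<m. M i (p i)))"

text \<open>Linear coordinate chart of p (+) Q_+ from the oriented bases bp, bq:
  y_0..y_{dp-1} are the p-coordinates, y_dp..y_{dp+dq-1} the Q_+-coordinates.\<close>
definition PSchart where
  "PSchart bp bq y = PS (\<Sum>k<length bp. y k *\<^sub>R bp ! k)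
                        (\<Sum>k<length bq. y (length bp + k) *\<^sub>R bq ! k)"

text \<open>Pull back of the constant volume form dQ (determined by the ordered basis bQ of Q,
  i.e. dQ = the dual wedge of bQ) under PS, evaluated on the oriented coordinate frame:
  the Jacobian determinant dQ(d_0 PS, ..., d_{m-1} PS).\<close>
definition PSjac where
  "PSjac bp bq bQ y = ndet (length bQ)
     (\<lambda>i j. coords bQ (vector_derivative (\<lambda>t::real. PSchart bp bq (y(j := y j + t))) (at 0)) i)"

definition chi :: "complex^'n^'n \<Rightarrow> real \<Rightarrow> complex^'n^'n \<Rightarrow> complex" where
  "chi s \<epsilon> Q = exp (complex_of_real (\<epsilon> / 4) * mtrace ((Q - theta s Q) ** (Q - theta s Q)))"

definition integrand where
  "integrand s A \<epsilon> Q = exp (- mtrace (Q ** Q) - 2 * \<i> * mtrace (Q ** A)) * chi s \<epsilon> Q"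

text \<open>The integral over the PS domain of integrand(Q) dQ, as integral over the
  coordinate space R^(dp+dq) (Lebesgue measure) of the pulled back form.\<close>
definition PSintegrand where
  "PSintegrand s A \<epsilon> bp bq bQ y =
     integrand s A \<epsilon> (PSchart bp bq y) * complex_of_real (PSjac bp bq bQ y)"

definition PSdomain :: "'a list \<Rightarrow> 'b list \<Rightarrow> (nat \<Rightarrow> real) measure" where
  "PSdomain bp bq = PiM {..<length bp + length bq} (\<lambda>_. lborel)"

end

theory Submission
  imports Defs "HOL-Complex_Analysis.Conformal_Mappings"
begin

unbundle no fps_syntax

text \<open>
  Write \<open>F(Y,X) = e\<^sup>Y X e\<^sup>-\<^sup>Y\<close>. The form \<open>dQ\<close> and the Gaussian make sense for complex \<open>X\<close>, and replacing
  \<open>X\<close> by \<open>X + z s\<close> is a shift along a single real direction of \<open>\<Q>\<^sub>+\<close>, so analytic continuation in that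
  one variable permits imaginary \<open>z\<close>. Because the Jacobian changes with \<open>z\<close> only polynomially, an interpolation
  formula writes the integral as a combination of integrals over shifted domains. On these, positivity of
  \<open>A s\<close> and \<open>Tr e\<^sup>2\<^sup>Y \<ge> n + 2 |Y|\<^sup>2\<close> provide a bound that does not depend on \<open>\<epsilon>\<close>; it is integrable because
  \<open>F\<close> is injective off a null set, so that \<open>|det dF|\<close> is controlled by Lebesgue measure on \<open>\<Q>\<close>. The limit
  is the unregulated integral over the domain shifted by \<open>z = - i b\<close> with small \<open>b > 0\<close>, where the integrand
  decays like a Gaussian in both variables.

  Completing the square, \<open>exp (Tr A\<^sup>2)\<close> times this limit integrates \<open>exp (- Tr (Q + i A)\<^sup>2)\<close>, whose derivative in the
  direction of \<open>A\<close> is a divergence; by Stokes' theorem it is constant in \<open>A\<close>. For \<open>A = \<lambda> s\<close> and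
  \<open>Y = Z / \<lambda>\<close> the limit \<open>\<lambda> \<rightarrow> \<infinity>\<close> turns it into a nondegenerate determinant times the Gaussian integral of
  \<open>exp (- |X|\<^sup>2 - 4 |Z|\<^sup>2)\<close>, hence it is not zero.
\<close>

subsection \<open>Matrices, traces and the matrix exponential\<close>

text \<open>On the real domain Tr F(Y,X)^2 = Tr X^2, so without the regulator nothing decays in
  \<open>Y\<close>. Decay comes from the pairing of F(Y,s) = e^(2Y) s with \<open>A\<close>, which
  an imaginary shift brings into the modulus. For \<epsilon> > 0 the same shift meets the regulator
  and can cost \<epsilon> \<beta>^2 |e^Y|^4; its size is therefore taken as \<beta> = b / (1 +
  \<epsilon> |e^Y|^2), dependent on \<open>Y\<close>, and the shift is made separately for each
  fixed \<open>Y\<close>. A plain shift would also replace the Jacobian by a complex determinant,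
  about which injectivity of F says nothing. Hence the interpolation: for fixed \<open>Y\<close>,
  the integral with shifted integrand but unshifted Jacobian is a polynomial of degree at most
  \<open>m\<close> in the shift, so its value at 0 follows from \<open>m + 1\<close> nodes, all of
  imaginary part 1. Every integral to be dominated then contains the real Jacobian. The symmetries
  \<tau> preserve brackets but not products, so membership in \<Q> is obtained from brackets and
  differential equations.\<close>

lemma norm_matrix_mult_le:
  fixes X :: "complex^'n^'m" and Y :: "complex^'p^'n"
  shows "norm (X ** Y) \<le> norm X * norm Y"
proof -
  define c where "c j = L2_set (\<lambda>k. norm (Y $ k $ j)) UNIV" for j
  have nY: "(norm Y)\<^sup>2 = (\<Sum>j\<in>UNIV. (c j)\<^sup>2)"
    unfolding norm_vec_def c_def L2_set_def
    by (simp add: sum_nonneg) (rule sum.swap)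
  have ent: "norm ((X ** Y) $ i $ j) \<le> norm (X $ i) * c j" for i j
  proof -
    have "norm ((X ** Y) $ i $ j) \<le> (\<Sum>k\<in>UNIV. norm (X $ i $ k * Y $ k $ j))"
      unfolding matrix_matrix_mult_def by (simp add: norm_sum)
    also have "\<dots> = (\<Sum>k\<in>UNIV. \<bar>norm (X $ i $ k)\<bar> * \<bar>norm (Y $ k $ j)\<bar>)"
      by (simp add: norm_mult)
    also have "\<dots> \<le> norm (X $ i) * c j"
      unfolding c_def norm_vec_def by (rule L2_set_mult_ineq)
    finally show ?thesis .
  qed
  have "(norm (X ** Y))\<^sup>2 = (\<Sum>i\<in>UNIV. \<Sum>j\<in>UNIV. (norm ((X ** Y) $ i $ j))\<^sup>2)"
    unfolding norm_vec_def L2_set_def by (simp add: sum_nonneg)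
  also have "\<dots> \<le> (\<Sum>i\<in>UNIV. \<Sum>j\<in>UNIV. (norm (X $ i) * c j)\<^sup>2)"
    by (intro sum_mono power_mono ent) auto
  also have "\<dots> = (\<Sum>i\<in>UNIV. (norm (X $ i))\<^sup>2) * (norm Y)\<^sup>2"
    by (simp add: nY power_mult_distrib sum_product)
  also have "\<dots> = (norm X * norm Y)\<^sup>2"
    unfolding norm_vec_def[of X] L2_set_def by (simp add: sum_nonneg power_mult_distrib)
  finally show ?thesis
    by (rule power2_le_imp_le) auto
qed

text \<open>This is the source of all product rules, limits and continuity statements for matrix
  products below, such as \<open>mm.FDERIV\<close>, \<open>mm.has_vector_derivative\<close> and
  \<open>mm.tendsto\<close>.\<close>

interpretation mm: bounded_bilinear "matrix_matrix_mult :: complex^'n^'m \<Rightarrow> complex^'p^'n \<Rightarrow> complex^'p^'m"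
proof
  fix A A' :: "complex^'n^'m" and B B' :: "complex^'p^'n" and r :: real
  show "(A + A') ** B = A ** B + A' ** B" "A ** (B + B') = A ** B + A ** B'"
    by (simp_all add: vec_eq_iff matrix_matrix_mult_def algebra_simps sum.distrib)
  show "(r *\<^sub>R A) ** B = r *\<^sub>R (A ** B)" "A ** (r *\<^sub>R B) = r *\<^sub>R (A ** B)"
    by (simp_all add: vec_eq_iff matrix_matrix_mult_def scaleR_sum_right)
  show "\<exists>K. \<forall>(a :: complex^'n^'m) (b :: complex^'p^'n). norm (a ** b) \<le> norm a * norm b * K"
    by (rule exI[of _ 1]) (simp add: norm_matrix_mult_le)
qed

lemmas mm_simps = mm.add_left mm.add_right mm.diff_left mm.diff_right mm.minus_left mm.minus_right
  mm.scaleR_left mm.scaleR_right mm.zero_left mm.zero_right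

lemma norm_matrix_sq: "(norm (X :: complex^'n^'m))\<^sup>2 = (\<Sum>i\<in>UNIV. \<Sum>j\<in>UNIV. (cmod (X $ i $ j))\<^sup>2)"
  unfolding norm_vec_def L2_set_def by (simp add: sum_nonneg)

lemma mtrace_linear: "linear mtrace"
  by (rule linearI) (simp_all add: mtrace_def sum.distrib scaleR_sum_right)

lemmas mtrace_add = linear_add[OF mtrace_linear]
  and mtrace_diff = linear_diff[OF mtrace_linear]
  and mtrace_neg = linear_neg[OF mtrace_linear]
  and mtrace_scaleR = linear_cmul[OF mtrace_linear]
  and mtrace_zero = linear_0[OF mtrace_linear]
  and mtrace_sum = linear_sum[OF mtrace_linear]

lemma bounded_linear_mtrace: "bounded_linear mtrace"
  using mtrace_linear by (simp add: linear_conv_bounded_linear)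

lemma mtrace_commute: "mtrace (X ** Y) = mtrace (Y ** X)"
  unfolding mtrace_def matrix_matrix_mult_def
  by (simp add: mult.commute) (rule sum.swap)

lemma mtrace_adj: "mtrace (adj X) = cnj (mtrace X)"
  by (simp add: mtrace_def adj_def)

lemma mtrace_one: "mtrace (mat 1 :: complex^'n^'n) = of_nat CARD('n)"
  by (simp add: mtrace_def mat_def)

lemma adj_add: "adj (X + Y) = adj X + adj Y"
  and adj_diff: "adj (X - Y) = adj X - adj Y"
  and adj_scaleR: "adj (r *\<^sub>R X) = r *\<^sub>R adj X"
  and adj_zero: "adj 0 = 0"
  and adj_adj: "adj (adj X) = X"
  and adj_one: "adj (mat 1) = mat 1"
  by (simp_all add: adj_def vec_eq_iff mat_def)

lemma adj_mult: "adj (X ** Y) = adj Y ** adj X"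
  by (simp add: adj_def vec_eq_iff matrix_matrix_mult_def mult.commute)

lemma linear_adj: "linear adj"
  by (rule linearI) (simp_all add: adj_add adj_scaleR)

lemma norm_adj: "norm (adj X) = norm X"
proof -
  have "(norm (adj X))\<^sup>2 = (norm X)\<^sup>2"
    unfolding norm_matrix_sq by (simp add: adj_def) (rule sum.swap)
  then show ?thesis by simp
qed

lemma mtrace_adj_mult: "mtrace (adj X ** X) = of_real ((norm X)\<^sup>2)"
proof -
  have "mtrace (adj X ** X) = (\<Sum>i\<in>UNIV. \<Sum>k\<in>UNIV. of_real ((cmod (X $ k $ i))\<^sup>2))"
    unfolding mtrace_def matrix_matrix_mult_def adj_def
    by (simp add: complex_norm_square[symmetric] mult.commute flip: of_real_power)
  also have "\<dots> = of_real ((norm X)\<^sup>2)"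
    unfolding norm_matrix_sq of_real_sum by (rule sum.swap)
  finally show ?thesis .
qed

text \<open>Cauchy-Schwarz twice: once for each row of \<open>X\<close> against the matching column
  of \<open>Y\<close>, once over the row index.\<close>

lemma norm_mtrace_mult_le: "norm (mtrace (X ** Y)) \<le> norm X * norm Y" for X Y :: "complex^'n^'n"
proof -
  have "norm (mtrace (X ** Y)) \<le> (\<Sum>i\<in>UNIV. norm (X $ i) * norm ((\<chi> k. Y $ k $ i) :: complex^'n))"
  proof -
    have "norm (mtrace (X ** Y)) \<le> (\<Sum>i\<in>UNIV. norm (\<Sum>k\<in>UNIV. X $ i $ k * Y $ k $ i))"
      unfolding mtrace_def matrix_matrix_mult_def by (simp add: norm_sum)
    also have "\<dots> \<le> (\<Sum>i\<in>UNIV. norm (X $ i) * norm ((\<chi> k. Y $ k $ i) :: complex^'n))"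
    proof (rule sum_mono)
      fix i :: 'n
      have "norm (\<Sum>k\<in>UNIV. X $ i $ k * Y $ k $ i) \<le> (\<Sum>k\<in>UNIV. \<bar>norm (X $ i $ k)\<bar> * \<bar>norm (Y $ k $ i)\<bar>)"
        by (rule order_trans[OF norm_sum]) (simp add: norm_mult)
      also have "\<dots> \<le> norm (X $ i) * norm ((\<chi> k. Y $ k $ i) :: complex^'n)"
        unfolding norm_vec_def by (simp add: L2_set_mult_ineq[of "\<lambda>k. norm (X $ i $ k)" "\<lambda>k. norm (Y $ k $ i)", simplified])
      finally show "norm (\<Sum>k\<in>UNIV. X $ i $ k * Y $ k $ i) \<le> norm (X $ i) * norm ((\<chi> k. Y $ k $ i) :: complex^'n)" .
    qed
    finally show ?thesis .
  qed
  also have "\<dots> \<le> L2_set (\<lambda>i. norm (X $ i)) UNIV * L2_set (\<lambda>i. norm ((\<chi> k. Y $ k $ i) :: complex^'n)) UNIV"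
    using L2_set_mult_ineq[of "\<lambda>i. norm (X $ i)" "\<lambda>i. norm ((\<chi> k. Y $ k $ i) :: complex^'n)" UNIV] by simp
  also have "L2_set (\<lambda>i. norm ((\<chi> k. Y $ k $ i) :: complex^'n)) UNIV = norm Y"
  proof -
    have "(\<Sum>i\<in>UNIV. \<Sum>k\<in>UNIV. (cmod (Y $ k $ i))\<^sup>2) = (norm Y)\<^sup>2"
      unfolding norm_matrix_sq by (rule sum.swap)
    then show ?thesis
      unfolding L2_set_def norm_vec_def by (simp add: sum_nonneg L2_set_def)
  qed
  also have "L2_set (\<lambda>i. norm (X $ i)) UNIV = norm X"
    by (simp add: norm_vec_def)
  finally show ?thesis .
qed

text \<open>Complex scalars acting on matrices. The non-real shifts \<open>X + csc z s\<close> leave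
  the real space \<open>Q\<close> and are formed with it; \<open>scaleR\<close> covers the real
  ones.\<close>

definition csc :: "complex \<Rightarrow> complex^'n^'n \<Rightarrow> complex^'n^'n" where
  "csc z X = (\<chi> i j. z * X $ i $ j)"

lemma csc_mult_left: "csc z X ** Y = csc z (X ** Y)"
  and csc_mult_right: "X ** csc z Y = csc z (X ** Y)"
  and csc_csc: "csc z (csc w X) = csc (z * w) X"
  and csc_add_right: "csc z (X + Y) = csc z X + csc z Y"
  and csc_diff_right: "csc z (X - Y) = csc z X - csc z Y"
  and csc_add_left: "csc (z + w) X = csc z X + csc w X"
  and csc_diff_left: "csc (z - w) X = csc z X - csc w X"
  and csc_minus_left: "csc (- z) X = - csc z X"
  and csc_minus_right: "csc z (- X) = - csc z X"
  and csc_of_real: "csc (of_real r) X = r *\<^sub>R X"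
  and csc_one: "csc 1 X = X"
  and csc_zero: "csc 0 X = 0" "csc z 0 = 0"
  and csc_scaleR_right: "csc z (r *\<^sub>R X) = r *\<^sub>R csc z X"
  and csc_scaleR_left: "csc (r *\<^sub>R z) X = r *\<^sub>R csc z X"
  and mtrace_csc: "mtrace (csc z X) = z * mtrace X"
  by (simp_all add: csc_def vec_eq_iff matrix_matrix_mult_def sum_distrib_left mtrace_def
      algebra_simps scaleR_conv_of_real[where 'a = complex])

lemmas csc_simps = csc_mult_left csc_mult_right csc_csc csc_add_right csc_diff_right csc_add_left
  csc_diff_left csc_minus_left csc_minus_right csc_of_real csc_one csc_zero

lemma norm_csc: "norm (csc z X) = norm z * norm X"
proof -
  have "(norm (csc z X))\<^sup>2 = (norm z * norm X)\<^sup>2"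
    unfolding norm_matrix_sq power_mult_distrib
    by (simp add: csc_def norm_mult power_mult_distrib sum_distrib_left)
  then show ?thesis by (simp add: power2_eq_iff_nonneg)
qed

interpretation csc: bounded_bilinear "csc :: complex \<Rightarrow> complex^'n^'n \<Rightarrow> complex^'n^'n"
  by standard (auto simp: csc_simps csc_scaleR_left csc_scaleR_right norm_csc intro!: exI[of _ 1])

subsection \<open>The matrix exponential and its derivatives\<close>

fun dpow :: "complex^'n^'n \<Rightarrow> complex^'n^'n \<Rightarrow> nat \<Rightarrow> complex^'n^'n" where
  "dpow Y Z 0 = 0"
| "dpow Y Z (Suc k) = Z ** mpow Y k + Y ** dpow Y Z k"

fun ddpow :: "complex^'n^'n \<Rightarrow> complex^'n^'n \<Rightarrow> complex^'n^'n \<Rightarrow> nat \<Rightarrow> complex^'n^'n" where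
  "ddpow Y Z W 0 = 0"
| "ddpow Y Z W (Suc k) = Z ** dpow Y W k + W ** dpow Y Z k + Y ** ddpow Y Z W k"

definition dexp :: "complex^'n^'n \<Rightarrow> complex^'n^'n \<Rightarrow> complex^'n^'n" where
  "dexp Y Z = (\<Sum>k. (1 / fact k) *\<^sub>R dpow Y Z k)"

definition ddexp :: "complex^'n^'n \<Rightarrow> complex^'n^'n \<Rightarrow> complex^'n^'n \<Rightarrow> complex^'n^'n" where
  "ddexp Y Z W = (\<Sum>k. (1 / fact k) *\<^sub>R ddpow Y Z W k)"

definition sqn :: "'n itself \<Rightarrow> real" where "sqn _ = sqrt (real CARD('n))"

lemma sqn_nonneg [simp]: "0 \<le> sqn x"
  by (simp add: sqn_def)

lemma norm_mat_one: "norm (mat 1 :: complex^'n^'n) = sqn TYPE('n)"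
proof -
  have "(norm (mat 1 :: complex^'n^'n))\<^sup>2 = real CARD('n)"
    unfolding norm_matrix_sq by (simp add: mat_def if_distrib[of cmod] if_distrib[of "\<lambda>x. x\<^sup>2"] cong: if_cong)
  then show ?thesis unfolding sqn_def by (simp add: real_sqrt_unique)
qed

lemma norm_mpow: "norm (mpow Y k) \<le> sqn TYPE('n) * norm (Y :: complex^'n^'n) ^ k"
proof (induction k)
  case (Suc k)
  have "norm (mpow Y (Suc k)) \<le> norm Y * norm (mpow Y k)" by (simp add: norm_matrix_mult_le)
  also have "\<dots> \<le> norm Y * (sqn TYPE('n) * norm Y ^ k)" by (rule mult_left_mono) (use Suc in auto)
  finally show ?case by (simp add: ac_simps)
qed (simp add: norm_mat_one)

lemma norm_mpow': "1 \<le> r \<Longrightarrow> norm Y \<le> r \<Longrightarrow> norm (mpow Y k) \<le> sqn TYPE('n) * r ^ k"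
  for Y :: "complex^'n^'n"
proof -
  assume "1 \<le> r" "norm Y \<le> r"
  then have "norm Y ^ k \<le> r ^ k" by (simp add: power_mono)
  then show ?thesis using norm_mpow[of Y k] mult_left_mono[of "norm Y ^ k" "r ^ k" "sqn TYPE('n)"] by simp
qed

text \<open>The derivative is a sum of k words, so a factor k would do; the cruder 2^k closes the
  induction in geometric form, which the factorials absorb. With r >= 1 the term r^k is at most r (2
  r)^k.\<close>

lemma norm_dpow: "norm (dpow Y Z k) \<le> sqn TYPE('n) * (2 * r) ^ k * norm Z"
  if r: "1 \<le> r" "norm Y \<le> r" for Y :: "complex^'n^'n"
proof (induction k)
  case (Suc k)
  let ?c = "sqn TYPE('n)"
  have "norm (dpow Y Z (Suc k)) \<le> norm Z * norm (mpow Y k) + norm Y * norm (dpow Y Z k)"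
    by simp (rule norm_triangle_le, intro add_mono norm_matrix_mult_le)
  also have "\<dots> \<le> norm Z * (?c * r ^ k) + r * (?c * (2 * r) ^ k * norm Z)"
    using r by (intro add_mono mult_mono Suc norm_mpow' that order_refl) auto
  also have "\<dots> \<le> norm Z * (?c * (r * (2 * r) ^ k)) + r * (?c * (2 * r) ^ k * norm Z)"
  proof -
    have "r ^ k \<le> (2 * r) ^ k" using r by (intro power_mono) auto
    also have "\<dots> \<le> r * (2 * r) ^ k" using r by simp
    finally show ?thesis by (intro add_mono mult_left_mono order_refl) auto
  qed
  also have "\<dots> = ?c * (2 * r) ^ Suc k * norm Z" by (simp add: algebra_simps)
  finally show ?case .
qed simp

lemma norm_ddpow: "norm (ddpow Y Z W k) \<le> sqn TYPE('n) * (3 * r) ^ k * (norm Z * norm W)"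
  if r: "1 \<le> r" "norm Y \<le> r" for Y :: "complex^'n^'n"
proof (induction k)
  case (Suc k)
  let ?c = "sqn TYPE('n)"
  have "norm (ddpow Y Z W (Suc k)) \<le> norm Z * norm (dpow Y W k) + norm W * norm (dpow Y Z k)
      + norm Y * norm (ddpow Y Z W k)"
    by simp (intro norm_triangle_le add_mono norm_matrix_mult_le)
  also have "\<dots> \<le> norm Z * (?c * (2 * r) ^ k * norm W) + norm W * (?c * (2 * r) ^ k * norm Z)
      + r * (?c * (3 * r) ^ k * (norm Z * norm W))"
    using r by (intro add_mono mult_mono Suc norm_dpow that order_refl) auto
  also have "\<dots> = (?c * (norm Z * norm W)) * (2 * (2 * r) ^ k + r * (3 * r) ^ k)"
    by (simp add: algebra_simps)
  also have "\<dots> \<le> (?c * (norm Z * norm W)) * (2 * (r * (3 * r) ^ k) + r * (3 * r) ^ k)"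
  proof -
    have "(2 * r) ^ k \<le> (3 * r) ^ k" using r by (intro power_mono) auto
    also have "\<dots> \<le> r * (3 * r) ^ k" using r by simp
    finally show ?thesis by (intro mult_left_mono add_mono order_refl) auto
  qed
  also have "\<dots> = ?c * (3 * r) ^ Suc k * (norm Z * norm W)" by (simp add: algebra_simps)
  finally show ?case .
qed simp

lemma mpow_has_derivative: "((\<lambda>Y. mpow Y k) has_derivative (\<lambda>Z. dpow Y Z k)) (at Y within S)"
proof (induction k)
  case (Suc k)
  show ?case
    using mm.FDERIV[OF has_derivative_ident Suc] by (simp add: add.commute)
qed simp

lemma dpow_has_derivative: "((\<lambda>Y. dpow Y Z k) has_derivative (\<lambda>W. ddpow Y Z W k)) (at Y within S)"
proof (induction k)
  case (Suc k)
  show ?case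
    using has_derivative_add[OF mm.FDERIV[OF has_derivative_const mpow_has_derivative] mm.FDERIV[OF has_derivative_ident Suc], of Z]
    by (simp add: mm_simps ac_simps)
qed simp

lemma ddpow_commute: "ddpow Y Z W k = ddpow Y W Z k"
  by (induction k) (simp_all add: ac_simps)

text \<open>On the ball of radius |x| + 1 the differentiated series has the majorant d (b R)^k / k!,
  so its tails are uniformly small in operator norm, as termwise differentiation requires. Keeping
  \<open>p\<close> general lets the lemma serve both for the powers and for their first
  derivatives.\<close>

lemma exp_series_has_derivative:
  fixes p :: "nat \<Rightarrow> 'a::real_normed_vector \<Rightarrow> 'b::banach"
  assumes der: "\<And>k x. (p k has_derivative p' k x) (at x)"
    and bp: "\<And>k x r. 1 \<le> r \<Longrightarrow> norm x \<le> r \<Longrightarrow> norm (p k x) \<le> c * (a * r) ^ k"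
    and bp': "\<And>k x r h. 1 \<le> r \<Longrightarrow> norm x \<le> r \<Longrightarrow> norm (p' k x h) \<le> d * (b * r) ^ k * norm h"
    and a: "0 \<le> a" and b: "0 \<le> b" and d: "0 \<le> d"
  shows "((\<lambda>x. \<Sum>k. (1 / fact k) *\<^sub>R p k x) has_derivative (\<lambda>h. \<Sum>k. (1 / fact k) *\<^sub>R p' k x h)) (at x)"
proof -
  have summ_exp: "summable (\<lambda>k. C * (1 / fact k * t ^ k))" for C t :: real
    using summable_exp[of t] by (intro summable_mult) (simp add: divide_inverse)
  define R where "R = norm x + 1"
  have R: "1 \<le> R" by (simp add: R_def)
  define S where "S = ball (0::'a) R"
  have xS: "x \<in> S" by (simp add: S_def R_def)
  have S: "norm y \<le> R" if "y \<in> S" for y using that by (simp add: S_def)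
  define T where "T k = d * (1 / fact k * (b * R) ^ k)" for k
  have T: "summable T" unfolding T_def by (rule summ_exp)
  have T0: "0 \<le> T k" for k unfolding T_def using b d R by simp
  have le1: "norm ((1 / fact k) *\<^sub>R p k y) \<le> c * (1 / fact k * (a * R) ^ k)" if "y \<in> S" for k y
    using mult_left_mono[OF bp[OF R S[OF that], of k], of "1 / fact k"] by (simp add: field_simps)
  have le2: "norm ((1 / fact k) *\<^sub>R p' k y h) \<le> T k * norm h" if "y \<in> S" for k y h
    using mult_left_mono[OF bp'[OF R S[OF that], of k h], of "1 / fact k"] by (simp add: field_simps T_def)
  have sum1: "summable (\<lambda>k. (1 / fact k) *\<^sub>R p k y)" if "y \<in> S" for y
    by (rule summable_norm_cancel, rule summable_comparison_test[OF _ summ_exp[of c "a * R"]])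
      (auto intro!: exI[of _ 0] le1[OF that, simplified])
  have sum2n: "summable (\<lambda>k. norm ((1 / fact k) *\<^sub>R p' k y h))" if "y \<in> S" for y h
    by (rule summable_comparison_test[OF _ summable_mult2[OF T, of "norm h"]])
      (use le2[OF that] in auto)
  have sum2: "summable (\<lambda>k. (1 / fact k) *\<^sub>R p' k y h)" if "y \<in> S" for y h
    by (rule summable_norm_cancel[OF sum2n[OF that]])
  have "\<exists>g. \<forall>y\<in>S. (\<lambda>k. (1 / fact k) *\<^sub>R p k y) sums g y \<and>
      (g has_derivative (\<lambda>h. \<Sum>k. (1 / fact k) *\<^sub>R p' k y h)) (at y within S)"
  proof (rule has_derivative_series[where f' = "\<lambda>k y h. (1 / fact k) *\<^sub>R p' k y h"])
    show "convex S" by (simp add: S_def)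
    show "((\<lambda>y. (1 / fact k) *\<^sub>R p k y) has_derivative (\<lambda>h. (1 / fact k) *\<^sub>R p' k y h)) (at y within S)"
      if "y \<in> S" for k y
      by (rule has_derivative_at_withinI, rule has_derivative_scaleR_right, rule der)
    show "(\<lambda>k. (1 / fact k) *\<^sub>R p k x) sums (\<Sum>k. (1 / fact k) *\<^sub>R p k x)"
      using sum1[OF xS] by (rule summable_sums)
    fix e :: real assume "e > 0"
    obtain N where N: "\<And>n. n \<ge> N \<Longrightarrow> norm (\<Sum>i. T (i + n)) < e"
      using suminf_exist_split[OF \<open>e > 0\<close> T] by blast
    show "\<forall>\<^sub>F n in sequentially. \<forall>y\<in>S. \<forall>h. norm ((\<Sum>k<n. (1 / fact k) *\<^sub>R p' k y h)
        - (\<Sum>k. (1 / fact k) *\<^sub>R p' k y h)) \<le> e * norm h"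
      unfolding eventually_sequentially
    proof (intro exI[of _ N] allI impI ballI)
      fix n y h assume "N \<le> n" and y: "y \<in> S"
      have sm: "summable (\<lambda>k. norm ((1 / fact (k + n)) *\<^sub>R p' (k + n) y h))"
        using sum2n[OF y, of h] by (subst summable_iff_shift)
      have "norm ((\<Sum>k<n. (1 / fact k) *\<^sub>R p' k y h) - (\<Sum>k. (1 / fact k) *\<^sub>R p' k y h))
          = norm (\<Sum>k. (1 / fact (k + n)) *\<^sub>R p' (k + n) y h)"
        using suminf_split_initial_segment[OF sum2[OF y, of h], of n]
        by (simp add: norm_minus_commute)
      also have "\<dots> \<le> (\<Sum>k. norm ((1 / fact (k + n)) *\<^sub>R p' (k + n) y h))"
        by (rule summable_norm[OF sm])
      also have "\<dots> \<le> (\<Sum>k. T (k + n) * norm h)"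
        by (intro suminf_le sm summable_mult2 summable_ignore_initial_segment T le2 y)
      also have "\<dots> = (\<Sum>k. T (k + n)) * norm h"
        by (intro suminf_mult2[symmetric] summable_ignore_initial_segment T)
      also have "\<dots> \<le> e * norm h"
        using N[OF \<open>N \<le> n\<close>] by (intro mult_right_mono) auto
      finally show "norm ((\<Sum>k<n. (1 / fact k) *\<^sub>R p' k y h) - (\<Sum>k. (1 / fact k) *\<^sub>R p' k y h)) \<le> e * norm h" .
    qed
  qed (rule xS)
  then obtain g where g: "\<And>y. y \<in> S \<Longrightarrow> (\<lambda>k. (1 / fact k) *\<^sub>R p k y) sums g y"
    and g': "\<And>y. y \<in> S \<Longrightarrow> (g has_derivative (\<lambda>h. \<Sum>k. (1 / fact k) *\<^sub>R p' k y h)) (at y within S)"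
    by blast
  have "((\<lambda>x. \<Sum>k. (1 / fact k) *\<^sub>R p k x) has_derivative (\<lambda>h. \<Sum>k. (1 / fact k) *\<^sub>R p' k x h)) (at x within S)"
    by (rule has_derivative_transform[OF xS _ g'[OF xS]]) (use g in \<open>auto simp: sums_iff\<close>)
  then show ?thesis
    using at_within_open[OF xS] by (simp add: S_def)
qed

lemma mexp_has_derivative: "(mexp has_derivative dexp Y) (at Y)"
proof -
  have "((\<lambda>x. \<Sum>k. (1 / fact k) *\<^sub>R mpow x k) has_derivative (\<lambda>h. \<Sum>k. (1 / fact k) *\<^sub>R dpow Y h k)) (at Y)"
    by (rule exp_series_has_derivative[where c = "sqn TYPE('a)" and d = "sqn TYPE('a)" and a = 1 and b = 2])
      (use norm_mpow' norm_dpow mpow_has_derivative in auto)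
  then show ?thesis by (simp add: mexp_def[abs_def] dexp_def[abs_def])
qed

lemma dexp_has_derivative: "((\<lambda>Y. dexp Y Z) has_derivative ddexp Y Z) (at (Y :: complex^'a^'a))"
proof -
  have "((\<lambda>x. \<Sum>k. (1 / fact k) *\<^sub>R dpow x Z k) has_derivative (\<lambda>h. \<Sum>k. (1 / fact k) *\<^sub>R ddpow Y Z h k)) (at Y)"
  proof (rule exp_series_has_derivative[where c = "sqn TYPE('a) * norm Z" and d = "sqn TYPE('a) * norm Z" and a = 2 and b = 3])
    fix k :: nat and x :: "complex^'a^'a" and r :: real and h :: "complex^'a^'a"
    show "((\<lambda>x. dpow x Z k) has_derivative (\<lambda>h. ddpow x Z h k)) (at x)" by (rule dpow_has_derivative)
    assume r: "1 \<le> r" "norm x \<le> r"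
    show "norm (dpow x Z k) \<le> sqn TYPE('a) * norm Z * (2 * r) ^ k"
      using norm_dpow[OF r, of Z k] by (simp add: ac_simps)
    show "norm (ddpow x Z h k) \<le> sqn TYPE('a) * norm Z * (3 * r) ^ k * norm h"
      using norm_ddpow[OF r, of Z h k] by (simp add: ac_simps)
  qed auto
  then show ?thesis by (simp add: ddexp_def[abs_def] dexp_def[abs_def])
qed

lemma ddexp_commute: "ddexp Y Z W = ddexp Y W Z"
  by (simp add: ddexp_def ddpow_commute[of Y Z W])

lemma exp_series_bound:
  fixes q :: "nat \<Rightarrow> 'a::banach"
  assumes "\<And>k. norm (q k) \<le> c * t ^ k"
  shows "summable (\<lambda>k. (1 / fact k) *\<^sub>R q k)" and "norm (\<Sum>k. (1 / fact k) *\<^sub>R q k) \<le> c * exp t"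
proof -
  have e: "(\<lambda>k. c * (1 / fact k * t ^ k)) sums (c * exp t)"
    using exp_converges[of t] by (intro sums_mult) (simp add: divide_inverse)
  have le: "norm ((1 / fact k) *\<^sub>R q k) \<le> c * (1 / fact k * t ^ k)" for k
    using mult_left_mono[OF assms[of k], of "1 / fact k"] by (simp add: field_simps)
  have sn: "summable (\<lambda>k. norm ((1 / fact k) *\<^sub>R q k))"
    by (rule summable_comparison_test[OF _ sums_summable[OF e]]) (use le in auto)
  show "summable (\<lambda>k. (1 / fact k) *\<^sub>R q k)" by (rule summable_norm_cancel[OF sn])
  have "norm (\<Sum>k. (1 / fact k) *\<^sub>R q k) \<le> (\<Sum>k. norm ((1 / fact k) *\<^sub>R q k))"
    by (rule summable_norm[OF sn])
  also have "\<dots> \<le> (\<Sum>k. c * (1 / fact k * t ^ k))"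
    by (intro suminf_le sn sums_summable[OF e] le)
  finally show "norm (\<Sum>k. (1 / fact k) *\<^sub>R q k) \<le> c * exp t" using e by (simp add: sums_iff)
qed

lemma mexp_summable: "summable (\<lambda>k. (1 / fact k) *\<^sub>R mpow Y k)"
  and norm_mexp: "norm (mexp Y) \<le> sqn TYPE('n) * exp (norm Y)" for Y :: "complex^'n^'n"
  unfolding mexp_def by (rule exp_series_bound norm_mpow)+

lemma norm_dexp: "norm (dexp Y Z) \<le> sqn TYPE('n) * exp (2 * (1 + norm Y)) * norm Z"
  and norm_ddexp: "norm (ddexp Y Z W) \<le> sqn TYPE('n) * exp (3 * (1 + norm Y)) * (norm Z * norm W)"
  for Y :: "complex^'n^'n"
proof -
  have "norm (dexp Y Z) \<le> (sqn TYPE('n) * norm Z) * exp (2 * (1 + norm Y))" unfolding dexp_def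
    by (rule exp_series_bound) (use norm_dpow[of "1 + norm Y" Y Z] in \<open>simp add: ac_simps\<close>)
  then show "norm (dexp Y Z) \<le> sqn TYPE('n) * exp (2 * (1 + norm Y)) * norm Z" by (simp add: ac_simps)
  have "norm (ddexp Y Z W) \<le> (sqn TYPE('n) * (norm Z * norm W)) * exp (3 * (1 + norm Y))" unfolding ddexp_def
    by (rule exp_series_bound) (use norm_ddpow[of "1 + norm Y" Y Z W] in \<open>simp add: ac_simps\<close>)
  then show "norm (ddexp Y Z W) \<le> sqn TYPE('n) * exp (3 * (1 + norm Y)) * (norm Z * norm W)" by (simp add: ac_simps)
qed

lemma mpow_commute: "Y ** mpow Y k = mpow Y k ** Y"
  by (induction k) (simp_all add: matrix_mul_assoc)

lemma mpow_zero: "mpow 0 k = (if k = 0 then mat 1 else 0)"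
  by (cases k) (simp_all add: mm_simps)

lemma mexp_zero: "mexp 0 = (mat 1 :: complex^'n^'n)"
proof -
  have "(\<lambda>k. (1 / fact k) *\<^sub>R mpow (0::complex^'n^'n) k) = (\<lambda>k. if k = 0 then mat 1 else 0)"
    by (auto simp: mpow_zero)
  then show ?thesis unfolding mexp_def using sums_single[of 0 "\<lambda>_. mat 1 :: complex^'n^'n"]
    by (simp only: sums_iff)
qed

lemma dexp_zero: "dexp 0 Z = Z"
proof -
  have d: "dpow 0 Z k = (if k = 1 then Z else 0)" for k
    by (cases k) (simp_all add: mm_simps mpow_zero)
  have "(\<lambda>k. (1 / fact k) *\<^sub>R dpow 0 Z k) = (\<lambda>k. if k = 1 then Z else 0)"
    by (auto simp: d)
  then show ?thesis unfolding dexp_def using sums_single[of 1 "\<lambda>_. Z"] by (simp add: sums_iff)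
qed

lemma mpow_scaleR: "mpow (t *\<^sub>R Y) k = t ^ k *\<^sub>R mpow Y k"
  by (induction k) (simp_all add: mm_simps)

lemma dpow_scaleR: "dpow (t *\<^sub>R Y) Y (Suc k) = real (Suc k) *\<^sub>R (t ^ k *\<^sub>R (Y ** mpow Y k))"
proof (induction k)
  case (Suc k)
  have "dpow (t *\<^sub>R Y) Y (Suc (Suc k)) = t ^ Suc k *\<^sub>R (Y ** mpow Y (Suc k))
      + (real (Suc k) * t ^ Suc k) *\<^sub>R (Y ** mpow Y (Suc k))"
    unfolding dpow.simps(2)[of _ _ "Suc k"] Suc mpow_scaleR by (simp add: mm_simps ac_simps)
  also have "\<dots> = (t ^ Suc k + real (Suc k) * t ^ Suc k) *\<^sub>R (Y ** mpow Y (Suc k))"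
    by (rule scaleR_left.add[symmetric])
  finally show ?case by (simp add: algebra_simps del: mpow.simps)
qed simp

text \<open>In the direction \<open>Y\<close> itself everything commutes and \<open>dpow\<close>
  collapses to (k+1) t^k Y^(k+1); the factor k+1 cancels against the factorial and shifts the series
  by one index.\<close>

lemma dexp_scaleR_self: "dexp (t *\<^sub>R Y) Y = Y ** mexp (t *\<^sub>R Y)" for Y :: "complex^'a^'a"
proof -
  have s: "(\<lambda>k. (1 / fact k) *\<^sub>R dpow (t *\<^sub>R Y) Y k) sums dexp (t *\<^sub>R Y) Y"
    unfolding dexp_def
    by (rule summable_sums, rule exp_series_bound[where c = "sqn TYPE('a) * norm Y" and t = "2 * (1 + norm (t *\<^sub>R Y))"])
      (use norm_dpow[of "1 + norm (t *\<^sub>R Y)" "t *\<^sub>R Y" Y] in \<open>simp add: ac_simps\<close>)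
  have "(\<lambda>k. (1 / fact (Suc k)) *\<^sub>R dpow (t *\<^sub>R Y) Y (Suc k)) sums dexp (t *\<^sub>R Y) Y"
    using s by (subst sums_Suc_iff) simp
  moreover have "(1 / fact (Suc k)) *\<^sub>R dpow (t *\<^sub>R Y) Y (Suc k) = Y ** ((1 / fact k) *\<^sub>R mpow (t *\<^sub>R Y) k)" for k
    unfolding dpow_scaleR mpow_scaleR by (simp add: mm_simps del: of_nat_Suc)
  moreover have "(\<lambda>k. Y ** ((1 / fact k) *\<^sub>R mpow (t *\<^sub>R Y) k)) sums (Y ** mexp (t *\<^sub>R Y))"
    unfolding mexp_def by (rule bounded_linear.sums[OF mm.bounded_linear_right summable_sums[OF mexp_summable]])
  ultimately show ?thesis by (simp add: sums_iff)
qed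

lemma mexp_commute_of_commute: "X ** Y = Y ** X \<Longrightarrow> X ** mexp Y = mexp Y ** X"
proof -
  assume XY: "X ** Y = Y ** X"
  have c: "X ** mpow Y k = mpow Y k ** X" for k
    by (induction k) (simp_all add: matrix_mul_assoc XY, simp add: matrix_mul_assoc[symmetric])
  have "(\<lambda>k. X ** ((1 / fact k) *\<^sub>R mpow Y k)) sums (X ** mexp Y)"
    unfolding mexp_def by (rule bounded_linear.sums[OF mm.bounded_linear_right summable_sums[OF mexp_summable]])
  moreover have "(\<lambda>k. ((1 / fact k) *\<^sub>R mpow Y k) ** X) sums (mexp Y ** X)"
    unfolding mexp_def by (rule bounded_linear.sums[OF mm.bounded_linear_left summable_sums[OF mexp_summable]])
  ultimately show ?thesis by (simp add: mm_simps c sums_iff)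
qed

lemma mexp_scaleR_vector_derivative:
  "((\<lambda>t. mexp (t *\<^sub>R Y)) has_vector_derivative Y ** mexp (t *\<^sub>R Y)) (at t within S)"
proof -
  have "((\<lambda>t. mexp (t *\<^sub>R Y)) has_derivative (\<lambda>h. dexp (t *\<^sub>R Y) (h *\<^sub>R Y))) (at t)"
    by (rule has_derivative_compose[OF _ mexp_has_derivative]) (auto intro!: derivative_eq_intros)
  moreover have "dexp (t *\<^sub>R Y) (h *\<^sub>R Y) = h *\<^sub>R dexp (t *\<^sub>R Y) Y" for h
    using linear_cmul[OF has_derivative_linear[OF mexp_has_derivative]] .
  ultimately show ?thesis
    unfolding has_vector_derivative_def dexp_scaleR_self by (auto intro: has_derivative_at_withinI)
qed

lemma mexp_neg_mult: "mexp Y ** mexp (- Y) = mat 1" and mexp_neg_mult': "mexp (- Y) ** mexp Y = mat 1"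
proof -
  have "mexp Y ** mexp (- Y) = mat 1" for Y :: "complex^'a^'a"
  proof -
    define f where "f t = mexp (t *\<^sub>R Y) ** mexp (t *\<^sub>R (- Y))" for t
    have "(f has_vector_derivative 0) (at t within UNIV)" for t
    proof -
      have "(f has_vector_derivative (mexp (t *\<^sub>R Y) ** (- Y ** mexp (t *\<^sub>R (- Y)))
          + (Y ** mexp (t *\<^sub>R Y)) ** mexp (t *\<^sub>R (- Y)))) (at t within UNIV)"
        unfolding f_def by (rule mm.has_vector_derivative[OF mexp_scaleR_vector_derivative mexp_scaleR_vector_derivative])
      moreover have "Y ** mexp (t *\<^sub>R Y) = mexp (t *\<^sub>R Y) ** Y"
        by (rule mexp_commute_of_commute) (simp add: mm_simps)
      ultimately show ?thesis by (simp add: mm_simps matrix_mul_assoc)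
    qed
    then have "\<exists>c. \<forall>t\<in>UNIV. f t = c"
      by (intro has_derivative_zero_constant) (auto simp: has_vector_derivative_def)
    then have "f 1 = f 0" by auto
    then show ?thesis by (simp add: f_def mexp_zero)
  qed
  from this[of Y] this[of "- Y"] show "mexp Y ** mexp (- Y) = mat 1" "mexp (- Y) ** mexp Y = mat 1" by simp_all
qed

text \<open>Holds power by power. The use is \<open>A = s\<close>, \<open>Z = - Y\<close> with
  \<open>Y\<close> in \<open>p\<close>, where anticommutation with \<open>s\<close> becomes s e^Y =
  e^(-Y) s.\<close>

lemma mexp_intertwine: "A ** Y = Z ** A \<Longrightarrow> A ** mexp Y = mexp Z ** A" for A :: "complex^'n^'n"
proof -
  assume AY: "A ** Y = Z ** A"
  have c: "A ** mpow Y k = mpow Z k ** A" for k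
  proof (induction k)
    case (Suc k)
    then show ?case by (simp add: matrix_mul_assoc AY) (simp add: matrix_mul_assoc[symmetric])
  qed simp
  have "(\<lambda>k. A ** ((1 / fact k) *\<^sub>R mpow Y k)) sums (A ** mexp Y)"
    unfolding mexp_def by (rule bounded_linear.sums[OF mm.bounded_linear_right summable_sums[OF mexp_summable]])
  moreover have "(\<lambda>k. ((1 / fact k) *\<^sub>R mpow Z k) ** A) sums (mexp Z ** A)"
    unfolding mexp_def by (rule bounded_linear.sums[OF mm.bounded_linear_left summable_sums[OF mexp_summable]])
  ultimately show ?thesis by (simp add: mm_simps c sums_iff)
qed

lemma adj_mpow: "adj (mpow Y k) = mpow (adj Y) k"
  by (induction k) (simp_all add: adj_one adj_mult mpow_commute)

lemma bounded_linear_adj: "bounded_linear adj"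
  using linear_adj by (simp add: linear_conv_bounded_linear)

lemma adj_mexp: "adj (mexp Y) = mexp (adj Y)"
proof -
  have "(\<lambda>k. adj ((1 / fact k) *\<^sub>R mpow Y k)) sums (adj (mexp Y))"
    unfolding mexp_def by (rule bounded_linear.sums[OF bounded_linear_adj summable_sums[OF mexp_summable]])
  moreover have "(\<lambda>k. (1 / fact k) *\<^sub>R mpow (adj Y) k) sums mexp (adj Y)"
    unfolding mexp_def by (rule summable_sums[OF mexp_summable])
  ultimately show ?thesis by (simp add: adj_scaleR adj_mpow sums_iff)
qed

text \<open>The function t -> e^(tY) e^((a+b-t)Y) has derivative zero; its values at t = a and t = 0
  are the two sides.\<close>

lemma mexp_scaleR_add: "mexp (a *\<^sub>R Y) ** mexp (b *\<^sub>R Y) = mexp ((a + b) *\<^sub>R Y)" for Y :: "complex^'n^'n"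
proof -
  define f where "f t = mexp (t *\<^sub>R Y) ** mexp ((a + b) *\<^sub>R Y + t *\<^sub>R (- Y))" for t
  have e: "mexp (c *\<^sub>R Y + t *\<^sub>R (- Y)) = mexp ((c - t) *\<^sub>R Y)" for c t
    by (simp add: scaleR_left.diff)
  have d: "((\<lambda>t. mexp ((c - t) *\<^sub>R Y)) has_vector_derivative - (Y ** mexp ((c - t) *\<^sub>R Y))) (at t)" for c t
  proof -
    have "((\<lambda>t. mexp ((c - t) *\<^sub>R Y)) has_vector_derivative (-1) *\<^sub>R (Y ** mexp ((c - t) *\<^sub>R Y))) (at t)"
    proof -
      have 1: "((\<lambda>t. c - t) has_vector_derivative (-1)) (at t)" by (auto intro!: derivative_eq_intros)
      have 2: "((\<lambda>t. mexp (t *\<^sub>R Y)) has_vector_derivative Y ** mexp ((c - t) *\<^sub>R Y)) (at (c - t))"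
        by (rule mexp_scaleR_vector_derivative)
      from vector_diff_chain_at[OF 1 2] show ?thesis by (simp add: o_def)
    qed
    then show ?thesis by simp
  qed
  have "(f has_vector_derivative 0) (at t within UNIV)" for t
  proof -
    have "(f has_vector_derivative (mexp (t *\<^sub>R Y) ** (- (Y ** mexp ((a + b - t) *\<^sub>R Y)))
        + (Y ** mexp (t *\<^sub>R Y)) ** mexp ((a + b - t) *\<^sub>R Y))) (at t)"
      unfolding f_def e by (rule mm.has_vector_derivative[OF mexp_scaleR_vector_derivative d])
    moreover have "Y ** mexp (t *\<^sub>R Y) = mexp (t *\<^sub>R Y) ** Y"
      by (rule mexp_commute_of_commute) (simp add: mm_simps)
    ultimately show ?thesis by (simp add: mm_simps matrix_mul_assoc)
  qed
  then have "\<exists>c. \<forall>t\<in>UNIV. f t = c"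
    by (intro has_derivative_zero_constant) (auto simp: has_vector_derivative_def)
  then have "f a = f 0" by auto
  moreover have "f a = mexp (a *\<^sub>R Y) ** mexp ((a + b - a) *\<^sub>R Y)" by (simp only: f_def e)
  moreover have "f 0 = mexp (0 *\<^sub>R Y) ** mexp ((a + b - 0) *\<^sub>R Y)" by (simp only: f_def e)
  ultimately show ?thesis by (simp add: mexp_zero)
qed

lemma mexp_half: "mexp ((1/2) *\<^sub>R Y) ** mexp ((1/2) *\<^sub>R Y) = mexp Y"
  using mexp_scaleR_add[of "1/2" Y "1/2"] by simp

lemma hermitian_scaleR: "hermitian Y \<Longrightarrow> hermitian (r *\<^sub>R Y)"
  by (simp add: hermitian_def adj_scaleR)

section \<open>Positive square roots and injectivity of the exponential on hermitian
  matrices\<close>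

lemma matrix_cancel_left: "L ** M = mat 1 \<Longrightarrow> M ** Z = 0 \<Longrightarrow> Z = (0 :: complex^'n^'n)"
  by (metis matrix_mul_assoc matrix_mul_lid mm.zero_right)

text \<open>No diagonalisation is used. With P = M \<open>adj M\<close>, R = L \<open>adj L\<close>
  and Z = P - R, equality of the squares gives P Z + Z R = 0. Multiplying by Z and taking the trace
  gives |\<open>adj M\<close> Z|^2 + |Z L|^2 = 0, and the left inverse \<open>M'\<close> of
  \<open>adj M\<close> forces Z = 0.\<close>

lemma pos_sqrt_unique:
  fixes M L :: "complex^'n^'n"
  assumes M: "M' ** adj M = mat 1" and L: "L ** L' = mat 1"
    and eq: "(M ** adj M) ** (M ** adj M) = (L ** adj L) ** (L ** adj L)"
  shows "M ** adj M = L ** adj L"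
proof -
  define P R Z where "P = M ** adj M" and "R = L ** adj L" and "Z = P - R"
  have h: "adj P = P" "adj R = R" "adj Z = Z" by (simp_all add: P_def R_def Z_def adj_mult adj_adj adj_diff)
  have "P ** Z + Z ** R = 0"
    using eq by (simp add: Z_def mm_simps P_def[symmetric] R_def[symmetric])
  then have "mtrace (Z ** (P ** Z)) + mtrace (Z ** (Z ** R)) = 0"
    by (metis mm.add_right mm.zero_right mtrace_add mtrace_zero)
  moreover have "mtrace (Z ** (P ** Z)) = of_real ((norm (adj M ** Z))\<^sup>2)"
    unfolding mtrace_adj_mult[symmetric] by (simp add: adj_mult adj_adj h P_def matrix_mul_assoc)
  moreover have "mtrace (Z ** (Z ** R)) = of_real ((norm (Z ** L))\<^sup>2)"
  proof -
    have "mtrace (Z ** (Z ** R)) = mtrace ((Z ** Z ** L) ** adj L)" by (simp add: R_def matrix_mul_assoc)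
    also have "\<dots> = mtrace (adj L ** (Z ** Z ** L))" by (rule mtrace_commute)
    also have "\<dots> = of_real ((norm (Z ** L))\<^sup>2)"
      unfolding mtrace_adj_mult[symmetric] by (simp add: adj_mult h matrix_mul_assoc)
    finally show ?thesis .
  qed
  ultimately have "complex_of_real ((norm (adj M ** Z))\<^sup>2 + (norm (Z ** L))\<^sup>2) = 0"
    by (simp only: of_real_add)
  then have "(norm (adj M ** Z))\<^sup>2 + (norm (Z ** L))\<^sup>2 = 0" by (simp only: of_real_eq_0_iff)
  then have "adj M ** Z = 0" by (simp add: sum_power2_eq_zero_iff)
  then have "Z = 0" using matrix_cancel_left[OF M] by blast
  then show ?thesis by (simp add: Z_def P_def R_def)
qed

text \<open>For hermitian \<open>Y\<close> the matrix e^Y is e^(Y/2) times its own adjoint, which is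
  the positive form required by \<open>pos_sqrt_unique\<close>.\<close>

lemma mexp_hermitian_root_eq:
  fixes Y Y' :: "complex^'n^'n"
  assumes h: "hermitian Y" "hermitian Y'"
    and eq: "mexp Y ** mexp Y = mexp Y' ** mexp Y'"
  shows "mexp Y = mexp Y'"
proof -
  let ?M = "mexp ((1/2) *\<^sub>R Y)" and ?L = "mexp ((1/2) *\<^sub>R Y')"
  have aM: "adj ?M = ?M" "adj ?L = ?L" using h by (simp_all add: adj_mexp adj_scaleR hermitian_def)
  have "?M ** adj ?M = ?L ** adj ?L"
    by (rule pos_sqrt_unique[where M' = "mexp (- ((1/2) *\<^sub>R Y))" and L' = "mexp (- ((1/2) *\<^sub>R Y'))"])
      (simp_all only: aM mexp_half eq mexp_neg_mult mexp_neg_mult')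
  then show ?thesis by (simp only: aM mexp_half)
qed

text \<open>Repeated square roots give e^(Y/2^k) = e^(Y'/2^k) for all k, and \<open>Y\<close> is the
  limit of 2^k (e^(Y/2^k) - 1). Neither a logarithm nor a spectral decomposition enters.\<close>

lemma mexp_hermitian_inj:
  fixes Y Y' :: "complex^'n^'n"
  assumes h: "hermitian Y" "hermitian Y'" and eq: "mexp Y = mexp Y'"
  shows "Y = Y'"
proof -
  have e: "mexp ((1/2)^k *\<^sub>R Y) = mexp ((1/2)^k *\<^sub>R Y')" for k
  proof (induction k)
    case (Suc k)
    have "mexp ((1/2)^Suc k *\<^sub>R Z) ** mexp ((1/2)^Suc k *\<^sub>R Z) = mexp ((1/2)^k *\<^sub>R Z)" for Z :: "complex^'n^'n"
      using mexp_half[of "(1/2)^k *\<^sub>R Z"] by simp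
    then show ?case
      by (intro mexp_hermitian_root_eq hermitian_scaleR h) (use Suc in simp)
  qed (simp add: eq)
  have lim: "(\<lambda>k. inverse ((1/2)^k) *\<^sub>R (mexp ((1/2)^k *\<^sub>R Z) - mat 1)) \<longlonglongrightarrow> Z" for Z :: "complex^'n^'n"
  proof -
    have "((\<lambda>t. mexp (t *\<^sub>R Z)) has_vector_derivative Z) (at 0)"
      using mexp_scaleR_vector_derivative[of Z 0 UNIV] by (simp add: mexp_zero)
    then have "((\<lambda>h. norm (mexp (h *\<^sub>R Z) - mat 1 - h *\<^sub>R Z) / norm h) \<longlongrightarrow> 0) (at 0)"
      by (simp add: has_vector_derivative_def has_derivative_at mexp_zero)
    moreover have "norm (inverse h *\<^sub>R (mexp (h *\<^sub>R Z) - mat 1) - Z) = norm (mexp (h *\<^sub>R Z) - mat 1 - h *\<^sub>R Z) / norm h"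
      if "h \<noteq> 0" for h
    proof -
      have "inverse h *\<^sub>R (mexp (h *\<^sub>R Z) - mat 1) - Z = inverse h *\<^sub>R (mexp (h *\<^sub>R Z) - mat 1 - h *\<^sub>R Z)"
        using that by (simp add: scaleR_diff_right)
      then show ?thesis by (simp add: divide_inverse mult.commute)
    qed
    ultimately have "((\<lambda>h. norm (inverse h *\<^sub>R (mexp (h *\<^sub>R Z) - mat 1) - Z)) \<longlongrightarrow> 0) (at 0)"
      by (auto elim!: Lim_transform_eventually simp: eventually_at_filter)
    then have l: "((\<lambda>t. inverse t *\<^sub>R (mexp (t *\<^sub>R Z) - mat 1)) \<longlongrightarrow> Z) (at 0)"
      by (rule LIM_zero_cancel[OF tendsto_norm_zero_cancel])
    have "filterlim (\<lambda>k. (1/2::real)^k) (at 0) sequentially"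
      by (intro filterlim_atI LIMSEQ_power_zero) auto
    from filterlim_compose[OF l this] show ?thesis .
  qed
  from lim[of Y] lim[of Y'] show ?thesis unfolding e by (rule LIMSEQ_unique)
qed

lemma inner_mat: "inner X Y = Re (mtrace (adj X ** Y))" for X Y :: "complex^'n^'n"
  unfolding inner_vec_def mtrace_def matrix_matrix_mult_def adj_def
  by (simp add: inner_complex_def sum.swap[of "\<lambda>i j. Re (X $ i $ j) * Re (Y $ i $ j) + _ i j"])

subsection \<open>The Lie-theoretic setting\<close>

locale ps_data =
  fixes s :: "complex^'n^'n"
    and tes :: "((complex^'n^'n \<Rightarrow> complex^'n^'n) \<times> real) list"
  assumes herm_s: "hermitian s"
    and s_sq: "s ** s = mat 1"
    and taus: "\<forall>(t,e)\<in>set tes. inv_lie_aut t \<and> e \<in> {1, -1} \<and> s = e *\<^sub>R t s"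
    and comm_taus_theta: "\<forall>(t,e)\<in>set tes. t \<circ> theta s = theta s \<circ> t"
begin

lemma inv_s: "matrix_inv s = s"
proof -
  have "\<exists>A'. s ** A' = mat 1 \<and> A' ** s = mat 1" using s_sq by blast
  then have "matrix_inv s ** s = mat 1" unfolding matrix_inv_def by (rule someI2_ex) blast
  then have "matrix_inv s ** s ** s = s" by simp
  then show ?thesis by (simp add: matrix_mul_assoc[symmetric] s_sq)
qed

lemma adj_s: "adj s = s" using herm_s by (simp add: hermitian_def)

lemma ss: "s ** (s ** X) = X" "X ** s ** s = X"
  by (simp_all add: matrix_mul_assoc s_sq) (simp add: matrix_mul_assoc[symmetric] s_sq)

lemma theta_eq: "theta s X = s ** X ** s" and gamma_eq: "gamma s X = - (s ** adj X ** s)"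
  by (simp_all add: theta_def gamma_def inv_s)

lemma theta_add: "theta s (X + Y) = theta s X + theta s Y"
  and theta_diff: "theta s (X - Y) = theta s X - theta s Y"
  and theta_minus: "theta s (- X) = - theta s X"
  and theta_scaleR: "theta s (r *\<^sub>R X) = r *\<^sub>R theta s X"
  and theta_csc: "theta s (csc z X) = csc z (theta s X)"
  and theta_theta: "theta s (theta s X) = X"
  and theta_s: "theta s s = s"
  by (simp_all add: theta_eq mm_simps csc_simps matrix_mul_assoc s_sq)
    (simp add: matrix_mul_assoc[symmetric] s_sq)

lemma theta_mult: "theta s (X ** Y) = theta s X ** theta s Y"
  by (simp add: theta_eq matrix_mul_assoc) (metis matrix_mul_assoc ss(1))

text \<open>\<open>s\<close> is unitary, being hermitian with square one.\<close>

lemma norm_s_mult: "norm (s ** X) = norm X" and norm_mult_s: "norm (X ** s) = norm X" for X :: "complex^'n^'n"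
proof -
  have 1: "norm (s ** X) = norm X" for X :: "complex^'n^'n"
  proof -
    have "complex_of_real ((norm (s ** X))\<^sup>2) = of_real ((norm X)\<^sup>2)"
      unfolding mtrace_adj_mult[symmetric] adj_mult adj_s by (simp add: matrix_mul_assoc[symmetric] ss)
    then have "(norm (s ** X))\<^sup>2 = (norm X)\<^sup>2" by (simp only: of_real_eq_iff)
    then show ?thesis by simp
  qed
  show "norm (s ** X) = norm X" by (rule 1)
  show "norm (X ** s) = norm X"
    using 1[of "adj X"] norm_adj[of "X ** s"] by (simp add: adj_mult adj_s norm_adj)
qed

lemma norm_theta: "norm (theta s X) = norm X"
  by (simp add: theta_eq norm_s_mult norm_mult_s)

lemma t_linear: "(t,e) \<in> set tes \<Longrightarrow> linear t"
  and t_bracket: "(t,e) \<in> set tes \<Longrightarrow> t (X ** Y - Y ** X) = t X ** t Y - t Y ** t X"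
  and e_sq: "(t,e) \<in> set tes \<Longrightarrow> e * e = 1"
  and t_s: "(t,e) \<in> set tes \<Longrightarrow> s = e *\<^sub>R t s"
  and t_theta: "(t,e) \<in> set tes \<Longrightarrow> t (theta s X) = theta s (t X)"
  using taus comm_taus_theta by (force simp: inv_lie_aut_def fun_eq_iff)+

abbreviation "G \<equiv> gset s tes"
abbreviation "Q \<equiv> Qset s tes"
abbreviation "p \<equiv> pset s tes"
abbreviation "Qp \<equiv> Qplus s tes"
abbreviation "Qm \<equiv> Qminus s tes"

text \<open>Solving the membership equations for \<open>adj X\<close> turns them into rewrite rules;
  with these the closure properties under brackets become pure rewriting.\<close>

lemma G_iff: "X \<in> G \<longleftrightarrow> adj X = - theta s X \<and> (\<forall>(t,e)\<in>set tes. t X = X)"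
proof -
  have "gamma s X = - theta s (adj X)" by (simp add: gamma_eq theta_eq)
  then have "X = gamma s X \<longleftrightarrow> adj X = - theta s X" by (metis theta_theta theta_minus minus_minus)
  then show ?thesis by (auto simp: gset_def)
qed

lemma Q_iff: "X \<in> Q \<longleftrightarrow> adj X = theta s X \<and> (\<forall>(t,e)\<in>set tes. t X = e *\<^sub>R X)"
proof -
  have "gamma s X = - theta s (adj X)" by (simp add: gamma_eq theta_eq)
  then have "X = - gamma s X \<longleftrightarrow> adj X = theta s X" by (metis theta_theta minus_minus)
  moreover have "X = e *\<^sub>R t X \<longleftrightarrow> t X = e *\<^sub>R X" if "(t,e) \<in> set tes" for t e
  proof -
    have "e *\<^sub>R (e *\<^sub>R Z) = Z" for Z :: "complex^'n^'n" using e_sq[OF that] by simp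
    then show ?thesis by metis
  qed
  ultimately show ?thesis unfolding Qset_def by auto
qed

lemma G_adj: "X \<in> G \<Longrightarrow> adj X = - theta s X"
  and G_t: "X \<in> G \<Longrightarrow> (t,e) \<in> set tes \<Longrightarrow> t X = X"
  and Q_adj: "X \<in> Q \<Longrightarrow> adj X = theta s X"
  and Q_t: "X \<in> Q \<Longrightarrow> (t,e) \<in> set tes \<Longrightarrow> t X = e *\<^sub>R X"
  unfolding G_iff Q_iff by auto

lemma GI: "adj X = - theta s X \<Longrightarrow> (\<And>t e. (t,e) \<in> set tes \<Longrightarrow> t X = X) \<Longrightarrow> X \<in> G"
  and QI: "adj X = theta s X \<Longrightarrow> (\<And>t e. (t,e) \<in> set tes \<Longrightarrow> t X = e *\<^sub>R X) \<Longrightarrow> X \<in> Q"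
  unfolding G_iff Q_iff by auto

text \<open>The maps \<open>t\<close> respect brackets only, so a product of elements of
  \<open>G\<close> and \<open>Q\<close> has no evident symmetry. Every later product whose
  membership matters is therefore exhibited as a bracket or as the solution of a differential
  equation.\<close>

lemma Q_bracket: "X \<in> G \<Longrightarrow> Z \<in> Q \<Longrightarrow> X ** Z - Z ** X \<in> Q"
  by (rule QI) (simp_all add: t_bracket G_t Q_t G_adj Q_adj adj_diff adj_mult theta_diff theta_mult mm_simps scaleR_diff_right)

lemma QQ_bracket: "X \<in> Q \<Longrightarrow> Z \<in> Q \<Longrightarrow> X ** Z - Z ** X \<in> G"
  by (rule GI) (simp_all add: t_bracket Q_t Q_adj adj_diff adj_mult theta_diff theta_mult mm_simps e_sq)

lemma theta_zero: "theta s 0 = 0"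
  by (simp add: theta_eq mm_simps)

lemma subspace_Q: "subspace Q"
  unfolding subspace_def
  by (intro conjI ballI allI QI)
    (simp_all add: adj_zero adj_add adj_scaleR theta_add theta_scaleR scaleR_add_right Q_adj Q_t theta_zero
      linear_add[OF t_linear] linear_cmul[OF t_linear] linear_0[OF t_linear])

lemma subspace_G: "subspace G"
  unfolding subspace_def
  by (intro conjI ballI allI GI)
    (simp_all add: adj_zero adj_add adj_scaleR theta_add theta_scaleR scaleR_add_right G_adj G_t theta_zero
      linear_add[OF t_linear] linear_cmul[OF t_linear] linear_0[OF t_linear])

lemma linear_theta: "linear (theta s)"
  by (rule linearI) (simp_all add: theta_add theta_scaleR)

lemma subspace_p: "subspace p" and subspace_Qp: "subspace Qp" and subspace_Qm: "subspace Qm"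
proof -
  have l: "theta s 0 = 0" using linear_0[OF linear_theta] .
  show "subspace p" using subspace_G unfolding subspace_def pset_def
    by (auto simp: theta_add theta_scaleR l)
  show "subspace Qp" "subspace Qm" using subspace_Q unfolding subspace_def Qplus_def Qminus_def
    by (auto simp: theta_add theta_scaleR l)
qed

lemma s_in_Qp: "s \<in> Qp"
proof -
  have "t s = e *\<^sub>R s" if "(t,e) \<in> set tes" for t e
    using t_s[OF that] e_sq[OF that] by (metis scaleR_one scaleR_scaleR)
  then show ?thesis by (auto simp: Qplus_def Q_iff theta_s adj_s)
qed

lemma Qp_sub: "Qp \<subseteq> Q" and Qm_sub: "Qm \<subseteq> Q" and p_sub: "p \<subseteq> G"
  by (auto simp: Qplus_def Qminus_def pset_def)

lemma s_in_Q: "s \<in> Q" using s_in_Qp Qp_sub by blast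

lemma Q_theta: "X \<in> Q \<Longrightarrow> theta s X \<in> Q"
proof -
  assume X: "X \<in> Q"
  have "adj (theta s X) = theta s (adj X)" by (simp add: theta_eq adj_mult adj_s matrix_mul_assoc)
  moreover have "t (theta s X) = e *\<^sub>R theta s X" if "(t,e) \<in> set tes" for t e
    using X that by (auto simp: t_theta Q_iff theta_scaleR)
  ultimately show ?thesis using X by (auto simp: Q_iff)
qed

lemma p_anti: "Y \<in> p \<Longrightarrow> s ** Y = - (Y ** s)"
  and Qm_anti: "Y \<in> Qm \<Longrightarrow> s ** Y = - (Y ** s)"
  and Qp_comm: "Y \<in> Qp \<Longrightarrow> s ** Y = Y ** s"
  unfolding pset_def Qminus_def Qplus_def theta_eq
  by (simp_all, metis mm.minus_left ss(2), metis mm.minus_left ss(2), metis ss(2))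

lemma p_herm: "Y \<in> p \<Longrightarrow> adj Y = Y" and Qm_antiherm: "Y \<in> Qm \<Longrightarrow> adj Y = - Y"
  and Qp_herm: "Y \<in> Qp \<Longrightarrow> adj Y = Y"
  by (simp_all add: pset_def G_iff Qminus_def Qplus_def Q_iff)

text \<open>As \<open>Y\<close> anticommutes with \<open>s\<close>, Y s is half the bracket of
  \<open>Y\<close> and \<open>s\<close>, so the bracket rules apply to it. Together with
  \<open>Qm_s\<close> this is the isomorphism of \<open>p\<close> and \<open>Qm\<close> behind the
  dimension count.\<close>

lemma p_s: "Y \<in> p \<Longrightarrow> Y ** s \<in> Qm"
proof -
  assume Y: "Y \<in> p"
  have "Y ** s - s ** Y \<in> Q" using Q_bracket[OF _ s_in_Q] Y p_sub by blast
  then have "(1/2::real) *\<^sub>R (Y ** s - s ** Y) \<in> Q" using subspace_Q by (simp add: subspace_def)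
  moreover have "(1/2::real) *\<^sub>R (Y ** s - s ** Y) = Y ** s"
    by (simp add: p_anti[OF Y] flip: scaleR_2)
  moreover have "theta s (Y ** s) = - (Y ** s)" by (simp add: theta_eq matrix_mul_assoc p_anti[OF Y] mm_simps ss)
  ultimately show ?thesis by (simp add: Qminus_def)
qed

lemma Qm_s: "Y \<in> Qm \<Longrightarrow> Y ** s \<in> p"
proof -
  assume Y: "Y \<in> Qm"
  have "Y ** s - s ** Y \<in> G" using QQ_bracket[OF _ s_in_Q] Y Qm_sub by blast
  then have "(1/2::real) *\<^sub>R (Y ** s - s ** Y) \<in> G" using subspace_G by (simp add: subspace_def)
  moreover have "(1/2::real) *\<^sub>R (Y ** s - s ** Y) = Y ** s"
    by (simp add: Qm_anti[OF Y] flip: scaleR_2)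
  moreover have "theta s (Y ** s) = - (Y ** s)" by (simp add: theta_eq matrix_mul_assoc Qm_anti[OF Y] mm_simps ss)
  ultimately show ?thesis by (simp add: pset_def)
qed

text \<open>The \<open>theta\<close>-odd half; \<open>ppart\<close> is the even one. On
  \<open>Q\<close> the odd half is the antihermitian part, the one damped by the regulator.\<close>

definition mpart :: "complex^'n^'n \<Rightarrow> complex^'n^'n" where "mpart X = (1/2::real) *\<^sub>R (X - theta s X)"
definition ppart :: "complex^'n^'n \<Rightarrow> complex^'n^'n" where "ppart X = (1/2::real) *\<^sub>R (X + theta s X)"

lemma parts_sum: "ppart X + mpart X = X"
  by (simp add: ppart_def mpart_def flip: scaleR_add_right scaleR_2)

lemma mpart_Q: "X \<in> Q \<Longrightarrow> mpart X \<in> Qm" and ppart_Q: "X \<in> Q \<Longrightarrow> ppart X \<in> Qp"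
  using subspace_Q Q_theta[of X] unfolding mpart_def ppart_def Qminus_def Qplus_def
  by (auto simp: subspace_def theta_scaleR theta_diff theta_add theta_theta subspace_diff scaleR_diff_right add.commute)

section \<open>Invariance of the target space and injectivity of the map\<close>

text \<open>\<open>T\<close> is merely real linear and compatible with the bracket by
  \<open>Y\<close>, so it cannot be pulled through the product e^Y X e^(-Y). Instead u -> T (e^(uY)
  X e^(-uY)) solves the same linear equation f' = Y f - f Y with the same initial value
  \<open>X\<close>; \<open>\<omega>\<close> undoes the flow and is constant.\<close>

lemma invariant_PS:
  fixes T :: "complex^'n^'n \<Rightarrow> complex^'n^'n"
  assumes T: "linear T" and TY: "\<And>Z. T (Y ** Z - Z ** Y) = Y ** T Z - T Z ** Y" and TX: "T X = X"
  shows "T (PS Y X) = PS Y X"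
proof -
  define \<phi> where "\<phi> u = mexp (u *\<^sub>R Y) ** X ** mexp (u *\<^sub>R (- Y))" for u
  have blT: "bounded_linear T" using T by (simp add: linear_conv_bounded_linear)
  have cm: "mexp (- (u *\<^sub>R Y)) ** Y = Y ** mexp (- (u *\<^sub>R Y))" for u
    by (rule mexp_commute_of_commute[symmetric]) (simp add: mm_simps)
  have cm': "mexp (u *\<^sub>R Y) ** Y = Y ** mexp (u *\<^sub>R Y)" for u
    by (rule mexp_commute_of_commute[symmetric]) (simp add: mm_simps)
  have d\<phi>: "(\<phi> has_vector_derivative (Y ** \<phi> u - \<phi> u ** Y)) (at u within UNIV)" for u
  proof -
    have "(\<phi> has_vector_derivative (mexp (u *\<^sub>R Y) ** X ** (- Y ** mexp (u *\<^sub>R (- Y)))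
       + (mexp (u *\<^sub>R Y) ** 0 + (Y ** mexp (u *\<^sub>R Y)) ** X) ** mexp (u *\<^sub>R (- Y)))) (at u within UNIV)"
      unfolding \<phi>_def
      by (intro mm.has_vector_derivative mexp_scaleR_vector_derivative has_vector_derivative_const)
    then show ?thesis by (simp add: \<phi>_def mm_simps matrix_mul_assoc[symmetric] cm)
  qed
  have d\<psi>: "((\<lambda>u. T (\<phi> u)) has_vector_derivative (Y ** T (\<phi> u) - T (\<phi> u) ** Y)) (at u within UNIV)" for u
    using bounded_linear.has_vector_derivative[OF blT d\<phi>[of u]] by (simp add: TY)
  define \<omega> where "\<omega> u = mexp (u *\<^sub>R (- Y)) ** T (\<phi> u) ** mexp (u *\<^sub>R Y)" for u
  have "(\<omega> has_vector_derivative 0) (at u within UNIV)" for u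
  proof -
    have "(\<omega> has_vector_derivative (mexp (u *\<^sub>R (- Y)) ** T (\<phi> u) ** (Y ** mexp (u *\<^sub>R Y))
       + (mexp (u *\<^sub>R (- Y)) ** (Y ** T (\<phi> u) - T (\<phi> u) ** Y) + (- Y ** mexp (u *\<^sub>R (- Y))) ** T (\<phi> u))
         ** mexp (u *\<^sub>R Y))) (at u within UNIV)"
      unfolding \<omega>_def
      by (intro mm.has_vector_derivative mexp_scaleR_vector_derivative d\<psi>)
    then show ?thesis by (simp add: mm_simps matrix_mul_assoc cm)
  qed
  then have "\<exists>c. \<forall>t\<in>UNIV. \<omega> t = c"
    by (intro has_derivative_zero_constant) (auto simp: has_vector_derivative_def)
  then have "\<omega> 1 = \<omega> 0" by auto
  then have *: "mexp (- Y) ** T (PS Y X) ** mexp Y = X"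
    by (simp add: \<omega>_def \<phi>_def mexp_zero PS_def TX)
  have "PS Y X = mexp Y ** (mexp (- Y) ** T (PS Y X) ** mexp Y) ** mexp (- Y)"
    unfolding * by (simp add: PS_def)
  also have "\<dots> = (mexp Y ** mexp (- Y)) ** T (PS Y X) ** (mexp Y ** mexp (- Y))"
    by (simp add: matrix_mul_assoc)
  finally show ?thesis by (simp add: mexp_neg_mult)
qed

text \<open>\<open>invariant_PS\<close> is applied to the map sending Z to
  \<open>theta s (adj Z)\<close> and to each map sending Z to \<open>e *\<^sub>R t Z\<close>; the
  common fixed points of these maps are the elements of \<open>Q\<close>.\<close>

lemma PS_in_Q: "Y \<in> G \<Longrightarrow> X \<in> Q \<Longrightarrow> PS Y X \<in> Q"
proof -
  assume Y: "Y \<in> G" and X: "X \<in> Q"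
  have aY: "adj Y = - theta s Y" using Y by (simp add: G_iff)
  have aX: "theta s (adj X) = X" using X by (simp add: Q_iff theta_theta)
  have "theta s (adj (PS Y X)) = PS Y X"
  proof (rule invariant_PS)
    show "linear (\<lambda>Z. theta s (adj Z))"
      using linear_compose[OF linear_adj linear_theta] by (simp add: o_def)
    show "theta s (adj (Y ** Z - Z ** Y)) = Y ** theta s (adj Z) - theta s (adj Z) ** Y" for Z
      by (simp add: adj_diff adj_mult theta_diff theta_mult aY mm_simps theta_theta theta_minus)
  qed (rule aX)
  then have "adj (PS Y X) = theta s (PS Y X)" by (metis theta_theta)
  moreover have "t (PS Y X) = e *\<^sub>R PS Y X" if te: "(t,e) \<in> set tes" for t e
  proof -
    have "e *\<^sub>R t (PS Y X) = PS Y X"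
    proof (rule invariant_PS)
      show "linear (\<lambda>Z. e *\<^sub>R t Z)" using linear_compose_scale_right[OF t_linear[OF te]] .
      have tY: "t Y = Y" using Y te by (auto simp: G_iff)
      show "e *\<^sub>R t (Y ** Z - Z ** Y) = Y ** (e *\<^sub>R t Z) - (e *\<^sub>R t Z) ** Y" for Z
        by (simp add: t_bracket[OF te] tY mm_simps scaleR_diff_right)
      show "e *\<^sub>R t X = X" using X te e_sq[OF te] by (auto simp: Q_iff)
    qed
    then show ?thesis using e_sq[OF te] by (metis scaleR_one scaleR_scaleR)
  qed
  ultimately show ?thesis by (auto simp: Q_iff)
qed

lemma s_mexp: "Y \<in> p \<Longrightarrow> s ** mexp Y = mexp (- Y) ** s"
  by (rule mexp_intertwine) (simp add: p_anti mm_simps)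

lemma p_neg: "Y \<in> p \<Longrightarrow> - Y \<in> p" using subspace_neg[OF subspace_p] by simp

lemma s_mexp': "Y \<in> p \<Longrightarrow> s ** mexp (- Y) = mexp Y ** s"
  using s_mexp[OF p_neg] by simp

lemma mexp_p_herm: "Y \<in> p \<Longrightarrow> adj (mexp Y) = mexp Y"
  by (simp add: adj_mexp p_herm)

lemma PS_s: "Y \<in> p \<Longrightarrow> PS Y s = mexp Y ** mexp Y ** s"
  by (simp add: PS_def s_mexp' matrix_mul_assoc[symmetric])

lemma norm_mexp_neg: "Y \<in> p \<Longrightarrow> norm (mexp (- Y)) = norm (mexp Y)"
  by (metis norm_mult_s norm_s_mult s_mexp)

lemma norm_PS_le: "Y \<in> p \<Longrightarrow> norm (PS Y X) \<le> (norm (mexp Y))\<^sup>2 * norm X"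
proof -
  assume Y: "Y \<in> p"
  have "norm (PS Y X) \<le> norm (mexp Y) * norm X * norm (mexp (- Y))"
    unfolding PS_def by (meson mult_right_mono norm_ge_zero norm_matrix_mult_le order_trans)
  then show ?thesis by (simp add: norm_mexp_neg[OF Y] power2_eq_square ac_simps)
qed

lemma mtrace_PS: "mtrace (PS Y X ** PS Y Z) = mtrace (X ** Z)"
proof -
  have "PS Y X ** PS Y Z = PS Y (X ** Z)"
    by (simp add: PS_def matrix_mul_assoc) (metis matrix_mul_assoc matrix_mul_rid mexp_neg_mult')
  moreover have "mtrace (PS Y W) = mtrace W" for W
    unfolding PS_def by (subst mtrace_commute) (simp add: matrix_mul_assoc mexp_neg_mult')
  ultimately show ?thesis by simp
qed

text \<open>The involution T' = F(Y',s) lies in \<open>Q\<close> and commutes with F(Y',X') =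
  F(Y,X). Conjugated by e^(-Y) it becomes an involution \<open>C\<close> in \<open>Q\<close>
  commuting with \<open>X\<close>. Regularity of \<open>X\<close> kills the odd part of
  \<open>C\<close>, so \<open>C\<close> commutes with \<open>s\<close>; then C s is positive with
  square one, hence equal to one, and this reads e^(2Y') = e^(2Y).\<close>

lemma PS_inj:
  assumes Y: "Y \<in> p" "Y' \<in> p" and X: "X \<in> Qp" "X' \<in> Qp" and eq: "PS Y X = PS Y' X'"
    and reg: "\<And>\<xi>. \<xi> \<in> p \<Longrightarrow> \<xi> ** X = X ** \<xi> \<Longrightarrow> \<xi> = 0"
  shows "Y = Y' \<and> X = X'"
proof -
  define M N M' N' where d: "M = mexp Y" "N = mexp (- Y)" "M' = mexp Y'" "N' = mexp (- Y')"
  have MN: "M ** N = mat 1" "N ** M = mat 1" "M' ** N' = mat 1" "N' ** M' = mat 1"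
    by (simp_all add: d mexp_neg_mult mexp_neg_mult')
  have MN': "M ** (N ** Z) = Z" "N ** (M ** Z) = Z" "M' ** (N' ** Z) = Z" "N' ** (M' ** Z) = Z" for Z
    by (simp_all add: matrix_mul_assoc MN)
  have sM: "s ** M = N ** s" "s ** N = M ** s" "s ** M' = N' ** s" "s ** N' = M' ** s"
    using Y by (simp_all add: d s_mexp s_mexp')
  have sM': "s ** (M ** Z) = N ** (s ** Z)" "s ** (N ** Z) = M ** (s ** Z)"
     "s ** (M' ** Z) = N' ** (s ** Z)" "s ** (N' ** Z) = M' ** (s ** Z)" for Z
    using sM by (metis matrix_mul_assoc)+
  have sX: "s ** X = X ** s" "s ** X' = X' ** s" using X Qp_comm by auto
  have sX': "s ** (X ** Z) = X ** (s ** Z)" "s ** (X' ** Z) = X' ** (s ** Z)" for Z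
    using sX by (metis matrix_mul_assoc)+
  have q: "M ** (X ** N) = M' ** (X' ** N')" using eq by (simp add: PS_def d matrix_mul_assoc)
  define T' where "T' = M' ** (M' ** s)"
  have T'Q: "T' \<in> Q"
    using PS_in_Q[OF _ s_in_Q, of Y'] Y p_sub PS_s[OF Y(2)] by (auto simp: T'_def d matrix_mul_assoc[symmetric])
  have T'2: "T' ** T' = mat 1"
    by (simp add: T'_def matrix_mul_assoc[symmetric] sM' sM MN' ss MN s_sq)
  have T'c: "T' ** (M' ** (X' ** N')) = (M' ** (X' ** N')) ** T'"
    by (simp add: T'_def matrix_mul_assoc[symmetric] sM' sX' sX sM MN' ss MN)
  define C where "C = N ** (T' ** M)"
  have CQ: "C \<in> Q"
    using PS_in_Q[OF _ T'Q, of "- Y"] Y p_sub p_neg by (auto simp: C_def d PS_def matrix_mul_assoc)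
  have XC: "C ** X = X ** C"
  proof -
    have "C ** X = N ** (T' ** (M ** (X ** N))) ** M"
      by (simp add: C_def matrix_mul_assoc[symmetric] MN MN')
    also have "\<dots> = N ** ((M ** (X ** N)) ** T') ** M" unfolding q T'c ..
    also have "\<dots> = X ** C" by (simp add: C_def matrix_mul_assoc[symmetric] MN MN')
    finally show ?thesis .
  qed
  have C2: "C ** C = mat 1"
  proof -
    have "C ** C = N ** (T' ** (T' ** M))" by (simp add: C_def matrix_mul_assoc[symmetric] MN')
    also have "\<dots> = mat 1" by (simp add: matrix_mul_assoc T'2) (simp add: matrix_mul_assoc[symmetric] MN T'2 matrix_mul_assoc)
    finally show ?thesis .
  qed
  define P where "P = N ** M'"
  have aP: "adj P = M' ** N" using Y by (simp add: P_def adj_mult d mexp_p_herm p_neg)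
  \<comment> \<open>C s = e^(-Y) e^(2Y') e^(-Y), visibly a matrix times its adjoint.\<close>
  have Cs: "C ** s = P ** adj P"
    unfolding aP by (simp add: C_def T'_def P_def matrix_mul_assoc[symmetric] sM sM' ss s_sq)
  have "mpart C ** s \<in> p" by (intro Qm_s mpart_Q CQ)
  moreover have "mpart C ** s ** X = X ** (mpart C ** s)"
  proof -
    have 1: "theta s C ** X = X ** theta s C"
      by (simp add: theta_eq matrix_mul_assoc[symmetric] sX) (metis XC matrix_mul_assoc sX(1))
    have "mpart C ** X = X ** mpart C" unfolding mpart_def by (simp add: mm_simps XC 1)
    then show ?thesis by (metis matrix_mul_assoc sX(1))
  qed
  ultimately have "mpart C ** s = 0" by (rule reg)
  then have "mpart C = 0" by (metis mm.zero_left ss(2))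
  then have "theta s C = C" by (simp add: mpart_def)
  then have sC: "s ** C = C ** s" by (metis theta_eq ss(2))
  have "P ** adj P = mat 1 ** adj (mat 1)"
  proof (rule pos_sqrt_unique[where M' = "M ** N'" and L' = "mat 1"])
    show "M ** N' ** adj P = mat 1" unfolding aP by (simp add: matrix_mul_assoc[symmetric] MN' MN)
    have "(C ** s) ** (C ** s) = mat 1"
    proof -
      have "(C ** s) ** (C ** s) = C ** (s ** C) ** s" by (simp add: matrix_mul_assoc)
      also have "\<dots> = C ** C ** (s ** s)" unfolding sC by (simp add: matrix_mul_assoc)
      finally show ?thesis by (simp add: C2 s_sq)
    qed
    then show "P ** adj P ** (P ** adj P) = mat 1 ** adj (mat 1) ** (mat 1 ** adj (mat 1))"
      by (simp add: Cs adj_one)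
  qed simp
  then have "N ** (M' ** (M' ** N)) = mat 1" unfolding aP by (simp add: P_def adj_one matrix_mul_assoc)
  then have "M' ** (M' ** N) = M" by (metis MN'(1) matrix_mul_rid)
  then have "M' ** M' = M ** M" by (metis MN(2) matrix_mul_assoc matrix_mul_rid)
  then have "mexp Y = mexp Y'" using mexp_hermitian_root_eq[of Y Y'] Y by (simp add: d hermitian_def p_herm)
  then have YY: "Y = Y'" using mexp_hermitian_inj[of Y Y'] Y by (simp add: hermitian_def p_herm)
  have "M' = M" "N' = N" by (simp_all add: d YY)
  then have "N ** (M ** (X ** N)) ** M = N ** (M ** (X' ** N)) ** M" using q by simp
  then have "X = X'" by (simp add: matrix_mul_assoc[symmetric] MN MN')
  with YY show ?thesis by simp
qed

text \<open>Multiplication by \<open>s\<close> turns the commutation relation into the eigenvalue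
  equation \<xi> H + H \<xi> = - 2 t \<xi> with H = X s. The operator on the left is symmetric for
  the trace form, so eigenvectors for different t are orthogonal and there are finitely many. This
  later makes the set of non-regular \<open>X\<close> a null set.\<close>

lemma singular_line_finite:
  assumes X: "X \<in> Qp"
  shows "finite {t::real. \<exists>\<xi>\<in>p. \<xi> \<noteq> 0 \<and> \<xi> ** (X + t *\<^sub>R s) = (X + t *\<^sub>R s) ** \<xi>}" (is "finite ?S")
proof -
  define H where "H = X ** s"
  obtain f where f: "\<And>t. t \<in> ?S \<Longrightarrow> f t \<in> p \<and> f t \<noteq> 0 \<and> f t ** (X + t *\<^sub>R s) = (X + t *\<^sub>R s) ** f t"
    using bchoice[of ?S "\<lambda>t \<xi>. \<xi> \<in> p \<and> \<xi> \<noteq> 0 \<and> \<xi> ** (X + t *\<^sub>R s) = (X + t *\<^sub>R s) ** \<xi>"] by blast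
  have eig: "f t ** H + H ** f t = (- 2 * t) *\<^sub>R f t" if "t \<in> ?S" for t
  proof -
    have a: "f t ** s = - (s ** f t)" using p_anti[of "f t"] f[OF that] by simp
    have aux: "a + b = - c - b \<Longrightarrow> a + c = - b - b" for a b c :: "'x::ab_group_add"
      by (simp add: algebra_simps eq_neg_iff_add_eq_0)
    have "f t ** (X + t *\<^sub>R s) ** s = (X + t *\<^sub>R s) ** f t ** s" using f[OF that] by simp
    then have "f t ** H + t *\<^sub>R f t = - (H ** f t) - t *\<^sub>R f t"
      by (simp only: H_def mm_simps matrix_mul_assoc[symmetric] s_sq a ss matrix_mul_rid minus_add_distrib diff_conv_add_uminus scaleR_minus_right minus_minus)
    then have "f t ** H + H ** f t = - (t *\<^sub>R f t) - t *\<^sub>R f t" by (rule aux)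
    also have "\<dots> = (- 2 * t) *\<^sub>R f t"
      by (simp only: scaleR_left.minus[symmetric] scaleR_left.diff[symmetric]) simp
    finally show ?thesis .
  qed
  have orth: "inner (f t) (f u) = 0" if "t \<in> ?S" "u \<in> ?S" "t \<noteq> u" for t u
  proof -
    have "mtrace (f t ** (f u ** H + H ** f u)) = mtrace (f u ** (f t ** H + H ** f t))"
      by (simp add: mm_simps mtrace_add matrix_mul_assoc)
        (simp add: mtrace_commute[of "f t ** f u" H] mtrace_commute[of "f t ** H" "f u"]
          mtrace_commute[of "f u ** H" "f t"] mtrace_commute[of "f u ** f t" H] matrix_mul_assoc)
    then have "(- 2 * u) *\<^sub>R mtrace (f t ** f u) = (- 2 * t) *\<^sub>R mtrace (f u ** f t)"
      unfolding eig[OF that(1)] eig[OF that(2)] by (simp add: mm_simps mtrace_scaleR mtrace_neg)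
    then have "(- 2 * u) *\<^sub>R mtrace (f t ** f u) = (- 2 * t) *\<^sub>R mtrace (f t ** f u)"
      by (simp only: mtrace_commute[of "f u" "f t"])
    then have "mtrace (f t ** f u) = 0" using that(3) by simp
    then show ?thesis using f[OF that(1)] by (simp add: inner_mat p_herm)
  qed
  have "pairwise orthogonal (f ` ?S)"
    unfolding pairwise_def orthogonal_def using orth by blast
  then have "finite (f ` ?S)" by (rule pairwise_orthogonal_imp_finite)
  moreover have "inj_on f ?S"
  proof (rule inj_onI, rule ccontr)
    fix t u assume tu: "t \<in> ?S" "u \<in> ?S" "f t = f u" "t \<noteq> u"
    have "inner (f t) (f t) = 0" using orth[OF tu(1,2,4)] unfolding tu(3)[symmetric] .
    then show False using f[OF tu(1)] by simp
  qed
  ultimately show ?thesis by (rule finite_imageD)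
qed

section \<open>Quantitative positivity of the source and growth of Tr e^(2Y)\<close>

text \<open>For M = e^Y the factor M \<open>adj M\<close> s is F(Y,s), so this bounds the pairing of
  F(Y,s) with \<open>A\<close> from below. The constant \<open>l\<close> stays explicit because it
  limits the size of the admissible shift, and the condition is convex in \<open>A\<close>, which
  allows moving along segments.\<close>

definition pos_bound :: "complex^'n^'n \<Rightarrow> real \<Rightarrow> bool" where
  "pos_bound A l \<longleftrightarrow> (\<forall>M. l * (norm M)\<^sup>2 \<le> Re (mtrace (M ** adj M ** s ** A)))"

lemma pos_bound_s: "0 \<le> l \<Longrightarrow> pos_bound (l *\<^sub>R s) l"
  unfolding pos_bound_def
proof
  fix M :: "complex^'n^'n"
  have "mtrace (M ** adj M ** s ** (l *\<^sub>R s)) = l *\<^sub>R mtrace (M ** adj M)"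
    by (simp add: mm_simps mtrace_scaleR ss)
  also have "mtrace (M ** adj M) = of_real ((norm M)\<^sup>2)"
    unfolding mtrace_adj_mult[symmetric] by (rule mtrace_commute)
  finally show "l * (norm M)\<^sup>2 \<le> Re (mtrace (M ** adj M ** s ** (l *\<^sub>R s)))" by simp
qed

lemma pos_bound_mono: "pos_bound A l \<Longrightarrow> l' \<le> l \<Longrightarrow> pos_bound A l'"
  unfolding pos_bound_def by (meson mult_right_mono order_trans zero_le_power2)

lemma pos_bound_convex:
  "pos_bound A l \<Longrightarrow> pos_bound B l \<Longrightarrow> 0 \<le> t \<Longrightarrow> t \<le> 1 \<Longrightarrow> pos_bound ((1 - t) *\<^sub>R A + t *\<^sub>R B) l"
  unfolding pos_bound_def
proof safe
  fix M assume a: "\<forall>M. l * (norm M)\<^sup>2 \<le> Re (mtrace (M ** adj M ** s ** A))"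
    "\<forall>M. l * (norm M)\<^sup>2 \<le> Re (mtrace (M ** adj M ** s ** B))" and t: "0 \<le> t" "t \<le> 1"
  have "(1 - t) * (l * (norm M)\<^sup>2) + t * (l * (norm M)\<^sup>2) \<le> (1 - t) * Re (mtrace (M ** adj M ** s ** A)) + t * Re (mtrace (M ** adj M ** s ** B))"
    using a t by (intro add_mono mult_left_mono) auto
  then show "l * (norm M)\<^sup>2 \<le> Re (mtrace (M ** adj M ** s ** ((1 - t) *\<^sub>R A + t *\<^sub>R B)))"
    by (simp only: mm.add_right mm.scaleR_right mtrace_add mtrace_scaleR) (simp add: algebra_simps)
qed

text \<open>The form attains a positive minimum on the unit sphere, and it is homogeneous of degree
  two.\<close>

lemma pos_def_quadratic_bound:
  fixes B :: "complex^'n^'n"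
  assumes B: "pos_def B"
  shows "\<exists>l>0. \<forall>x. l * (norm x)\<^sup>2 \<le> Re (\<Sum>i\<in>UNIV. \<Sum>j\<in>UNIV. cnj (x $ i) * B $ i $ j * x $ j)"
proof -
  define q where "q x = Re (\<Sum>i\<in>UNIV. \<Sum>j\<in>UNIV. cnj (x $ i) * B $ i $ j * x $ j)" for x :: "complex^'n"
  have qpos: "x \<noteq> 0 \<Longrightarrow> 0 < q x" for x using B by (simp add: pos_def_def q_def)
  have qs: "q (r *\<^sub>R x) = r\<^sup>2 * q x" for r x
    by (simp add: q_def sum_distrib_left power2_eq_square algebra_simps)
  have ne: "sphere (0::complex^'n) 1 \<noteq> {}" by simp
  have "continuous_on (sphere 0 1) q" unfolding q_def by (intro continuous_intros)
  then obtain x0 where x0: "x0 \<in> sphere 0 1" "\<And>x. x \<in> sphere 0 1 \<Longrightarrow> q x0 \<le> q x"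
    using continuous_attains_inf[OF compact_sphere ne] by metis
  have "0 < q x0" using x0(1) by (intro qpos) auto
  moreover have "q x0 * (norm x)\<^sup>2 \<le> q x" for x
  proof (cases "x = 0")
    case False
    then have "q x0 \<le> q (inverse (norm x) *\<^sub>R x)" by (intro x0(2)) simp
    also have "\<dots> = q x / (norm x)\<^sup>2" by (simp add: qs power_inverse divide_inverse)
    finally show ?thesis using False by (simp add: field_simps)
  qed (simp add: q_def)
  ultimately show ?thesis unfolding q_def by blast
qed

lemma pos_bound_exists:
  assumes B: "pos_def (A ** s)"
  shows "\<exists>l>0. pos_bound A l"
proof -
  obtain l where l: "l > 0" and q: "\<And>x. l * (norm x)\<^sup>2 \<le> Re (\<Sum>i\<in>UNIV. \<Sum>j\<in>UNIV. cnj (x $ i) * (A ** s) $ i $ j * x $ j)"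
    using pos_def_quadratic_bound[OF B] by blast
  have "l * (norm M)\<^sup>2 \<le> Re (mtrace (M ** adj M ** s ** A))" for M
  proof -
    \<comment> \<open>With N = s M the trace becomes Tr (\<open>adj N\<close> (A s) N), the sum of
      the quadratic form of A s over the columns of \<open>N\<close>, while |N| = |M|.\<close>
    define N where "N = s ** M"
    define col where "col k = (\<chi> i. N $ i $ k)" for k
    have "(norm M)\<^sup>2 = (norm N)\<^sup>2" by (simp add: N_def norm_s_mult)
    also have "\<dots> = (\<Sum>k\<in>UNIV. (norm (col k))\<^sup>2)"
      unfolding norm_matrix_sq norm_vec_def[of "col _"] L2_set_def
      by (simp add: col_def sum_nonneg) (rule sum.swap)
    finally have 1: "l * (norm M)\<^sup>2 = (\<Sum>k\<in>UNIV. l * (norm (col k))\<^sup>2)" by (simp add: sum_distrib_left)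
    have "mtrace (M ** adj M ** s ** A) = mtrace (adj N ** (A ** s) ** N)"
    proof -
      have "mtrace (adj N ** (A ** s) ** N) = mtrace (adj M ** s ** A ** M)"
        by (simp add: N_def adj_mult adj_s matrix_mul_assoc ss)
      also have "\<dots> = mtrace (M ** (adj M ** s ** A))" by (rule mtrace_commute)
      finally show ?thesis by (simp add: matrix_mul_assoc)
    qed
    also have "\<dots> = (\<Sum>k\<in>UNIV. \<Sum>i\<in>UNIV. \<Sum>j\<in>UNIV. cnj (col k $ i) * (A ** s) $ i $ j * col k $ j)"
    proof -
      have "mtrace (adj N ** B ** N) = (\<Sum>k\<in>UNIV. \<Sum>i\<in>UNIV. \<Sum>j\<in>UNIV. cnj (col k $ i) * B $ i $ j * col k $ j)" for B
        unfolding matrix_mul_assoc[symmetric]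
        by (simp add: mtrace_def matrix_matrix_mult_def adj_def col_def sum_distrib_left mult.assoc)
      then show ?thesis .
    qed
    finally have 2: "Re (mtrace (M ** adj M ** s ** A)) = (\<Sum>k\<in>UNIV. Re (\<Sum>i\<in>UNIV. \<Sum>j\<in>UNIV. cnj (col k $ i) * (A ** s) $ i $ j * col k $ j))"
      by simp
    show ?thesis unfolding 1 2 by (intro sum_mono q)
  qed
  then show ?thesis using l by (auto simp: pos_bound_def)
qed

lemma tau_eq: "Y \<in> p \<Longrightarrow> mtrace (mexp (2 *\<^sub>R Y)) = of_real ((norm (mexp Y))\<^sup>2)"
  using mexp_scaleR_add[of 1 Y 1] mtrace_adj_mult[of "mexp Y"] by (simp add: mexp_p_herm)

lemma mpow_add: "mpow Z (j + k) = mpow Z j ** mpow Z k"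
  by (induction j) (simp_all add: matrix_mul_assoc)

text \<open>Odd powers of \<open>Z\<close> are traceless because conjugation by \<open>s\<close>
  changes their sign, and Z^(2k) has trace |Z^k|^2. So every term of the exponential series has
  nonnegative trace, and the terms k = 0 and k = 2 are kept.\<close>

lemma mtrace_mexp_p_ge:
  assumes Z: "Z \<in> p"
  shows "real CARD('n) + (norm Z)\<^sup>2 / 2 \<le> Re (mtrace (mexp Z))"
proof -
  define a where "a k = Re (mtrace (mpow Z k))" for k
  have aZ: "adj Z = Z" by (rule p_herm[OF Z])
  have even0: "0 \<le> a (k + k)" for k
    using mtrace_adj_mult[of "mpow Z k"] by (simp add: a_def mpow_add adj_mpow aZ)
  have odd0: "a k = 0" if "odd k" for k
  proof -
    have "s ** mpow Z k = - (mpow Z k ** s)" if "odd k" for k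
      using that
    proof (induction k rule: nat_less_induct)
      case (1 k)
      show ?case
      proof (cases "k = 1")
        case True then show ?thesis using p_anti[OF Z] by simp
      next
        case False
        then obtain m where m: "k = Suc (Suc m)" "odd m" using 1(2) by (metis One_nat_def even_Suc even_zero not0_implies_Suc)
        then have "s ** mpow Z m = - (mpow Z m ** s)" using 1 by simp
        then show ?thesis unfolding m
          by (simp add: matrix_mul_assoc p_anti[OF Z] mm_simps) (metis matrix_mul_assoc mm.minus_right mm.minus_left p_anti[OF Z] minus_minus)
      qed
    qed
    then have "mtrace (mpow Z k) = - mtrace (mpow Z k)"
      by (metis matrix_mul_assoc mm.minus_left mtrace_commute mtrace_neg ss(1) that)
    then show ?thesis by (simp add: a_def)
  qed
  have nn: "0 \<le> a k" for k
  proof (cases "even k")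
    case True then obtain j where "k = j + j" by (metis evenE mult_2)
    then show ?thesis using even0 by simp
  qed (simp add: odd0)
  have sm: "(\<lambda>k. Re (mtrace ((1 / fact k) *\<^sub>R mpow Z k))) sums Re (mtrace (mexp Z))"
    unfolding mexp_def
    by (intro bounded_linear.sums[OF bounded_linear_Re] bounded_linear.sums[OF bounded_linear_mtrace] summable_sums[OF mexp_summable])
  have sm: "(\<lambda>k. 1 / fact k * a k) sums Re (mtrace (mexp Z))"
    using sm by (simp add: mtrace_scaleR a_def)
  have "(\<Sum>k\<in>{0,2::nat}. 1 / fact k * a k) \<le> (\<Sum>k. 1 / fact k * a k)"
    by (rule sum_le_suminf) (use sm nn in \<open>auto simp: sums_iff\<close>)
  moreover have "a 0 = real CARD('n)" by (simp add: a_def mtrace_one)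
  moreover have "a 2 = (norm Z)\<^sup>2"
    using mtrace_adj_mult[of Z] by (simp add: a_def aZ numeral_2_eq_2)
  ultimately show ?thesis using sm by (simp add: sums_iff)
qed

lemma tau_ge: "Y \<in> p \<Longrightarrow> real CARD('n) + 2 * (norm Y)\<^sup>2 \<le> (norm (mexp Y))\<^sup>2"
proof -
  assume Y: "Y \<in> p"
  then have "2 *\<^sub>R Y \<in> p" using subspace_p by (simp add: subspace_def)
  from mtrace_mexp_p_ge[OF this] show ?thesis by (simp add: tau_eq[OF Y] power_mult_distrib)
qed

end

subsection \<open>Determinants of function-indexed matrices\<close>

text \<open>Same formula as \<open>ndet\<close>, over any commutative ring: the real Jacobian and
  its complexification become two instances, and the size remains a term.\<close>

definition gdet :: "nat \<Rightarrow> (nat \<Rightarrow> nat \<Rightarrow> 'a::comm_ring_1) \<Rightarrow> 'a" where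
  "gdet m M = (\<Sum>p | p permutes {..<m}. of_int (sign p) * (\<Prod>i<m. M i (p i)))"

lemma gdet_cong: "(\<And>i j. i < m \<Longrightarrow> j < m \<Longrightarrow> M i j = N i j) \<Longrightarrow> gdet m M = gdet m N"
  unfolding gdet_def
  by (intro sum.cong prod.cong refl arg_cong2[of _ _ _ _ times]) (auto dest: permutes_in_image)

lemma ndet_eq_gdet: "ndet m M = gdet m M"
  by (simp add: ndet_def gdet_def)

lemma of_real_gdet: "of_real (gdet m M) = gdet m (\<lambda>i j. complex_of_real (M i j))"
  by (simp add: gdet_def)

lemma finite_permutes: "finite {p. p permutes {..<m::nat}}"
  by (rule finite_permutations) simp

text \<open>Reindexing by a transposition shows that the sum equals its own negative. Used for
  repeated rows and, in \<open>stokes\<close>, for symmetric second derivatives.\<close>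

lemma sum_permutes_antisym:
  fixes T :: "(nat \<Rightarrow> nat) \<Rightarrow> 'b::real_vector"
  assumes ab: "a < m" "b < m"
    and T: "\<And>p. p permutes {..<m} \<Longrightarrow> T (p \<circ> Transposition.transpose a b) = - T p"
  shows "(\<Sum>p | p permutes {..<m}. T p) = 0"
proof -
  have "Transposition.transpose a b permutes {..<m}" using ab by (intro permutes_swap_id) auto
  then have "(\<Sum>p | p permutes {..<m}. T p) = (\<Sum>p | p permutes {..<m}. T (p \<circ> Transposition.transpose a b))"
    by (rule sum_permutations_compose_right)
  also have "\<dots> = - (\<Sum>p | p permutes {..<m}. T p)"
    by (simp add: T sum_negf)
  finally have "2 *\<^sub>R (\<Sum>p | p permutes {..<m}. T p) = 0"
    unfolding scaleR_2 by (simp add: eq_neg_iff_add_eq_0)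
  then show ?thesis by simp
qed

lemma sign_comp_transpose:
  assumes "p permutes {..<m::nat}" "a < m" "b < m" "a \<noteq> b"
  shows "sign (p \<circ> Transposition.transpose a b) = - sign p"
proof -
  have "permutation p" using assms(1) permutation_permutes by blast
  then show ?thesis using assms by (simp add: sign_compose permutation_swap_id sign_swap_id)
qed

text \<open>Multilinearity in the row, and vanishing for repeated rows. In \<open>stokes\<close> it
  recognises \<open>av\<close> times the Jacobian as a determinant with one row replaced by partial
  derivatives of the Gaussian.\<close>

lemma gdet_row_combination:
  fixes M :: "nat \<Rightarrow> nat \<Rightarrow> complex"
  assumes r: "r < m"
  shows "gdet m (\<lambda>i j. if i = r then \<Sum>l<m. a l * M l j else M i j) = a r * gdet m M"
proof -
  define T where "T l p = of_int (sign p) * (M l (p r) * (\<Prod>i\<in>{..<m} - {r}. M i (p i)))" for l p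
  have pr: "(\<Prod>i<m. f i) = f r * (\<Prod>i\<in>{..<m} - {r}. f i)" for f :: "nat \<Rightarrow> complex"
    using r by (simp add: prod.remove)
  have "gdet m (\<lambda>i j. if i = r then \<Sum>l<m. a l * M l j else M i j)
      = (\<Sum>p | p permutes {..<m}. \<Sum>l<m. a l * T l p)"
    unfolding gdet_def pr T_def by (simp add: sum_distrib_left sum_distrib_right algebra_simps)
  also have "\<dots> = (\<Sum>l<m. a l * (\<Sum>p | p permutes {..<m}. T l p))"
    unfolding sum_distrib_left by (rule sum.swap)
  also have "\<dots> = (\<Sum>l<m. if l = r then a r * gdet m M else 0)"
  proof (rule sum.cong[OF refl])
    fix l assume l: "l \<in> {..<m}"
    show "a l * (\<Sum>p | p permutes {..<m}. T l p) = (if l = r then a r * gdet m M else 0)"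
    proof (cases "l = r")
      case True
      then show ?thesis unfolding gdet_def pr by (simp add: T_def)
    next
      case False
      have "(\<Sum>p | p permutes {..<m}. T l p) = 0"
      proof (rule sum_permutes_antisym[of l m r])
        fix p assume p: "p permutes {..<m}"
        have fin: "finite ({..<m} - {r})" by simp
        have lr: "l \<in> {..<m} - {r}" using l False by simp
        have e: "T l q = of_int (sign q) * (M l (q r) * (M l (q l) * (\<Prod>i\<in>{..<m} - {r} - {l}. M i (q i))))" for q
          unfolding T_def by (subst prod.remove[OF fin lr]) simp
        have "(\<Prod>i\<in>{..<m} - {r} - {l}. M i ((p \<circ> Transposition.transpose l r) i)) = (\<Prod>i\<in>{..<m} - {r} - {l}. M i (p i))"
          by (rule prod.cong) (auto simp: Transposition.transpose_def)
        then show "T l (p \<circ> Transposition.transpose l r) = - T l p"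
          unfolding e using sign_comp_transpose[OF p, of l r] l r False by simp
      qed (use l r in auto)
      then show ?thesis using False by simp
    qed
  qed
  also have "\<dots> = a r * gdet m M" using r by simp
  finally show ?thesis .
qed

lemma gdet_col_scale:
  "gdet m (\<lambda>i j. c j * M i j) = (\<Prod>j<m. c j) * gdet m M"
proof -
  have "(\<Prod>i<m. c (p i)) = (\<Prod>j<m. c j)" if "p permutes {..<m}" for p
    using prod.permute[OF that, of c] by (simp add: o_def)
  then show ?thesis
    unfolding gdet_def sum_distrib_left by (intro sum.cong refl) (simp add: prod.distrib)
qed

lemma norm_gdet_le:
  fixes M :: "nat \<Rightarrow> nat \<Rightarrow> 'a::{real_normed_field}"
  assumes "\<And>i j. i < m \<Longrightarrow> j < m \<Longrightarrow> norm (M i j) \<le> B"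
  shows "norm (gdet m M) \<le> fact m * B ^ m"
proof -
  have "norm (gdet m M) \<le> (\<Sum>p | p permutes {..<m}. B ^ m)"
    unfolding gdet_def
  proof (rule sum_norm_le)
    fix p assume "p \<in> {p. p permutes {..<m}}"
    then have p: "p permutes {..<m}" by simp
    have "norm (of_int (sign p) * (\<Prod>i<m. M i (p i))) = (\<Prod>i<m. norm (M i (p i)))"
      by (simp add: norm_mult prod_norm sign_def)
    also have "\<dots> \<le> (\<Prod>i<m. B)"
      by (intro prod_mono conjI norm_ge_zero assms) (use permutes_in_image[OF p] in auto)
    finally show "norm (of_int (sign p) * (\<Prod>i<m. M i (p i))) \<le> B ^ m" by simp
  qed
  also have "\<dots> = fact m * B ^ m"
    using card_permutations[of "{..<m}" m] by simp
  finally show ?thesis .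
qed

text \<open>Every factor of every product is affine in z; the bound \<open>m\<close> on the degree
  is what fixes the number of interpolation nodes later.\<close>

lemma gdet_affine_poly:
  fixes A B :: "nat \<Rightarrow> nat \<Rightarrow> 'a::comm_ring_1"
  obtains q :: "'a poly" where "degree q \<le> m" "\<And>z. poly q z = gdet m (\<lambda>i j. A i j + z * B i j)"
proof
  let ?q = "\<Sum>p | p permutes {..<m}. smult (of_int (sign p)) (\<Prod>i<m. [:A i (p i), B i (p i):])"
  show "degree ?q \<le> m"
  proof (rule degree_sum_le[OF finite_permutes])
    fix p assume "p \<in> {p. p permutes {..<m}}"
    have "degree (\<Prod>i<m. [:A i (p i), B i (p i):]) \<le> (\<Sum>i<m. degree [:A i (p i), B i (p i):])"
      using degree_prod_sum_le[of "{..<m}" "\<lambda>i. [:A i (p i), B i (p i):]"] by (simp add: o_def)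
    also have "\<dots> \<le> (\<Sum>i<m. 1)" by (rule sum_mono) simp
    finally show "degree (smult (of_int (sign p)) (\<Prod>i<m. [:A i (p i), B i (p i):])) \<le> m"
      using degree_smult_le order_trans by fastforce
  qed
  show "poly ?q z = gdet m (\<lambda>i j. A i j + z * B i j)" for z
    by (simp add: poly_sum poly_prod gdet_def)
qed

text \<open>The block is completed by an identity block to a matrix indexed by the type
  \<open>'N\<close>, since the change of variables speaks of such matrices while \<open>m\<close> is
  a term. Permutations that move an index outside the block contribute zero.\<close>

lemma gdet_as_det:
  fixes M :: "nat \<Rightarrow> nat \<Rightarrow> real" and e :: "'N::finite \<Rightarrow> nat"
  assumes e: "bij_betw e UNIV {..<CARD('N)}" and m: "m \<le> CARD('N)"
  shows "det (\<chi> a b. if e a < m \<and> e b < m then M (e a) (e b) else if a = b then 1 else 0 :: real^'N^'N) = gdet m M"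
    (is "det ?A = _")
proof -
  define U where "U = {a. e a < m}"
  have inj: "inj e" using e by (simp add: bij_betw_def)
  have bU: "bij_betw e U {..<m}"
  proof -
    have "e ` U = {..<m}"
    proof -
      have "\<exists>a. k = e a" if "k < m" for k
        using e that m by (auto simp: bij_betw_def image_iff set_eq_iff)
      then show ?thesis by (force simp: U_def)
    qed
    then show ?thesis using inj by (auto simp: bij_betw_def intro: inj_on_subset)
  qed
  define f where "f = inv_into U e"
  have fe: "f (e a) = a" if "a \<in> U" for a
    using bU that by (simp add: f_def bij_betw_inv_into_left)
  have bf: "bij_betw f {..<m} U" unfolding f_def by (rule bij_betw_inv_into[OF bU])
  have ef: "e (f i) = i" if "i \<in> {..<m}" for i
    using bij_betw_inv_into_right[OF bU that] by (simp add: f_def)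
  have "det ?A = (\<Sum>p | p permutes UNIV. of_int (sign p) * (\<Prod>a\<in>UNIV. ?A $ a $ p a))"
    by (simp add: det_def)
  also have "\<dots> = (\<Sum>p | p permutes U. of_int (sign p) * (\<Prod>a\<in>UNIV. ?A $ a $ p a))"
  proof (rule sum.mono_neutral_right)
    show "finite {p. p permutes (UNIV::'N set)}" by (rule finite_permutations) simp
    show "{p. p permutes U} \<subseteq> {p. p permutes UNIV}" by (auto intro: permutes_subset)
    show "\<forall>p\<in>{p. p permutes UNIV} - {p. p permutes U}. of_int (sign p) * (\<Prod>a\<in>UNIV. ?A $ a $ p a) = 0"
    proof
      fix p assume p: "p \<in> {p. p permutes (UNIV::'N set)} - {p. p permutes U}"
      have "\<exists>a. a \<notin> U \<and> p a \<noteq> a"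
      proof (rule ccontr)
        assume "\<nexists>a. a \<notin> U \<and> p a \<noteq> a"
        then have "p permutes U" using p by (auto simp: permutes_def)
        then show False using p by simp
      qed
      then obtain a where "a \<notin> U" "p a \<noteq> a" by blast
      then have "?A $ a $ p a = 0" by (auto simp: U_def)
      then have "\<exists>a\<in>UNIV. ?A $ a $ p a = 0" by blast
      then have "(\<Prod>a\<in>UNIV. ?A $ a $ p a) = 0" by (intro prod_zero finite)
      then show "of_int (sign p) * (\<Prod>a\<in>UNIV. ?A $ a $ p a) = 0" by simp
    qed
  qed
  also have "\<dots> = (\<Sum>q | q permutes {..<m}. of_int (sign q) * (\<Prod>i<m. M i (q i)))"
  proof (rule sum.reindex_bij_witness[where j = "map_permutation U e" and i = "map_permutation {..<m} f"])
    fix p assume "p \<in> {p. p permutes U}"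
    then have p: "p permutes U" by simp
    show "map_permutation {..<m} f (map_permutation U e p) = p"
      by (rule map_permutation_compose_inv[OF bU p fe])
    show "map_permutation U e p \<in> {q. q permutes {..<m}}"
      using map_permutation_permutes[OF bU p] by simp
    have s: "sign (map_permutation U e p) = sign p"
      by (rule sign_map_permutation) (use p inj in \<open>auto intro: inj_on_subset\<close>)
    have "(\<Prod>a\<in>UNIV. ?A $ a $ p a) = (\<Prod>a\<in>U. M (e a) (e (p a)))"
    proof -
      have "(\<Prod>a\<in>UNIV. ?A $ a $ p a) = (\<Prod>a\<in>U. ?A $ a $ p a)"
        by (rule prod.mono_neutral_right) (use p in \<open>auto simp: U_def permutes_def\<close>)
      also have "\<dots> = (\<Prod>a\<in>U. M (e a) (e (p a)))"
        by (rule prod.cong) (use permutes_in_image[OF p] in \<open>auto simp: U_def\<close>)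
      finally show ?thesis .
    qed
    also have "\<dots> = (\<Prod>i<m. M i (map_permutation U e p i))"
    proof (rule prod.reindex_bij_betw[OF bU, symmetric, THEN trans, symmetric])
      show "(\<Prod>a\<in>U. M (e a) (map_permutation U e p (e a))) = (\<Prod>a\<in>U. M (e a) (e (p a)))"
      proof (rule prod.cong)
        fix a assume a: "a \<in> U"
        then have "map_permutation U e p (e a) = e (p (inv_into U e (e a)))"
          by (auto simp: map_permutation_def restrict_id_def)
        then show "M (e a) (map_permutation U e p (e a)) = M (e a) (e (p a))"
          using fe[OF a] by (simp add: f_def)
      qed simp
    qed
    finally show "of_int (sign (map_permutation U e p)) * (\<Prod>i<m. M i (map_permutation U e p i))
        = of_int (sign p) * (\<Prod>a\<in>UNIV. ?A $ a $ p a)" by (simp add: s)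
  next
    fix q assume "q \<in> {q. q permutes {..<m}}"
    then have q: "q permutes {..<m}" by simp
    show "map_permutation U e (map_permutation {..<m} f q) = q"
      by (rule map_permutation_compose_inv[OF bf q ef])
    show "map_permutation {..<m} f q \<in> {p. p permutes U}"
      using map_permutation_permutes[OF bf q] by simp
  qed
  finally show ?thesis by (simp add: gdet_def)
qed

text \<open>Both \<open>M\<close> and its right inverse \<open>R\<close> are completed by identity
  blocks, and \<open>det\<close> is multiplicative.\<close>

lemma gdet_nonzero:
  fixes M R :: "nat \<Rightarrow> nat \<Rightarrow> real" and T :: "'N::finite itself"
  assumes m: "m \<le> CARD('N)"
    and inv: "\<And>i k. i < m \<Longrightarrow> k < m \<Longrightarrow> (\<Sum>j<m. M i j * R j k) = (if i = k then 1 else 0)"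
  shows "gdet m M \<noteq> 0"
proof -
  obtain e :: "'N \<Rightarrow> nat" where e: "bij_betw e UNIV {..<CARD('N)}"
    using ex_bij_betw_finite_nat[of "UNIV::'N set"] by (auto simp: atLeast0LessThan)
  define ext where "ext M = (\<chi> a b. if e a < m \<and> e b < m then M (e a) (e b) else if a = b then 1 else 0 :: real^'N^'N)" for M :: "nat \<Rightarrow> nat \<Rightarrow> real"
  have "ext M ** ext R = mat 1"
  proof -
    have "(ext M ** ext R) $ a $ b = mat 1 $ a $ b" for a b
    proof -
      have inje: "e a = e b \<longleftrightarrow> a = b" for a b using e by (auto simp: bij_betw_def inj_def)
      show ?thesis
      proof (cases "e a < m")
        case True
        have "(ext M ** ext R) $ a $ b = (\<Sum>c\<in>UNIV. (if e c < m then M (e a) (e c) else 0) * (ext R $ c $ b))"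
          unfolding matrix_matrix_mult_def using True by (auto simp: ext_def intro!: sum.cong)
        also have "\<dots> = (\<Sum>c\<in>UNIV. if e c < m \<and> e b < m then M (e a) (e c) * R (e c) (e b) else 0)"
          by (rule sum.cong) (auto simp: ext_def)
        also have "\<dots> = (\<Sum>j<CARD('N). if j < m \<and> e b < m then M (e a) j * R j (e b) else 0)"
          by (rule sum.reindex_bij_betw[OF e, of "\<lambda>j. if j < m \<and> e b < m then M (e a) j * R j (e b) else 0"])
        also have "\<dots> = (\<Sum>j<m. if e b < m then M (e a) j * R j (e b) else 0)"
          by (rule sum.mono_neutral_cong_right) (use m in auto)
        also have "\<dots> = mat 1 $ a $ b"
        proof (cases "e b < m")
          case True
          then show ?thesis using inv[OF \<open>e a < m\<close>, of "e b"] by (simp add: mat_def inje)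
        next
          case False
          then show ?thesis using \<open>e a < m\<close> by (auto simp: mat_def)
        qed
        finally show ?thesis .
      next
        case False
        have "(ext M ** ext R) $ a $ b = (\<Sum>c\<in>UNIV. (if a = c then ext R $ c $ b else 0))"
          proof -
          have "ext M $ a $ c = (if a = c then 1 else 0)" for c using False by (simp add: ext_def)
          then show ?thesis unfolding matrix_matrix_mult_def by (simp add: if_distrib[of "\<lambda>x. x * _"] cong: if_cong)
        qed
        also have "\<dots> = ext R $ a $ b" by (simp add: sum.delta)
        also have "\<dots> = mat 1 $ a $ b" using False by (auto simp: ext_def mat_def)
        finally show ?thesis .
      qed
    qed
    then show ?thesis by (simp add: vec_eq_iff)
  qed
  then have "det (ext M) * det (ext R) = 1" by (metis det_I det_mul)
  then have "det (ext M) \<noteq> 0" by auto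
  then show ?thesis using gdet_as_det[OF e m, of M] by (simp add: ext_def)
qed

subsection \<open>Lebesgue measure on finite products\<close>

abbreviation LM :: "nat set \<Rightarrow> (nat \<Rightarrow> real) measure" where
  "LM I \<equiv> PiM I (\<lambda>_. lborel)"

interpretation LM: product_sigma_finite "\<lambda>_::nat. lborel::real measure"
  by standard

lemma emeasure_lborel_affine:
  assumes c: "c \<noteq> (0::real)" and A: "A \<in> sets borel"
  shows "ennreal \<bar>c\<bar> * emeasure lborel ((\<lambda>x. t + c * x) -` A) = emeasure lborel A"
proof -
  have "emeasure lborel A = emeasure (density (distr lborel borel (\<lambda>x. t + c * x)) (\<lambda>_. ennreal \<bar>c\<bar>)) A"
    using lborel_real_affine[OF c, of t] by simp
  also have "\<dots> = ennreal \<bar>c\<bar> * emeasure (distr lborel borel (\<lambda>x. t + c * x)) A"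
    using A by (subst emeasure_density_const) auto
  also have "\<dots> = ennreal \<bar>c\<bar> * emeasure lborel ((\<lambda>x. t + c * x) -` A)"
    using A by (subst emeasure_distr) auto
  finally show ?thesis ..
qed

text \<open>Two instances matter: translation of the X-coordinates by a real multiple of
  \<open>s\<close>, and the shrinking of the Y-coordinates in the argument that the constant does
  not vanish. The restriction to \<open>I\<close> keeps the image inside the extensional product
  space.\<close>

lemma LM_affine:
  assumes fin: "finite I" and c: "\<And>i. i \<in> I \<Longrightarrow> c i \<noteq> 0"
  shows "density (distr (LM I) (LM I) (\<lambda>y. \<lambda>i\<in>I. t i + c i * y i)) (\<lambda>_. ennreal (\<Prod>i\<in>I. \<bar>c i\<bar>)) = LM I"
proof (rule LM.PiM_eqI[OF fin])
  let ?T = "\<lambda>y. \<lambda>i\<in>I. t i + c i * y i"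
  have T: "?T \<in> measurable (LM I) (LM I)" by (intro measurable_restrict) measurable
  show "sets (density (distr (LM I) (LM I) ?T) (\<lambda>_. ennreal (\<Prod>i\<in>I. \<bar>c i\<bar>))) = sets (LM I)" by simp
  fix A assume A: "\<And>i. i \<in> I \<Longrightarrow> A i \<in> sets (lborel :: real measure)"
  have sA: "Pi\<^sub>E I A \<in> sets (LM I)" by (intro sets_PiM_I_finite fin A)
  have pre: "?T -` Pi\<^sub>E I A \<inter> space (LM I) = Pi\<^sub>E I (\<lambda>i. (\<lambda>x. t i + c i * x) -` A i)"
    by (auto simp: space_PiM PiE_iff)
  have m: "(\<lambda>x. t i + c i * x) -` A i \<in> sets lborel" if "i \<in> I" for i
    using measurable_sets[of "\<lambda>x. t i + c i * x" lborel lborel "A i"] A[OF that] by simp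
  have "emeasure (density (distr (LM I) (LM I) ?T) (\<lambda>_. ennreal (\<Prod>i\<in>I. \<bar>c i\<bar>))) (Pi\<^sub>E I A)
      = ennreal (\<Prod>i\<in>I. \<bar>c i\<bar>) * emeasure (LM I) (Pi\<^sub>E I (\<lambda>i. (\<lambda>x. t i + c i * x) -` A i))"
    using sA T by (subst emeasure_density_const) (auto simp: emeasure_distr pre)
  also have "\<dots> = (\<Prod>i\<in>I. ennreal \<bar>c i\<bar>) * (\<Prod>i\<in>I. emeasure lborel ((\<lambda>x. t i + c i * x) -` A i))"
    using fin m by (subst LM.emeasure_PiM) (auto simp: prod_ennreal)
  also have "\<dots> = (\<Prod>i\<in>I. emeasure lborel (A i))"
    unfolding prod.distrib[symmetric]
    by (intro prod.cong refl emeasure_lborel_affine c) (use A in auto)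
  finally show "emeasure (density (distr (LM I) (LM I) ?T) (\<lambda>_. ennreal (\<Prod>i\<in>I. \<bar>c i\<bar>))) (Pi\<^sub>E I A)
      = (\<Prod>i\<in>I. emeasure lborel (A i))" .
qed

lemma
  fixes f :: "(nat \<Rightarrow> real) \<Rightarrow> 'b::{banach, second_countable_topology}"
  assumes fin: "finite I" and c: "\<And>i. i \<in> I \<Longrightarrow> c i \<noteq> 0" and f[measurable]: "f \<in> borel_measurable (LM I)"
  shows integrable_LM_affine: "integrable (LM I) (\<lambda>y. f (\<lambda>i\<in>I. t i + c i * y i)) \<longleftrightarrow> integrable (LM I) f"
    and integral_LM_affine: "(\<integral>y. f y \<partial>LM I) = (\<Prod>i\<in>I. \<bar>c i\<bar>) *\<^sub>R (\<integral>y. f (\<lambda>i\<in>I. t i + c i * y i) \<partial>LM I)"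
proof -
  let ?T = "\<lambda>y. \<lambda>i\<in>I. t i + c i * y i" and ?P = "\<Prod>i\<in>I. \<bar>c i\<bar>"
  have T[measurable]: "?T \<in> measurable (LM I) (LM I)" by (intro measurable_restrict) measurable
  have P: "?P > 0" using c fin by (intro prod_pos) auto
  have m: "density (distr (LM I) (LM I) ?T) (\<lambda>_. ennreal ?P) = LM I"
    by (rule LM_affine) (use fin c in auto)
  have "integrable (density (distr (LM I) (LM I) ?T) (\<lambda>_. ennreal ?P)) f
      \<longleftrightarrow> integrable (distr (LM I) (LM I) ?T) (\<lambda>x. ?P *\<^sub>R f x)"
    by (rule integrable_density) (use P in auto)
  also have "\<dots> \<longleftrightarrow> integrable (distr (LM I) (LM I) ?T) f"
  proof
    assume "integrable (distr (LM I) (LM I) ?T) (\<lambda>x. ?P *\<^sub>R f x)"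
    then have "integrable (distr (LM I) (LM I) ?T) (\<lambda>x. inverse ?P *\<^sub>R ?P *\<^sub>R f x)"
      by (rule integrable_scaleR_right)
    moreover have "inverse ?P *\<^sub>R ?P *\<^sub>R f x = f x" for x
      using P by (simp only: scaleR_scaleR left_inverse[OF less_imp_neq[OF P, symmetric]] scaleR_one)
    ultimately show "integrable (distr (LM I) (LM I) ?T) f" by (simp only:)
  qed (intro integrable_scaleR_right)
  also have "\<dots> \<longleftrightarrow> integrable (LM I) (\<lambda>y. f (?T y))"
    by (rule integrable_distr_eq) auto
  finally show "integrable (LM I) (\<lambda>y. f (?T y)) \<longleftrightarrow> integrable (LM I) f" unfolding m by simp
  have "integral\<^sup>L (density (distr (LM I) (LM I) ?T) (\<lambda>_. ennreal ?P)) f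
      = integral\<^sup>L (distr (LM I) (LM I) ?T) (\<lambda>x. ?P *\<^sub>R f x)"
    by (rule integral_density) (use P in auto)
  also have "\<dots> = ?P *\<^sub>R integral\<^sup>L (LM I) (\<lambda>y. f (?T y))"
    by (subst integral_distr) auto
  finally show "(\<integral>y. f y \<partial>LM I) = ?P *\<^sub>R (\<integral>y. f (?T y) \<partial>LM I)" unfolding m .
qed

section \<open>Gaussian integrals and vanishing of boundary terms\<close>

lemma integrable_gaussian_lborel:
  assumes a: "0 < a"
  shows "integrable lborel (\<lambda>x::real. exp (- (a * x\<^sup>2)))"
    and "(\<integral>x. exp (- (a * x\<^sup>2)) \<partial>lborel) > 0"
proof -
  define \<sigma> where "\<sigma> = 1 / sqrt (2 * a)"
  have \<sigma>: "\<sigma> > 0" "\<sigma>\<^sup>2 = 1 / (2 * a)" using a by (simp_all add: \<sigma>_def power_divide)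
  have e: "exp (- (a * x\<^sup>2)) = sqrt (2 * pi * \<sigma>\<^sup>2) * normal_density 0 \<sigma> x" for x
    using \<sigma> a by (simp add: normal_density_def)
  show "integrable lborel (\<lambda>x::real. exp (- (a * x\<^sup>2)))"
    unfolding e by (intro integrable_mult_right integrable_normal_density \<sigma>(1))
  have "(\<integral>x. exp (- (a * x\<^sup>2)) \<partial>lborel) = sqrt (2 * pi * \<sigma>\<^sup>2)"
    unfolding e using \<sigma> by simp
  also have "\<dots> > 0" using \<sigma> a by simp
  finally show "(\<integral>x. exp (- (a * x\<^sup>2)) \<partial>lborel) > 0" .
qed

definition sqsum :: "nat set \<Rightarrow> (nat \<Rightarrow> real) \<Rightarrow> real" where
  "sqsum I y = (\<Sum>i\<in>I. (y i)\<^sup>2)"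

lemma sqsum_nonneg [simp]: "0 \<le> sqsum I y"
  by (simp add: sqsum_def sum_nonneg)

lemma measurable_sqsum [measurable]: "sqsum I \<in> borel_measurable (LM I)"
  unfolding sqsum_def[abs_def] by measurable

lemma LM_gaussian:
  assumes fin: "finite I" and a: "0 < a"
  shows integrable_LM_gaussian: "integrable (LM I) (\<lambda>y. exp (- (a * sqsum I y)))"
    and integral_LM_gaussian_pos: "(\<integral>y. exp (- (a * sqsum I y)) \<partial>LM I) > 0"
proof -
  have e: "exp (- (a * sqsum I y)) = (\<Prod>i\<in>I. exp (- (a * (y i)\<^sup>2)))" for y
    using fin by (simp add: sqsum_def exp_sum sum_distrib_left sum_negf[symmetric])
  show "integrable (LM I) (\<lambda>y. exp (- (a * sqsum I y)))"
    unfolding e by (rule LM.product_integrable_prod[OF fin integrable_gaussian_lborel(1)[OF a]])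
  have "(\<integral>y. exp (- (a * sqsum I y)) \<partial>LM I) = (\<Prod>i\<in>I. \<integral>x. exp (- (a * x\<^sup>2)) \<partial>lborel)"
    unfolding e by (rule LM.product_integral_prod[OF fin integrable_gaussian_lborel(1)[OF a]])
  also have "\<dots> > 0" by (intro prod_pos) (use integrable_gaussian_lborel(2)[OF a] in auto)
  finally show "(\<integral>y. exp (- (a * sqsum I y)) \<partial>LM I) > 0" .
qed

lemma integrable_gaussian_bound:
  fixes f :: "_ \<Rightarrow> 'b::{banach, second_countable_topology}"
  assumes fin: "finite I" and a: "0 < a" and f: "f \<in> borel_measurable (LM I)"
    and b: "\<And>y. norm (f y) \<le> C * exp (- (a * sqsum I y))"
  shows "integrable (LM I) f"
proof (rule Bochner_Integration.integrable_bound[OF _ f])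
  show "integrable (LM I) (\<lambda>y. C * exp (- (a * sqsum I y)))"
    using integrable_LM_gaussian[OF fin a] by simp
  show "AE y in LM I. norm (f y) \<le> norm (C * exp (- (a * sqsum I y)))"
    by (intro AE_I2 order_trans[OF b]) simp
qed

text \<open>The integral over [-n, n] is g n - g (-n) by the fundamental theorem; dominated
  convergence on one side and decay of \<open>g\<close> on the other give zero.\<close>

lemma integral_vector_derivative_eq_0:
  fixes g g' :: "real \<Rightarrow> complex"
  assumes d: "\<And>t. (g has_vector_derivative g' t) (at t)"
    and i: "integrable lborel g'"
    and top: "(g \<longlongrightarrow> 0) at_top" and bot: "(g \<longlongrightarrow> 0) at_bot"
  shows "(\<integral>t. g' t \<partial>lborel) = 0"
proof -
  have m: "g' \<in> borel_measurable lborel" using i by auto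
  have eq: "(\<integral>t. indicator {- real n..real n} t *\<^sub>R g' t \<partial>lborel) = g (real n) - g (- real n)" for n
  proof -
    have s: "set_integrable lborel {- real n..real n} g'"
      unfolding set_integrable_def by (rule integrable_mult_indicator[OF _ i]) simp
    have "(g' has_integral (g (real n) - g (- real n))) {- real n..real n}"
      by (rule fundamental_theorem_of_calculus) (auto intro: has_vector_derivative_at_within d)
    then have "integral {- real n..real n} g' = g (real n) - g (- real n)"
      by (rule integral_unique)
    then show ?thesis using set_borel_integral_eq_integral(2)[OF s]
      by (simp add: set_lebesgue_integral_def)
  qed
  have "(\<lambda>n. \<integral>t. indicator {- real n..real n} t *\<^sub>R g' t \<partial>lborel) \<longlonglongrightarrow> (\<integral>t. g' t \<partial>lborel)"
  proof (rule integral_dominated_convergence[where w = "\<lambda>t. norm (g' t)"])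
    show "AE t in lborel. (\<lambda>n. indicator {- real n..real n} t *\<^sub>R g' t) \<longlonglongrightarrow> g' t"
    proof (rule AE_I2)
      fix t :: real
      obtain N :: nat where N: "\<bar>t\<bar> < real N" using reals_Archimedean2 by blast
      show "(\<lambda>n. indicator {- real n..real n} t *\<^sub>R g' t) \<longlonglongrightarrow> g' t"
      proof (rule tendsto_eventually, rule eventually_sequentiallyI[of N])
        fix n assume "N \<le> n"
        then have "real N \<le> real n" by simp
        then have "t \<in> {- real n..real n}" using N by auto
        then show "indicator {- real n..real n} t *\<^sub>R g' t = g' t" by simp
      qed
    qed
  qed (use m i in \<open>auto simp: indicator_def\<close>)
  moreover have "(\<lambda>n. g (real n) - g (- real n)) \<longlonglongrightarrow> 0 - 0"
    by (intro tendsto_diff filterlim_compose[OF top] filterlim_compose[OF bot]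
        filterlim_real_sequentially filterlim_compose[OF filterlim_uminus_at_bot_at_top])
  ultimately show ?thesis unfolding eq by (auto dest: LIMSEQ_unique)
qed

lemma gaussian_tendsto_0:
  assumes a: "0 < (a::real)"
  shows "((\<lambda>x. exp (- (a * x\<^sup>2))) \<longlongrightarrow> 0) at_top" "((\<lambda>x. exp (- (a * x\<^sup>2))) \<longlongrightarrow> 0) at_bot"
  using a by real_asymp+

text \<open>Fubini with coordinate \<open>k\<close> innermost. On each line the Gaussian bound still
  decays in t, because t^2 is at most the full sum of squares.\<close>

lemma integral_partial_derivative_eq_0:
  fixes g g' :: "(nat \<Rightarrow> real) \<Rightarrow> complex"
  assumes fin: "finite I" and k: "k \<in> I" and a: "0 < a"
    and d: "\<And>y. ((\<lambda>t. g (y(k := t))) has_vector_derivative g' y) (at (y k))"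
    and m: "g' \<in> borel_measurable (LM I)"
    and b: "\<And>y. norm (g y) \<le> C * exp (- (a * sqsum I y))"
    and b': "\<And>y. norm (g' y) \<le> C * exp (- (a * sqsum I y))"
  shows "(\<integral>y. g' y \<partial>LM I) = 0"
proof -
  define J where "J = I - {k}"
  have J: "finite J" "k \<notin> J" "I = insert k J" using fin k by (auto simp: J_def)
  have int: "integrable (LM I) g'" by (rule integrable_gaussian_bound[OF fin a m b'])
  have "(\<integral>y. g' y \<partial>LM I) = (\<integral>x. (\<integral>t. g' (x(k := t)) \<partial>lborel) \<partial>LM J)"
    unfolding J(3) by (rule LM.product_integral_insert[OF J(1,2)]) (use int J in simp)
  also have "\<dots> = (\<integral>x. 0 \<partial>LM J)"
  proof (rule Bochner_Integration.integral_cong[OF refl])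
    fix x assume x: "x \<in> space (LM J)"
    have C: "0 \<le> C"
    proof -
      have "0 \<le> C * exp (- (a * sqsum I x))" using norm_ge_zero b order_trans by blast
      then show ?thesis by (simp add: zero_le_mult_iff)
    qed
    have sq: "t\<^sup>2 \<le> sqsum I (x(k := t))" for t
      unfolding sqsum_def J(3) using J(1,2) by (simp add: sum_nonneg)
    have le: "C * exp (- (a * sqsum I (x(k := t)))) \<le> C * exp (- (a * t\<^sup>2))" for t
      using C a sq[of t] by (intro mult_left_mono) auto
    show "(\<integral>t. g' (x(k := t)) \<partial>lborel) = 0"
    proof (rule integral_vector_derivative_eq_0[where g = "\<lambda>t. g (x(k := t))"])
      show "((\<lambda>t. g (x(k := t))) has_vector_derivative g' (x(k := t))) (at t)" for t
        using d[of "x(k := t)"] by simp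
      have me: "(\<lambda>t. x(k := t)) \<in> measurable lborel (LM I)"
        unfolding J(3) using x by (intro measurable_fun_upd[where J = J]) auto
      show "integrable lborel (\<lambda>t. g' (x(k := t)))"
      proof (rule Bochner_Integration.integrable_bound)
        show "integrable lborel (\<lambda>t. C * exp (- (a * t\<^sup>2)))"
          using integrable_gaussian_lborel(1)[OF a] by simp
        show "(\<lambda>t. g' (x(k := t))) \<in> borel_measurable lborel" by (rule measurable_compose[OF me m])
        show "AE t in lborel. norm (g' (x(k := t))) \<le> norm (C * exp (- (a * t\<^sup>2)))"
          using C by (intro AE_I2 order_trans[OF b'] order_trans[OF le]) simp
      qed
      have bg: "norm (g (x(k := t))) \<le> C * exp (- (a * t\<^sup>2))" for t
        by (rule order_trans[OF b le])
      show "((\<lambda>t. g (x(k := t))) \<longlongrightarrow> 0) at_top" "((\<lambda>t. g (x(k := t))) \<longlongrightarrow> 0) at_bot"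
        by (rule Lim_null_comparison[OF always_eventually tendsto_mult_right_zero[OF gaussian_tendsto_0(1)[OF a]]], use bg in blast,
          rule Lim_null_comparison[OF always_eventually tendsto_mult_right_zero[OF gaussian_tendsto_0(2)[OF a]]], use bg in blast)
    qed
  qed
  finally show ?thesis by simp
qed

section \<open>Null sets and integrability through change of variables\<close>

text \<open>By translation invariance the measure of \<open>B\<close> is the average of the measures
  of its translates by t v, t in [0,1]. Exchanging the integrals leaves, for each x, the length of a
  finite set.\<close>

lemma null_set_of_finite_lines:
  fixes B :: "'a::euclidean_space set"
  assumes B: "closed B" and fin: "\<And>x. finite {t::real. x + t *\<^sub>R v \<in> B}"
  shows "B \<in> null_sets lborel"
proof -
  have Bb[measurable]: "B \<in> sets borel" using B by simp
  have tr: "(\<integral>\<^sup>+x. indicator B (x + t *\<^sub>R v) \<partial>lborel) = emeasure lborel B" for t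
  proof -
    have "emeasure lborel B = (\<integral>\<^sup>+x. indicator B x \<partial>distr lborel borel ((+) (t *\<^sub>R v)))"
      unfolding lborel_distr_plus by simp
    also have "\<dots> = (\<integral>\<^sup>+x. indicator B (t *\<^sub>R v + x) \<partial>lborel)"
      by (subst nn_integral_distr) auto
    finally show ?thesis by (simp add: add.commute)
  qed
  have "emeasure lborel B = (\<integral>\<^sup>+t. emeasure lborel B * indicator {0..1::real} t \<partial>lborel)"
    by (subst nn_integral_cmult_indicator) auto
  also have "\<dots> = (\<integral>\<^sup>+t. (\<integral>\<^sup>+x. indicator B (x + t *\<^sub>R v) * indicator {0..1::real} t \<partial>lborel) \<partial>lborel)"
    by (intro nn_integral_cong) (subst nn_integral_multc, auto simp: tr)
  also have "\<dots> = (\<integral>\<^sup>+x. (\<integral>\<^sup>+t. indicator B (x + t *\<^sub>R v) * indicator {0..1::real} t \<partial>lborel) \<partial>lborel)"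
    by (rule lborel_pair.Fubini'[symmetric]) measurable
  also have "\<dots> = (\<integral>\<^sup>+x. 0 \<partial>(lborel::'a measure))"
  proof (rule nn_integral_cong)
    fix x :: 'a
    have "AE t in lborel. t \<notin> {t::real. x + t *\<^sub>R v \<in> B}"
      by (rule AE_not_in) (rule finite_imp_null_set_lborel[OF fin])
    then have "AE t in lborel. indicator B (x + t *\<^sub>R v) * indicator {0..1::real} t = (0::ennreal)"
      by (rule AE_mp) (auto simp: indicator_def)
    then show "(\<integral>\<^sup>+t. indicator B (x + t *\<^sub>R v) * indicator {0..1::real} t \<partial>lborel) = 0"
      by (subst nn_integral_0_iff_AE) auto
  qed
  finally have "emeasure lborel B = 0" by simp
  then show ?thesis by (intro null_setsI) auto
qed

lemma integrable_inverse_1_plus_sq: "integrable lborel (\<lambda>x::real. 1 / (1 + x\<^sup>2))"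
  using integrable_inverse_1_plus_square by (simp add: set_integrable_def divide_inverse)

lemma integrable_prod_inverse_1_plus_sq:
  "integrable lborel (\<lambda>x::'a::euclidean_space. \<Prod>b\<in>Basis. 1 / (1 + (x \<bullet> b)\<^sup>2))"
proof -
  interpret B: product_sigma_finite "\<lambda>_::'a. lborel::real measure" by standard
  have "integrable (\<Pi>\<^sub>M b\<in>(Basis::'a set). lborel) (\<lambda>f. \<Prod>b\<in>Basis. 1 / (1 + (f b :: real)\<^sup>2))"
    by (rule B.product_integrable_prod[of Basis "\<lambda>_ x. 1 / (1 + x\<^sup>2)", OF finite_Basis integrable_inverse_1_plus_sq])
  also have "(\<lambda>f. \<Prod>b\<in>Basis. 1 / (1 + (f b :: real)\<^sup>2)) = (\<lambda>f. \<Prod>b\<in>(Basis::'a set). 1 / (1 + ((\<Sum>c\<in>Basis. f c *\<^sub>R c) \<bullet> b)\<^sup>2))"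
    by (auto simp: inner_sum_left_Basis intro!: prod.cong)
  finally show ?thesis
    by (subst lborel_eq, subst integrable_distr_eq) auto
qed

text \<open>Transfers results about Lebesgue measure on \<open>real^'N\<close> to coordinates
  indexed by natural numbers.\<close>

lemma lborel_vec_eq_distr:
  fixes e :: "'N::finite \<Rightarrow> nat"
  assumes e: "bij_betw e UNIV {..<CARD('N)}"
  shows "(lborel :: (real^'N) measure) = distr (LM {..<CARD('N)}) borel (\<lambda>y. \<chi> a. y (e a))"
proof (rule lborel_eqI)
  let ?T = "\<lambda>y. (\<chi> a. y (e a)) :: real^'N"
  have ea: "e a < CARD('N)" for a using e by (auto simp: bij_betw_def)
  have Tm: "?T \<in> borel_measurable (LM {..<CARD('N)})"
  proof (subst borel_measurable_euclidean_space, intro ballI)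
    fix i :: "real^'N" assume "i \<in> Basis"
    then obtain a where i: "i = axis a 1" by (auto simp: Basis_vec_def)
    show "(\<lambda>y. ?T y \<bullet> i) \<in> borel_measurable (LM {..<CARD('N)})"
      unfolding i inner_axis using ea[of a] by simp
  qed
  show "sets (distr (LM {..<CARD('N)}) borel ?T) = sets borel" by simp
  fix l u :: "real^'N" assume le: "\<And>b. b \<in> Basis \<Longrightarrow> l \<bullet> b \<le> u \<bullet> b"
  define f where "f = inv_into UNIV e"
  have fe: "f (e a) = a" for a using e by (simp add: f_def bij_betw_def)
  have ef: "e (f k) = k" if "k < CARD('N)" for k
    using e that by (auto simp: f_def bij_betw_def f_inv_into_f)
  have "emeasure (distr (LM {..<CARD('N)}) borel ?T) (box l u)
      = emeasure (LM {..<CARD('N)}) (?T -` box l u \<inter> space (LM {..<CARD('N)}))"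
    by (rule emeasure_distr[OF Tm]) simp
  also have "?T -` box l u \<inter> space (LM {..<CARD('N)}) = Pi\<^sub>E {..<CARD('N)} (\<lambda>k. {l $ f k<..<u $ f k})"
  proof -
    have "(\<forall>a. l $ a < y (e a) \<and> y (e a) < u $ a) \<longleftrightarrow> (\<forall>k<CARD('N). l $ f k < y k \<and> y k < u $ f k)" for y
      using ea fe ef by metis
    then show ?thesis by (auto simp: mem_box_cart space_PiM PiE_iff set_eq_iff)
  qed
  also have "emeasure (LM {..<CARD('N)}) \<dots> = (\<Prod>k<CARD('N). emeasure lborel {l $ f k<..<u $ f k})"
    by (subst LM.emeasure_PiM) auto
  also have "\<dots> = (\<Prod>k<CARD('N). ennreal (u $ f k - l $ f k))"
    by (intro prod.cong refl emeasure_lborel_Ioo) (use le[of "axis _ 1"] in \<open>auto simp: inner_axis axis_in_Basis_iff\<close>)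
  also have "\<dots> = (\<Prod>a\<in>UNIV. ennreal (u $ a - l $ a))"
    by (subst prod.reindex_bij_betw[OF e, symmetric]) (simp add: fe)
  also have "\<dots> = ennreal (\<Prod>a\<in>UNIV. (u - l) $ a)"
    using le[of "axis _ 1"] by (subst prod_ennreal) (auto simp: inner_axis axis_in_Basis_iff)
  also have "(\<Prod>a\<in>UNIV. (u - l) $ a) = (\<Prod>b\<in>Basis. (u - l) \<bullet> b)"
  proof -
    have B: "(Basis :: (real^'N) set) = (\<lambda>a. axis a 1) ` UNIV" by (auto simp: Basis_vec_def)
    show ?thesis unfolding B
      by (subst prod.reindex) (auto simp: inj_on_def axis_eq_axis inner_axis)
  qed
  finally show "emeasure (distr (LM {..<CARD('N)}) borel ?T) (box l u) = ennreal (\<Prod>b\<in>Basis. (u - l) \<bullet> b)" .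
qed

text \<open>\<open>F\<close> is extended to \<open>G\<close>, the identity in the coordinates beyond
  \<open>m\<close>. \<open>G\<close> is injective where \<open>R\<close> holds, so the integral of
  |det G'| \<Phi>(G x) equals the integral of \<Phi> over an image set, which is finite for the
  fixed integrable product \<Phi>. The extra coordinates contribute a separate factor that Fubini
  splits off.\<close>

lemma area_integrable:
  fixes F :: "(nat \<Rightarrow> real) \<Rightarrow> nat \<Rightarrow> real" and P :: "nat \<Rightarrow> nat \<Rightarrow> (nat \<Rightarrow> real) \<Rightarrow> real"
    and e :: "'N::{finite,wellorder} \<Rightarrow> nat" and R :: "(nat \<Rightarrow> real) \<Rightarrow> bool"
  assumes e: "bij_betw e UNIV {..<CARD('N)}" and m: "m \<le> CARD('N)"
    and f_def: "f = inv_into UNIV e"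
    and dep: "\<And>y y'. (\<And>k. k < m \<Longrightarrow> y k = y' k) \<Longrightarrow> F y = F y' \<and> (\<forall>i k. P i k y = P i k y') \<and> R y = R y'"
    and der: "\<And>x i. i < m \<Longrightarrow> ((\<lambda>x::(real,'N) vec. F (\<lambda>k. x $ f k) i) has_derivative (\<lambda>h. \<Sum>k<m. P i k (\<lambda>k. x $ f k) * h $ f k)) (at x)"
    and inj: "\<And>y y'. R y \<Longrightarrow> R y' \<Longrightarrow> (\<And>i. i < m \<Longrightarrow> F y i = F y' i) \<Longrightarrow> (\<forall>k<m. y k = y' k)"
    and null: "{x. \<not> R (\<lambda>k. x $ f k)} \<in> null_sets (lborel :: ((real,'N) vec) measure)"
    and meas: "(\<lambda>y. gdet m (\<lambda>i k. P i k y)) \<in> borel_measurable (LM {..<m})"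
    and measF: "\<And>i. i < m \<Longrightarrow> (\<lambda>y. F y i) \<in> borel_measurable (LM {..<m})"
  shows "integrable (LM {..<m}) (\<lambda>y. gdet m (\<lambda>i k. P i k y) * (\<Prod>i<m. 1 / (1 + (F y i)\<^sup>2)))"
proof -
  let ?N = "CARD('N)"
  define \<iota> where "\<iota> x = (\<lambda>k. x $ f k)" for x :: "(real,'N) vec"
  have ea: "e a < ?N" for a using e by (auto simp: bij_betw_def)
  have fe: "f (e a) = a" for a using e by (simp add: f_def bij_betw_def)
  have ef: "e (f k) = k" if "k < ?N" for k
    using e that by (auto simp: f_def bij_betw_def f_inv_into_f)
  have inje: "e a = e b \<longleftrightarrow> a = b" for a b using fe by metis
  define G where "G x = (\<chi> a. if e a < m then F (\<iota> x) (e a) else x $ a)" for x :: "(real,'N) vec"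
  define G' where "G' x h = (\<chi> a. if e a < m then \<Sum>k<m. P (e a) k (\<iota> x) * h $ f k else h $ a)" for x h :: "(real,'N) vec"
  define \<Phi> where "\<Phi> z = (\<Prod>b\<in>Basis. 1 / (1 + (z \<bullet> b)\<^sup>2))" for z :: "(real,'N) vec"
  define S where "S = {x. R (\<iota> x)}"
  have derG: "(G has_derivative G' x) (at x)" for x
    unfolding G_def G'_def
  proof (subst has_derivative_componentwise_within, intro ballI)
    fix b :: "(real,'N) vec" assume "b \<in> Basis"
    then obtain a where b: "b = axis a 1" by (auto simp: Basis_vec_def)
    have "((\<lambda>x. if e a < m then F (\<iota> x) (e a) else x $ a) has_derivative
        (\<lambda>h. if e a < m then \<Sum>k<m. P (e a) k (\<iota> x) * h $ f k else h $ a)) (at x)"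
      using der[of "e a" x] by (cases "e a < m") (auto simp: \<iota>_def intro!: bounded_linear_imp_has_derivative bounded_linear_vec_nth)
    then show "((\<lambda>x. (\<chi> a. if e a < m then F (\<iota> x) (e a) else x $ a) \<bullet> b) has_derivative
        (\<lambda>h. (\<chi> a. if e a < m then \<Sum>k<m. P (e a) k (\<iota> x) * h $ f k else h $ a) \<bullet> b)) (at x)"
      by (simp add: b inner_axis)
  qed
  have detG: "det (matrix (G' x)) = gdet m (\<lambda>i k. P i k (\<iota> x))" for x
  proof -
    have "matrix (G' x) = (\<chi> a b. if e a < m \<and> e b < m then P (e a) (e b) (\<iota> x) else if a = b then 1 else 0)"
    proof -
      have "(\<Sum>k<m. P (e a) k (\<iota> x) * axis b 1 $ f k) = (if e b < m then P (e a) (e b) (\<iota> x) else 0)" for a b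
      proof -
        have "(\<Sum>k<m. P (e a) k (\<iota> x) * axis b 1 $ f k) = (\<Sum>k<m. if k = e b then P (e a) (e b) (\<iota> x) else 0)"
          by (rule sum.cong) (use m in \<open>auto simp: axis_def fe ef\<close>)
        then show ?thesis by simp
      qed
      then show ?thesis
        by (auto simp: matrix_def G'_def vec_eq_iff axis_def)
    qed
    then show ?thesis using gdet_as_det[OF e m, of "\<lambda>i k. P i k (\<iota> x)"] by simp
  qed
  have Sleb: "S \<in> sets lebesgue"
  proof -
    have "- S \<in> sets borel" using null by (auto simp: S_def \<iota>_def null_sets_def Compl_eq)
    then have "S \<in> sets borel" by (metis Compl_in_sets_lebesgue borel_comp double_complement)
    then show ?thesis by simp
  qed
  have injG: "inj_on G S"
  proof (rule inj_onI)
    fix x x' assume x: "x \<in> S" "x' \<in> S" "G x = G x'"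
    have c: "G x $ a = G x' $ a" for a using x(3) by simp
    have "\<forall>k<m. \<iota> x k = \<iota> x' k"
    proof (rule inj)
      show "R (\<iota> x)" "R (\<iota> x')" using x by (auto simp: S_def)
      fix i assume "i < m"
      then show "F (\<iota> x) i = F (\<iota> x') i" using c[of "f i"] m by (simp add: G_def ef)
    qed
    then have "x $ a = x' $ a" for a
      using c[of a] by (cases "e a < m") (auto simp: G_def \<iota>_def fe dest: spec[of _ "e a"])
    then show "x = x'" by (simp add: vec_eq_iff)
  qed
  \<comment> \<open>The change of variables theorem concerns vector-valued integrands, so \<Phi> is
    wrapped as a vector with one entry.\<close>
  define g where "g z = (vec (\<Phi> z) :: real^1)" for z
  have \<Phi>int: "integrable lebesgue \<Phi>"
    unfolding \<Phi>_def by (rule integrable_completion[THEN iffD2, OF _ integrable_prod_inverse_1_plus_sq]) simp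
  have gint: "g absolutely_integrable_on G ` S"
  proof -
    have "\<Phi> absolutely_integrable_on UNIV" using \<Phi>int by (simp add: set_integrable_def)
    moreover have "G ` S \<in> sets lebesgue"
      by (rule differentiable_image_in_sets_lebesgue[OF Sleb])
        (use derG in \<open>auto simp: differentiable_on_def differentiable_def intro: has_derivative_at_withinI\<close>)
    ultimately have "\<Phi> absolutely_integrable_on G ` S" by (rule set_integrable_subset) auto
    moreover have "bounded_linear (\<lambda>r::real. vec r :: real^1)"
      by (simp add: linear_conv_bounded_linear[symmetric] linear_iff vec_eq_iff)
    ultimately show ?thesis unfolding g_def by (rule absolutely_integrable_linear[unfolded o_def])
  qed
  have "(\<lambda>x. \<bar>det (matrix (G' x))\<bar> *\<^sub>R g (G x)) absolutely_integrable_on S"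
    using has_absolute_integral_change_of_variables[OF Sleb has_derivative_at_withinI[OF derG] injG, of g] gint by blast
  then have "(\<lambda>x. (\<bar>det (matrix (G' x))\<bar> *\<^sub>R g (G x)) $ 1) absolutely_integrable_on S"
    by (rule absolutely_integrable_linear[unfolded o_def, OF _ bounded_linear_vec_nth])
  then have "(\<lambda>x. \<bar>gdet m (\<lambda>i k. P i k (\<iota> x))\<bar> * \<Phi> (G x)) absolutely_integrable_on S"
    by (simp add: g_def detG)
  then have i1: "integrable lebesgue (\<lambda>x. indicator S x *\<^sub>R (\<bar>gdet m (\<lambda>i k. P i k (\<iota> x))\<bar> * \<Phi> (G x)))"
    by (simp add: set_integrable_def)
  define V0 where "V0 y = \<bar>gdet m (\<lambda>i k. P i k y)\<bar> * (\<Prod>i<m. 1 / (1 + (F y i)\<^sup>2))" for y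
  define V1 where "V1 y = (\<Prod>k\<in>{m..<?N}. 1 / (1 + (y k)\<^sup>2))" for y :: "nat \<Rightarrow> real"
  have V0dep: "(\<And>k. k < m \<Longrightarrow> y k = y' k) \<Longrightarrow> V0 y = V0 y'" for y y'
    using dep[of y y'] by (simp add: V0_def)
  have V0m[measurable]: "V0 \<in> borel_measurable (LM {..<m})"
    unfolding V0_def[abs_def] using meas measF by (auto intro!: borel_measurable_prod)
  have \<Phi>G: "\<Phi> (G x) = (\<Prod>i<m. 1 / (1 + (F (\<iota> x) i)\<^sup>2)) * V1 (\<iota> x)" for x
  proof -
    have B: "(Basis :: ((real,'N) vec) set) = (\<lambda>a. axis a 1) ` UNIV" by (auto simp: Basis_vec_def)
    have "\<Phi> (G x) = (\<Prod>a\<in>UNIV. 1 / (1 + (G x $ a)\<^sup>2))" unfolding \<Phi>_def B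
      by (subst prod.reindex) (auto simp: inj_on_def axis_eq_axis inner_axis)
    also have "\<dots> = (\<Prod>a\<in>UNIV. (\<lambda>k. 1 / (1 + (if k < m then F (\<iota> x) k else \<iota> x k)\<^sup>2)) (e a))"
      by (intro prod.cong refl) (simp add: G_def \<iota>_def fe)
    also have "\<dots> = (\<Prod>k<?N. 1 / (1 + (if k < m then F (\<iota> x) k else \<iota> x k)\<^sup>2))"
      by (rule prod.reindex_bij_betw[OF e])
    also have "{..<?N} = {..<m} \<union> {m..<?N}" using m by auto
    also have "(\<Prod>k\<in>{..<m} \<union> {m..<?N}. 1 / (1 + (if k < m then F (\<iota> x) k else \<iota> x k)\<^sup>2))
        = (\<Prod>i<m. 1 / (1 + (F (\<iota> x) i)\<^sup>2)) * V1 (\<iota> x)"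
      unfolding V1_def by (subst prod.union_disjoint) (auto intro!: arg_cong2[of _ _ _ _ times] prod.cong)
    finally show ?thesis .
  qed
  define V where "V y = V0 y * V1 y" for y
  have i2: "integrable lebesgue (\<lambda>x. indicator S x *\<^sub>R V (\<iota> x))"
    using i1 by (simp add: \<Phi>G V_def V0_def mult.assoc)
  have resm: "(\<lambda>y. restrict y {..<m}) \<in> measurable (LM {..<?N}) (LM {..<m})"
    by (rule measurable_restrict_subset) (use m in auto)
  have V0m'[measurable]: "V0 \<in> borel_measurable (LM {..<?N})"
  proof -
    have "(\<lambda>y. V0 (restrict y {..<m})) \<in> borel_measurable (LM {..<?N})"
      by (rule measurable_compose[OF resm V0m])
    moreover have "V0 (restrict y {..<m}) = V0 y" for y by (rule V0dep) simp
    ultimately show ?thesis by simp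
  qed
  have Vm[measurable]: "V \<in> borel_measurable (LM {..<?N})"
    unfolding V_def[abs_def] V1_def[abs_def] by (auto intro!: borel_measurable_times borel_measurable_prod V0m')
  have \<iota>m: "(\<lambda>x. restrict (\<iota> x) {..<?N}) \<in> measurable lborel (LM {..<?N})"
    by (rule measurable_restrict) (simp add: \<iota>_def)
  have V\<iota>: "V (restrict (\<iota> x) {..<?N}) = V (\<iota> x)" for x
    unfolding V_def by (intro arg_cong2[of _ _ _ _ times] V0dep) (use m in \<open>auto simp: V1_def\<close>)
  have V\<iota>m: "(\<lambda>x. V (\<iota> x)) \<in> borel_measurable lborel"
    using measurable_compose[OF \<iota>m Vm] by (simp add: V\<iota>)
  have "integrable lebesgue (\<lambda>x. V (\<iota> x))"
  proof (rule integrable_cong_AE_imp[OF i2])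
    show "(\<lambda>x. V (\<iota> x)) \<in> borel_measurable lebesgue" by (rule measurable_completion[OF V\<iota>m])
    have "AE x in lborel. x \<notin> {x. \<not> R (\<lambda>k. x $ f k)}" by (rule AE_not_in[OF null])
    then show "AE x in lebesgue. indicator S x *\<^sub>R V (\<iota> x) = V (\<iota> x)"
      by (intro AE_completion) (auto simp: S_def \<iota>_def elim: AE_mp)
  qed
  then have "integrable lborel (\<lambda>x. V (\<iota> x))" by (subst (asm) integrable_completion[OF V\<iota>m])
  then have iD: "integrable (distr (LM {..<?N}) borel (\<lambda>y. \<chi> a. y (e a))) (\<lambda>x. V (\<iota> x))"
    by (simp add: lborel_vec_eq_distr[OF e, symmetric])
  have Tm: "(\<lambda>y. \<chi> a. y (e a)) \<in> measurable (LM {..<?N}) borel"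
  proof (subst borel_measurable_euclidean_space, intro ballI)
    fix i :: "(real,'N) vec" assume "i \<in> Basis"
    then obtain a where i: "i = axis a 1" by (auto simp: Basis_vec_def)
    show "(\<lambda>y. (\<chi> a. y (e a)) \<bullet> i) \<in> borel_measurable (LM {..<?N})"
      unfolding i inner_axis using ea[of a] by simp
  qed
  have iN: "integrable (LM {..<?N}) (\<lambda>y. V (\<iota> (\<chi> a. y (e a))))"
    by (rule integrable_distr[OF Tm iD])
  have "V (\<iota> (\<chi> a. y (e a))) = V y" for y
    unfolding V_def by (intro arg_cong2[of _ _ _ _ times] V0dep) (use m in \<open>auto simp: V1_def \<iota>_def ef\<close>)
  then have iV: "integrable (LM {..<?N}) V" using iN by simp
  have Vpos: "0 \<le> V0 y" "0 < V1 y" for y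
  proof -
    have p: "0 < 1 + x\<^sup>2" for x :: real by (simp add: add_pos_nonneg)
    show "0 \<le> V0 y" "0 < V1 y" unfolding V0_def V1_def
      by (auto intro!: mult_nonneg_nonneg prod_nonneg prod_pos divide_nonneg_pos p)
  qed
  have U: "{..<?N} = {..<m} \<union> {m..<?N}" using m by auto
  have "(\<integral>\<^sup>+y. ennreal (V y) \<partial>LM {..<?N}) < \<infinity>"
    using iV Vpos by (simp add: integrable_iff_bounded V_def less_imp_le)
  also have "(\<integral>\<^sup>+y. ennreal (V y) \<partial>LM {..<?N})
      = (\<integral>\<^sup>+x. (\<integral>\<^sup>+y. ennreal (V (merge {..<m} {m..<?N} (x, y))) \<partial>LM {m..<?N}) \<partial>LM {..<m})"
    unfolding U by (rule LM.product_nn_integral_fold) (auto intro!: measurable_compose[OF Vm[unfolded U] measurable_ennreal])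
  also have "\<dots> = (\<integral>\<^sup>+x. (\<integral>\<^sup>+y. ennreal (V0 x) * ennreal (V1 y) \<partial>LM {m..<?N}) \<partial>LM {..<m})"
  proof (intro nn_integral_cong)
    fix x y
    have "V0 (merge {..<m} {m..<?N} (x, y)) = V0 x" by (rule V0dep) (simp add: merge_def)
    moreover have "V1 (merge {..<m} {m..<?N} (x, y)) = V1 y" by (simp add: V1_def merge_def)
    ultimately show "ennreal (V (merge {..<m} {m..<?N} (x, y))) = ennreal (V0 x) * ennreal (V1 y)"
      using Vpos by (simp add: V_def ennreal_mult less_imp_le)
  qed
  also have "\<dots> = (\<integral>\<^sup>+x. ennreal (V0 x) \<partial>LM {..<m}) * (\<integral>\<^sup>+y. ennreal (V1 y) \<partial>LM {m..<?N})"
  proof -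
    have V1m: "V1 \<in> borel_measurable (LM {m..<?N})"
      unfolding V1_def[abs_def] by (auto intro!: borel_measurable_prod)
    show ?thesis using V1m by (simp add: nn_integral_cmult nn_integral_multc)
  qed
  finally have fin: "(\<integral>\<^sup>+x. ennreal (V0 x) \<partial>LM {..<m}) * (\<integral>\<^sup>+y. ennreal (V1 y) \<partial>LM {m..<?N}) < \<infinity>" .
  \<comment> \<open>A finite product in \<open>ennreal\<close> bounds its first factor only if the
    second factor is not zero.\<close>
  have "(\<integral>\<^sup>+y. ennreal (V1 y) \<partial>LM {m..<?N}) \<noteq> 0"
  proof -
    have "(\<integral>\<^sup>+y. ennreal (V1 y) \<partial>LM {m..<?N}) = (\<integral>\<^sup>+y. (\<Prod>k\<in>{m..<?N}. ennreal (1 / (1 + (y k)\<^sup>2))) \<partial>LM {m..<?N})"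
      unfolding V1_def by (simp add: prod_ennreal)
    also have "\<dots> = (\<Prod>k\<in>{m..<?N}. (\<integral>\<^sup>+x. ennreal (1 / (1 + x\<^sup>2)) \<partial>(lborel::real measure)))"
      by (rule LM.product_nn_integral_prod) auto
    also have "\<dots> \<noteq> 0"
    proof -
      have "(\<integral>\<^sup>+x. ennreal (1 / (1 + x\<^sup>2)) \<partial>(lborel::real measure)) \<noteq> 0"
      proof
        assume "(\<integral>\<^sup>+x. ennreal (1 / (1 + x\<^sup>2)) \<partial>(lborel::real measure)) = 0"
        then have "AE x in (lborel::real measure). ennreal (1 / (1 + x\<^sup>2)) = 0"
          by (subst (asm) nn_integral_0_iff_AE) auto
        moreover have "ennreal (1 / (1 + x\<^sup>2)) \<noteq> 0" for x :: real
          by (simp add: ennreal_eq_0_iff not_le add_pos_nonneg)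
        ultimately have "AE x in (lborel::real measure). False" by (auto elim: AE_mp)
        then show False by (simp add: AE_iff_null null_sets_def emeasure_lborel_UNIV)
      qed
      then show ?thesis by simp
    qed
    finally show ?thesis .
  qed
  with fin have "(\<integral>\<^sup>+x. ennreal (V0 x) \<partial>LM {..<m}) < \<infinity>"
    by (auto simp: ennreal_mult_less_top)
  then have "integrable (LM {..<m}) V0"
    using Vpos by (simp add: integrable_iff_bounded)
  then show ?thesis
  proof (rule Bochner_Integration.integrable_bound)
    show "(\<lambda>y. gdet m (\<lambda>i k. P i k y) * (\<Prod>i<m. 1 / (1 + (F y i)\<^sup>2))) \<in> borel_measurable (LM {..<m})"
      using meas measF by (auto intro!: borel_measurable_times borel_measurable_prod)
    show "AE y in LM {..<m}. norm (gdet m (\<lambda>i k. P i k y) * (\<Prod>i<m. 1 / (1 + (F y i)\<^sup>2))) \<le> norm (V0 y)"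
      by (intro AE_I2) (simp add: V0_def abs_mult)
  qed
qed

section \<open>Coordinates with respect to an ordered basis\<close>

text \<open>Coordinate functionals extended linearly to the whole space. \<open>coords\<close> is
  meaningful on the span only; the extensions can be differentiated and estimated everywhere, and
  \<open>coords_eq_dual\<close> identifies the two on \<open>V\<close>.\<close>

definition dual :: "'a::real_vector list \<Rightarrow> nat \<Rightarrow> 'a \<Rightarrow> real" where
  "dual b i = (SOME g. linear g \<and> (\<forall>j<length b. g (b ! j) = (if i = j then 1 else 0)))"

lemma dual:
  assumes b: "ordered_basis b V"
  shows linear_dual: "linear (dual b i)"
    and dual_nth: "j < length b \<Longrightarrow> dual b i (b ! j) = (if i = j then 1 else 0)"
proof -
  have d: "distinct b" and ind: "independent (set b)" using b by (auto simp: ordered_basis_def)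
  obtain g :: "'a \<Rightarrow> real" where g: "linear g" "\<forall>x\<in>set b. g x = (if i < length b \<and> x = b ! i then 1 else 0)"
    using linear_independent_extend[OF ind, of "\<lambda>x. if i < length b \<and> x = b ! i then 1 else 0"] by auto
  have "\<forall>j<length b. g (b ! j) = (if i = j then 1 else 0)"
    using g(2) d by (auto simp: nth_eq_iff_index_eq)
  then have "\<exists>g::'a \<Rightarrow> real. linear g \<and> (\<forall>j<length b. g (b ! j) = (if i = j then 1 else 0))"
    using g(1) by blast
  then have "linear (dual b i) \<and> (\<forall>j<length b. dual b i (b ! j) = (if i = j then 1 else 0))"
    unfolding dual_def by (rule someI_ex)
  then show "linear (dual b i)" "j < length b \<Longrightarrow> dual b i (b ! j) = (if i = j then 1 else 0)" by auto
qed

lemma ordered_basis_nth: "ordered_basis b V \<Longrightarrow> k < length b \<Longrightarrow> b ! k \<in> V"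
  by (auto simp: ordered_basis_def intro: span_base)

lemma dual_sum:
  assumes b: "ordered_basis b V" and i: "i < length b"
  shows "dual b i (\<Sum>k<length b. c k *\<^sub>R b ! k) = c i"
proof -
  have "dual b i (\<Sum>k<length b. c k *\<^sub>R b ! k) = (\<Sum>k<length b. c k * (if i = k then 1 else 0))"
    unfolding linear_sum[OF linear_dual[OF b]]
    by (intro sum.cong refl) (simp add: linear_cmul[OF linear_dual[OF b]] dual_nth[OF b])
  then show ?thesis using i by (simp add: if_distrib cong: if_cong)
qed

lemma dual_repr:
  assumes b: "ordered_basis b V" and v: "v \<in> V"
  shows "v = (\<Sum>k<length b. dual b k v *\<^sub>R b ! k)"
proof -
  have d: "distinct b" and sp: "span (set b) = V" using b by (auto simp: ordered_basis_def)
  from v have "v \<in> span (set b)" using sp by simp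
  then obtain u where u: "v = (\<Sum>w\<in>set b. u w *\<^sub>R w)" by (auto simp: span_finite)
  also have "\<dots> = (\<Sum>k<length b. u (b ! k) *\<^sub>R b ! k)"
    by (rule sum.reindex_bij_betw[symmetric]) (use d in \<open>auto intro: bij_betw_nth\<close>)
  finally have e: "v = (\<Sum>k<length b. u (b ! k) *\<^sub>R b ! k)" .
  have "dual b k v = u (b ! k)" if "k < length b" for k
    unfolding e by (rule dual_sum[OF b that])
  then show ?thesis by (subst e) (auto intro!: sum.cong)
qed

lemma coords_eq_dual:
  assumes b: "ordered_basis b V" and v: "v \<in> V" and i: "i < length b"
  shows "coords b v i = dual b i v"
proof -
  define c where "c j = (if j < length b then dual b j v else 0)" for j
  have "coords b v = c"
    unfolding coords_def
  proof (rule the_equality)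
    show "(\<forall>j. length b \<le> j \<longrightarrow> c j = 0) \<and> v = (\<Sum>j<length b. c j *\<^sub>R b ! j)"
      using dual_repr[OF b v] by (auto simp: c_def)
    fix c' assume c': "(\<forall>j. length b \<le> j \<longrightarrow> c' j = 0) \<and> v = (\<Sum>j<length b. c' j *\<^sub>R b ! j)"
    have "dual b j v = c' j" if "j < length b" for j
      using c' dual_sum[OF b that, of c'] by simp
    then show "c' = c" using c' by (auto simp: c_def fun_eq_iff not_less)
  qed
  then show ?thesis using i by (simp add: c_def)
qed

lemma length_ordered_basis: "ordered_basis b V \<Longrightarrow> length b = dim V"
  by (metis distinct_card ordered_basis_def dim_eq_card_independent dim_span)

lemma dual_norm_bound:
  fixes b :: "'a::euclidean_space list"
  assumes b: "ordered_basis b V"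
  obtains K where "K > 0" "\<And>i v. i < length b \<Longrightarrow> \<bar>dual b i v\<bar> \<le> K * norm v"
proof -
  have "\<exists>K. \<forall>v. norm (dual b i v) \<le> norm v * K" for i
    using linear_dual[OF b, of i] unfolding linear_conv_bounded_linear by (rule bounded_linear.bounded)
  then obtain K where K: "\<And>i v. norm (dual b i v) \<le> norm v * K i" by metis
  define K' where "K' = 1 + (\<Sum>i<length b. \<bar>K i\<bar>)"
  have "K' > 0" by (simp add: K'_def add_pos_nonneg sum_nonneg)
  moreover have "\<bar>dual b i v\<bar> \<le> K' * norm v" if "i < length b" for i v
  proof -
    have "K i \<le> \<bar>K i\<bar>" by simp
    also have "\<bar>K i\<bar> \<le> (\<Sum>i<length b. \<bar>K i\<bar>)" using that by (intro member_le_sum) auto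
    finally have "K i \<le> K'" by (simp add: K'_def)
    then have "norm v * K i \<le> norm v * K'" by (intro mult_left_mono) auto
    then show ?thesis using K[of i v] by (simp add: mult.commute)
  qed
  ultimately show ?thesis by (rule that)
qed

text \<open>Boundedness of the dual functionals bounds every coefficient by the norm. This converts
  Gaussian decay in matrices into Gaussian decay in coordinates.\<close>

lemma ordered_basis_norm_ge:
  fixes b :: "'a::euclidean_space list"
  assumes b: "ordered_basis b V"
  obtains a where "a > 0" "\<And>c. a * (\<Sum>k<length b. (c k)\<^sup>2) \<le> (norm (\<Sum>k<length b. c k *\<^sub>R b ! k))\<^sup>2"
proof -
  obtain K where K: "K > 0" "\<And>i v. i < length b \<Longrightarrow> \<bar>dual b i v\<bar> \<le> K * norm v"
    using dual_norm_bound[OF b] by blast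
  \<comment> \<open>The sum contributes \<open>length b\<close> copies of K^2; the extra 1 keeps
    \<open>L\<close> positive for an empty basis.\<close>
  define L where "L = (1 + real (length b)) * K\<^sup>2"
  have L: "L > 0" using K by (simp add: L_def)
  have "(\<Sum>k<length b. (c k)\<^sup>2) \<le> L * (norm (\<Sum>k<length b. c k *\<^sub>R b ! k))\<^sup>2" for c
  proof -
    let ?v = "\<Sum>k<length b. c k *\<^sub>R b ! k"
    have "(\<Sum>k<length b. (c k)\<^sup>2) \<le> (\<Sum>k<length b. K\<^sup>2 * (norm ?v)\<^sup>2)"
    proof (rule sum_mono)
      fix k assume "k \<in> {..<length b}"
      then have "\<bar>c k\<bar> \<le> K * norm ?v" using K(2)[of k ?v] dual_sum[OF b, of k c] by simp
      then have "\<bar>c k\<bar>\<^sup>2 \<le> (K * norm ?v)\<^sup>2" by (intro power_mono) auto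
      then show "(c k)\<^sup>2 \<le> K\<^sup>2 * (norm ?v)\<^sup>2" by (simp add: power_mult_distrib)
    qed
    also have "\<dots> \<le> L * (norm ?v)\<^sup>2" by (simp add: L_def algebra_simps)
    finally show ?thesis .
  qed
  then have "1 / L * (\<Sum>k<length b. (c k)\<^sup>2) \<le> (norm (\<Sum>k<length b. c k *\<^sub>R b ! k))\<^sup>2" for c
    using L by (simp add: field_simps)
  then show ?thesis using L that[of "1 / L"] by simp
qed

text \<open>Difference quotients lie in \<open>V\<close>, and \<open>V\<close> is closed. It places
  the partial derivatives of the chart in \<open>Q\<close> without any computation with the
  exponential series.\<close>

lemma has_vector_derivative_in_closed_subspace:
  fixes f :: "real \<Rightarrow> 'a::euclidean_space"
  assumes d: "(f has_vector_derivative D) (at x)" and V: "subspace V" and f: "\<And>t. f t \<in> V"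
  shows "D \<in> V"
proof (rule Lim_in_closed_set[OF closed_subspace[OF V]])
  have "((\<lambda>h. (f (x + h) - f x - h *\<^sub>R D) /\<^sub>R norm h) \<longlongrightarrow> 0) (at 0)"
    by (rule tendsto_norm_zero_cancel)
      (use d in \<open>simp add: has_vector_derivative_def has_derivative_at divide_inverse mult.commute\<close>)
  \<comment> \<open>\<open>has_derivative_at\<close> divides by |h|; the sign of h restores the
    ordinary difference quotient.\<close>
  then have "((\<lambda>h. sgn h *\<^sub>R ((f (x + h) - f x - h *\<^sub>R D) /\<^sub>R norm h)) \<longlongrightarrow> 0) (at 0)"
  proof (rule Lim_null_comparison[rotated, OF tendsto_norm_zero])
    have "norm (sgn h *\<^sub>R w) \<le> norm w" for h :: real and w :: 'a
      by (cases "h = 0") (auto simp: abs_sgn_eq)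
    then show "\<forall>\<^sub>F h in at 0. norm (sgn h *\<^sub>R ((f (x + h) - f x - h *\<^sub>R D) /\<^sub>R norm h))
        \<le> norm ((f (x + h) - f x - h *\<^sub>R D) /\<^sub>R norm h)"
      by (intro always_eventually allI)
  qed
  then have "((\<lambda>h. sgn h *\<^sub>R ((f (x + h) - f x - h *\<^sub>R D) /\<^sub>R norm h) + D) \<longlongrightarrow> 0 + D) (at 0)"
    by (intro tendsto_add tendsto_const)
  moreover have "\<forall>\<^sub>F h in at 0. sgn h *\<^sub>R ((f (x + h) - f x - h *\<^sub>R D) /\<^sub>R norm h) + D = (1 / h) *\<^sub>R (f (x + h) - f x)"
  proof (rule eventually_mono[OF eventually_neq_at_within[of 0 0 UNIV]])
    fix h :: real assume h: "h \<noteq> 0"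
    have "sgn h * inverse (norm h) = 1 / h" using h by (auto simp: sgn_if field_simps)
    then have "sgn h *\<^sub>R (w /\<^sub>R norm h) = (1 / h) *\<^sub>R w" for w :: 'a by (simp only: scaleR_scaleR)
    then have "sgn h *\<^sub>R ((f (x + h) - f x - h *\<^sub>R D) /\<^sub>R norm h) + D = (1 / h) *\<^sub>R (f (x + h) - f x - h *\<^sub>R D) + D"
      by (simp only:)
    also have "\<dots> = (1 / h) *\<^sub>R (f (x + h) - f x)"
      using h by (simp add: scaleR_diff_right)
    finally show "sgn h *\<^sub>R ((f (x + h) - f x - h *\<^sub>R D) /\<^sub>R norm h) + D = (1 / h) *\<^sub>R (f (x + h) - f x)" .
  qed
  ultimately show "((\<lambda>h. (1 / h) *\<^sub>R (f (x + h) - f x)) \<longlongrightarrow> D) (at 0)"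
    by (auto elim: Lim_transform_eventually)
  show "\<forall>\<^sub>F h in at 0. (1 / h) *\<^sub>R (f (x + h) - f x) \<in> V"
    using V f by (intro always_eventually allI) (simp add: subspace_mul subspace_diff)
qed simp

subsection \<open>Derivatives of the Pruisken--Schaefer map\<close>

text \<open>Derivative of F in the direction \<open>Z\<close> of its first argument;
  \<open>ddPS\<close> is the second one. \<open>X\<close> is an arbitrary complex matrix, so the
  formulas also serve on the shifted domain.\<close>

definition dPS :: "complex^'n^'n \<Rightarrow> complex^'n^'n \<Rightarrow> complex^'n^'n \<Rightarrow> complex^'n^'n" where
  "dPS Y Z X = dexp Y Z ** X ** mexp (- Y) - mexp Y ** X ** dexp (- Y) Z"

definition ddPS :: "complex^'n^'n \<Rightarrow> complex^'n^'n \<Rightarrow> complex^'n^'n \<Rightarrow> complex^'n^'n \<Rightarrow> complex^'n^'n" where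
  "ddPS Y Z W X = ddexp Y Z W ** X ** mexp (- Y) - dexp Y Z ** X ** dexp (- Y) W
     - dexp Y W ** X ** dexp (- Y) Z + mexp Y ** X ** ddexp (- Y) Z W"

lemma ddPS_commute: "ddPS Y Z W X = ddPS Y W Z X"
  by (simp add: ddPS_def ddexp_commute[of Y Z W] ddexp_commute[of "- Y" Z W])

lemma linear_dexp: "linear (dexp Y)" and linear_ddexp: "linear (ddexp Y Z)"
  using has_derivative_linear[OF mexp_has_derivative] has_derivative_linear[OF dexp_has_derivative] by auto

lemma mexp_compose_has_derivative:
  "(A has_derivative A') (at x) \<Longrightarrow> ((\<lambda>x. mexp (A x)) has_derivative (\<lambda>h. dexp (A x) (A' h))) (at x)"
  by (rule has_derivative_compose[OF _ mexp_has_derivative])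

lemma mexp_neg_compose_has_derivative:
  assumes A: "(A has_derivative A') (at x)"
  shows "((\<lambda>x. mexp (- A x)) has_derivative (\<lambda>h. - dexp (- A x) (A' h))) (at x)"
  using mexp_compose_has_derivative[OF has_derivative_minus[OF A]] by (simp add: linear_neg[OF linear_dexp])

lemma dexp_compose_has_derivative:
  "(A has_derivative A') (at x) \<Longrightarrow> ((\<lambda>x. dexp (A x) Z) has_derivative (\<lambda>h. ddexp (A x) Z (A' h))) (at x)"
  by (rule has_derivative_compose[OF _ dexp_has_derivative])

lemma dexp_neg_compose_has_derivative:
  assumes A: "(A has_derivative A') (at x)"
  shows "((\<lambda>x. dexp (- A x) Z) has_derivative (\<lambda>h. - ddexp (- A x) Z (A' h))) (at x)"
  using dexp_compose_has_derivative[OF has_derivative_minus[OF A]] by (simp add: linear_neg[OF linear_ddexp])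

lemma PS_has_derivative:
  assumes A: "(A has_derivative A') (at x)" and B: "(B has_derivative B') (at x)"
  shows "((\<lambda>x. PS (A x) (B x)) has_derivative (\<lambda>h. dPS (A x) (A' h) (B x) + PS (A x) (B' h))) (at x)"
proof -
  have "((\<lambda>x. PS (A x) (B x)) has_derivative (\<lambda>h. mexp (A x) ** B x ** (- dexp (- A x) (A' h))
      + (mexp (A x) ** B' h + dexp (A x) (A' h) ** B x) ** mexp (- A x))) (at x)"
    unfolding PS_def
    by (rule mm.FDERIV[OF mm.FDERIV[OF mexp_compose_has_derivative[OF A] B] mexp_neg_compose_has_derivative[OF A]])
  then show ?thesis by (simp add: dPS_def PS_def mm_simps algebra_simps)
qed

lemma dPS_has_derivative:
  assumes A: "(A has_derivative A') (at x)" and B: "(B has_derivative B') (at x)"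
  shows "((\<lambda>x. dPS (A x) Z (B x)) has_derivative (\<lambda>h. ddPS (A x) Z (A' h) (B x) + dPS (A x) Z (B' h))) (at x)"
proof -
  have 1: "((\<lambda>x. dexp (A x) Z ** B x ** mexp (- A x)) has_derivative
     (\<lambda>h. dexp (A x) Z ** B x ** (- dexp (- A x) (A' h)) + (dexp (A x) Z ** B' h + ddexp (A x) Z (A' h) ** B x) ** mexp (- A x))) (at x)"
    by (rule mm.FDERIV[OF mm.FDERIV[OF dexp_compose_has_derivative[OF A] B] mexp_neg_compose_has_derivative[OF A]])
  have 2: "((\<lambda>x. mexp (A x) ** B x ** dexp (- A x) Z) has_derivative
     (\<lambda>h. mexp (A x) ** B x ** (- ddexp (- A x) Z (A' h)) + (mexp (A x) ** B' h + dexp (A x) (A' h) ** B x) ** dexp (- A x) Z)) (at x)"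
    by (rule mm.FDERIV[OF mm.FDERIV[OF mexp_compose_has_derivative[OF A] B] dexp_neg_compose_has_derivative[OF A]])
  show ?thesis
    using has_derivative_diff[OF 1 2] by (simp add: dPS_def ddPS_def mm_simps algebra_simps)
qed

lemma PS_linear: "linear (PS Y)" and dPS_linear: "linear (dPS Y Z)"
  by (rule linearI; simp add: PS_def dPS_def mm_simps algebra_simps)+

lemma dPS_linear_dir: "linear (\<lambda>Z. dPS Y Z X)"
  by (rule linearI; simp add: dPS_def mm_simps linear_add[OF linear_dexp] linear_cmul[OF linear_dexp] algebra_simps)

lemma PS_csc: "PS Y (csc z X) = csc z (PS Y X)" and dPS_csc: "dPS Y Z (csc z X) = csc z (dPS Y Z X)"
  by (simp_all add: PS_def dPS_def csc_simps)

lemma dPS_zero: "dPS 0 Z X = Z ** X - X ** Z"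
  by (simp add: dPS_def dexp_zero mexp_zero)

lemma PS_zero: "PS 0 X = X"
  by (simp add: PS_def mexp_zero)

lemma continuous_mexp: "continuous_on UNIV mexp" and continuous_dexp: "continuous_on UNIV (\<lambda>Y. dexp Y Z)"
  by (rule has_derivative_continuous_on; use mexp_has_derivative dexp_has_derivative in blast)+

text \<open>The two lower orders are continuous because they are differentiable; the top order is
  obtained as a uniform limit of its series on balls. Its purpose is measurability of the second
  partial derivatives.\<close>

lemma continuous_ddexp: "continuous_on UNIV (\<lambda>Y. ddexp Y Z W)"
proof -
  have dp: "continuous_on UNIV (\<lambda>Y::complex^'a^'a. dpow Y Z k)" for k Z
    by (rule has_derivative_continuous_on; use dpow_has_derivative in blast)
  have ddp: "continuous_on UNIV (\<lambda>Y. ddpow Y Z W k)" for k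
    by (induction k) (auto intro!: continuous_intros mm.continuous_on dp)
  have "continuous_on (cball 0 r) (\<lambda>Y. ddexp Y Z W)" for r
    unfolding ddexp_def
  proof (rule uniform_limit_theorem[OF always_eventually])
    show "\<forall>n. continuous_on (cball 0 r) (\<lambda>Y. \<Sum>k<n. (1 / fact k) *\<^sub>R ddpow Y Z W k)"
      by (intro allI continuous_intros) (rule continuous_on_subset[OF ddp], simp)
    show "uniform_limit (cball 0 r) (\<lambda>n Y. \<Sum>k<n. (1 / fact k) *\<^sub>R ddpow Y Z W k) (\<lambda>Y. \<Sum>k. (1 / fact k) *\<^sub>R ddpow Y Z W k) sequentially"
    proof (rule Weierstrass_m_test)
      let ?c = "sqn TYPE('a) * (norm Z * norm W)"
      show "summable (\<lambda>k. ?c * (1 / fact k * (3 * (1 + \<bar>r\<bar>)) ^ k))"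
        using summable_exp[of "3 * (1 + \<bar>r\<bar>)"] by (intro summable_mult) (simp add: divide_inverse)
      fix k and Y :: "complex^'a^'a" assume "Y \<in> cball 0 r"
      then have "norm Y \<le> 1 + \<bar>r\<bar>" by simp
      then have "norm (ddpow Y Z W k) \<le> sqn TYPE('a) * (3 * (1 + \<bar>r\<bar>)) ^ k * (norm Z * norm W)"
        by (intro norm_ddpow) auto
      then have "1 / fact k * norm (ddpow Y Z W k) \<le> 1 / fact k * (sqn TYPE('a) * (3 * (1 + \<bar>r\<bar>)) ^ k * (norm Z * norm W))"
        by (intro mult_left_mono) auto
      then show "norm ((1 / fact k) *\<^sub>R ddpow Y Z W k) \<le> ?c * (1 / fact k * (3 * (1 + \<bar>r\<bar>)) ^ k)"
        by (simp add: mult_ac)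
    qed
  qed simp
  from this[THEN continuous_on_subset, OF ball_subset_cball]
  have "continuous_on (ball 0 r) (\<lambda>Y. ddexp Y Z W)" for r .
  then have "isCont (\<lambda>Y. ddexp Y Z W) Y" for Y
    by (meson centre_in_ball continuous_on_eq_continuous_at open_ball mem_ball_0 gt_ex)
  then show ?thesis by (simp add: continuous_at_imp_continuous_on)
qed

lemma measurable_matrix_mult [measurable]:
  fixes f g :: "'x \<Rightarrow> complex^'n^'n"
  assumes "f \<in> borel_measurable M" "g \<in> borel_measurable M"
  shows "(\<lambda>x. f x ** g x) \<in> borel_measurable M"
  by (rule borel_measurable_continuous_Pair[OF assms]) (intro mm.continuous_on continuous_intros)

lemma measurable_PS [measurable]:
  assumes f: "f \<in> borel_measurable M" and g: "g \<in> borel_measurable M"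
  shows "(\<lambda>x. PS (f x) (g x)) \<in> borel_measurable M"
  unfolding PS_def
  by (intro measurable_matrix_mult g borel_measurable_continuous_on[OF continuous_mexp] borel_measurable_uminus f)

lemma measurable_dPS [measurable]:
  assumes f: "f \<in> borel_measurable M" and g: "g \<in> borel_measurable M"
  shows "(\<lambda>x. dPS (f x) Z (g x)) \<in> borel_measurable M"
  unfolding dPS_def
  by (intro borel_measurable_diff measurable_matrix_mult g borel_measurable_continuous_on[OF continuous_mexp]
      borel_measurable_continuous_on[OF continuous_dexp] borel_measurable_uminus f)

lemma measurable_ddPS [measurable]:
  assumes f: "f \<in> borel_measurable M" and g: "g \<in> borel_measurable M"
  shows "(\<lambda>x. ddPS (f x) Z W (g x)) \<in> borel_measurable M"
  unfolding ddPS_def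
  by (intro borel_measurable_diff borel_measurable_add measurable_matrix_mult g borel_measurable_continuous_on[OF continuous_mexp]
      borel_measurable_continuous_on[OF continuous_dexp] borel_measurable_continuous_on[OF continuous_ddexp] borel_measurable_uminus f)

subsection \<open>The pulled back volume form in coordinates\<close>

lemma ddPS_linear_dir: "linear (\<lambda>W. ddPS Y Z W X)"
  by (rule linearI; simp add: ddPS_def mm_simps linear_add[OF linear_dexp] linear_cmul[OF linear_dexp]
    linear_add[OF linear_ddexp] linear_cmul[OF linear_ddexp] algebra_simps)

lemma sum_lessThan_add: "(\<Sum>k<a + b. f k) = (\<Sum>k<a. f k) + (\<Sum>k<b. f (a + k))" for a b :: nat
  by (induction b) (simp_all add: add.assoc)

locale ps_bases = ps_data s tes for s :: "complex^'n^'n" and tes +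
  fixes bp bq bQ :: "(complex^'n^'n) list"
  assumes bp: "ordered_basis bp (pset s tes)"
    and bq: "ordered_basis bq (Qplus s tes)"
    and bQ: "ordered_basis bQ (Qset s tes)"
begin

abbreviation "dp \<equiv> length bp"
abbreviation "dq \<equiv> length bq"
abbreviation "m \<equiv> length bp + length bq"
abbreviation "II \<equiv> {..<length bp + length bq}"

definition Yv :: "(nat \<Rightarrow> real) \<Rightarrow> complex^'n^'n" where "Yv y = (\<Sum>k<dp. y k *\<^sub>R bp ! k)"
definition Xv :: "(nat \<Rightarrow> real) \<Rightarrow> complex^'n^'n" where "Xv y = (\<Sum>k<dq. y (dp + k) *\<^sub>R bq ! k)"

lemma PSchart_eq: "PSchart bp bq y = PS (Yv y) (Xv y)"
  by (simp add: PSchart_def Yv_def Xv_def)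

lemma Yv_p: "Yv y \<in> p"
  unfolding Yv_def by (intro subspace_sum subspace_p subspace_mul ordered_basis_nth[OF bp]) auto

lemma Xv_Qp: "Xv y \<in> Qp"
  unfolding Xv_def by (intro subspace_sum subspace_Qp subspace_mul ordered_basis_nth[OF bq]) auto

lemma Xv_Q: "Xv y \<in> Q" using Xv_Qp Qp_sub by blast
lemma Yv_G: "Yv y \<in> G" using Yv_p p_sub by blast
lemma PSchart_Q: "PSchart bp bq y \<in> Q" unfolding PSchart_eq by (intro PS_in_Q Yv_G Xv_Q)

lemma bp_p: "k < dp \<Longrightarrow> bp ! k \<in> p" by (rule ordered_basis_nth[OF bp])
lemma Yv_cong: "(\<And>k. k < dp \<Longrightarrow> y k = y' k) \<Longrightarrow> Yv y = Yv y'" by (simp add: Yv_def)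
lemma Xv_cong: "(\<And>k. dp \<le> k \<Longrightarrow> k < m \<Longrightarrow> y k = y' k) \<Longrightarrow> Xv y = Xv y'" by (simp add: Xv_def)

text \<open>\<open>Q\<close> is the direct sum of its even and odd parts, and right multiplication
  by \<open>s\<close> carries \<open>p\<close> onto the odd part. Thus the chart has as many
  coordinates as \<open>Q\<close> has dimensions, and the Jacobian is a square determinant.\<close>

lemma dim_Q: "length bQ = m"
proof -
  have "dim Qm = dim p"
  proof -
    have "Qm = (\<lambda>Y. Y ** s) ` p"
    proof safe
      fix Z assume "Z \<in> Qm"
      then show "Z \<in> (\<lambda>Y. Y ** s) ` p" using Qm_s[of Z] by (intro image_eqI[of _ _ "Z ** s"]) (simp_all add: ss)
    qed (rule p_s)
    moreover have "dim ((\<lambda>Y. Y ** s) ` p) = dim p"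
    proof (rule dim_image_eq)
      show "linear (\<lambda>Y. Y ** s)" by (rule linearI) (simp_all add: mm_simps)
      have "inj (\<lambda>Y::complex^'n^'n. Y ** s)" by (rule injI) (metis ss(2))
      then show "inj_on (\<lambda>Y. Y ** s) (span p)" by (rule inj_on_subset) simp
    qed
    ultimately show ?thesis by simp
  qed
  moreover have "dim {x + y |x y. x \<in> Qp \<and> y \<in> Qm} + dim (Qp \<inter> Qm) = dim Qp + dim Qm"
    by (rule dim_sums_Int[OF subspace_Qp subspace_Qm])
  moreover have "{x + y |x y. x \<in> Qp \<and> y \<in> Qm} = Q"
  proof safe
    fix x y assume "x \<in> Qp" "y \<in> Qm"
    then show "x + y \<in> Q" using Qp_sub Qm_sub subspace_Q by (blast intro: subspace_add)
  next
    fix x assume "x \<in> Q"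
    then show "\<exists>u v. x = u + v \<and> u \<in> Qp \<and> v \<in> Qm"
      using parts_sum[of x] mpart_Q ppart_Q by metis
  qed
  moreover have "Qp \<inter> Qm = {0}"
  proof -
    have "x = 0" if "x \<in> Qp" "x \<in> Qm" for x
    proof -
      have "x = - x" using that by (simp add: Qplus_def Qminus_def)
      then show ?thesis by (metis add.right_inverse scaleR_2 scaleR_eq_0_iff zero_neq_numeral)
    qed
    then show ?thesis using subspace_0[OF subspace_Qp] subspace_0[OF subspace_Qm] by auto
  qed
  ultimately show ?thesis
    using length_ordered_basis[OF bp] length_ordered_basis[OF bq] length_ordered_basis[OF bQ] by simp
qed

abbreviation co :: "nat \<Rightarrow> complex^'n^'n \<Rightarrow> real" where "co \<equiv> dual bQ"

lemma co_linear: "linear (co i)" by (rule linear_dual[OF bQ])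
lemma co_repr: "Z \<in> Q \<Longrightarrow> Z = (\<Sum>i<m. co i Z *\<^sub>R bQ ! i)" using dual_repr[OF bQ] dim_Q by metis

text \<open>Partial derivative of the chart in coordinate j, with the second argument of F left
  free: at \<open>X + csc z s\<close> it is the partial derivative on the shifted domain.\<close>

definition D :: "nat \<Rightarrow> (nat \<Rightarrow> real) \<Rightarrow> complex^'n^'n \<Rightarrow> complex^'n^'n" where
  "D j y X = (if j < dp then dPS (Yv y) (bp ! j) X else PS (Yv y) (bq ! (j - dp)))"

definition DD :: "nat \<Rightarrow> nat \<Rightarrow> (nat \<Rightarrow> real) \<Rightarrow> complex^'n^'n \<Rightarrow> complex^'n^'n" where
  "DD j k y X = (if j < dp then if k < dp then ddPS (Yv y) (bp ! j) (bp ! k) X else dPS (Yv y) (bp ! j) (bq ! (k - dp))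
     else if k < dp then dPS (Yv y) (bp ! k) (bq ! (j - dp)) else 0)"

lemma DD_commute: "DD j k y X = DD k j y X"
  by (auto simp: DD_def ddPS_commute[of "Yv y" "bp ! j" "bp ! k"])

lemma Yv_upd: "k < m \<Longrightarrow> Yv (y(k := t)) = Yv y + (if k < dp then (t - y k) *\<^sub>R bp ! k else 0)"
proof -
  have "Yv (y(k := t)) = (\<Sum>i<dp. y i *\<^sub>R bp ! i + (if i = k then (t - y k) *\<^sub>R bp ! k else 0))"
    unfolding Yv_def by (rule sum.cong) (auto simp: algebra_simps)
  then show ?thesis by (simp add: sum.distrib Yv_def)
qed

lemma Xv_upd: "k < m \<Longrightarrow> Xv (y(k := t)) = Xv y + (if k < dp then 0 else (t - y k) *\<^sub>R bq ! (k - dp))"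
proof -
  assume k: "k < m"
  have "Xv (y(k := t)) = (\<Sum>i<dq. y (dp + i) *\<^sub>R bq ! i + (if dp + i = k then (t - y k) *\<^sub>R bq ! (k - dp) else 0))"
    unfolding Xv_def by (rule sum.cong) (auto simp: algebra_simps)
  also have "\<dots> = Xv y + (\<Sum>i<dq. if dp + i = k then (t - y k) *\<^sub>R bq ! (k - dp) else 0)"
    by (simp add: sum.distrib Xv_def)
  also have "(\<Sum>i<dq. if dp + i = k then (t - y k) *\<^sub>R bq ! (k - dp) else 0)
      = (\<Sum>i<dq. if dp \<le> k \<and> i = k - dp then (t - y k) *\<^sub>R bq ! (k - dp) else 0)"
    by (rule sum.cong) auto
  also have "\<dots> = (if k < dp then 0 else (t - y k) *\<^sub>R bq ! (k - dp))" using k by auto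
  finally show ?thesis .
qed

lemma Yv_upd_has_derivative:
  "k < m \<Longrightarrow> ((\<lambda>t. Yv (y(k := t))) has_derivative (\<lambda>h. h *\<^sub>R (if k < dp then bp ! k else 0))) (at x)"
  by (simp only: Yv_upd) (auto intro!: derivative_eq_intros)

lemma Xv_upd_has_derivative:
  "k < m \<Longrightarrow> ((\<lambda>t. Xv (y(k := t)) + M) has_derivative (\<lambda>h. h *\<^sub>R (if k < dp then 0 else bq ! (k - dp)))) (at x)"
  by (simp only: Xv_upd) (auto intro!: derivative_eq_intros)

text \<open>The constant offset \<open>M\<close> covers the unshifted chart, complex shifts and
  passage to any prescribed \<open>X\<close> at once.\<close>

lemma PS_partial:
  assumes k: "k < m"
  shows "((\<lambda>t. PS (Yv (y(k := t))) (Xv (y(k := t)) + M)) has_vector_derivative D k y (Xv y + M)) (at (y k))"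
proof -
  have "((\<lambda>t. PS (Yv (y(k := t))) (Xv (y(k := t)) + M)) has_derivative
     (\<lambda>h. dPS (Yv (y(k := y k))) (h *\<^sub>R (if k < dp then bp ! k else 0)) (Xv (y(k := y k)) + M)
        + PS (Yv (y(k := y k))) (h *\<^sub>R (if k < dp then 0 else bq ! (k - dp))))) (at (y k))"
    by (rule PS_has_derivative[OF Yv_upd_has_derivative[OF k] Xv_upd_has_derivative[OF k]])
  then show ?thesis
    unfolding has_vector_derivative_def
    by (simp add: D_def linear_cmul[OF dPS_linear_dir] linear_cmul[OF PS_linear]
        linear_0[OF dPS_linear_dir] linear_0[OF PS_linear] split: if_splits)
qed

lemma D_partial:
  assumes k: "k < m" and j: "j < m"
  shows "((\<lambda>t. D j (y(k := t)) (Xv (y(k := t)) + M)) has_vector_derivative DD j k y (Xv y + M)) (at (y k))"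
proof (cases "j < dp")
  case True
  have "((\<lambda>t. dPS (Yv (y(k := t))) (bp ! j) (Xv (y(k := t)) + M)) has_derivative
     (\<lambda>h. ddPS (Yv (y(k := y k))) (bp ! j) (h *\<^sub>R (if k < dp then bp ! k else 0)) (Xv (y(k := y k)) + M)
        + dPS (Yv (y(k := y k))) (bp ! j) (h *\<^sub>R (if k < dp then 0 else bq ! (k - dp))))) (at (y k))"
    by (rule dPS_has_derivative[OF Yv_upd_has_derivative[OF k] Xv_upd_has_derivative[OF k]])
  then show ?thesis
    using True unfolding has_vector_derivative_def
    by (simp add: D_def DD_def linear_cmul[OF ddPS_linear_dir] linear_cmul[OF dPS_linear]
        linear_0[OF ddPS_linear_dir] linear_0[OF dPS_linear] split: if_splits)
next
  case False
  have "((\<lambda>t. PS (Yv (y(k := t))) (bq ! (j - dp))) has_derivative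
     (\<lambda>h. dPS (Yv (y(k := y k))) (h *\<^sub>R (if k < dp then bp ! k else 0)) (bq ! (j - dp))
        + PS (Yv (y(k := y k))) 0)) (at (y k))"
    by (rule PS_has_derivative[OF Yv_upd_has_derivative[OF k] has_derivative_const])
  then show ?thesis
    using False unfolding has_vector_derivative_def
    by (simp add: D_def DD_def linear_cmul[OF dPS_linear_dir] linear_0[OF PS_linear]
        linear_0[OF dPS_linear_dir] split: if_splits)
qed

lemma D_Q: "j < m \<Longrightarrow> X \<in> Q \<Longrightarrow> D j y X \<in> Q"
proof -
  assume j: "j < m" and X: "X \<in> Q"
  have a: "((\<lambda>t. PS (Yv (y(j := t))) (Xv (y(j := t)) + (X - Xv y))) has_vector_derivative D j y (Xv y + (X - Xv y))) (at (y j))"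
    by (rule PS_partial[OF j])
  have b: "PS (Yv z) (Xv z + (X - Xv y)) \<in> Q" for z
    by (intro PS_in_Q Yv_G subspace_add[OF subspace_Q] subspace_diff[OF subspace_Q] Xv_Q X)
  have "D j y (Xv y + (X - Xv y)) \<in> Q"
    by (rule has_vector_derivative_in_closed_subspace[OF a subspace_Q b])
  then show ?thesis by simp
qed

text \<open>Coefficient of the shift in \<open>D\<close>, see \<open>D_add_csc\<close>. As F is
  linear in \<open>X\<close>, derivatives in the Q_+-directions do not see the shift.\<close>

definition E :: "nat \<Rightarrow> (nat \<Rightarrow> real) \<Rightarrow> complex^'n^'n" where
  "E j y = (if j < dp then dPS (Yv y) (bp ! j) s else 0)"

lemma D_add_s: "D j y (X + t *\<^sub>R s) = D j y X + t *\<^sub>R E j y"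
  and D_add_csc: "D j y (X + csc z s) = D j y X + csc z (E j y)"
  by (simp_all add: D_def E_def linear_add[OF dPS_linear] linear_cmul[OF dPS_linear] dPS_csc csc_simps)

lemma E_Q: "j < m \<Longrightarrow> E j y \<in> Q"
  using D_Q[of j s y] s_in_Q subspace_0[OF subspace_Q] by (auto simp: E_def D_def)

text \<open>Jacobian of the domain shifted by z s, expressed through real coordinates of
  \<open>D\<close> and \<open>E\<close> so that it is a polynomial in z. At z = 0 it is the real
  Jacobian, and a real z amounts to a translated base point, by \<open>jac_shift\<close>.\<close>

definition jac :: "complex \<Rightarrow> (nat \<Rightarrow> real) \<Rightarrow> complex" where
  "jac z y = gdet m (\<lambda>i j. of_real (co i (D j y (Xv y))) + z * of_real (co i (E j y)))"

lemma PSjac_eq_gdet: "PSjac bp bq bQ y = gdet m (\<lambda>i j. co i (D j y (Xv y)))"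
  unfolding PSjac_def ndet_eq_gdet dim_Q
proof (rule gdet_cong)
  fix i j assume ij: "i < m" "j < m"
  have "((\<lambda>t. PSchart bp bq (y(j := t))) has_vector_derivative D j y (Xv y)) (at (y j + 0))"
    using PS_partial[OF ij(2), of y 0] by (simp add: PSchart_eq)
  moreover have "((\<lambda>t. y j + t) has_vector_derivative 1) (at 0)" by (auto intro!: derivative_eq_intros)
  ultimately have "((\<lambda>t. PSchart bp bq (y(j := y j + t))) has_vector_derivative D j y (Xv y)) (at 0)"
    using vector_diff_chain_at[of "\<lambda>t. y j + t" 1 0 "\<lambda>t. PSchart bp bq (y(j := t))" "D j y (Xv y)"] by (simp add: o_def)
  then have "vector_derivative (\<lambda>t. PSchart bp bq (y(j := y j + t))) (at 0) = D j y (Xv y)"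
    by (rule vector_derivative_at)
  then show "coords bQ (vector_derivative (\<lambda>t. PSchart bp bq (y(j := y j + t))) (at 0)) i = co i (D j y (Xv y))"
    using coords_eq_dual[OF bQ D_Q[OF ij(2) Xv_Q]] ij dim_Q by simp
qed

lemma of_real_PSjac: "complex_of_real (PSjac bp bq bQ y) = jac 0 y"
  by (simp add: PSjac_eq_gdet of_real_gdet jac_def)

text \<open>The coordinate vector of \<open>s\<close> in the product chart: translation by t
  \<sigma> fixes Y and adds t s to X.\<close>

definition \<sigma> :: "nat \<Rightarrow> real" where "\<sigma> k = (if dp \<le> k then dual bq (k - dp) s else 0)"

lemma Yv_shift: "Yv (\<lambda>k. y k + t * \<sigma> k) = Yv y"
  by (rule Yv_cong) (simp add: \<sigma>_def)

lemma Xv_shift: "Xv (\<lambda>k. y k + t * \<sigma> k) = Xv y + t *\<^sub>R s"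
proof -
  have "Xv (\<lambda>k. y k + t * \<sigma> k) = Xv y + t *\<^sub>R (\<Sum>k<dq. dual bq k s *\<^sub>R bq ! k)"
    by (simp add: Xv_def \<sigma>_def scaleR_add_left sum.distrib scaleR_sum_right)
  also have "(\<Sum>k<dq. dual bq k s *\<^sub>R bq ! k) = s" by (rule dual_repr[OF bq s_in_Qp, symmetric])
  finally show ?thesis .
qed

lemma D_cong_Yv: "Yv y = Yv y' \<Longrightarrow> D j y X = D j y' X" and E_cong_Yv: "Yv y = Yv y' \<Longrightarrow> E j y = E j y'"
  by (simp_all add: D_def E_def)

lemma jac_shift: "jac z (\<lambda>k. y k + t * \<sigma> k) = jac (z + of_real t) y"
  unfolding jac_def
  by (rule gdet_cong, simp only: Xv_shift D_cong_Yv[OF Yv_shift] E_cong_Yv[OF Yv_shift] D_add_s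
      linear_add[OF co_linear] linear_cmul[OF co_linear]) (simp add: algebra_simps)

lemma jac_poly: obtains q where "degree q \<le> m" "\<And>z. poly q z = jac z y"
  using gdet_affine_poly[where m = m and A = "\<lambda>i j. complex_of_real (co i (D j y (Xv y)))" and B = "\<lambda>i j. of_real (co i (E j y))"]
  unfolding jac_def by blast

lemma Yv_measurable [measurable]: "Yv \<in> borel_measurable (LM II)"
  unfolding Yv_def[abs_def] by (intro borel_measurable_sum borel_measurable_scaleR) (auto intro: measurable_component_singleton)

lemma Xv_measurable [measurable]: "Xv \<in> borel_measurable (LM II)"
  unfolding Xv_def[abs_def] by (intro borel_measurable_sum borel_measurable_scaleR) (auto intro: measurable_component_singleton)

lemma co_measurable: "f \<in> borel_measurable M \<Longrightarrow> (\<lambda>x. co i (f x)) \<in> borel_measurable M"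
  by (rule borel_measurable_continuous_on[OF linear_continuous_on])
    (use co_linear in \<open>simp add: linear_conv_bounded_linear\<close>)

lemma D_measurable: "f \<in> borel_measurable (LM II) \<Longrightarrow> (\<lambda>y. D j y (f y)) \<in> borel_measurable (LM II)"
  unfolding D_def[abs_def] by (cases "j < dp") auto

lemma E_measurable: "(\<lambda>y. E j y) \<in> borel_measurable (LM II)"
  unfolding E_def[abs_def] by (cases "j < dp") auto

lemma DD_measurable: "f \<in> borel_measurable (LM II) \<Longrightarrow> (\<lambda>y. DD j k y (f y)) \<in> borel_measurable (LM II)"
  unfolding DD_def[abs_def] by (cases "j < dp"; cases "k < dp") auto

lemma gdet_measurable:
  fixes f :: "nat \<Rightarrow> nat \<Rightarrow> 'x \<Rightarrow> 'b::{real_normed_field, second_countable_topology}"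
  shows "(\<And>i j. f i j \<in> borel_measurable M) \<Longrightarrow> (\<lambda>x. gdet k (\<lambda>i j. f i j x)) \<in> borel_measurable M"
  unfolding gdet_def by (intro borel_measurable_sum borel_measurable_times borel_measurable_prod borel_measurable_const) auto

lemma of_real_measurable: "f \<in> borel_measurable M \<Longrightarrow> (\<lambda>x. complex_of_real (f x)) \<in> borel_measurable M"
  by measurable

lemma jac_measurable [measurable]: "jac z \<in> borel_measurable (LM II)"
  unfolding jac_def[abs_def]
  by (intro gdet_measurable borel_measurable_add borel_measurable_times borel_measurable_const
      of_real_measurable co_measurable D_measurable Xv_measurable E_measurable)

text \<open>The type \<open>('n \<times> 'n) bit0\<close> has 2 n^2 elements, the real dimension of
  the matrix space, and it is finite and well ordered, as \<open>area_integrable\<close> demands of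
  its index type.\<close>

lemma card_index: "m \<le> CARD(('n \<times> 'n) bit0)"
proof -
  have "m = card (set bQ)" using bQ dim_Q by (simp add: ordered_basis_def distinct_card)
  also have "\<dots> \<le> DIM(complex^'n^'n)" 
    using independent_bound[of "set bQ"] bQ unfolding ordered_basis_def by blast
  also have "\<dots> = CARD(('n \<times> 'n) bit0)" by simp
  finally show ?thesis .
qed

text \<open>Instance of \<open>area_integrable\<close>. The good set consists of the points where no
  nonzero element of \<open>p\<close> commutes with X: there \<open>PS_inj\<close> applies. Its
  complement is closed and meets each line in the direction of \<open>s\<close> in finitely many
  points, hence is null.\<close>

lemma PSchart_integrable_weight:
  "integrable (LM II) (\<lambda>y. PSjac bp bq bQ y * (\<Prod>i<m. 1 / (1 + (co i (PSchart bp bq y))\<^sup>2)))"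
proof -
  obtain e :: "('n \<times> 'n) bit0 \<Rightarrow> nat" where e: "bij_betw e UNIV {..<CARD(('n \<times> 'n) bit0)}"
    using ex_bij_betw_finite_nat[of "UNIV::('n \<times> 'n) bit0 set"] by (auto simp: atLeast0LessThan)
  define f where "f = inv_into UNIV e"
  have fe: "f (e a) = a" for a using e by (simp add: f_def bij_betw_def)
  have ef: "e (f k) = k" if "k < CARD(('n \<times> 'n) bit0)" for k
    using e that by (auto simp: f_def bij_betw_def f_inv_into_f simp del: card_bit0)
  define R where "R y \<longleftrightarrow> (\<forall>\<xi>\<in>p. \<xi> ** Xv y = Xv y ** \<xi> \<longrightarrow> \<xi> = 0)" for y
  let ?F = "\<lambda>y i. co i (PSchart bp bq y)" and ?P = "\<lambda>i k y. co i (D k y (Xv y))"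
  let ?\<iota> = "\<lambda>x::(real, ('n \<times> 'n) bit0) vec. (\<lambda>k. x $ f k)"
  have XR: "Xv (?\<iota> x) = (\<Sum>k<dq. (x $ f (dp + k)) *\<^sub>R bq ! k)" and YR: "Yv (?\<iota> x) = (\<Sum>k<dp. (x $ f k) *\<^sub>R bp ! k)" for x
    by (simp_all add: Xv_def Yv_def)
  have "integrable (LM {..<m}) (\<lambda>y. gdet m (\<lambda>i k. ?P i k y) * (\<Prod>i<m. 1 / (1 + (?F y i)\<^sup>2)))"
  proof (rule area_integrable[where R = R, OF e card_index f_def])
    fix y y' :: "nat \<Rightarrow> real" assume yy: "\<And>k. k < m \<Longrightarrow> y k = y' k"
    have Y: "Yv y = Yv y'" by (rule Yv_cong) (use yy in auto)
    moreover have "Xv y = Xv y'" by (rule Xv_cong) (use yy in auto)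
    ultimately show "?F y = ?F y' \<and> (\<forall>i k. ?P i k y = ?P i k y') \<and> R y = R y'"
      by (simp add: PSchart_eq R_def D_cong_Yv[OF Y])
  next
    fix x :: "(real, ('n \<times> 'n) bit0) vec" and i assume i: "i < m"
    have dY: "((\<lambda>x. Yv (?\<iota> x)) has_derivative (\<lambda>h. Yv (?\<iota> h))) (at x)"
      unfolding YR by (intro has_derivative_sum has_derivative_scaleR_left bounded_linear_imp_has_derivative bounded_linear_vec_nth)
    have dX: "((\<lambda>x. Xv (?\<iota> x)) has_derivative (\<lambda>h. Xv (?\<iota> h))) (at x)"
      unfolding XR by (intro has_derivative_sum has_derivative_scaleR_left bounded_linear_imp_has_derivative bounded_linear_vec_nth)
    have "((\<lambda>x. co i (PS (Yv (?\<iota> x)) (Xv (?\<iota> x)))) has_derivative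
        (\<lambda>h. co i (dPS (Yv (?\<iota> x)) (Yv (?\<iota> h)) (Xv (?\<iota> x)) + PS (Yv (?\<iota> x)) (Xv (?\<iota> h))))) (at x)"
      by (rule bounded_linear.has_derivative[OF _ PS_has_derivative[OF dY dX]])
        (use co_linear in \<open>simp add: linear_conv_bounded_linear\<close>)
    moreover have "co i (dPS (Yv (?\<iota> x)) (Yv (?\<iota> h)) (Xv (?\<iota> x)) + PS (Yv (?\<iota> x)) (Xv (?\<iota> h)))
        = (\<Sum>k<m. ?P i k (?\<iota> x) * h $ f k)" for h
    proof -
      have "dPS (Yv (?\<iota> x)) (Yv (?\<iota> h)) (Xv (?\<iota> x)) = (\<Sum>k<dp. h $ f k *\<^sub>R D k (?\<iota> x) (Xv (?\<iota> x)))"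
        unfolding YR[of h] linear_sum[OF dPS_linear_dir] by (simp add: linear_cmul[OF dPS_linear_dir] D_def)
      moreover have "PS (Yv (?\<iota> x)) (Xv (?\<iota> h)) = (\<Sum>k<dq. h $ f (dp + k) *\<^sub>R D (dp + k) (?\<iota> x) (Xv (?\<iota> x)))"
        unfolding XR[of h] linear_sum[OF PS_linear] by (simp add: linear_cmul[OF PS_linear] D_def)
      moreover have "(\<Sum>k<m. ?P i k (?\<iota> x) * h $ f k) = (\<Sum>k<dp. ?P i k (?\<iota> x) * h $ f k) + (\<Sum>k<dq. ?P i (dp + k) (?\<iota> x) * h $ f (dp + k))"
        by (rule sum_lessThan_add)
      ultimately show ?thesis
        by (simp add: linear_add[OF co_linear] linear_sum[OF co_linear] linear_cmul[OF co_linear] mult.commute)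
    qed
    ultimately show "((\<lambda>x. ?F (?\<iota> x) i) has_derivative (\<lambda>h. \<Sum>k<m. ?P i k (?\<iota> x) * h $ f k)) (at x)"
      by (simp add: PSchart_eq)
  next
    fix y y' assume R: "R y" "R y'" and eq: "\<And>i. i < m \<Longrightarrow> ?F y i = ?F y' i"
    have "PSchart bp bq y = PSchart bp bq y'"
      using co_repr[OF PSchart_Q[of y]] co_repr[OF PSchart_Q[of y']] eq by (metis (no_types, lifting) lessThan_iff sum.cong)
    then have "PS (Yv y) (Xv y) = PS (Yv y') (Xv y')" by (simp add: PSchart_eq)
    then have YX: "Yv y = Yv y' \<and> Xv y = Xv y'"
      by (intro PS_inj Yv_p Xv_Qp) (use R in \<open>auto simp: R_def\<close>)
    have "y k = y' k" if "k < dp" for k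
      using dual_sum[OF bp that, of y] dual_sum[OF bp that, of y'] YX by (simp add: Yv_def)
    moreover have "y (dp + k) = y' (dp + k)" if "k < dq" for k
      using dual_sum[OF bq that, of "\<lambda>k. y (dp + k)"] dual_sum[OF bq that, of "\<lambda>k. y' (dp + k)"] YX by (simp add: Xv_def)
    ultimately show "\<forall>k<m. y k = y' k"
      by (metis add_diff_inverse_nat nat_add_left_cancel_less)
  next
    show "{x. \<not> R (?\<iota> x)} \<in> null_sets lborel"
    proof (rule null_set_of_finite_lines[where v = "\<chi> a. if e a < m then \<sigma> (e a) else 0"])
      \<comment> \<open>A commuting \<xi> can be normalised to unit length, so the bad set is the
        projection of a closed set along a compact one, and therefore closed.\<close>
      define N where "N = {X::complex^'n^'n. \<exists>\<xi>. \<xi> \<in> p \<inter> sphere 0 1 \<and> (\<xi>, X) \<in> {(\<xi>, X). \<xi> ** X = X ** \<xi>}}"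
      have "closed N" unfolding N_def
      proof (rule closed_compact_projection)
        show "compact (p \<inter> sphere 0 1)" by (intro closed_Int_compact closed_subspace subspace_p compact_sphere)
        have "continuous_on UNIV (\<lambda>z::(complex^'n^'n) \<times> (complex^'n^'n). fst z ** snd z - snd z ** fst z)"
          by (intro continuous_intros mm.continuous_on)
        then have "closed ((\<lambda>z::(complex^'n^'n) \<times> (complex^'n^'n). fst z ** snd z - snd z ** fst z) -` {0})"
          by (intro closed_vimage closed_singleton)
        moreover have "(\<lambda>z::(complex^'n^'n) \<times> (complex^'n^'n). fst z ** snd z - snd z ** fst z) -` {0} = {(\<xi>, X). \<xi> ** X = X ** \<xi>}"
          by auto
        ultimately show "closed {(\<xi>::complex^'n^'n, X). \<xi> ** X = X ** \<xi>}" by simp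
      qed
      moreover have "continuous_on UNIV (\<lambda>x. Xv (?\<iota> x))"
        unfolding XR by (intro continuous_intros)
      ultimately have "closed ((\<lambda>x. Xv (?\<iota> x)) -` N)" by (intro closed_vimage)
      moreover have "{x. \<not> R (?\<iota> x)} = (\<lambda>x. Xv (?\<iota> x)) -` N"
      proof -
        have "\<not> R y \<longleftrightarrow> Xv y \<in> N" for y
        proof
          assume "\<not> R y"
          then obtain \<xi> where \<xi>: "\<xi> \<in> p" "\<xi> ** Xv y = Xv y ** \<xi>" "\<xi> \<noteq> 0" by (auto simp: R_def)
          then show "Xv y \<in> N" unfolding N_def
            by (auto intro!: exI[of _ "(1 / norm \<xi>) *\<^sub>R \<xi>"] simp: mm_simps subspace_mul[OF subspace_p])
        next
          assume "Xv y \<in> N" then show "\<not> R y" by (force simp: N_def R_def)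
        qed
        then show ?thesis by auto
      qed
      ultimately show "closed {x. \<not> R (?\<iota> x)}" by simp
    next
      fix x :: "(real, ('n \<times> 'n) bit0) vec"
      have "Xv (?\<iota> (x + t *\<^sub>R (\<chi> a. if e a < m then \<sigma> (e a) else 0))) = Xv (?\<iota> x) + t *\<^sub>R s" for t
        unfolding Xv_shift[symmetric] by (rule Xv_cong) (use card_index ef in \<open>auto simp del: card_bit0\<close>)
      then have "{t. x + t *\<^sub>R (\<chi> a. if e a < m then \<sigma> (e a) else 0) \<in> {x. \<not> R (?\<iota> x)}}
          = {t. \<exists>\<xi>\<in>p. \<xi> \<noteq> 0 \<and> \<xi> ** (Xv (?\<iota> x) + t *\<^sub>R s) = (Xv (?\<iota> x) + t *\<^sub>R s) ** \<xi>}"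
        unfolding R_def mem_Collect_eq by auto
      then show "finite {t. x + t *\<^sub>R (\<chi> a. if e a < m then \<sigma> (e a) else 0) \<in> {x. \<not> R (?\<iota> x)}}"
        using singular_line_finite[OF Xv_Qp] by simp
    qed
  next
    show "(\<lambda>y. gdet m (\<lambda>i k. ?P i k y)) \<in> borel_measurable (LM {..<m})"
      by (intro gdet_measurable co_measurable D_measurable Xv_measurable)
    show "(\<lambda>y. ?F y i) \<in> borel_measurable (LM {..<m})" for i
      unfolding PSchart_eq by (intro co_measurable measurable_PS Yv_measurable Xv_measurable)
  qed
  then show ?thesis by (simp add: PSjac_eq_gdet)
qed

end

subsection \<open>Decay of the integrand\<close>

lemma power_le_exp:
  fixes a :: real
  assumes a: "0 < a"
  obtains C where "C > 0" "\<And>x. 0 \<le> x \<Longrightarrow> (1 + x) ^ N \<le> C * exp (a * x)"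
proof -
  have le: "x ^ N \<le> fact N * exp x" if "0 \<le> x" for x :: real
  proof -
    have "(\<Sum>k\<in>{N}. x ^ k /\<^sub>R fact k) \<le> exp x"
      unfolding exp_def by (rule sum_le_suminf[OF summable_exp_generic]) (use that in auto)
    then show ?thesis by (simp add: field_simps)
  qed
  define C where "C = fact N * exp a / a ^ N"
  have "C > 0" using a by (simp add: C_def)
  moreover have "(1 + x) ^ N \<le> C * exp (a * x)" if "0 \<le> x" for x
  proof -
    have "(a * (1 + x)) ^ N \<le> fact N * exp (a * (1 + x))" using a that by (intro le) simp
    moreover have "(a * (1 + x)) ^ N = a ^ N * (1 + x) ^ N" by (rule power_mult_distrib)
    moreover have "exp (a * (1 + x)) = exp a * exp (a * x)" by (simp add: distrib_left exp_add)
    ultimately have "a ^ N * (1 + x) ^ N \<le> fact N * exp a * exp (a * x)"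
      by (simp only: mult.assoc)
    then show ?thesis using a by (simp add: C_def field_simps)
  qed
  ultimately show ?thesis by (rule that)
qed

lemma power_le_exp_sq:
  fixes a :: real
  assumes a: "0 < a"
  obtains C where "C > 0" "\<And>x. 0 \<le> x \<Longrightarrow> (1 + x) ^ N * exp (- (a * x\<^sup>2)) \<le> C"
proof -
  obtain C where C: "C > 0" "\<And>x. 0 \<le> x \<Longrightarrow> (1 + x) ^ N \<le> C * exp (a * x)"
    using power_le_exp[OF a] by metis
  have "(1 + x) ^ N * exp (- (a * x\<^sup>2)) \<le> C * exp a" if "0 \<le> x" for x
  proof -
    have "0 \<le> (x - 1)\<^sup>2 + x" using that by simp
    then have "x \<le> x\<^sup>2 + 1" by (simp add: power2_eq_square algebra_simps)
    then have "a * x \<le> a * (x\<^sup>2 + 1)" using a by (intro mult_left_mono) auto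
    then have e: "a * x + - (a * x\<^sup>2) \<le> a" by (simp add: algebra_simps)
    have "(1 + x) ^ N * exp (- (a * x\<^sup>2)) \<le> C * exp (a * x) * exp (- (a * x\<^sup>2))"
      by (intro mult_right_mono C that) simp
    also have "\<dots> = C * exp (a * x + - (a * x\<^sup>2))" by (simp only: exp_add mult.assoc)
    also have "\<dots> \<le> C * exp a" using C(1) e by (intro mult_left_mono) auto
    finally show ?thesis .
  qed
  then show ?thesis using C(1) that[of "C * exp a"] by simp
qed

context ps_data
begin

lemma mtrace_theta: "mtrace (theta s X) = mtrace X"
  unfolding theta_eq by (subst mtrace_commute) (simp add: matrix_mul_assoc ss(1) s_sq)

text \<open>Conjugating the trace amounts to applying \<open>theta\<close> and a cyclic permutation.
  On the unshifted domain the source term is therefore a pure phase.\<close>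

lemma mtrace_Q_real: "X \<in> Q \<Longrightarrow> Z \<in> Q \<Longrightarrow> Im (mtrace (X ** Z)) = 0"
proof -
  assume X: "X \<in> Q" and Z: "Z \<in> Q"
  have "cnj (mtrace (X ** Z)) = mtrace (adj Z ** adj X)" by (simp add: mtrace_adj[symmetric] adj_mult)
  also have "\<dots> = mtrace (theta s (Z ** X))" by (simp add: Q_adj X Z theta_mult)
  also have "\<dots> = mtrace (X ** Z)" unfolding mtrace_theta by (rule mtrace_commute)
  finally have "Im (cnj (mtrace (X ** Z))) = Im (mtrace (X ** Z))" by (rule arg_cong)
  then show ?thesis by simp
qed

lemma mtrace_Qm_sq: "q \<in> Qm \<Longrightarrow> mtrace (q ** q) = - of_real ((norm q)\<^sup>2)"
proof -
  assume "q \<in> Qm"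
  then have "- mtrace (q ** q) = of_real ((norm q)\<^sup>2)"
    using mtrace_adj_mult[of q] by (simp only: Qm_antiherm mm.minus_left mtrace_neg)
  then show ?thesis by (metis minus_minus)
qed

lemma mtrace_Qp_sq: "q \<in> Qp \<Longrightarrow> mtrace (q ** q) = of_real ((norm q)\<^sup>2)"
  using mtrace_adj_mult[of q] by (simp add: Qp_herm)

lemma mpart_diff: "mpart (X - Z) = mpart X - mpart Z"
  and mpart_scaleR: "mpart (r *\<^sub>R X) = r *\<^sub>R mpart X"
  and mpart_csc: "mpart (csc z X) = csc z (mpart X)"
  by (simp_all add: mpart_def theta_add theta_diff theta_scaleR theta_csc algebra_simps csc_diff_right csc_scaleR_right)

lemma norm_mpart_le: "norm (mpart X) \<le> norm X"
proof -
  have "norm (X - theta s X) \<le> norm X + norm (theta s X)" by (rule norm_triangle_ineq4)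
  then show ?thesis by (simp add: mpart_def norm_theta)
qed

text \<open>The trace form is negative on the odd part, so Tr X^2 bounds the norm only together with
  that part. Through this identity the regulator controls the full norm of F(Y,X).\<close>

lemma norm_Q_sq: "X \<in> Q \<Longrightarrow> (norm X)\<^sup>2 = Re (mtrace (X ** X)) + 2 * (norm (mpart X))\<^sup>2"
proof -
  assume X: "X \<in> Q"
  have 1: "mtrace (theta s X ** X) = of_real ((norm X)\<^sup>2)"
    using mtrace_adj_mult[of X] by (simp add: Q_adj[OF X])
  have 2: "mtrace (X ** theta s X) = of_real ((norm X)\<^sup>2)" using 1 mtrace_commute[of X "theta s X"] by (simp only:)
  have 3: "mtrace (theta s X ** theta s X) = mtrace (X ** X)" by (simp add: theta_mult[symmetric] mtrace_theta)
  have "- of_real ((norm (mpart X))\<^sup>2) = mtrace (mpart X ** mpart X)" by (simp add: mtrace_Qm_sq mpart_Q X)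
  also have "\<dots> = (1/4) *\<^sub>R (mtrace (X ** X) + mtrace (X ** X) - of_real ((norm X)\<^sup>2) - of_real ((norm X)\<^sup>2))"
  proof -
    have "mtrace ((X - theta s X) ** (X - theta s X)) = mtrace (X ** X) + mtrace (X ** X) - of_real ((norm X)\<^sup>2) - of_real ((norm X)\<^sup>2)"
      by (simp only: mm.diff_left mm.diff_right mtrace_diff 1 2 3) simp
    moreover have "mpart X ** mpart X = (1/4) *\<^sub>R ((X - theta s X) ** (X - theta s X))"
      by (simp only: mpart_def mm.scaleR_left mm.scaleR_right scaleR_scaleR) simp
    ultimately show ?thesis by (simp only: mtrace_scaleR)
  qed
  finally have "- of_real ((norm (mpart X))\<^sup>2) = (1/4) *\<^sub>R (mtrace (X ** X) + mtrace (X ** X) - of_real ((norm X)\<^sup>2) - complex_of_real ((norm X)\<^sup>2))" .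
  then have "Re (- of_real ((norm (mpart X))\<^sup>2)) = Re ((1/4) *\<^sub>R (mtrace (X ** X) + mtrace (X ** X) - of_real ((norm X)\<^sup>2) - complex_of_real ((norm X)\<^sup>2)))"
    by (rule arg_cong)
  then show ?thesis by simp
qed

lemma integrand_eq:
  "integrand s A \<epsilon> X = exp (- mtrace (X ** X) - 2 * \<i> * mtrace (X ** A) + of_real \<epsilon> * mtrace (mpart X ** mpart X))"
proof -
  have "(X - theta s X) ** (X - theta s X) = 4 *\<^sub>R (mpart X ** mpart X)"
    by (simp only: mpart_def mm.scaleR_left mm.scaleR_right scaleR_scaleR) simp
  then have "complex_of_real (\<epsilon> / 4) * mtrace ((X - theta s X) ** (X - theta s X)) = of_real \<epsilon> * mtrace (mpart X ** mpart X)"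
    by (simp only: mtrace_scaleR) (simp add: scaleR_conv_of_real)
  then show ?thesis unfolding integrand_def chi_def exp_add[symmetric] by (simp only:)
qed

lemma norm_diff_sq_ge: "(norm x)\<^sup>2 / 2 - (norm y)\<^sup>2 \<le> (norm (x - y))\<^sup>2" for x y :: "'x::real_normed_vector"
proof -
  have "norm x \<le> norm (x - y) + norm y" using norm_triangle_ineq[of "x - y" y] by simp
  then have "(norm x)\<^sup>2 \<le> (norm (x - y) + norm y)\<^sup>2" by (intro power_mono) auto
  also have "\<dots> \<le> 2 * (norm (x - y))\<^sup>2 + 2 * (norm y)\<^sup>2"
    using zero_le_power2[of "norm (x - y) - norm y"] by (simp add: power2_eq_square algebra_simps)
  finally show ?thesis by simp
qed

text \<open>The real part u is absorbed by giving away half of |X|^2 and half of the regulator. The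
  shift costs at most (u^2 + \<beta>^2)(n + \<epsilon> |e^Y|^4), and its imaginary part turns the
  source phase into the factor exp (- 2 \<beta> Re Tr (F(Y,s) A)), which decays in \<open>Y\<close>
  when \<open>pos_bound\<close> holds with positive \<open>l\<close> and \<beta> > 0.\<close>

lemma norm_integrand_shift_le:
  assumes Y: "Y \<in> p" and X: "X \<in> Qp" and A: "A \<in> Q" and \<epsilon>: "0 \<le> \<epsilon>"
  shows "norm (integrand s A \<epsilon> (PS Y (X - csc (Complex u \<beta>) s)))
    \<le> exp (- (norm X)\<^sup>2 / 2 - \<epsilon> / 2 * (norm (mpart (PS Y X)))\<^sup>2
        + (u\<^sup>2 + \<beta>\<^sup>2) * (real CARD('n) + \<epsilon> * (norm (mexp Y)) ^ 4) - 2 * \<beta> * Re (mtrace (PS Y s ** A)))"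
proof -
  define X1 Q1 Q2 where "X1 = X - u *\<^sub>R s" and "Q1 = PS Y X1" and "Q2 = PS Y s"
  have X1: "X1 \<in> Qp" unfolding X1_def by (intro subspace_diff subspace_mul subspace_Qp X s_in_Qp)
  have Q1: "Q1 \<in> Q" and Q2: "Q2 \<in> Q"
    using Y X1 p_sub Qp_sub by (auto simp: Q1_def Q2_def intro!: PS_in_Q s_in_Q)
  have z: "Complex u \<beta> = of_real u + \<i> * of_real \<beta>" by (simp add: complex_eq_iff)
  have e: "PS Y (X - csc (Complex u \<beta>) s) = Q1 - csc (\<i> * of_real \<beta>) Q2"
    by (simp add: z csc_add_left csc_of_real Q1_def Q2_def X1_def linear_diff[OF PS_linear] linear_add[OF PS_linear] PS_csc algebra_simps
        linear_cmul[OF PS_linear])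
  let ?Q = "Q1 - csc (\<i> * of_real \<beta>) Q2"
  have t1: "Re (mtrace (?Q ** ?Q)) = (norm X1)\<^sup>2 - \<beta>\<^sup>2 * real CARD('n)"
  proof -
    have "mtrace (Q1 ** Q1) = of_real ((norm X1)\<^sup>2)" by (simp add: Q1_def mtrace_PS mtrace_Qp_sq X1)
    moreover have "mtrace (Q2 ** Q2) = of_nat CARD('n)" by (simp add: Q2_def mtrace_PS s_sq mtrace_one)
    ultimately show ?thesis
      by (simp add: mm_simps csc_simps mtrace_diff mtrace_csc mtrace_Q_real Q1 Q2 power2_eq_square)
  qed
  have t2: "Re (- 2 * \<i> * mtrace (?Q ** A)) = - 2 * \<beta> * Re (mtrace (Q2 ** A))"
    by (simp add: mm_simps csc_simps mtrace_diff mtrace_csc mtrace_Q_real Q1 Q2 A)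
  have q: "mpart Q1 \<in> Qm" "mpart Q2 \<in> Qm" by (intro mpart_Q Q1 Q2)+
  have t3: "Re (mtrace (mpart ?Q ** mpart ?Q)) = - (norm (mpart Q1))\<^sup>2 + \<beta>\<^sup>2 * (norm (mpart Q2))\<^sup>2"
    using q Qm_sub
    by (simp add: mpart_diff mpart_csc mm_simps csc_simps mtrace_diff mtrace_csc mtrace_Q_real[of "mpart Q1" "mpart Q2"]
        mtrace_Q_real[of "mpart Q2" "mpart Q1"] subset_iff mtrace_Qm_sq power2_eq_square)
  have n1: "(norm X)\<^sup>2 / 2 - u\<^sup>2 * real CARD('n) \<le> (norm X1)\<^sup>2"
  proof -
    have "(norm s)\<^sup>2 = real CARD('n)"
      using mtrace_Qp_sq[OF s_in_Qp] by (simp add: s_sq mtrace_one) (metis of_real_eq_iff of_real_of_nat_eq of_real_power)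
    then show ?thesis using norm_diff_sq_ge[of X "u *\<^sub>R s"] by (simp add: X1_def power_mult_distrib)
  qed
  have n2: "(norm (mpart (PS Y X)))\<^sup>2 / 2 - u\<^sup>2 * (norm (mpart Q2))\<^sup>2 \<le> (norm (mpart Q1))\<^sup>2"
    using norm_diff_sq_ge[of "mpart (PS Y X)" "u *\<^sub>R mpart Q2"]
    by (simp add: Q1_def Q2_def X1_def linear_diff[OF PS_linear] linear_cmul[OF PS_linear] mpart_diff mpart_scaleR power_mult_distrib)
  have n3: "(norm (mpart Q2))\<^sup>2 \<le> (norm (mexp Y)) ^ 4"
  proof -
    have "norm (mpart Q2) \<le> norm Q2" by (rule norm_mpart_le)
    also have "\<dots> = norm (mexp Y ** mexp Y)" by (simp add: Q2_def PS_s[OF Y] norm_mult_s)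
    also have "\<dots> \<le> (norm (mexp Y))\<^sup>2" using norm_matrix_mult_le by (simp add: power2_eq_square)
    finally have "(norm (mpart Q2))\<^sup>2 \<le> ((norm (mexp Y))\<^sup>2)\<^sup>2" by (intro power_mono) auto
    then show ?thesis by simp
  qed
  have "norm (integrand s A \<epsilon> ?Q) = exp (- Re (mtrace (?Q ** ?Q)) + Re (- 2 * \<i> * mtrace (?Q ** A)) + \<epsilon> * Re (mtrace (mpart ?Q ** mpart ?Q)))"
    unfolding integrand_eq norm_exp_eq_Re by simp
  also have "\<dots> \<le> exp (- (norm X)\<^sup>2 / 2 - \<epsilon> / 2 * (norm (mpart (PS Y X)))\<^sup>2
        + (u\<^sup>2 + \<beta>\<^sup>2) * (real CARD('n) + \<epsilon> * (norm (mexp Y)) ^ 4) - 2 * \<beta> * Re (mtrace (PS Y s ** A)))"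
  proof -
    define r4 where "r4 = (norm (mexp Y)) ^ 4"
    have "\<epsilon> * ((norm (mpart (PS Y X)))\<^sup>2 / 2 - u\<^sup>2 * (norm (mpart Q2))\<^sup>2) \<le> \<epsilon> * (norm (mpart Q1))\<^sup>2"
      by (intro mult_left_mono n2 \<epsilon>)
    moreover have "\<epsilon> * ((u\<^sup>2 + \<beta>\<^sup>2) * (norm (mpart Q2))\<^sup>2) \<le> \<epsilon> * ((u\<^sup>2 + \<beta>\<^sup>2) * r4)"
      unfolding r4_def by (intro mult_left_mono n3 \<epsilon>) auto
    ultimately have "- ((norm X1)\<^sup>2 - \<beta>\<^sup>2 * real CARD('n)) + \<epsilon> * (- (norm (mpart Q1))\<^sup>2 + \<beta>\<^sup>2 * (norm (mpart Q2))\<^sup>2)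
        \<le> - (norm X)\<^sup>2 / 2 - \<epsilon> / 2 * (norm (mpart (PS Y X)))\<^sup>2
        + (u\<^sup>2 + \<beta>\<^sup>2) * (real CARD('n) + \<epsilon> * r4)"
      using n1 by (simp add: algebra_simps)
    then show ?thesis unfolding t1 t2 t3 r4_def Q2_def[symmetric] by (simp only: exp_le_cancel_iff)
  qed
  finally show ?thesis unfolding e .
qed

lemma pos_bound_PS_s: "pos_bound A l \<Longrightarrow> Y \<in> p \<Longrightarrow> l * (norm (mexp Y))\<^sup>2 \<le> Re (mtrace (PS Y s ** A))"
  unfolding pos_bound_def by (metis PS_s mexp_p_herm)

text \<open>Put t = |e^Y|^2, so n <= t. The cost is at most (1 + x^2) \<beta>^2 t (1 + \<epsilon>
  t), and the choice of \<beta> with \<beta> (1 + \<epsilon> t) = b makes this (1 + x^2) b \<beta>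
  t. The gain is at least 2 b \<beta> t because b <= l. As x <= 1/2 the cost factor is at most 5/4,
  so at least b \<beta> t / 2 is left.\<close>

lemma norm_integrand_shift_le_uniform:
  assumes Y: "Y \<in> p" and X: "X \<in> Qp" and A: "A \<in> Q" and \<epsilon>: "0 \<le> \<epsilon>"
    and l: "pos_bound A l" and b: "0 < b" "b \<le> l" and x: "0 \<le> x" "x \<le> 1/2"
    and \<beta>: "\<beta> = b / (1 + \<epsilon> * (norm (mexp Y))\<^sup>2)"
  shows "norm (integrand s A \<epsilon> (PS Y (X - csc (Complex (x * \<beta>) \<beta>) s)))
    \<le> exp (- (norm X)\<^sup>2 / 2 - \<epsilon> / 2 * (norm (mpart (PS Y X)))\<^sup>2
        - b\<^sup>2 / 2 * ((norm (mexp Y))\<^sup>2 / (1 + \<epsilon> * (norm (mexp Y))\<^sup>2)))"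
proof (rule order_trans[OF norm_integrand_shift_le[OF Y X A \<epsilon>]])
  define t where "t = (norm (mexp Y))\<^sup>2"
  have t: "real CARD('n) \<le> t" using tau_ge[OF Y] by (simp add: t_def) (smt (verit) zero_le_power2)
  have t0: "0 < t" using t by (metis of_nat_0_less_iff order_less_le_trans zero_less_card_finite)
  have d: "0 < 1 + \<epsilon> * t" using \<epsilon> t0 by (simp add: add_pos_nonneg)
  have \<beta>0: "0 < \<beta>" using b d by (simp add: \<beta> t_def[symmetric])
  have "((x * \<beta>)\<^sup>2 + \<beta>\<^sup>2) * (real CARD('n) + \<epsilon> * t\<^sup>2) \<le> (5/4 * \<beta>\<^sup>2) * (t * (1 + \<epsilon> * t))"
  proof (rule mult_mono)
    have "x\<^sup>2 \<le> (1/2)\<^sup>2" using x by (intro power_mono) auto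
    then have "x\<^sup>2 * \<beta>\<^sup>2 \<le> 1/4 * \<beta>\<^sup>2" by (intro mult_right_mono) (auto simp: power2_eq_square)
    then show "(x * \<beta>)\<^sup>2 + \<beta>\<^sup>2 \<le> 5/4 * \<beta>\<^sup>2" by (simp add: power_mult_distrib)
    show "real CARD('n) + \<epsilon> * t\<^sup>2 \<le> t * (1 + \<epsilon> * t)" using t by (simp add: algebra_simps power2_eq_square)
  qed (use \<epsilon> t0 in auto)
  also have "\<dots> = 5/4 * b * (\<beta> * t)" 
  proof -
    have "\<beta> * (1 + \<epsilon> * t) = b" using d by (simp add: \<beta> t_def[symmetric])
    moreover have "5/4 * \<beta>\<^sup>2 * (t * (1 + \<epsilon> * t)) = 5/4 * (\<beta> * (1 + \<epsilon> * t)) * (\<beta> * t)"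
      by (simp add: power2_eq_square algebra_simps)
    ultimately show ?thesis by (simp only:)
  qed
  finally have 1: "((x * \<beta>)\<^sup>2 + \<beta>\<^sup>2) * (real CARD('n) + \<epsilon> * t\<^sup>2) \<le> 5/4 * b * (\<beta> * t)" .
  have "l * t \<le> Re (mtrace (PS Y s ** A))" using pos_bound_PS_s[OF l Y] by (simp add: t_def)
  then have "2 * \<beta> * (l * t) \<le> 2 * \<beta> * Re (mtrace (PS Y s ** A))" using \<beta>0 by (intro mult_left_mono) auto
  moreover have "2 * (b * (\<beta> * t)) \<le> 2 * \<beta> * (l * t)"
    using mult_right_mono[OF b(2), of "\<beta> * t"] \<beta>0 t0 by (simp add: algebra_simps)
  ultimately have 2: "2 * (b * (\<beta> * t)) \<le> 2 * \<beta> * Re (mtrace (PS Y s ** A))" by linarith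
  have "0 \<le> b * (\<beta> * t)" using b \<beta>0 t0 by simp
  then have "((x * \<beta>)\<^sup>2 + \<beta>\<^sup>2) * (real CARD('n) + \<epsilon> * t\<^sup>2) - 2 * \<beta> * Re (mtrace (PS Y s ** A)) \<le> - (1/2) * (b * (\<beta> * t))"
    using 1 2 by linarith
  also have "b * (\<beta> * t) = b\<^sup>2 * (t / (1 + \<epsilon> * t))"
    unfolding \<beta> t_def[symmetric] by (simp add: power2_eq_square)
  finally have 3: "((x * \<beta>)\<^sup>2 + \<beta>\<^sup>2) * (real CARD('n) + \<epsilon> * t\<^sup>2) - 2 * \<beta> * Re (mtrace (PS Y s ** A)) \<le> - (b\<^sup>2 / 2 * (t / (1 + \<epsilon> * t)))"
    by simp
  have t4: "(norm (mexp Y)) ^ 4 = t\<^sup>2" by (simp add: t_def)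
  show "exp (- (norm X)\<^sup>2 / 2 - \<epsilon> / 2 * (norm (mpart (PS Y X)))\<^sup>2
        + ((x * \<beta>)\<^sup>2 + \<beta>\<^sup>2) * (real CARD('n) + \<epsilon> * (norm (mexp Y)) ^ 4) - 2 * \<beta> * Re (mtrace (PS Y s ** A)))
    \<le> exp (- (norm X)\<^sup>2 / 2 - \<epsilon> / 2 * (norm (mpart (PS Y X)))\<^sup>2
        - b\<^sup>2 / 2 * ((norm (mexp Y))\<^sup>2 / (1 + \<epsilon> * (norm (mexp Y))\<^sup>2)))"
    unfolding t4 t_def[symmetric] using 3 by simp
qed

text \<open>The rate t / (1 + \<epsilon> t) saturates at 1 / \<epsilon>, hence two regimes. If
  \<epsilon> t <= 1, it is at least t / 2, and |F| <= t |X|. If \<epsilon> t > 1, the regulator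
  takes over: \<epsilon> q^2 / 2 + c / (2 \<epsilon>) >= sqrt c q by the arithmetic-geometric mean,
  a rate free of \<epsilon>, and |F| <= |X| + 2 q.\<close>

lemma uniform_decay:
  assumes c: "0 < c"
  obtains C where "C > 0"
    "\<And>Y X \<epsilon>. Y \<in> p \<Longrightarrow> X \<in> Qp \<Longrightarrow> 0 \<le> \<epsilon> \<Longrightarrow>
      exp (- (norm X)\<^sup>2 / 2 - \<epsilon> / 2 * (norm (mpart (PS Y X)))\<^sup>2 - c * ((norm (mexp Y))\<^sup>2 / (1 + \<epsilon> * (norm (mexp Y))\<^sup>2)))
        * (1 + norm (PS Y X)) ^ N \<le> C"
proof -
  obtain C1 :: real where C1: "C1 > 0" "\<And>x. 0 \<le> x \<Longrightarrow> (1 + x) ^ N * exp (- (1/2 * x\<^sup>2)) \<le> C1"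
    using power_le_exp_sq[of "1/2" N] by auto
  obtain C2 :: real where C2: "C2 > 0" "\<And>x. 0 \<le> x \<Longrightarrow> (1 + x) ^ N \<le> C2 * exp (c / 2 * x)"
    using power_le_exp[of "c / 2" N] c by auto
  obtain C3 :: real where C3: "C3 > 0" "\<And>x. 0 \<le> x \<Longrightarrow> (1 + x) ^ N \<le> C3 * exp (sqrt c / 2 * x)"
    using power_le_exp[of "sqrt c / 2" N] c by auto
  show ?thesis
  proof (rule that[of "C1 * C2 + C1 * C3"])
    show "C1 * C2 + C1 * C3 > 0" using C1 C2 C3 by (simp add: add_pos_pos)
    fix Y X \<epsilon> assume Y: "Y \<in> p" and X: "X \<in> Qp" and \<epsilon>: "0 \<le> (\<epsilon>::real)"
    define t q r where "t = (norm (mexp Y))\<^sup>2" and "q = norm (mpart (PS Y X))" and "r = norm X"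
    have t0: "0 \<le> t" and q0: "0 \<le> q" and r0: "0 \<le> r" by (simp_all add: t_def q_def r_def)
    let ?L = "exp (- r\<^sup>2 / 2 - \<epsilon> / 2 * q\<^sup>2 - c * (t / (1 + \<epsilon> * t))) * (1 + norm (PS Y X)) ^ N"
    have "?L \<le> C1 * C2 + C1 * C3"
    proof (cases "\<epsilon> * t \<le> 1")
      case True
      have "t / 2 \<le> t / (1 + \<epsilon> * t)"
        by (rule divide_left_mono) (use True t0 \<epsilon> in \<open>auto intro!: mult_pos_pos add_pos_nonneg\<close>)
      then have "c * (t / 2) \<le> c * (t / (1 + \<epsilon> * t))" using c by (intro mult_left_mono) auto
      moreover have "0 \<le> \<epsilon> / 2 * q\<^sup>2" using \<epsilon> by simp
      ultimately have e: "- r\<^sup>2 / 2 - \<epsilon> / 2 * q\<^sup>2 - c * (t / (1 + \<epsilon> * t)) \<le> - (1/2 * r\<^sup>2) + - (c / 2 * t)" by linarith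
      have "1 + norm (PS Y X) \<le> (1 + t) * (1 + r)"
        using norm_PS_le[OF Y, of X] t0 r0 by (simp add: t_def[symmetric] r_def[symmetric] algebra_simps)
      then have "(1 + norm (PS Y X)) ^ N \<le> ((1 + t) * (1 + r)) ^ N" by (intro power_mono) auto
      then have "?L \<le> exp (- (1/2 * r\<^sup>2) + - (c / 2 * t)) * ((1 + t) ^ N * (1 + r) ^ N)"
        using e by (intro mult_mono) (auto simp: power_mult_distrib)
      also have "\<dots> = ((1 + r) ^ N * exp (- (1/2 * r\<^sup>2))) * ((1 + t) ^ N * exp (- (c / 2 * t)))"
        unfolding exp_add by (simp add: mult_ac)
      also have "\<dots> \<le> C1 * C2"
      proof (rule mult_mono)
        have "(1 + t) ^ N * exp (- (c / 2 * t)) \<le> C2 * exp (c / 2 * t) * exp (- (c / 2 * t))"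
          by (intro mult_right_mono C2 t0) simp
        also have "\<dots> = C2" by (simp add: exp_minus)
        finally show "(1 + t) ^ N * exp (- (c / 2 * t)) \<le> C2" .
      qed (use C1(2)[OF r0] C1(1) t0 in auto)
      finally show ?thesis using C1(1) C3(1) by (smt (verit) mult_pos_pos)
    next
      case False
      have \<epsilon>0: "0 < \<epsilon>" using False \<epsilon> by (cases "\<epsilon> = 0") auto
      have "1 / (2 * \<epsilon>) \<le> t / (1 + \<epsilon> * t)"
        using False \<epsilon>0 t0 by (simp add: field_simps add_pos_nonneg)
      then have "c * (1 / (2 * \<epsilon>)) \<le> c * (t / (1 + \<epsilon> * t))" using c by (intro mult_left_mono) auto
      moreover have "sqrt c * q \<le> \<epsilon> / 2 * q\<^sup>2 + c * (1 / (2 * \<epsilon>))"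
      proof -
        have "0 \<le> (\<epsilon> * q - sqrt c)\<^sup>2 / (2 * \<epsilon>)" using \<epsilon>0 by simp
        also have "(\<epsilon> * q - sqrt c)\<^sup>2 / (2 * \<epsilon>) = \<epsilon> / 2 * q\<^sup>2 + c * (1 / (2 * \<epsilon>)) - sqrt c * q"
          using \<epsilon>0 c by (simp add: power2_diff power_mult_distrib field_simps power2_eq_square)
        finally show ?thesis by simp
      qed
      ultimately have e: "- r\<^sup>2 / 2 - \<epsilon> / 2 * q\<^sup>2 - c * (t / (1 + \<epsilon> * t)) \<le> - (1/2 * r\<^sup>2) + - (sqrt c * q)" by simp
      have "PS Y X \<in> Q" using Y X p_sub Qp_sub by (intro PS_in_Q) auto
      then have "(norm (PS Y X))\<^sup>2 = r\<^sup>2 + 2 * q\<^sup>2"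
        by (simp add: norm_Q_sq mtrace_PS mtrace_Qp_sq X r_def q_def)
      also have "\<dots> \<le> (r + 2 * q)\<^sup>2" using r0 q0 by (simp add: power2_eq_square algebra_simps)
      finally have "norm (PS Y X) \<le> r + 2 * q" by (rule power2_le_imp_le) (use r0 q0 in simp)
      then have "1 + norm (PS Y X) \<le> (1 + 2 * q) * (1 + r)" using r0 q0 by (simp add: algebra_simps) (smt (verit) mult_nonneg_nonneg)
      then have "(1 + norm (PS Y X)) ^ N \<le> ((1 + 2 * q) * (1 + r)) ^ N" by (intro power_mono) auto
      then have "?L \<le> exp (- (1/2 * r\<^sup>2) + - (sqrt c * q)) * ((1 + 2 * q) ^ N * (1 + r) ^ N)"
        using e by (intro mult_mono) (auto simp: power_mult_distrib)
      also have "\<dots> = ((1 + r) ^ N * exp (- (1/2 * r\<^sup>2))) * ((1 + 2 * q) ^ N * exp (- (sqrt c * q)))"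
        unfolding exp_add by (simp add: mult_ac)
      also have "\<dots> \<le> C1 * C3"
      proof (rule mult_mono)
        have "(1 + 2 * q) ^ N * exp (- (sqrt c * q)) \<le> C3 * exp (sqrt c / 2 * (2 * q)) * exp (- (sqrt c * q))"
          by (intro mult_right_mono C3) (use q0 in auto)
        also have "\<dots> = C3" by (simp add: exp_minus)
        finally show "(1 + 2 * q) ^ N * exp (- (sqrt c * q)) \<le> C3" .
      qed (use C1(2)[OF r0] C1(1) q0 in auto)
      finally show ?thesis using C1(1) C2(1) by (smt (verit) mult_pos_pos)
    qed
    then show "exp (- (norm X)\<^sup>2 / 2 - \<epsilon> / 2 * (norm (mpart (PS Y X)))\<^sup>2 - c * ((norm (mexp Y))\<^sup>2 / (1 + \<epsilon> * (norm (mexp Y))\<^sup>2)))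
        * (1 + norm (PS Y X)) ^ N \<le> C1 * C2 + C1 * C3" by (simp only: t_def q_def r_def)
  qed
qed

text \<open>For fixed \<epsilon> the term t / (1 + \<epsilon> t) is at most 1 / \<epsilon>, so
  dropping it from \<open>uniform_decay\<close> costs the constant factor exp (1 /
  \<epsilon>).\<close>

lemma regulated_decay:
  assumes \<epsilon>: "0 < (\<epsilon>::real)"
  obtains C where "C > 0"
    "\<And>Y X. Y \<in> p \<Longrightarrow> X \<in> Qp \<Longrightarrow>
      exp (- (norm X)\<^sup>2 / 2 - \<epsilon> / 2 * (norm (mpart (PS Y X)))\<^sup>2) * (1 + norm (PS Y X)) ^ N \<le> C"
proof -
  obtain C where C: "C > 0" "\<And>Y X \<epsilon>'. Y \<in> p \<Longrightarrow> X \<in> Qp \<Longrightarrow> 0 \<le> \<epsilon>' \<Longrightarrow>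
      exp (- (norm X)\<^sup>2 / 2 - \<epsilon>' / 2 * (norm (mpart (PS Y X)))\<^sup>2 - 1 * ((norm (mexp Y))\<^sup>2 / (1 + \<epsilon>' * (norm (mexp Y))\<^sup>2)))
        * (1 + norm (PS Y X)) ^ N \<le> C"
    using uniform_decay[of 1 N] by auto
  have "exp (- (norm X)\<^sup>2 / 2 - \<epsilon> / 2 * (norm (mpart (PS Y X)))\<^sup>2) * (1 + norm (PS Y X)) ^ N \<le> exp (1 / \<epsilon>) * C"
    if Y: "Y \<in> p" and X: "X \<in> Qp" for Y X
  proof -
    define t where "t = (norm (mexp Y))\<^sup>2"
    have "0 \<le> t" by (simp add: t_def)
    then have "t / (1 + \<epsilon> * t) \<le> 1 / \<epsilon>" using \<epsilon> by (simp add: field_simps add_pos_nonneg)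
    then have "exp (- (norm X)\<^sup>2 / 2 - \<epsilon> / 2 * (norm (mpart (PS Y X)))\<^sup>2)
        \<le> exp (1 / \<epsilon>) * exp (- (norm X)\<^sup>2 / 2 - \<epsilon> / 2 * (norm (mpart (PS Y X)))\<^sup>2 - 1 * (t / (1 + \<epsilon> * t)))"
      unfolding exp_add[symmetric] by simp
    then have "exp (- (norm X)\<^sup>2 / 2 - \<epsilon> / 2 * (norm (mpart (PS Y X)))\<^sup>2) * (1 + norm (PS Y X)) ^ N
        \<le> exp (1 / \<epsilon>) * exp (- (norm X)\<^sup>2 / 2 - \<epsilon> / 2 * (norm (mpart (PS Y X)))\<^sup>2 - 1 * (t / (1 + \<epsilon> * t))) * (1 + norm (PS Y X)) ^ N"
      by (rule mult_right_mono) simp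
    also have "\<dots> \<le> exp (1 / \<epsilon>) * C"
      unfolding mult.assoc t_def by (intro mult_left_mono C(2)[OF Y X]) (use \<epsilon> in auto)
    finally show ?thesis .
  qed
  then show ?thesis using C(1) that[of "exp (1 / \<epsilon>) * C"] by simp
qed

lemma continuous_integrand: "continuous_on UNIV (integrand s A \<epsilon>)"
proof -
  have tr: "continuous_on UNIV (\<lambda>X. mtrace (f X))" if "continuous_on UNIV f" for f :: "complex^'n^'n \<Rightarrow> complex^'n^'n"
    by (rule continuous_on_compose2[OF linear_continuous_on[OF bounded_linear_mtrace, of UNIV] that]) simp
  show ?thesis unfolding integrand_def chi_def theta_eq
    by (intro continuous_intros tr mm.continuous_on)
qed

lemma measurable_integrand: "f \<in> borel_measurable M \<Longrightarrow> (\<lambda>x. integrand s A \<epsilon> (f x)) \<in> borel_measurable M"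
  by (rule borel_measurable_continuous_on[OF continuous_integrand])

end

context ps_bases
begin

section \<open>Domination by an integrable weight on the target space\<close>

definition W :: "(nat \<Rightarrow> real) \<Rightarrow> real" where
  "W y = (\<Prod>i<m. 1 / (1 + (co i (PSchart bp bq y))\<^sup>2))"

lemma W_pos: "0 < W y"
  unfolding W_def by (intro prod_pos ballI divide_pos_pos) (auto simp: add_pos_nonneg)

text \<open>Each of the \<open>m\<close> factors is at least of order (1 + |F|)^(-2). This is why
  decay against the power \<open>2 * m\<close> of the norm is what the estimates have to
  supply.\<close>

lemma W_lower:
  obtains c where "c > 0" "\<And>y. c \<le> W y * (1 + norm (PSchart bp bq y)) ^ (2 * m)"
proof -
  obtain K where K: "K > 0" "\<And>i v. i < length bQ \<Longrightarrow> \<bar>co i v\<bar> \<le> K * norm v"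
    using dual_norm_bound[OF bQ] by blast
  define L where "L = 1 + K\<^sup>2"
  have L: "1 \<le> L" by (simp add: L_def)
  show ?thesis
  proof (rule that[of "1 / L ^ m"])
    show "1 / L ^ m > 0" using L by simp
    fix y
    define r where "r = norm (PSchart bp bq y)"
    have r: "0 \<le> r" by (simp add: r_def)
    have "1 / (L ^ m * (1 + r) ^ (2 * m)) = (\<Prod>i<m. 1 / (L * (1 + r)\<^sup>2))"
      by (simp add: power_divide power_mult_distrib power_mult[symmetric])
    also have "\<dots> \<le> W y" unfolding W_def
    proof (intro prod_mono conjI)
      fix i assume i: "i \<in> {..<m}"
      have "\<bar>co i (PSchart bp bq y)\<bar> \<le> K * r" unfolding r_def using i dim_Q by (intro K(2)) auto
      then have "\<bar>co i (PSchart bp bq y)\<bar>\<^sup>2 \<le> (K * r)\<^sup>2" by (intro power_mono) auto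
      then have "1 + (co i (PSchart bp bq y))\<^sup>2 \<le> 1 + K\<^sup>2 * r\<^sup>2" by (simp add: power_mult_distrib)
      also have "\<dots> \<le> L * (1 + r)\<^sup>2" using r K(1) by (simp add: L_def power2_eq_square algebra_simps)
      finally show "1 / (L * (1 + r)\<^sup>2) \<le> 1 / (1 + (co i (PSchart bp bq y))\<^sup>2)"
        by (intro divide_left_mono mult_pos_pos) (use L r in \<open>auto simp: add_pos_nonneg\<close>)
      show "0 \<le> 1 / (L * (1 + r)\<^sup>2)" using L by simp
    qed
    finally have *: "1 / (L ^ m * (1 + r) ^ (2 * m)) \<le> W y" .
    have "1 / L ^ m = 1 / (L ^ m * (1 + r) ^ (2 * m)) * (1 + r) ^ (2 * m)" using r L by simp
    also have "\<dots> \<le> W y * (1 + r) ^ (2 * m)" by (intro mult_right_mono *) (use r in auto)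
    finally show "1 / L ^ m \<le> W y * (1 + norm (PSchart bp bq y)) ^ (2 * m)" by (simp add: r_def)
  qed
qed

text \<open>The index \<open>i\<close> carries the parameters, such as the node and \<epsilon>, in
  which the constant has to be uniform.\<close>

lemma decay_imp_W_bound:
  fixes h :: "'i \<Rightarrow> (nat \<Rightarrow> real) \<Rightarrow> real"
  assumes "\<And>i y. i \<in> S \<Longrightarrow> h i y * (1 + norm (PSchart bp bq y)) ^ (2 * m) \<le> C" and C: "C > 0"
  obtains C' where "C' > 0" "\<And>i y. i \<in> S \<Longrightarrow> h i y \<le> C' * W y"
proof -
  obtain c where c: "c > 0" "\<And>y. c \<le> W y * (1 + norm (PSchart bp bq y)) ^ (2 * m)"
    using W_lower by blast
  show ?thesis
  proof (rule that[of "C / c"])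
    show "C / c > 0" using C c by simp
    fix i y assume i: "i \<in> S"
    define R where "R = (1 + norm (PSchart bp bq y)) ^ (2 * m)"
    have R: "0 < R" by (simp add: R_def add_pos_nonneg)
    have "h i y * R * c \<le> C * (W y * R)"
      by (intro mult_mono) (use assms(1)[OF i, of y] c(2)[of y] c(1) C R W_pos[of y] in \<open>auto simp: R_def less_imp_le\<close>)
    then have "h i y * c \<le> C * W y" using R by (simp add: mult_ac)
    then show "h i y \<le> C / c * W y" using c(1) by (simp add: field_simps)
  qed
qed

lemma integrable_W: "integrable (LM II) (\<lambda>y. \<bar>PSjac bp bq bQ y\<bar> * W y)"
  using integrable_abs[OF PSchart_integrable_weight] W_pos
  by (simp add: W_def[symmetric] abs_mult less_imp_le)

lemma PSjac_measurable [measurable]: "PSjac bp bq bQ \<in> borel_measurable (LM II)"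
  unfolding PSjac_eq_gdet[abs_def] by (intro gdet_measurable co_measurable D_measurable Xv_measurable)

lemma integrable_W_bound:
  fixes f :: "(nat \<Rightarrow> real) \<Rightarrow> complex"
  assumes f: "f \<in> borel_measurable (LM II)" and b: "\<And>y. norm (f y) \<le> C * W y"
  shows "integrable (LM II) (\<lambda>y. f y * complex_of_real (PSjac bp bq bQ y))"
proof (rule Bochner_Integration.integrable_bound)
  show "integrable (LM II) (\<lambda>y. C * (\<bar>PSjac bp bq bQ y\<bar> * W y))" using integrable_W by simp
  show "(\<lambda>y. f y * complex_of_real (PSjac bp bq bQ y)) \<in> borel_measurable (LM II)"
    by (intro borel_measurable_times f of_real_measurable PSjac_measurable)
  show "AE y in LM II. norm (f y * complex_of_real (PSjac bp bq bQ y)) \<le> norm (C * (\<bar>PSjac bp bq bQ y\<bar> * W y))"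
  proof (intro AE_I2)
    fix y
    have "norm (f y * complex_of_real (PSjac bp bq bQ y)) = norm (f y) * \<bar>PSjac bp bq bQ y\<bar>" by (simp add: norm_mult)
    also have "\<dots> \<le> C * W y * \<bar>PSjac bp bq bQ y\<bar>" by (intro mult_right_mono b) simp
    also have "\<dots> = C * (\<bar>PSjac bp bq bQ y\<bar> * W y)" by simp
    also have "\<dots> \<le> norm (C * (\<bar>PSjac bp bq bQ y\<bar> * W y))" by simp
    finally show "norm (f y * complex_of_real (PSjac bp bq bQ y)) \<le> norm (C * (\<bar>PSjac bp bq bQ y\<bar> * W y))" .
  qed
qed

lemma PSdomain_eq: "PSdomain bp bq = LM II"
  by (simp add: PSdomain_def)

lemma regulated_integrable:
  assumes A: "A \<in> Q" and \<epsilon>: "0 < \<epsilon>"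
  shows "integrable (LM II) (PSintegrand s A \<epsilon> bp bq bQ)"
proof -
  obtain C where C: "C > 0" "\<And>Y X. Y \<in> p \<Longrightarrow> X \<in> Qp \<Longrightarrow>
      exp (- (norm X)\<^sup>2 / 2 - \<epsilon> / 2 * (norm (mpart (PS Y X)))\<^sup>2) * (1 + norm (PS Y X)) ^ (2 * m) \<le> C"
    using regulated_decay[OF \<epsilon>] by metis
  have h: "norm (integrand s A \<epsilon> (PSchart bp bq y)) * (1 + norm (PSchart bp bq y)) ^ (2 * m) \<le> C" for y
  proof -
    have "norm (integrand s A \<epsilon> (PS (Yv y) (Xv y - csc (Complex 0 0) s))) \<le>
        exp (- (norm (Xv y))\<^sup>2 / 2 - \<epsilon> / 2 * (norm (mpart (PS (Yv y) (Xv y))))\<^sup>2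
        + (0\<^sup>2 + 0\<^sup>2) * (real CARD('n) + \<epsilon> * (norm (mexp (Yv y))) ^ 4) - 2 * 0 * Re (mtrace (PS (Yv y) s ** A)))"
      by (rule norm_integrand_shift_le[OF Yv_p Xv_Qp A]) (use \<epsilon> in simp)
    then have "norm (integrand s A \<epsilon> (PS (Yv y) (Xv y))) \<le> exp (- (norm (Xv y))\<^sup>2 / 2 - \<epsilon> / 2 * (norm (mpart (PS (Yv y) (Xv y))))\<^sup>2)"
      by (simp add: complex_eq_0[symmetric] Complex_eq csc_zero)
    then show ?thesis unfolding PSchart_eq
      by (intro order_trans[OF mult_right_mono C(2)[OF Yv_p Xv_Qp]]) auto
  qed
  show ?thesis
  proof (rule decay_imp_W_bound[of "UNIV :: unit set" "\<lambda>_ y. norm (integrand s A \<epsilon> (PSchart bp bq y))" C, OF h C(1)])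
    fix C' assume "\<And>i y. i \<in> (UNIV :: unit set) \<Longrightarrow> norm (integrand s A \<epsilon> (PSchart bp bq y)) \<le> C' * W y"
    then have b: "norm (integrand s A \<epsilon> (PSchart bp bq y)) \<le> C' * W y" for y by blast
    have "(\<lambda>y. integrand s A \<epsilon> (PSchart bp bq y)) \<in> borel_measurable (LM II)"
      unfolding PSchart_eq by (intro measurable_integrand measurable_PS Yv_measurable Xv_measurable)
    from integrable_W_bound[OF this b] show ?thesis by (simp add: PSintegrand_def[abs_def])
  qed
qed

end

subsection \<open>Contour shifts and the limit of the regulated integrals\<close>

text \<open>The Lagrange basis at \<open>m + 1\<close> distinct nodes.\<close>

lemma interpolation_polys:
  fixes x :: "nat \<Rightarrow> 'a::field"
  assumes inj: "inj_on x {..m}"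
  obtains L where "\<And>j. j \<le> m \<Longrightarrow> degree (L j) \<le> m"
    "\<And>p z. degree p \<le> m \<Longrightarrow> poly p z = (\<Sum>j\<le>m. poly (L j) z * poly p (x j))"
proof -
  define L where "L j = (\<Prod>k\<in>{..m} - {j}. smult (1 / (x j - x k)) [:- x k, 1:])" for j
  have ne: "x j - x k \<noteq> 0" if "j \<le> m" "k \<le> m" "k \<noteq> j" for j k
    using inj that by (auto simp: inj_on_def)
  have Lx: "poly (L j) (x i) = (if i = j then 1 else 0)" if "i \<le> m" "j \<le> m" for i j
  proof (cases "i = j")
    case True
    have "(\<Prod>k\<in>{..m} - {j}. poly (smult (1 / (x j - x k)) [:- x k, 1:]) (x j)) = 1"
    proof (intro prod.neutral ballI)
      fix k assume k: "k \<in> {..m} - {j}"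
      have "poly (smult (1 / (x j - x k)) [:- x k, 1:]) (x j) = (x j - x k) / (x j - x k)"
        by (simp only: poly_smult poly_pCons poly_0)
          (simp only: mult_zero_right add_0_right mult_1_right times_divide_eq_left mult_1_left uminus_add_conv_diff)
      also have "(x j - x k) / (x j - x k) = 1" by (rule divide_self) (use ne[of j k] k that in auto)
      finally show "poly (smult (1 / (x j - x k)) [:- x k, 1:]) (x j) = 1" .
    qed
    then show ?thesis using True by (simp add: L_def poly_prod)
  next
    case False
    then show ?thesis using that by (auto simp: L_def poly_prod intro!: exI[of _ i])
  qed
  have dL: "degree (L j) \<le> m" if "j \<le> m" for j
  proof -
    have "degree (L j) \<le> (\<Sum>k\<in>{..m} - {j}. degree (smult (1 / (x j - x k)) [:- x k, 1:]))"
      unfolding L_def using degree_prod_sum_le[of "{..m} - {j}" "\<lambda>k. smult (1 / (x j - x k)) [:- x k, 1:]"]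
      by (simp add: o_def)
    also have "\<dots> \<le> (\<Sum>k\<in>{..m} - {j}. 1)" by (rule sum_mono) simp
    also have "\<dots> = m" using that by simp
    finally show ?thesis .
  qed
  show ?thesis
  proof (rule that[of L])
    fix p :: "'a poly" and z assume p: "degree p \<le> m"
    define q where "q = (\<Sum>j\<le>m. smult (poly p (x j)) (L j))"
    have "p = q"
    proof (rule poly_eqI_degree[of "x ` {..m}"])
      have card: "card (x ` {..m}) = Suc m" using card_image[OF inj] by simp
      show "degree p < card (x ` {..m})" using p card by simp
      have "degree q \<le> m" unfolding q_def
        by (rule degree_sum_le) (auto intro!: order_trans[OF degree_smult_le] dL)
      then show "degree q < card (x ` {..m})" using card by simp
      fix y assume "y \<in> x ` {..m}"
      then obtain i where i: "i \<le> m" "y = x i" by auto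
      have "poly q y = (\<Sum>j\<le>m. poly p (x j) * (if i = j then 1 else 0))"
        unfolding q_def poly_sum i(2) by (rule sum.cong) (auto simp: Lx i)
      also have "\<dots> = poly p y" using i by (simp add: if_distrib cong: if_cong)
      finally show "poly p y = poly q y" by simp
    qed
    then have "poly p z = poly q z" by simp
    then show "poly p z = (\<Sum>j\<le>m. poly (L j) z * poly p (x j))" by (simp add: q_def poly_sum mult.commute)
  qed (rule dL)
qed

text \<open>Expanding the exponential and exchanging sum and integral yields an everywhere
  convergent power series; the hypothesis for all real r is exactly the dominating function of this
  exchange.\<close>

lemma holomorphic_exponential_integral:
  fixes g l :: "'x \<Rightarrow> complex"
  assumes g: "g \<in> borel_measurable M" and l: "l \<in> borel_measurable M"
    and int: "\<And>r::real. integrable M (\<lambda>x. norm (g x) * exp (r * norm (l x)))"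
  shows "(\<lambda>z. \<integral>x. g x * exp (z * l x) \<partial>M) holomorphic_on UNIV"
proof -
  define a where "a k = (\<integral>x. g x * l x ^ k / fact k \<partial>M)" for k
  have sums: "(\<lambda>k. a k * z ^ k) sums (\<integral>x. g x * exp (z * l x) \<partial>M)" for z
  proof -
    define f where "f k x = g x * (z * l x) ^ k / fact k" for k x
    have fm: "f k \<in> borel_measurable M" for k unfolding f_def using g l by measurable
    have partial: "(\<Sum>k<n. norm (f k x)) \<le> norm (g x) * exp (norm z * norm (l x))" for n x
    proof -
      have "(\<Sum>k<n. (norm z * norm (l x)) ^ k /\<^sub>R fact k) \<le> exp (norm z * norm (l x))"
        unfolding exp_def by (rule sum_le_suminf[OF summable_exp_generic]) auto
      then have "norm (g x) * (\<Sum>k<n. (norm z * norm (l x)) ^ k /\<^sub>R fact k) \<le> norm (g x) * exp (norm z * norm (l x))"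
        by (rule mult_left_mono) simp
      then show ?thesis by (simp add: f_def norm_mult norm_divide norm_power sum_distrib_left divide_inverse norm_inverse mult_ac)
    qed
    have fint: "integrable M (f k)" for k
    proof (rule Bochner_Integration.integrable_bound[OF int[of "norm z"] fm])
      show "AE x in M. norm (f k x) \<le> norm (norm (g x) * exp (norm z * norm (l x)))"
      proof (intro AE_I2)
        fix x
        have "norm (f k x) \<le> (\<Sum>k<Suc k. norm (f k x))" by (rule member_le_sum) auto
        also have "\<dots> \<le> norm (norm (g x) * exp (norm z * norm (l x)))" using partial[of x "Suc k"] by simp
        finally show "norm (f k x) \<le> norm (norm (g x) * exp (norm z * norm (l x)))" .
      qed
    qed
    have "(\<lambda>k. integral\<^sup>L M (f k)) sums (\<integral>x. (\<Sum>k. f k x) \<partial>M)"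
    proof (rule sums_integral[OF fint])
      show "AE x in M. summable (\<lambda>k. norm (f k x))"
        by (intro AE_I2 summableI_nonneg_bounded[OF norm_ge_zero partial])
      have "(\<Sum>k<n. \<integral>x. norm (f k x) \<partial>M) \<le> (\<integral>x. norm (g x) * exp (norm z * norm (l x)) \<partial>M)" for n
      proof -
        have "(\<Sum>k<n. \<integral>x. norm (f k x) \<partial>M) = (\<integral>x. (\<Sum>k<n. norm (f k x)) \<partial>M)"
          by (rule Bochner_Integration.integral_sum[symmetric]) (use fint in auto)
        also have "\<dots> \<le> (\<integral>x. norm (g x) * exp (norm z * norm (l x)) \<partial>M)"
          by (rule integral_mono[OF _ int partial]) (use fint in auto)
        finally show ?thesis .
      qed
      then show "summable (\<lambda>k. \<integral>x. norm (f k x) \<partial>M)"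
        by (intro summableI_nonneg_bounded) auto
    qed
    moreover have "integral\<^sup>L M (f k) = a k * z ^ k" for k
    proof -
      have "f k = (\<lambda>x. g x * l x ^ k / fact k * z ^ k)" by (auto simp: f_def power_mult_distrib)
      then show ?thesis unfolding a_def by simp
    qed
    moreover have "(\<Sum>k. f k x) = g x * exp (z * l x)" for x
    proof -
      have "(\<lambda>k. (z * l x) ^ k /\<^sub>R fact k) sums exp (z * l x)" by (rule exp_converges)
      then have "(\<lambda>k. g x * ((z * l x) ^ k /\<^sub>R fact k)) sums (g x * exp (z * l x))" by (rule sums_mult)
      then show ?thesis by (simp add: f_def sums_iff scaleR_conv_of_real divide_inverse mult_ac)
    qed
    ultimately show ?thesis by simp
  qed
  have "(\<lambda>z. \<integral>x. g x * exp (z * l x) \<partial>M) holomorphic_on ball 0 r" for r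
    by (rule power_series_holomorphic[where a = a]) (use sums in simp)
  then have "(\<lambda>z. \<integral>x. g x * exp (z * l x) \<partial>M) field_differentiable at z" for z
    by (rule holomorphic_on_imp_differentiable_at[of _ "ball 0 (norm z + 1)"]) auto
  then show ?thesis
    by (simp add: holomorphic_on_def field_differentiable_at_within)
qed

context ps_data
begin

text \<open>The exponent is quadratic in z, and the coefficient of z^2 depends on \<open>Y\<close>
  only. On a fibre of fixed \<open>Y\<close> the last factor leaves the integral, and the rest has
  the form treated in \<open>holomorphic_exponential_integral\<close>.\<close>

lemma integrand_shift_eq:
  "integrand s A \<epsilon> (PS Y (X - csc z s)) = integrand s A \<epsilon> (PS Y X)
    * exp (z * (2 * mtrace (X ** s) + 2 * \<i> * mtrace (PS Y s ** A) - 2 * of_real \<epsilon> * mtrace (mpart (PS Y X) ** mpart (PS Y s))))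
    * exp (z\<^sup>2 * (- of_nat CARD('n) + of_real \<epsilon> * mtrace (mpart (PS Y s) ** mpart (PS Y s))))"
proof -
  have e: "PS Y (X - csc z s) = PS Y X - csc z (PS Y s)"
    by (simp add: linear_diff[OF PS_linear] PS_csc)
  have 1: "mtrace ((PS Y X - csc z (PS Y s)) ** (PS Y X - csc z (PS Y s))) = mtrace (PS Y X ** PS Y X) - 2 * z * mtrace (X ** s) + z\<^sup>2 * of_nat CARD('n)"
    by (simp add: mm.diff_left mm.diff_right csc_simps mtrace_diff mtrace_csc mtrace_PS s_sq mtrace_one mtrace_commute[of s X] power2_eq_square)
  have 2: "mtrace ((PS Y X - csc z (PS Y s)) ** A) = mtrace (PS Y X ** A) - z * mtrace (PS Y s ** A)"
    by (simp add: mm.diff_left csc_simps mtrace_diff mtrace_csc)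
  have 3: "mtrace (mpart (PS Y X - csc z (PS Y s)) ** mpart (PS Y X - csc z (PS Y s)))
     = mtrace (mpart (PS Y X) ** mpart (PS Y X)) - 2 * z * mtrace (mpart (PS Y X) ** mpart (PS Y s)) + z\<^sup>2 * mtrace (mpart (PS Y s) ** mpart (PS Y s))"
    by (simp add: mpart_diff mpart_csc mm.diff_left mm.diff_right csc_simps mtrace_diff mtrace_csc
        mtrace_commute[of "mpart (PS Y s)" "mpart (PS Y X)"] power2_eq_square)
  show ?thesis
    unfolding integrand_eq e 1 2 3 exp_add[symmetric] by (rule arg_cong[of _ _ exp]) (simp add: algebra_simps)
qed

lemma norm_integrand_le:
  assumes Y: "Y \<in> p" and X: "X \<in> Qp" and A: "A \<in> Q" and \<epsilon>: "0 \<le> \<epsilon>"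
  shows "norm (integrand s A \<epsilon> (PS Y X)) \<le> exp (- (norm X)\<^sup>2 / 2)"
proof -
  have "norm (integrand s A \<epsilon> (PS Y (X - csc (Complex 0 0) s))) \<le>
      exp (- (norm X)\<^sup>2 / 2 - \<epsilon> / 2 * (norm (mpart (PS Y X)))\<^sup>2
      + (0\<^sup>2 + 0\<^sup>2) * (real CARD('n) + \<epsilon> * (norm (mexp Y)) ^ 4) - 2 * 0 * Re (mtrace (PS Y s ** A)))"
    by (rule norm_integrand_shift_le[OF Y X A \<epsilon>])
  also have "\<dots> \<le> exp (- (norm X)\<^sup>2 / 2)" using \<epsilon> by simp
  finally show ?thesis by (simp add: complex_eq_0[symmetric] Complex_eq csc_zero)
qed

text \<open>A common crude growth exp (4 |Y|): the exponents that occur add up to at most 4, as 3 +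
  1 and 2 + 2 in the second derivative. Any such growth is later beaten by a Gaussian in
  \<open>Y\<close>.\<close>

lemma norm_PS_bound: "norm (PS Y Z) \<le> (sqn TYPE('n))\<^sup>2 * exp 4 * exp (4 * norm Y) * norm Z"
  and norm_dPS_bound: "norm (dPS Y Z X) \<le> 2 * (sqn TYPE('n))\<^sup>2 * exp 4 * exp (4 * norm Y) * norm Z * norm X"
  and norm_ddPS_bound: "norm (ddPS Y Z W X) \<le> 4 * (sqn TYPE('n))\<^sup>2 * exp 4 * exp (4 * norm Y) * norm Z * norm W * norm X"
  for Y Z W X :: "complex^'n^'n"
proof -
  define c r where "c = sqn TYPE('n)" and "r = norm Y"
  have c: "0 \<le> c" and r: "0 \<le> r" by (simp_all add: c_def r_def)
  have e0: "norm (mexp Y') \<le> c * exp r" if "norm Y' = r" for Y' :: "complex^'n^'n"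
    using norm_mexp[of Y'] that by (simp add: c_def)
  have e1: "norm (dexp Y' Z) \<le> c * exp (2 * (1 + r)) * norm Z" if "norm Y' = r" for Y' Z :: "complex^'n^'n"
    using norm_dexp[of Y' Z] that by (simp add: c_def)
  have e2: "norm (ddexp Y' Z W) \<le> c * exp (3 * (1 + r)) * (norm Z * norm W)" if "norm Y' = r" for Y' Z W :: "complex^'n^'n"
    using norm_ddexp[of Y' Z W] that by (simp add: c_def)
  have n: "norm Y = r" "norm (- Y) = r" by (simp_all add: r_def)
  have tri: "norm (P ** X' ** R) \<le> a * norm X' * b" if "norm P \<le> a" "norm R \<le> b" for P X' R :: "complex^'n^'n" and a b
  proof -
    have "norm (P ** X' ** R) \<le> norm P * norm X' * norm R"
      by (meson mult_right_mono norm_ge_zero norm_matrix_mult_le order_trans)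
    also have "\<dots> \<le> a * norm X' * b"
      using that order_trans[OF norm_ge_zero that(1)] by (intro mult_mono) auto
    finally show ?thesis .
  qed
  have ex: "exp u * exp v \<le> exp 4 * exp (4 * r)" if "u + v \<le> 4 + 4 * r" for u v :: real
    using that by (simp add: exp_add[symmetric])
  have "norm (PS Y Z) \<le> c * exp r * norm Z * (c * exp r)"
    unfolding PS_def by (rule tri[OF e0[OF n(1)] e0[OF n(2)]])
  also have "\<dots> = c\<^sup>2 * norm Z * (exp r * exp r)" by (simp add: power2_eq_square)
  also have "\<dots> \<le> c\<^sup>2 * norm Z * (exp 4 * exp (4 * r))" by (rule mult_left_mono[OF ex]) (use r in auto)
  finally show "norm (PS Y Z) \<le> (sqn TYPE('n))\<^sup>2 * exp 4 * exp (4 * norm Y) * norm Z"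
    by (simp add: c_def r_def mult_ac)
  have "norm (dPS Y Z X) \<le> c * exp (2 * (1 + r)) * norm Z * norm X * (c * exp r) + c * exp r * norm X * (c * exp (2 * (1 + r)) * norm Z)"
    unfolding dPS_def by (rule norm_triangle_le_diff, intro add_mono tri e0 e1 n)
  also have "\<dots> = 2 * c\<^sup>2 * norm Z * norm X * (exp (2 * (1 + r)) * exp r)" by (simp add: power2_eq_square)
  also have "\<dots> \<le> 2 * c\<^sup>2 * norm Z * norm X * (exp 4 * exp (4 * r))" by (rule mult_left_mono[OF ex]) (use r in auto)
  finally show "norm (dPS Y Z X) \<le> 2 * (sqn TYPE('n))\<^sup>2 * exp 4 * exp (4 * norm Y) * norm Z * norm X"
    by (simp add: c_def r_def mult_ac)
  have "norm (ddPS Y Z W X) \<le> c * exp (3 * (1 + r)) * (norm Z * norm W) * norm X * (c * exp r)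
      + c * exp (2 * (1 + r)) * norm Z * norm X * (c * exp (2 * (1 + r)) * norm W)
      + c * exp (2 * (1 + r)) * norm W * norm X * (c * exp (2 * (1 + r)) * norm Z)
      + c * exp r * norm X * (c * exp (3 * (1 + r)) * (norm Z * norm W))"
    unfolding ddPS_def by (intro norm_triangle_le norm_triangle_le_diff add_mono tri e0 e1 e2 n)
  also have "\<dots> = 2 * c\<^sup>2 * norm Z * norm W * norm X * (exp (3 * (1 + r)) * exp r) + 2 * c\<^sup>2 * norm Z * norm W * norm X * (exp (2 * (1 + r)) * exp (2 * (1 + r)))"
    by (simp add: power2_eq_square)
  also have "\<dots> \<le> 2 * c\<^sup>2 * norm Z * norm W * norm X * (exp 4 * exp (4 * r)) + 2 * c\<^sup>2 * norm Z * norm W * norm X * (exp 4 * exp (4 * r))"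
    by (rule add_mono[OF mult_left_mono[OF ex] mult_left_mono[OF ex]]) (use r in auto)
  finally show "norm (ddPS Y Z W X) \<le> 4 * (sqn TYPE('n))\<^sup>2 * exp 4 * exp (4 * norm Y) * norm Z * norm W * norm X"
    by (simp add: c_def r_def mult_ac)
qed

end

context ps_bases
begin

section \<open>Growth of the frames and integrals over fibres of fixed Y\<close>

lemma frame_bounds:
  obtains C where "C > 0"
    "\<And>j y X. j < m \<Longrightarrow> norm (D j y X) \<le> C * exp (4 * norm (Yv y)) * (1 + norm X)"
    "\<And>j y. j < m \<Longrightarrow> norm (E j y) \<le> C * exp (4 * norm (Yv y))"
    "\<And>j k y X. j < m \<Longrightarrow> k < m \<Longrightarrow> norm (DD j k y X) \<le> C * exp (4 * norm (Yv y)) * (1 + norm X)"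
    "\<And>Y X :: complex^'n^'n. norm (PS Y X) \<le> C * exp (4 * norm Y) * norm X"
proof -
  define B where "B = 1 + (\<Sum>k<dp. norm (bp ! k)) + (\<Sum>k<dq. norm (bq ! k)) + norm s"
  have s1: "0 \<le> (\<Sum>k<dp. norm (bp ! k))" "0 \<le> (\<Sum>k<dq. norm (bq ! k))" by (simp_all add: sum_nonneg)
  have B1: "1 \<le> B" "norm s \<le> B" using s1 by (simp_all add: B_def)
  have Bp: "norm (bp ! k) \<le> B" if "k < dp" for k
  proof -
    have "norm (bp ! k) \<le> (\<Sum>k<dp. norm (bp ! k))" using that by (intro member_le_sum) auto
    then show ?thesis using s1 by (simp add: B_def add_increasing2)
  qed
  have Bq: "norm (bq ! k) \<le> B" if "k < dq" for k
  proof -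
    have "norm (bq ! k) \<le> (\<Sum>k<dq. norm (bq ! k))" using that by (intro member_le_sum) auto
    then show ?thesis using s1 by (simp add: B_def add_increasing2)
  qed
  define c where "c = (sqn TYPE('n))\<^sup>2 * exp 4"
  have c0: "0 \<le> c" by (simp add: c_def)
  define C where "C = 1 + 4 * c * B\<^sup>2"
  have BB: "B \<le> B\<^sup>2" "1 \<le> B\<^sup>2" using mult_mono[OF B1(1) order_refl, of B] mult_mono[OF B1(1) B1(1)] B1(1)
    by (simp_all add: power2_eq_square)
  have key: "a * c * e * u * v \<le> C * e * w" if "0 \<le> a" "a \<le> 4" "0 \<le> u" "u \<le> B\<^sup>2" "0 \<le> e" "0 \<le> v" "v \<le> w" for a u e v w
  proof -
    have "a * c * e * u * v = (a * c * u) * (e * v)" by simp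
    also have "\<dots> \<le> (4 * c * B\<^sup>2) * (e * w)"
      using that c0 by (intro mult_mono mult_nonneg_nonneg) auto
    also have "\<dots> \<le> C * (e * w)" using that by (intro mult_right_mono) (auto simp: C_def)
    finally show ?thesis by simp
  qed
  have P: "norm (PS Y X) \<le> 1 * c * exp (4 * norm Y) * 1 * norm X" for Y X :: "complex^'n^'n"
    using norm_PS_bound[of Y X] by (simp add: c_def)
  have P': "norm (PS Y X) \<le> 1 * c * exp (4 * norm Y) * norm X * 1" for Y X :: "complex^'n^'n"
    using norm_PS_bound[of Y X] by (simp add: c_def)
  have dP: "norm (dPS Y Z X) \<le> 2 * c * exp (4 * norm Y) * norm Z * norm X" for Y Z X :: "complex^'n^'n"
    using norm_dPS_bound[of Y Z X] by (simp add: c_def)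
  have dP': "norm (dPS Y Z X) \<le> 2 * c * exp (4 * norm Y) * (norm Z * norm X) * 1" for Y Z X :: "complex^'n^'n"
    using norm_dPS_bound[of Y Z X] by (simp add: c_def)
  have ddP: "norm (ddPS Y Z W X) \<le> 4 * c * exp (4 * norm Y) * (norm Z * norm W) * norm X" for Y Z W X :: "complex^'n^'n"
    using norm_ddPS_bound[of Y Z W X] by (simp add: c_def mult.assoc)
  have BB2: "norm Z * norm W' \<le> B\<^sup>2" if "norm Z \<le> B" "norm W' \<le> B" for Z W' :: "complex^'n^'n"
    unfolding power2_eq_square using that B1(1) by (intro mult_mono) auto
  have le: "norm Z \<le> B\<^sup>2" if "norm Z \<le> B" for Z :: "complex^'n^'n" using that BB by linarith
  have C0: "C > 0" using c0 by (simp add: C_def add_pos_nonneg)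
  show ?thesis
  proof (rule that[OF C0])
    fix j y and X :: "complex^'n^'n" assume j: "j < m"
    show "norm (D j y X) \<le> C * exp (4 * norm (Yv y)) * (1 + norm X)"
    proof (cases "j < dp")
      case True
      then show ?thesis unfolding D_def
        by (simp only: if_True) (rule order_trans[OF dP key], use le[OF Bp[OF True]] in auto)
    next
      case False
      then have k: "j - dp < dq" using j by simp
      show ?thesis unfolding D_def using False
        by (simp only: if_False) (rule order_trans[OF P' key], use le[OF Bq[OF k]] in auto)
    qed
  next
    fix j y assume j: "j < m"
    show "norm (E j y) \<le> C * exp (4 * norm (Yv y))"
    proof (cases "j < dp")
      case True
      have "norm (dPS (Yv y) (bp ! j) s) \<le> C * exp (4 * norm (Yv y)) * 1"
        by (rule order_trans[OF dP' key], use BB2[OF Bp[OF True] B1(2)] in auto)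
      then show ?thesis using True by (simp add: E_def)
    qed (use C0 in \<open>simp add: E_def\<close>)
  next
    fix j k y and X :: "complex^'n^'n" assume j: "j < m" and k: "k < m"
    have aux: "norm (dPS (Yv y) Z W') \<le> C * exp (4 * norm (Yv y)) * (1 + norm X)" if "norm Z \<le> B" "norm W' \<le> B" for Z W'
      by (rule order_trans[OF dP' key], use BB2[OF that] in auto)
    show "norm (DD j k y X) \<le> C * exp (4 * norm (Yv y)) * (1 + norm X)"
    proof (cases "j < dp \<and> k < dp")
      case True
      have "norm (ddPS (Yv y) (bp ! j) (bp ! k) X) \<le> C * exp (4 * norm (Yv y)) * (1 + norm X)"
        by (rule order_trans[OF ddP key], use BB2[OF Bp Bp] True in auto)
      then show ?thesis using True by (simp add: DD_def)
    next
      case False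
      have "norm (0 :: complex^'n^'n) \<le> C * exp (4 * norm (Yv y)) * (1 + norm X)" using C0 by simp
      then show ?thesis using False j k
        by (auto simp: DD_def intro!: aux Bp Bq)
    qed
  next
    fix Y X :: "complex^'n^'n"
    show "norm (PS Y X) \<le> C * exp (4 * norm Y) * norm X"
      by (rule order_trans[OF P key], use BB in auto)
  qed
qed

lemma jac_bound:
  obtains C where "C > 0" "\<And>z y. norm (jac z y) \<le> C * exp (real (4 * m) * norm (Yv y)) * ((1 + norm z) * (1 + norm (Xv y))) ^ m"
proof -
  obtain C where C: "C > 0"
    "\<And>j y X. j < m \<Longrightarrow> norm (D j y X) \<le> C * exp (4 * norm (Yv y)) * (1 + norm X)"
    "\<And>j y. j < m \<Longrightarrow> norm (E j y) \<le> C * exp (4 * norm (Yv y))"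
    using frame_bounds by metis
  obtain K where K: "K > 0" "\<And>i v. i < length bQ \<Longrightarrow> \<bar>co i v\<bar> \<le> K * norm v"
    using dual_norm_bound[OF bQ] by blast
  have "norm (jac z y) \<le> fact m * (K * C) ^ m * exp (real (4 * m) * norm (Yv y)) * ((1 + norm z) * (1 + norm (Xv y))) ^ m" for z y
  proof -
    let ?e = "exp (4 * norm (Yv y))"
    have "norm (jac z y) \<le> fact m * (K * C * ?e * ((1 + norm z) * (1 + norm (Xv y)))) ^ m"
      unfolding jac_def
    proof (rule norm_gdet_le)
      fix i j assume i: "i < m" and j: "j < m"
      have d: "\<bar>co i (D j y (Xv y))\<bar> \<le> K * (C * ?e * (1 + norm (Xv y)))"
        by (rule order_trans[OF K(2) mult_left_mono]) (use C(2)[OF j] K(1) i dim_Q in auto)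
      have e: "\<bar>co i (E j y)\<bar> \<le> K * (C * ?e)"
        by (rule order_trans[OF K(2) mult_left_mono]) (use C(3)[OF j] K(1) i dim_Q in auto)
      have "norm (of_real (co i (D j y (Xv y))) + z * of_real (co i (E j y)))
          \<le> \<bar>co i (D j y (Xv y))\<bar> + norm z * \<bar>co i (E j y)\<bar>"
        by (rule order_trans[OF norm_triangle_ineq]) (simp add: norm_mult)
      also have "\<dots> \<le> K * (C * ?e * (1 + norm (Xv y))) + norm z * (K * (C * ?e))"
        by (intro add_mono d mult_left_mono e) auto
      also have "\<dots> \<le> K * C * ?e * ((1 + norm z) * (1 + norm (Xv y)))"
      proof -
        have "0 \<le> (K * C * ?e) * (norm z * norm (Xv y))" using K(1) C(1) by simp
        then show ?thesis by (simp add: algebra_simps)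
      qed
      finally show "norm (of_real (co i (D j y (Xv y))) + z * of_real (co i (E j y))) \<le> K * C * ?e * ((1 + norm z) * (1 + norm (Xv y)))" .
    qed
    also have "\<dots> = fact m * (K * C) ^ m * exp (real (4 * m) * norm (Yv y)) * ((1 + norm z) * (1 + norm (Xv y))) ^ m"
    proof -
      have "?e ^ m = exp (real (4 * m) * norm (Yv y))" by (simp add: exp_of_nat_mult[symmetric] mult_ac)
      then show ?thesis by (simp only: power_mult_distrib mult.assoc)
    qed
    finally show ?thesis .
  qed
  then show ?thesis using that[of "fact m * (K * C) ^ m"] K(1) C(1) by simp
qed

lemma jac_cong: "(\<And>k. k < m \<Longrightarrow> y k = y' k) \<Longrightarrow> jac z y = jac z y'"
proof -
  assume yy: "\<And>k. k < m \<Longrightarrow> y k = y' k"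
  have Y: "Yv y = Yv y'" by (rule Yv_cong) (use yy in auto)
  have X: "Xv y = Xv y'" by (rule Xv_cong) (use yy in auto)
  show ?thesis unfolding jac_def X D_cong_Yv[OF Y] E_cong_Yv[OF Y] ..
qed

lemma Xv_norm_ge:
  obtains a where "a > 0" "\<And>y. a * sqsum {dp..<m} y \<le> (norm (Xv y))\<^sup>2"
proof -
  obtain a where a: "a > 0" "\<And>c. a * (\<Sum>k<length bq. (c k)\<^sup>2) \<le> (norm (\<Sum>k<length bq. c k *\<^sub>R bq ! k))\<^sup>2"
    using ordered_basis_norm_ge[OF bq] by blast
  have "sqsum {dp..<m} y = (\<Sum>k<dq. (y (dp + k))\<^sup>2)" for y
    unfolding sqsum_def by (rule sum.reindex_bij_witness[of _ "\<lambda>k. dp + k" "\<lambda>k. k - dp"]) auto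
  then show ?thesis using that[OF a(1)] a(2) by (simp add: Xv_def)
qed

lemma Yv_norm_ge:
  obtains a where "a > 0" "\<And>y. a * sqsum {..<dp} y \<le> (norm (Yv y))\<^sup>2"
  using ordered_basis_norm_ge[OF bp] unfolding sqsum_def Yv_def by blast

text \<open>Fibres of the chart: x holds the coordinates of Y and stays fixed, y holds those of
  X.\<close>

abbreviation "IJ \<equiv> {length bp..<length bp + length bq}"
abbreviation "mg x y \<equiv> merge {..<length bp} {length bp..<length bp + length bq} (x, y)"

lemma Yv_mg: "Yv (mg x y) = Yv x" and Xv_mg: "Xv (mg x y) = Xv y"
  by (rule Yv_cong Xv_cong; simp add: merge_def)+

lemma mg_measurable: "x \<in> space (LM {..<dp}) \<Longrightarrow> (\<lambda>y. mg x y) \<in> measurable (LM IJ) (LM II)"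
proof -
  assume x: "x \<in> space (LM {..<dp})"
  have U: "II = {..<dp} \<union> IJ" by auto
  have "(\<lambda>y. (x, y)) \<in> measurable (LM IJ) (LM {..<dp} \<Otimes>\<^sub>M LM IJ)" using x by simp
  from measurable_compose[OF this measurable_merge] show ?thesis unfolding U .
qed

lemma fiber_measurable:
  assumes x: "x \<in> space (LM {..<dp})" and f: "f \<in> borel_measurable (LM II)"
  shows "(\<lambda>y. f (mg x y)) \<in> borel_measurable (LM IJ)"
  by (rule measurable_compose[OF mg_measurable[OF x] f])

text \<open>The exponent |X|^2 / 2 is spent as 1/8 for the polynomial factor, 1/8 for the
  exponential one and 1/4 for decay in the coordinates.\<close>

lemma fiber_integrable:
  fixes f :: "(nat \<Rightarrow> real) \<Rightarrow> complex"
  assumes x: "x \<in> space (LM {..<dp})" and f: "f \<in> borel_measurable (LM II)"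
    and b: "\<And>y. norm (f (mg x y)) \<le> C * (1 + norm (Xv y)) ^ N * exp (r * norm (Xv y)) * exp (- (norm (Xv y))\<^sup>2 / 2)"
  shows "integrable (LM IJ) (\<lambda>y. f (mg x y))"
proof -
  obtain a where a: "a > 0" "\<And>y. a * sqsum IJ y \<le> (norm (Xv y))\<^sup>2" using Xv_norm_ge by blast
  obtain C1 :: real where C1: "C1 > 0" "\<And>x. 0 \<le> x \<Longrightarrow> (1 + x) ^ N * exp (- (1/8 * x\<^sup>2)) \<le> C1"
    using power_le_exp_sq[of "1/8" N] by auto
  have C0: "0 \<le> C"
  proof -
    have "0 \<le> C * (1 + norm (Xv x)) ^ N * exp (r * norm (Xv x)) * exp (- (norm (Xv x))\<^sup>2 / 2)"
      using b[of x] norm_ge_zero order_trans by blast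
    then show ?thesis by (simp add: zero_le_mult_iff add_pos_nonneg not_le) (smt (verit) exp_gt_zero norm_ge_zero zero_less_power)
  qed
  have "norm (f (mg x y)) \<le> C * C1 * exp (4 * r\<^sup>2) * exp (- (a / 4 * sqsum IJ y))" for y
  proof -
    define X where "X = norm (Xv y)"
    have X0: "0 \<le> X" by (simp add: X_def)
    have r: "r * X \<le> 4 * r\<^sup>2 + X\<^sup>2 / 8"
    proof -
      have "0 \<le> (4 * r - X)\<^sup>2" by simp
      then have "8 * (r * X) \<le> 16 * r\<^sup>2 + X\<^sup>2" by (simp add: power2_eq_square algebra_simps)
      moreover have "16 * r\<^sup>2 \<le> 32 * r\<^sup>2" by simp
      ultimately show ?thesis by linarith
    qed
    have "norm (f (mg x y)) \<le> C * ((1 + X) ^ N * (exp (r * X) * exp (- X\<^sup>2 / 2)))"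
      using b[of y] by (simp add: X_def mult.assoc)
    also have "\<dots> \<le> C * ((1 + X) ^ N * (exp (4 * r\<^sup>2) * exp (- (1/8 * X\<^sup>2)) * exp (- (X\<^sup>2 / 4))))"
    proof -
      have "exp (r * X) * exp (- X\<^sup>2 / 2) \<le> exp (4 * r\<^sup>2) * exp (- (1/8 * X\<^sup>2)) * exp (- (X\<^sup>2 / 4))"
        unfolding exp_add[symmetric] using r by simp
      then show ?thesis using C0 X0 by (intro mult_left_mono) auto
    qed
    also have "C * ((1 + X) ^ N * (exp (4 * r\<^sup>2) * exp (- (1/8 * X\<^sup>2)) * exp (- (X\<^sup>2 / 4))))
        = C * exp (4 * r\<^sup>2) * ((1 + X) ^ N * exp (- (1/8 * X\<^sup>2))) * exp (- (X\<^sup>2 / 4))" by simp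
    also have "\<dots> \<le> C * exp (4 * r\<^sup>2) * C1 * exp (- (a / 4 * sqsum IJ y))"
      using C1(1) C1(2)[OF X0] a(2)[of y] C0 X0 by (intro mult_mono mult_nonneg_nonneg) (auto simp: X_def)
    finally show ?thesis by (simp add: mult_ac)
  qed
  then show ?thesis
    by (intro integrable_gaussian_bound[of _ "a / 4", OF _ _ fiber_measurable[OF x f]]) (use a in auto)
qed

lemma fiber_jac_integrand_measurable:
  "(\<lambda>y. jac t y * integrand s A \<epsilon> (PS (Yv y) (Xv y - csc z s))) \<in> borel_measurable (LM II)"
  by (intro borel_measurable_times jac_measurable measurable_integrand measurable_PS Yv_measurable
      borel_measurable_diff Xv_measurable borel_measurable_const)

text \<open>\<open>H z\<close> is the fibre integral with X moved by - z s and the Jacobian left in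
  place. \<open>H\<close> is entire; for real z a translation moves the shift into the Jacobian, so
  there \<open>H\<close> is a polynomial of degree at most \<open>m\<close>, and by the identity
  theorem it is one everywhere. A formula recovering p 0 from values at nodes thus applies to
  \<open>H\<close>. As Y is fixed, the scale \<beta> may depend on it.\<close>

lemma fiber_shift:
  assumes x: "x \<in> space (LM {..<dp})" and A: "A \<in> Q" and \<epsilon>: "0 \<le> \<epsilon>"
    and w: "\<And>p::complex poly. degree p \<le> m \<Longrightarrow> poly p 0 = (\<Sum>j\<le>m. w j * poly p (\<nu> j))"
  shows "(\<integral>y. jac 0 (mg x y) * integrand s A \<epsilon> (PS (Yv x) (Xv y)) \<partial>LM IJ)
      = (\<Sum>j\<le>m. w j * (\<integral>y. jac 0 (mg x y) * integrand s A \<epsilon> (PS (Yv x) (Xv y - csc (of_real \<beta> * \<nu> j) s)) \<partial>LM IJ))"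
    and "integrable (LM IJ) (\<lambda>y. jac 0 (mg x y) * integrand s A \<epsilon> (PS (Yv x) (Xv y - csc z s)))"
proof -
  define Y where "Y = Yv x"
  have Y: "Y \<in> p" by (simp add: Y_def Yv_p)
  define l' where "l' y = 2 * mtrace (Xv y ** s) + 2 * \<i> * mtrace (PS (Yv y) s ** A) - 2 * of_real \<epsilon> * mtrace (mpart (PS (Yv y) (Xv y)) ** mpart (PS (Yv y) s))" for y
  define l where "l y = l' (mg x y)" for y
  have l_eq: "l y = 2 * mtrace (Xv y ** s) + 2 * \<i> * mtrace (PS Y s ** A) - 2 * of_real \<epsilon> * mtrace (mpart (PS Y (Xv y)) ** mpart (PS Y s))" for y
    by (simp add: l_def l'_def Yv_mg Xv_mg Y_def)
  define q0 where "q0 = - of_nat CARD('n) + of_real \<epsilon> * mtrace (mpart (PS Y s) ** mpart (PS Y s))"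
  have shift: "integrand s A \<epsilon> (PS Y (Xv y - csc z s)) = integrand s A \<epsilon> (PS Y (Xv y)) * exp (z * l y) * exp (z\<^sup>2 * q0)" for y z
    unfolding integrand_shift_eq l_eq q0_def ..
  obtain C where C: "C > 0" "\<And>Y X :: complex^'n^'n. norm (PS Y X) \<le> C * exp (4 * norm Y) * norm X"
    using frame_bounds by metis
  define a0 where "a0 = 2 * norm (mtrace (PS Y s ** A))"
  define a1 where "a1 = 2 * norm s + 2 * \<epsilon> * (C * exp (4 * norm Y) * norm (PS Y s))"
  have a0: "0 \<le> a0" by (simp add: a0_def)
  have a1: "0 \<le> a1" using C(1) \<epsilon> by (simp add: a1_def)
  have l_bound: "norm (l y) \<le> a0 + a1 * norm (Xv y)" for y
  proof -
    have t1: "norm (mtrace (Xv y ** s)) \<le> norm (Xv y) * norm s" by (rule norm_mtrace_mult_le)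
    have "norm (mtrace (mpart (PS Y (Xv y)) ** mpart (PS Y s))) \<le> norm (mpart (PS Y (Xv y))) * norm (mpart (PS Y s))"
      by (rule norm_mtrace_mult_le)
    also have "\<dots> \<le> (C * exp (4 * norm Y) * norm (Xv y)) * norm (PS Y s)"
      by (intro mult_mono order_trans[OF norm_mpart_le] C(2) order_refl) (use C(1) in auto)
    finally have t2: "\<epsilon> * norm (mtrace (mpart (PS Y (Xv y)) ** mpart (PS Y s))) \<le> \<epsilon> * ((C * exp (4 * norm Y) * norm (Xv y)) * norm (PS Y s))"
      using \<epsilon> by (rule mult_left_mono)
    have "norm (l y) \<le> norm (2 * mtrace (Xv y ** s)) + norm (2 * \<i> * mtrace (PS Y s ** A)) + norm (2 * of_real \<epsilon> * mtrace (mpart (PS Y (Xv y)) ** mpart (PS Y s)))"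
      unfolding l_eq by (intro norm_triangle_le_diff add_mono norm_triangle_ineq order_refl)
    also have "\<dots> = 2 * norm (mtrace (Xv y ** s)) + a0 + 2 * (\<epsilon> * norm (mtrace (mpart (PS Y (Xv y)) ** mpart (PS Y s))))"
      using \<epsilon> by (simp add: norm_mult a0_def)
    also have "\<dots> \<le> 2 * (norm (Xv y) * norm s) + a0 + 2 * (\<epsilon> * ((C * exp (4 * norm Y) * norm (Xv y)) * norm (PS Y s)))"
      using t1 t2 by linarith
    also have "\<dots> = a0 + a1 * norm (Xv y)" by (simp add: a1_def algebra_simps)
    finally show ?thesis .
  qed
  obtain Cj where Cj: "Cj > 0" "\<And>z y. norm (jac z y) \<le> Cj * exp (real (4 * m) * norm (Yv y)) * ((1 + norm z) * (1 + norm (Xv y))) ^ m"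
    using jac_bound by blast
  have jb: "norm (jac t (mg x y)) \<le> (Cj * exp (real (4 * m) * norm Y) * (1 + norm t) ^ m) * (1 + norm (Xv y)) ^ m" for t y
    using Cj(2)[of t "mg x y"] by (simp add: Yv_mg Xv_mg Y_def power_mult_distrib mult.assoc)
  have gb: "norm (jac t (mg x y) * integrand s A \<epsilon> (PS Y (Xv y))) \<le> (Cj * exp (real (4 * m) * norm Y) * (1 + norm t) ^ m) * (1 + norm (Xv y)) ^ m * exp (- (norm (Xv y))\<^sup>2 / 2)" for t y
    unfolding norm_mult using Cj(1)
    by (intro mult_mono jb norm_integrand_le[OF Y Xv_Qp A \<epsilon>] mult_nonneg_nonneg) auto
  have lb: "exp (r * norm (l y)) \<le> exp (\<bar>r\<bar> * a0) * exp (\<bar>r\<bar> * a1 * norm (Xv y))" for r y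
  proof -
    have "r * norm (l y) \<le> \<bar>r\<bar> * norm (l y)" by (intro mult_right_mono) auto
    also have "\<dots> \<le> \<bar>r\<bar> * (a0 + a1 * norm (Xv y))" by (intro mult_left_mono l_bound) auto
    finally show ?thesis unfolding exp_add[symmetric] by (simp add: algebra_simps)
  qed
  have meas0: "(\<lambda>y. jac t y * integrand s A \<epsilon> (PS (Yv y) (Xv y))) \<in> borel_measurable (LM II)" for t
    using fiber_jac_integrand_measurable[of t A \<epsilon> 0] by (simp add: csc_zero)
  have tr: "f \<in> borel_measurable M \<Longrightarrow> (\<lambda>x. mtrace (f x)) \<in> borel_measurable M" for f :: "'y \<Rightarrow> complex^'n^'n" and M
    by (rule borel_measurable_continuous_on[OF linear_continuous_on[OF bounded_linear_mtrace]])
  have mpm: "f \<in> borel_measurable M \<Longrightarrow> (\<lambda>x. mpart (f x)) \<in> borel_measurable M" for f :: "'y \<Rightarrow> complex^'n^'n" and M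
    unfolding mpart_def theta_eq by (intro borel_measurable_scaleR borel_measurable_const borel_measurable_diff measurable_matrix_mult)
  have l'm: "l' \<in> borel_measurable (LM II)"
    unfolding l'_def[abs_def]
    by (intro borel_measurable_diff borel_measurable_add borel_measurable_times borel_measurable_const tr measurable_matrix_mult mpm measurable_PS Xv_measurable Yv_measurable)
  have int_exp: "integrable (LM IJ) (\<lambda>y. norm (jac t (mg x y) * integrand s A \<epsilon> (PS Y (Xv y))) * exp (r * norm (l y)))" for r t
  proof -
    let ?f = "\<lambda>y'. complex_of_real (norm (jac t y' * integrand s A \<epsilon> (PS (Yv y') (Xv y'))) * exp (r * norm (l' y')))"
    have "integrable (LM IJ) (\<lambda>y. ?f (mg x y))"
    proof (rule fiber_integrable[OF x])
      show "?f \<in> borel_measurable (LM II)"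
      proof (rule of_real_measurable, rule borel_measurable_times)
        show "(\<lambda>y'. norm (jac t y' * integrand s A \<epsilon> (PS (Yv y') (Xv y')))) \<in> borel_measurable (LM II)"
          by (rule measurable_compose[OF meas0 borel_measurable_norm])
        show "(\<lambda>y'. exp (r * norm (l' y'))) \<in> borel_measurable (LM II)"
          using l'm by measurable
      qed
      fix y
      have "norm (?f (mg x y)) = norm (jac t (mg x y) * integrand s A \<epsilon> (PS Y (Xv y))) * exp (r * norm (l y))"
        by (simp add: Yv_mg Xv_mg Y_def l_def del: of_real_mult)
      also have "\<dots> \<le> ((Cj * exp (real (4 * m) * norm Y) * (1 + norm t) ^ m) * (1 + norm (Xv y)) ^ m * exp (- (norm (Xv y))\<^sup>2 / 2)) * (exp (\<bar>r\<bar> * a0) * exp (\<bar>r\<bar> * a1 * norm (Xv y)))"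
        using Cj(1) by (intro mult_mono gb lb mult_nonneg_nonneg) auto
      also have "\<dots> = (Cj * exp (real (4 * m) * norm Y) * (1 + norm t) ^ m * exp (\<bar>r\<bar> * a0)) * (1 + norm (Xv y)) ^ m * exp ((\<bar>r\<bar> * a1) * norm (Xv y)) * exp (- (norm (Xv y))\<^sup>2 / 2)"
        by (simp only: mult_ac)
      finally show "norm (?f (mg x y)) \<le> (Cj * exp (real (4 * m) * norm Y) * (1 + norm t) ^ m * exp (\<bar>r\<bar> * a0)) * (1 + norm (Xv y)) ^ m * exp ((\<bar>r\<bar> * a1) * norm (Xv y)) * exp (- (norm (Xv y))\<^sup>2 / 2)" .
    qed
    then have "integrable (LM IJ) (\<lambda>y. Re (?f (mg x y)))" by (rule integrable_Re)
    then show ?thesis by (simp add: Yv_mg Xv_mg Y_def l_def)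
  qed
  have gm: "(\<lambda>y. jac t (mg x y) * integrand s A \<epsilon> (PS Y (Xv y))) \<in> borel_measurable (LM IJ)" for t
    using fiber_measurable[OF x meas0[of t]] by (simp add: Yv_mg Xv_mg Y_def)
  have lm: "l \<in> borel_measurable (LM IJ)"
    using fiber_measurable[OF x l'm] by (simp add: l_def[abs_def])
  have gint: "integrable (LM IJ) (\<lambda>y. jac t (mg x y) * integrand s A \<epsilon> (PS Y (Xv y)))" for t
    using int_exp[of t 0] by (simp add: integrable_norm_iff[OF gm])
  have Hint: "integrable (LM IJ) (\<lambda>y. jac t (mg x y) * integrand s A \<epsilon> (PS Y (Xv y - csc z s)))" for t z
  proof -
    have "integrable (LM IJ) (\<lambda>y. jac t (mg x y) * integrand s A \<epsilon> (PS Y (Xv y)) * exp (z * l y))"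
    proof (rule Bochner_Integration.integrable_bound[OF int_exp[of t "norm z"]])
      show "(\<lambda>y. jac t (mg x y) * integrand s A \<epsilon> (PS Y (Xv y)) * exp (z * l y)) \<in> borel_measurable (LM IJ)"
      proof (rule borel_measurable_times[OF gm])
        show "(\<lambda>y. exp (z * l y)) \<in> borel_measurable (LM IJ)" using lm by measurable
      qed
      show "AE y in LM IJ. norm (jac t (mg x y) * integrand s A \<epsilon> (PS Y (Xv y)) * exp (z * l y))
          \<le> norm (norm (jac t (mg x y) * integrand s A \<epsilon> (PS Y (Xv y))) * exp (norm z * norm (l y)))"
      proof (intro AE_I2)
        fix y
        have "Re (z * l y) \<le> norm z * norm (l y)" using complex_Re_le_cmod[of "z * l y"] by (simp add: norm_mult)
        then have "norm (exp (z * l y)) \<le> exp (norm z * norm (l y))" by (simp add: norm_exp_eq_Re)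
        then show "norm (jac t (mg x y) * integrand s A \<epsilon> (PS Y (Xv y)) * exp (z * l y))
          \<le> norm (norm (jac t (mg x y) * integrand s A \<epsilon> (PS Y (Xv y))) * exp (norm z * norm (l y)))"
          unfolding norm_mult[of _ "exp (z * l y)"] by (simp add: mult_left_mono)
      qed
    qed
    then have "integrable (LM IJ) (\<lambda>y. jac t (mg x y) * integrand s A \<epsilon> (PS Y (Xv y)) * exp (z * l y) * exp (z\<^sup>2 * q0))"
      by (rule integrable_mult_left)
    then show ?thesis unfolding shift by (simp only: mult.assoc)
  qed
  then show "integrable (LM IJ) (\<lambda>y. jac 0 (mg x y) * integrand s A \<epsilon> (PS (Yv x) (Xv y - csc z s)))"
    unfolding Y_def .
  define H where "H z = (\<integral>y. jac 0 (mg x y) * integrand s A \<epsilon> (PS Y (Xv y - csc z s)) \<partial>LM IJ)" for z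
  have H_holo: "H holomorphic_on UNIV"
  proof -
    have "H = (\<lambda>z. (\<integral>y. (jac 0 (mg x y) * integrand s A \<epsilon> (PS Y (Xv y))) * exp (z * l y) \<partial>LM IJ) * exp (z\<^sup>2 * q0))"
      unfolding H_def shift by (simp add: mult.assoc[symmetric])
    moreover have "(\<lambda>z. (\<integral>y. (jac 0 (mg x y) * integrand s A \<epsilon> (PS Y (Xv y))) * exp (z * l y) \<partial>LM IJ) * exp (z\<^sup>2 * q0)) holomorphic_on UNIV"
      by (intro holomorphic_intros holomorphic_exponential_integral gm lm int_exp)
    ultimately show ?thesis by simp
  qed
  have H_real: "H (of_real u) = (\<integral>y. jac (of_real u) (mg x y) * integrand s A \<epsilon> (PS Y (Xv y)) \<partial>LM IJ)" for u :: real
  proof -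
    let ?f = "\<lambda>y. jac 0 (mg x y) * integrand s A \<epsilon> (PS Y (Xv y - csc (of_real u) s))"
    have fm: "?f \<in> borel_measurable (LM IJ)" using Hint[of 0 "of_real u"] by auto
    have "H (of_real u) = (\<Prod>i\<in>IJ. \<bar>1::real\<bar>) *\<^sub>R (\<integral>y. ?f (\<lambda>k\<in>IJ. u * \<sigma> k + 1 * y k) \<partial>LM IJ)"
      unfolding H_def by (rule integral_LM_affine[OF _ _ fm]) auto
    also have "\<dots> = (\<integral>y. jac (of_real u) (mg x y) * integrand s A \<epsilon> (PS Y (Xv y)) \<partial>LM IJ)"
    proof -
      have "jac 0 (mg x (\<lambda>k\<in>IJ. u * \<sigma> k + 1 * y k)) = jac (of_real u) (mg x y)" for y
      proof -
        have "jac 0 (mg x (\<lambda>k\<in>IJ. u * \<sigma> k + 1 * y k)) = jac 0 (\<lambda>k. mg x y k + u * \<sigma> k)"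
          by (rule jac_cong) (auto simp: merge_def \<sigma>_def)
        then show ?thesis by (simp add: jac_shift)
      qed
      moreover have "Xv (\<lambda>k\<in>IJ. u * \<sigma> k + 1 * y k) - csc (of_real u) s = Xv y" for y
      proof -
        have "Xv (\<lambda>k\<in>IJ. u * \<sigma> k + 1 * y k) = Xv (\<lambda>k. y k + u * \<sigma> k)"
          by (rule Xv_cong) auto
        then show ?thesis by (simp add: Xv_shift csc_of_real)
      qed
      ultimately show ?thesis by simp
    qed
    finally show ?thesis .
  qed
  have injn: "inj_on (\<lambda>j. of_nat j :: complex) {..m}" by (simp add: inj_on_def)
  obtain L where L: "\<And>j. j \<le> m \<Longrightarrow> degree (L j) \<le> m"
    "\<And>p z. degree p \<le> m \<Longrightarrow> poly p z = (\<Sum>j\<le>m. poly (L j) z * poly p (of_nat j :: complex))"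
    using interpolation_polys[OF injn] by blast
  \<comment> \<open>This auxiliary interpolation at 0, ..., m only shows that \<open>H\<close> is
    polynomial on the reals; it is separate from the nodes \<open>\<nu>\<close>.\<close>
  define Pol where "Pol = (\<Sum>j\<le>m. smult (H (of_nat j)) (L j))"
  have degPol: "degree Pol \<le> m" unfolding Pol_def
    by (rule degree_sum_le) (auto intro!: order_trans[OF degree_smult_le] L(1))
  have H_Pol_real: "H (of_real u) = poly Pol (of_real u)" for u :: real
  proof -
    have j: "jac (of_real u) y = (\<Sum>j\<le>m. poly (L j) (of_real u) * jac (of_nat j) y)" for y
    proof -
      obtain q where q: "degree q \<le> m" "\<And>z. poly q z = jac z y" using jac_poly[of y] by blast
      show ?thesis using L(2)[OF q(1), of "of_real u"] by (simp add: q(2))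
    qed
    have "H (of_real u) = (\<integral>y. (\<Sum>j\<le>m. poly (L j) (of_real u) * (jac (of_nat j) (mg x y) * integrand s A \<epsilon> (PS Y (Xv y)))) \<partial>LM IJ)"
      unfolding H_real j sum_distrib_right by (simp only: mult.assoc)
    also have "\<dots> = (\<Sum>j\<le>m. poly (L j) (of_real u) * (\<integral>y. jac (of_nat j) (mg x y) * integrand s A \<epsilon> (PS Y (Xv y)) \<partial>LM IJ))"
      by (subst Bochner_Integration.integral_sum) (auto intro!: integrable_mult_right gint)
    also have "\<dots> = (\<Sum>j\<le>m. poly (L j) (of_real u) * H (of_nat j))"
      using H_real[of "real _"] by simp
    also have "\<dots> = poly Pol (of_real u)" by (simp add: Pol_def poly_sum mult.commute)
    finally show ?thesis .
  qed
  have HP: "H z = poly Pol z" for z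
  proof -
    have "H z - poly Pol z = 0"
    proof (rule analytic_continuation[where f = "\<lambda>z. H z - poly Pol z" and w = z and S = UNIV and U = "range complex_of_real" and \<xi> = 0])
      show "(\<lambda>z. H z - poly Pol z) holomorphic_on UNIV" by (intro holomorphic_intros H_holo)
      show "0 islimpt range complex_of_real"
        unfolding islimpt_approachable
      proof (intro allI impI)
        fix e :: real assume "e > 0"
        then show "\<exists>x'\<in>range complex_of_real. x' \<noteq> 0 \<and> dist x' 0 < e"
          by (intro bexI[OF _ rangeI[of complex_of_real "e / 2"]]) simp
      qed
    qed (auto simp: H_Pol_real)
    then show ?thesis by simp
  qed
  \<comment> \<open>Substituting \<beta> z does not raise the degree, so the formula with nodes
    \<open>\<nu>\<close> also holds with nodes \<beta> \<open>\<nu>\<close>.\<close>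
  have "H 0 = poly (pcompose Pol [:0, of_real \<beta>:]) 0" by (simp add: HP poly_pcompose)
  also have "\<dots> = (\<Sum>j\<le>m. w j * poly (pcompose Pol [:0, of_real \<beta>:]) (\<nu> j))"
    by (rule w) (use degPol in \<open>auto intro!: order_trans[OF degree_pcompose_le] simp: mult_le_cancel1\<close>)
  also have "\<dots> = (\<Sum>j\<le>m. w j * H (of_real \<beta> * \<nu> j))" by (simp add: HP poly_pcompose mult.commute)
  finally show "(\<integral>y. jac 0 (mg x y) * integrand s A \<epsilon> (PS (Yv x) (Xv y)) \<partial>LM IJ)
      = (\<Sum>j\<le>m. w j * (\<integral>y. jac 0 (mg x y) * integrand s A \<epsilon> (PS (Yv x) (Xv y - csc (of_real \<beta> * \<nu> j) s)) \<partial>LM IJ))"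
    by (simp add: H_def Y_def csc_zero)
qed

definition \<nu> :: "nat \<Rightarrow> complex" where "\<nu> j = of_real (real j / (2 * (real m + 1))) + \<i>"

lemma nodes_weights:
  obtains w where "\<And>p::complex poly. degree p \<le> m \<Longrightarrow> poly p 0 = (\<Sum>j\<le>m. w j * poly p (\<nu> j))"
proof -
  have inj: "inj_on \<nu> {..m}"
  proof (rule inj_onI)
    fix j k assume "\<nu> j = \<nu> k"
    then have "Re (\<nu> j) = Re (\<nu> k)" by simp
    then have jk: "real j / (2 * (real m + 1)) = real k / (2 * (real m + 1))" by (simp only: \<nu>_def plus_complex.sel Re_complex_of_real imaginary_unit.sel add_0_right)
    have "0 < real (2 * (m + 1))" by (simp only: of_nat_0_less_iff) simp
    also have "real (2 * (m + 1)) = 2 * (real m + 1)" by simp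
    finally have "2 * (real m + 1) \<noteq> 0" by (rule less_imp_neq[symmetric])
    with jk show "j = k" by (simp only: divide_cancel_right of_nat_eq_iff) blast
  qed
  obtain L where "\<And>j. j \<le> m \<Longrightarrow> degree (L j) \<le> m" and
    L: "\<And>p z. degree p \<le> m \<Longrightarrow> poly p z = (\<Sum>j\<le>m. poly (L j) z * poly p (\<nu> j))"
    using interpolation_polys[OF inj] by blast
  show ?thesis by (rule that[of "\<lambda>j. poly (L j) 0"]) (rule L)
qed

lemma mult_\<nu>: "of_real \<beta> * \<nu> j = Complex (real j / (2 * (real m + 1)) * \<beta>) \<beta>"
  by (simp add: \<nu>_def complex_eq_iff)

lemma node_range: "j \<le> m \<Longrightarrow> 0 \<le> real j / (2 * (real m + 1)) \<and> real j / (2 * (real m + 1)) \<le> 1/2"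
  by (simp add: field_simps)

text \<open>One constant for all nodes and all \<epsilon> >= 0: this is the dominating function for
  the limit of vanishing regulator.\<close>

lemma shifted_W_bound:
  assumes A: "A \<in> Q" and l: "pos_bound A l" and b: "0 < b" "b \<le> l"
  obtains C where "C > 0" "\<And>j \<epsilon> y. j \<le> m \<Longrightarrow> 0 \<le> \<epsilon> \<Longrightarrow>
    norm (integrand s A \<epsilon> (PS (Yv y) (Xv y - csc (of_real (b / (1 + \<epsilon> * (norm (mexp (Yv y)))\<^sup>2)) * \<nu> j) s))) \<le> C * W y"
proof -
  have c: "0 < b\<^sup>2 / 2" using b by simp
  obtain C where C: "C > 0"
    "\<And>Y X \<epsilon>. Y \<in> p \<Longrightarrow> X \<in> Qp \<Longrightarrow> 0 \<le> \<epsilon> \<Longrightarrow>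
      exp (- (norm X)\<^sup>2 / 2 - \<epsilon> / 2 * (norm (mpart (PS Y X)))\<^sup>2 - b\<^sup>2 / 2 * ((norm (mexp Y))\<^sup>2 / (1 + \<epsilon> * (norm (mexp Y))\<^sup>2)))
        * (1 + norm (PS Y X)) ^ (2 * m) \<le> C"
    using uniform_decay[OF c] by metis
  let ?h = "\<lambda>(j, \<epsilon>) y. norm (integrand s A \<epsilon> (PS (Yv y) (Xv y - csc (of_real (b / (1 + \<epsilon> * (norm (mexp (Yv y)))\<^sup>2)) * \<nu> j) s)))"
  show ?thesis
  proof (rule decay_imp_W_bound[of "{..m} \<times> {0..}" ?h C])
    fix i :: "nat \<times> real" and y assume i: "i \<in> {..m} \<times> {0..}"
    then obtain j \<epsilon> where i': "i = (j, \<epsilon>)" "j \<le> m" "0 \<le> \<epsilon>" by auto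
    have "?h i y \<le> exp (- (norm (Xv y))\<^sup>2 / 2 - \<epsilon> / 2 * (norm (mpart (PS (Yv y) (Xv y))))\<^sup>2
        - b\<^sup>2 / 2 * ((norm (mexp (Yv y)))\<^sup>2 / (1 + \<epsilon> * (norm (mexp (Yv y)))\<^sup>2)))"
      unfolding i' prod.case mult_\<nu>
      by (rule norm_integrand_shift_le_uniform[OF Yv_p Xv_Qp A i'(3) l b]) (use node_range[OF i'(2)] in auto)
    then have "?h i y * (1 + norm (PSchart bp bq y)) ^ (2 * m) \<le> exp (- (norm (Xv y))\<^sup>2 / 2 - \<epsilon> / 2 * (norm (mpart (PS (Yv y) (Xv y))))\<^sup>2
        - b\<^sup>2 / 2 * ((norm (mexp (Yv y)))\<^sup>2 / (1 + \<epsilon> * (norm (mexp (Yv y)))\<^sup>2))) * (1 + norm (PSchart bp bq y)) ^ (2 * m)"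
      by (rule mult_right_mono) simp
    also have "\<dots> \<le> C" unfolding PSchart_eq by (rule C(2)[OF Yv_p Xv_Qp i'(3)])
    finally show "?h i y * (1 + norm (PSchart bp bq y)) ^ (2 * m) \<le> C" .
  next
    fix C' assume C': "0 < C'" "\<And>i y. i \<in> {..m} \<times> {0..} \<Longrightarrow> ?h i y \<le> C' * W y"
    show ?thesis
    proof (rule that[OF C'(1)])
      fix j :: nat and \<epsilon> :: real and y assume "j \<le> m" "0 \<le> \<epsilon>"
      then show "norm (integrand s A \<epsilon> (PS (Yv y) (Xv y - csc (of_real (b / (1 + \<epsilon> * (norm (mexp (Yv y)))\<^sup>2)) * \<nu> j) s))) \<le> C' * W y"
        using C'(2)[of "(j, \<epsilon>)" y] by simp
    qed
  qed (rule C(1))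
qed

lemma shifted_measurable:
  "(\<lambda>y. integrand s A \<epsilon> (PS (Yv y) (Xv y - csc (of_real (b / (1 + \<epsilon> * (norm (mexp (Yv y)))\<^sup>2)) * z) s))) \<in> borel_measurable (LM II)"
proof -
  have 1: "(\<lambda>y. mexp (Yv y)) \<in> borel_measurable (LM II)"
    by (rule borel_measurable_continuous_on[OF continuous_mexp Yv_measurable])
  have 2: "(\<lambda>y. complex_of_real (b / (1 + \<epsilon> * (norm (mexp (Yv y)))\<^sup>2)) * z) \<in> borel_measurable (LM II)"
    using 1 by measurable
  have 3: "continuous_on UNIV (\<lambda>c. csc c s)"
    by (rule linear_continuous_on) (rule csc.bounded_linear_left)
  have "(\<lambda>y. csc (complex_of_real (b / (1 + \<epsilon> * (norm (mexp (Yv y)))\<^sup>2)) * z) s) \<in> borel_measurable (LM II)"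
    by (rule borel_measurable_continuous_on[OF 3 2])
  then show ?thesis
    by (intro measurable_integrand measurable_PS Yv_measurable borel_measurable_diff Xv_measurable)
qed

text \<open>For \<epsilon> > 0 the integrand is exchanged fibrewise for its interpolated form
  \<open>K\<close>, whose limit \<epsilon> -> 0 is dominated. At \<epsilon> = 0 the scale is the
  constant b, so the real parts of the nodes can be removed by translating the whole domain, and the
  interpolation formula, read backwards, adds the resulting Jacobians up to the single value at - i
  b.\<close>

lemma limit_regulated:
  assumes A: "A \<in> Q" and l: "pos_bound A l" and b: "0 < b" "b \<le> l"
  shows "((\<lambda>\<epsilon>. integral\<^sup>L (LM II) (PSintegrand s A \<epsilon> bp bq bQ))
     \<longlongrightarrow> (\<integral>y. jac (- (of_real b * \<i>)) y * integrand s A 0 (PS (Yv y) (Xv y - csc (of_real b * \<i>) s)) \<partial>LM II)) (at_right 0)"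
proof -
  obtain w where w: "\<And>p::complex poly. degree p \<le> m \<Longrightarrow> poly p 0 = (\<Sum>j\<le>m. w j * poly p (\<nu> j))"
    using nodes_weights by blast
  define F where "F \<epsilon> j y = integrand s A \<epsilon> (PS (Yv y) (Xv y - csc (of_real (b / (1 + \<epsilon> * (norm (mexp (Yv y)))\<^sup>2)) * \<nu> j) s))" for \<epsilon> j y
  obtain C where C: "C > 0" "\<And>j \<epsilon> y. j \<le> m \<Longrightarrow> 0 \<le> \<epsilon> \<Longrightarrow> norm (F \<epsilon> j y) \<le> C * W y"
    unfolding F_def using shifted_W_bound[OF A l b] by metis
  have Fm: "F \<epsilon> j \<in> borel_measurable (LM II)" for \<epsilon> j
    unfolding F_def[abs_def] by (rule shifted_measurable)
  have Fint: "integrable (LM II) (\<lambda>y. F \<epsilon> j y * of_real (PSjac bp bq bQ y))" if "0 \<le> \<epsilon>" "j \<le> m" for \<epsilon> j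
    by (rule integrable_W_bound[OF Fm C(2)[OF that(2,1)]])
  define K where "K \<epsilon> y = (\<Sum>j\<le>m. w j * F \<epsilon> j y)" for \<epsilon> y
  have Keq: "K \<epsilon> y * of_real (PSjac bp bq bQ y) = (\<Sum>j\<le>m. w j * (F \<epsilon> j y * of_real (PSjac bp bq bQ y)))" for \<epsilon> y
    by (simp add: K_def sum_distrib_right mult.assoc)
  have Kint: "integrable (LM II) (\<lambda>y. K \<epsilon> y * of_real (PSjac bp bq bQ y))" if "0 \<le> \<epsilon>" for \<epsilon>
    unfolding Keq using Fint[OF that] by (intro Bochner_Integration.integrable_sum integrable_mult_right) auto
  have U: "II = {..<dp} \<union> IJ" by auto
  \<comment> \<open>The two integrands agree only after integration over each fibre; integrability
    of both on the whole domain, known independently, permits Fubini on either side.\<close>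
  have eq: "integral\<^sup>L (LM II) (PSintegrand s A \<epsilon> bp bq bQ) = (\<integral>y. K \<epsilon> y * of_real (PSjac bp bq bQ y) \<partial>LM II)" if \<epsilon>: "0 < \<epsilon>" for \<epsilon>
  proof -
    have i1: "integrable (LM ({..<dp} \<union> IJ)) (PSintegrand s A \<epsilon> bp bq bQ)"
      using regulated_integrable[OF A \<epsilon>] unfolding U[symmetric] .
    have i2: "integrable (LM ({..<dp} \<union> IJ)) (\<lambda>y. K \<epsilon> y * of_real (PSjac bp bq bQ y))"
      using Kint[of \<epsilon>] \<epsilon> unfolding U[symmetric] by simp
    have "integral\<^sup>L (LM II) (PSintegrand s A \<epsilon> bp bq bQ) = (\<integral>x. (\<integral>y. PSintegrand s A \<epsilon> bp bq bQ (mg x y) \<partial>LM IJ) \<partial>LM {..<dp})"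
      unfolding U by (rule LM.product_integral_fold[OF _ _ _ i1]) auto
    also have "\<dots> = (\<integral>x. (\<integral>y. K \<epsilon> (mg x y) * of_real (PSjac bp bq bQ (mg x y)) \<partial>LM IJ) \<partial>LM {..<dp})"
    proof (rule Bochner_Integration.integral_cong[OF refl])
      fix x assume x: "x \<in> space (LM {..<dp})"
      define \<beta> where "\<beta> = b / (1 + \<epsilon> * (norm (mexp (Yv x)))\<^sup>2)"
      have "(\<integral>y. PSintegrand s A \<epsilon> bp bq bQ (mg x y) \<partial>LM IJ) = (\<integral>y. jac 0 (mg x y) * integrand s A \<epsilon> (PS (Yv x) (Xv y)) \<partial>LM IJ)"
        by (simp add: PSintegrand_def of_real_PSjac PSchart_eq Yv_mg Xv_mg mult.commute)
      also have "\<dots> = (\<Sum>j\<le>m. w j * (\<integral>y. jac 0 (mg x y) * integrand s A \<epsilon> (PS (Yv x) (Xv y - csc (of_real \<beta> * \<nu> j) s)) \<partial>LM IJ))"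
        by (rule fiber_shift(1)[OF x A _ w]) (use \<epsilon> in auto)
      also have "\<dots> = (\<Sum>j\<le>m. \<integral>y. w j * (jac 0 (mg x y) * integrand s A \<epsilon> (PS (Yv x) (Xv y - csc (of_real \<beta> * \<nu> j) s))) \<partial>LM IJ)"
        by simp
      also have "\<dots> = (\<integral>y. (\<Sum>j\<le>m. w j * (jac 0 (mg x y) * integrand s A \<epsilon> (PS (Yv x) (Xv y - csc (of_real \<beta> * \<nu> j) s)))) \<partial>LM IJ)"
        by (rule Bochner_Integration.integral_sum[symmetric], rule integrable_mult_right, rule fiber_shift(2)[OF x A _ w]) (use \<epsilon> in auto)
      also have "\<dots> = (\<integral>y. K \<epsilon> (mg x y) * of_real (PSjac bp bq bQ (mg x y)) \<partial>LM IJ)"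
      proof (rule Bochner_Integration.integral_cong[OF refl])
        fix y
        have Ff: "F \<epsilon> j (mg x y) = integrand s A \<epsilon> (PS (Yv x) (Xv y - csc (of_real \<beta> * \<nu> j) s))" for j
          by (simp only: F_def Yv_mg Xv_mg \<beta>_def)
        show "(\<Sum>j\<le>m. w j * (jac 0 (mg x y) * integrand s A \<epsilon> (PS (Yv x) (Xv y - csc (of_real \<beta> * \<nu> j) s))))
            = K \<epsilon> (mg x y) * of_real (PSjac bp bq bQ (mg x y))"
          unfolding K_def Ff of_real_PSjac sum_distrib_right by (rule sum.cong) simp_all
      qed
      finally show "(\<integral>y. PSintegrand s A \<epsilon> bp bq bQ (mg x y) \<partial>LM IJ) = (\<integral>y. K \<epsilon> (mg x y) * of_real (PSjac bp bq bQ (mg x y)) \<partial>LM IJ)" .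
    qed
    also have "\<dots> = (\<integral>y. K \<epsilon> y * of_real (PSjac bp bq bQ y) \<partial>LM II)"
      unfolding U by (rule LM.product_integral_fold[OF _ _ _ i2, symmetric]) auto
    finally show ?thesis .
  qed
  have point: "((\<lambda>\<epsilon>. F \<epsilon> j y) \<longlongrightarrow> F 0 j y) (at 0)" for j y
  proof -
    have tr: "((\<lambda>\<epsilon>. mtrace (f \<epsilon>)) \<longlongrightarrow> mtrace g) G" if "(f \<longlongrightarrow> g) G" for f :: "real \<Rightarrow> complex^'n^'n" and g G
      by (rule bounded_linear.tendsto[OF bounded_linear_mtrace that])
    have PSt: "((\<lambda>\<epsilon>. PS (Yv y) (f \<epsilon>)) \<longlongrightarrow> PS (Yv y) g) G" if "(f \<longlongrightarrow> g) G" for f :: "real \<Rightarrow> complex^'n^'n" and g G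
      unfolding PS_def by (intro mm.tendsto tendsto_const that)
    have mt: "((\<lambda>\<epsilon>. mpart (f \<epsilon>)) \<longlongrightarrow> mpart g) G" if "(f \<longlongrightarrow> g) G" for f :: "real \<Rightarrow> complex^'n^'n" and g G
      unfolding mpart_def theta_eq by (intro tendsto_scaleR tendsto_const tendsto_diff mm.tendsto that)
    have "((\<lambda>\<epsilon>. b / (1 + \<epsilon> * (norm (mexp (Yv y)))\<^sup>2)) \<longlongrightarrow> b / (1 + 0 * (norm (mexp (Yv y)))\<^sup>2)) (at 0)"
      by (intro tendsto_divide tendsto_add tendsto_mult tendsto_const tendsto_ident_at) simp
    then have "((\<lambda>\<epsilon>. csc (complex_of_real (b / (1 + \<epsilon> * (norm (mexp (Yv y)))\<^sup>2)) * \<nu> j) s) \<longlongrightarrow> csc (complex_of_real (b / (1 + 0 * (norm (mexp (Yv y)))\<^sup>2)) * \<nu> j) s) (at 0)"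
      by (intro csc.tendsto tendsto_mult tendsto_of_real tendsto_const)
    then show ?thesis
      unfolding F_def integrand_eq
      by (intro tendsto_exp tendsto_add tendsto_diff tendsto_minus tendsto_mult tendsto_const tendsto_of_real
          tendsto_ident_at tr mm.tendsto mt PSt)
  qed
  have lim: "((\<lambda>\<epsilon>. \<integral>y. K \<epsilon> y * of_real (PSjac bp bq bQ y) \<partial>LM II) \<longlongrightarrow> (\<integral>y. K 0 y * of_real (PSjac bp bq bQ y) \<partial>LM II)) (at_right 0)"
  proof (rule tendsto_at_right_sequentially[of 0 1])
    fix S :: "nat \<Rightarrow> real" assume S: "\<And>n. 0 < S n" "\<And>n. S n < 1" "decseq S" "S \<longlonglongrightarrow> 0"
    show "(\<lambda>n. \<integral>y. K (S n) y * of_real (PSjac bp bq bQ y) \<partial>LM II) \<longlonglongrightarrow> (\<integral>y. K 0 y * of_real (PSjac bp bq bQ y) \<partial>LM II)"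
    proof (rule integral_dominated_convergence[where w = "\<lambda>y. (\<Sum>j\<le>m. norm (w j)) * C * (\<bar>PSjac bp bq bQ y\<bar> * W y)"])
      show "(\<lambda>y. K 0 y * of_real (PSjac bp bq bQ y)) \<in> borel_measurable (LM II)" using Kint[of 0] by auto
      show "(\<lambda>y. K (S n) y * of_real (PSjac bp bq bQ y)) \<in> borel_measurable (LM II)" for n
        using Kint[of "S n"] S(1)[of n] by auto
      show "integrable (LM II) (\<lambda>y. (\<Sum>j\<le>m. norm (w j)) * C * (\<bar>PSjac bp bq bQ y\<bar> * W y))"
        using integrable_W by simp
      have S0: "filterlim S (at 0) sequentially"
        using S by (intro filterlim_atI) (auto simp: less_imp_neq[symmetric] intro!: always_eventually)
      show "AE y in LM II. (\<lambda>n. K (S n) y * of_real (PSjac bp bq bQ y)) \<longlonglongrightarrow> K 0 y * of_real (PSjac bp bq bQ y)"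
        unfolding K_def
        by (intro AE_I2 tendsto_mult tendsto_sum tendsto_const filterlim_compose[OF point S0])
      show "AE y in LM II. norm (K (S n) y * of_real (PSjac bp bq bQ y)) \<le> (\<Sum>j\<le>m. norm (w j)) * C * (\<bar>PSjac bp bq bQ y\<bar> * W y)" for n
      proof (intro AE_I2)
        fix y
        have "norm (K (S n) y) \<le> (\<Sum>j\<le>m. norm (w j) * (C * W y))"
          unfolding K_def
          by (intro sum_norm_le) (use C(2)[of _ "S n" y] S(1)[of n] in \<open>auto simp: norm_mult intro!: mult_left_mono\<close>)
        then have "norm (K (S n) y) * \<bar>PSjac bp bq bQ y\<bar> \<le> (\<Sum>j\<le>m. norm (w j) * (C * W y)) * \<bar>PSjac bp bq bQ y\<bar>"
          by (rule mult_right_mono) simp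
        also have "\<dots> = (\<Sum>j\<le>m. norm (w j)) * C * (\<bar>PSjac bp bq bQ y\<bar> * W y)"
          by (simp add: sum_distrib_right[symmetric])
        finally show "norm (K (S n) y * of_real (PSjac bp bq bQ y)) \<le> (\<Sum>j\<le>m. norm (w j)) * C * (\<bar>PSjac bp bq bQ y\<bar> * W y)"
          by (simp add: norm_mult)
      qed
    qed
  qed simp
  have tj: "(\<integral>y. F 0 j y * jac 0 y \<partial>LM II) = (\<integral>y. integrand s A 0 (PS (Yv y) (Xv y - csc (of_real b * \<i>) s)) * jac (of_real b * \<nu> j - of_real b * \<i>) y \<partial>LM II)
      \<and> integrable (LM II) (\<lambda>y. integrand s A 0 (PS (Yv y) (Xv y - csc (of_real b * \<i>) s)) * jac (of_real b * \<nu> j - of_real b * \<i>) y)"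
    if j: "j \<le> m" for j
  proof -
    define u where "u = real j / (2 * (real m + 1)) * b"
    have bn: "of_real b * \<nu> j = of_real u + of_real b * \<i>" by (simp add: \<nu>_def u_def algebra_simps)
    let ?f = "\<lambda>y. F 0 j y * jac 0 y"
    have fi: "integrable (LM II) ?f" using Fint[OF _ j, of 0] by (simp add: of_real_PSjac)
    then have fm: "?f \<in> borel_measurable (LM II)" by auto
    \<comment> \<open>Translating X by u s, with u the real part of b \<open>\<nu> j\<close>, leaves
      the purely imaginary shift in the integrand and puts u into the Jacobian.\<close>
    have tf: "?f (\<lambda>k\<in>II. u * \<sigma> k + 1 * y k) = integrand s A 0 (PS (Yv y) (Xv y - csc (of_real b * \<i>) s)) * jac (of_real b * \<nu> j - of_real b * \<i>) y" for y
    proof -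
      let ?y = "\<lambda>k\<in>II. u * \<sigma> k + 1 * y k"
      have 1: "Yv ?y = Yv (\<lambda>k. y k + u * \<sigma> k)" by (rule Yv_cong) auto
      have 2: "Xv ?y = Xv (\<lambda>k. y k + u * \<sigma> k)" by (rule Xv_cong) auto
      have 3: "jac 0 ?y = jac 0 (\<lambda>k. y k + u * \<sigma> k)" by (rule jac_cong) auto
      show ?thesis
        unfolding F_def 1 2 3 Yv_shift Xv_shift jac_shift by (simp add: bn csc_add_left csc_of_real)
    qed
    have "(\<integral>y. ?f y \<partial>LM II) = (\<Prod>i\<in>II. \<bar>1::real\<bar>) *\<^sub>R (\<integral>y. ?f (\<lambda>k\<in>II. u * \<sigma> k + 1 * y k) \<partial>LM II)"
      by (rule integral_LM_affine[OF _ _ fm]) auto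
    moreover have "integrable (LM II) (\<lambda>y. ?f (\<lambda>k\<in>II. u * \<sigma> k + 1 * y k))"
      using fi by (subst integrable_LM_affine[OF _ _ fm]) auto
    ultimately show ?thesis unfolding tf by simp
  qed
  have "(\<integral>y. K 0 y * of_real (PSjac bp bq bQ y) \<partial>LM II) = (\<Sum>j\<le>m. w j * (\<integral>y. F 0 j y * jac 0 y \<partial>LM II))"
    unfolding Keq of_real_PSjac[symmetric]
    by (subst Bochner_Integration.integral_sum) (auto intro!: integrable_mult_right Fint)
  also have "\<dots> = (\<Sum>j\<le>m. w j * (\<integral>y. integrand s A 0 (PS (Yv y) (Xv y - csc (of_real b * \<i>) s)) * jac (of_real b * \<nu> j - of_real b * \<i>) y \<partial>LM II))"
    using tj by simp
  also have "\<dots> = (\<Sum>j\<le>m. \<integral>y. w j * (integrand s A 0 (PS (Yv y) (Xv y - csc (of_real b * \<i>) s)) * jac (of_real b * \<nu> j - of_real b * \<i>) y) \<partial>LM II)"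
    by simp
  also have "\<dots> = (\<integral>y. jac (- (of_real b * \<i>)) y * integrand s A 0 (PS (Yv y) (Xv y - csc (of_real b * \<i>) s)) \<partial>LM II)"
  proof -
    have "(\<Sum>j\<le>m. w j * (I * jac (of_real b * \<nu> j - of_real b * \<i>) y)) = jac (- (of_real b * \<i>)) y * I" for I y
    proof -
      obtain q where q: "degree q \<le> m" "\<And>z. poly q z = jac z y" using jac_poly[of y] by blast
      \<comment> \<open>The substitution z -> b z - i b gives the Jacobian at - i b for z = 0 and at
        the real translations for the nodes.\<close>
      let ?p = "pcompose q [:- (of_real b * \<i>), of_real b:]"
      have "poly ?p 0 = (\<Sum>j\<le>m. w j * poly ?p (\<nu> j))"
        by (rule w) (use q(1) in \<open>auto intro!: order_trans[OF degree_pcompose_le] simp: mult_le_cancel1\<close>)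
      then have "jac (- (of_real b * \<i>)) y = (\<Sum>j\<le>m. w j * jac (of_real b * \<nu> j - of_real b * \<i>) y)"
        by (simp add: poly_pcompose q(2) algebra_simps)
      then show ?thesis unfolding sum_distrib_right[symmetric]
        by (simp only: sum_distrib_right) (rule sum.cong, simp_all)
    qed
    then show ?thesis
      by (subst Bochner_Integration.integral_sum[symmetric]) (use tj in \<open>auto intro!: integrable_mult_right\<close>)
  qed
  finally have K0: "(\<integral>y. K 0 y * of_real (PSjac bp bq bQ y) \<partial>LM II)
      = (\<integral>y. jac (- (of_real b * \<i>)) y * integrand s A 0 (PS (Yv y) (Xv y - csc (of_real b * \<i>) s)) \<partial>LM II)" .
  show ?thesis
    using lim unfolding K0
    by (rule Lim_transform_eventually) (auto simp: eq eventually_at_right_less intro!: eventually_mono[OF eventually_at_right_less])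
qed

end

subsection \<open>Independence of the source matrix\<close>

text \<open>Differentiation under the integral sign along sequences: the signed difference quotient
  minus the derivative tends to zero pointwise and is bounded by 2 w through the mean value
  inequality.\<close>

lemma integral_eq_of_zero_derivative:
  fixes f f' :: "real \<Rightarrow> 'x \<Rightarrow> complex"
  assumes f: "\<And>t. t \<in> {0..1} \<Longrightarrow> integrable M (f t)"
    and d: "\<And>t y. t \<in> {0..1} \<Longrightarrow> ((\<lambda>t. f t y) has_vector_derivative f' t y) (at t within {0..1})"
    and w: "integrable M w" and b: "\<And>t y. t \<in> {0..1} \<Longrightarrow> norm (f' t y) \<le> w y"
    and m: "\<And>t. t \<in> {0..1} \<Longrightarrow> f' t \<in> borel_measurable M"
    and z: "\<And>t. t \<in> {0..1} \<Longrightarrow> (\<integral>y. f' t y \<partial>M) = 0"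
  shows "(\<integral>y. f 1 y \<partial>M) = (\<integral>y. f 0 y \<partial>M)"
proof -
  define h where "h t = (\<integral>y. f t y \<partial>M)" for t
  have "(h has_derivative (\<lambda>_. 0)) (at t within {0..1})" if t: "t \<in> {0..1}" for t
    unfolding has_derivative_within
  proof (intro conjI)
    show "((\<lambda>u. (1 / norm (u - t)) *\<^sub>R (h u - (h t + 0))) \<longlongrightarrow> 0) (at t within {0..1})"
      unfolding tendsto_at_iff_sequentially
    proof (intro allI impI)
      fix X :: "nat \<Rightarrow> real" assume X: "\<forall>i. X i \<in> {0..1} - {t}" "X \<longlonglongrightarrow> t"
      define g where "g n y = (1 / norm (X n - t)) *\<^sub>R (f (X n) y - f t y) - sgn (X n - t) *\<^sub>R f' t y" for n y
      have gi: "(\<lambda>n. \<integral>y. g n y \<partial>M) \<longlonglongrightarrow> (\<integral>y. 0 \<partial>M)"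
      proof (rule integral_dominated_convergence[where w = "\<lambda>y. 2 * w y"])
        show "g n \<in> borel_measurable M" for n
          unfolding g_def[abs_def] using f[of "X n"] f[OF t] m[OF t] X(1) by auto
        show "integrable M (\<lambda>y. 2 * w y)" using w by simp
        show "AE y in M. (\<lambda>n. g n y) \<longlonglongrightarrow> 0"
        proof (intro AE_I2)
          fix y
          have "((\<lambda>u. (1 / norm (u - t)) *\<^sub>R (f u y - (f t y + (u - t) *\<^sub>R f' t y))) \<longlongrightarrow> 0) (at t within {0..1})"
            using d[OF t, of y] unfolding has_vector_derivative_def has_derivative_within by blast
          then have "(\<lambda>n. (1 / norm (X n - t)) *\<^sub>R (f (X n) y - (f t y + (X n - t) *\<^sub>R f' t y))) \<longlonglongrightarrow> 0"
            unfolding tendsto_at_iff_sequentially using X by (auto simp: o_def)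
          moreover have "(1 / norm (X n - t)) *\<^sub>R (f (X n) y - (f t y + (X n - t) *\<^sub>R f' t y)) = g n y" for n
            unfolding g_def by (simp add: scaleR_diff_right scaleR_add_right sgn_div_norm divide_inverse mult.commute)
          ultimately show "(\<lambda>n. g n y) \<longlonglongrightarrow> 0" by simp
        qed
        show "AE y in M. norm (g n y) \<le> 2 * w y" for n
        proof (intro AE_I2)
          fix y
          have Xn: "X n \<in> {0..1}" "X n \<noteq> t" using X(1) by auto
          have "norm (f (X n) y - f t y) \<le> w y * norm (X n - t)"
          proof (rule differentiable_bound[where S = "{0..1}" and f' = "\<lambda>t h. h *\<^sub>R f' t y"])
            show "((\<lambda>t. f t y) has_derivative (\<lambda>h. h *\<^sub>R f' u y)) (at u within {0..1})" if "u \<in> {0..1}" for u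
              using d[OF that, of y] by (simp add: has_vector_derivative_def)
            show "onorm (\<lambda>h. h *\<^sub>R f' u y) \<le> w y" if "u \<in> {0..1}" for u
              by (rule onorm_le) (use mult_left_mono[OF b[OF that, of y], of "\<bar>_\<bar>"] in \<open>simp add: mult.commute\<close>)
          qed (use t Xn in auto)
          then have "norm ((1 / norm (X n - t)) *\<^sub>R (f (X n) y - f t y)) \<le> w y"
            unfolding norm_scaleR using Xn by (simp add: field_simps)
          moreover have "norm (sgn (X n - t) *\<^sub>R f' t y) \<le> w y"
            using b[OF t, of y] Xn by (simp add: abs_sgn_eq)
          ultimately show "norm (g n y) \<le> 2 * w y"
            unfolding g_def using norm_triangle_ineq4[of "(1 / norm (X n - t)) *\<^sub>R (f (X n) y - f t y)" "sgn (X n - t) *\<^sub>R f' t y"] by linarith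
        qed
      qed simp
      have f'i: "integrable M (f' t)"
        by (rule Bochner_Integration.integrable_bound[OF w m[OF t]]) (use b[OF t] in \<open>auto intro!: AE_I2 order_trans[OF _ abs_ge_self]\<close>)
      have "(\<integral>y. g n y \<partial>M) = (1 / norm (X n - t)) *\<^sub>R (h (X n) - (h t + 0))" for n
        unfolding g_def h_def using f[of "X n"] f[OF t] f'i X(1) z[OF t] by simp
      then show "((\<lambda>u. (1 / norm (u - t)) *\<^sub>R (h u - (h t + 0))) \<circ> X) \<longlonglongrightarrow> 0"
        using gi by (simp add: o_def)
    qed
  qed simp
  then have "\<exists>c. \<forall>t\<in>{0..1}. h t = c"
    by (intro has_derivative_zero_constant) auto
  then show ?thesis unfolding h_def by auto
qed

context ps_bases
begin

text \<open>Entries of the matrix whose determinant is \<open>jac\<close>; \<open>M2z\<close> holds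
  their partial derivatives, that is, the second derivatives of the shifted map in the coordinates
  of \<open>bQ\<close>.\<close>

definition Mz :: "complex \<Rightarrow> nat \<Rightarrow> nat \<Rightarrow> (nat \<Rightarrow> real) \<Rightarrow> complex" where
  "Mz z i k y = of_real (co i (D k y (Xv y))) + z * of_real (co i (E k y))"

definition M2z :: "complex \<Rightarrow> nat \<Rightarrow> nat \<Rightarrow> nat \<Rightarrow> (nat \<Rightarrow> real) \<Rightarrow> complex" where
  "M2z z i k l y = of_real (co i (DD k l y (Xv y))) + z * of_real (co i (DD k l y (Xv y + s) - DD k l y (Xv y)))"

definition Fm :: "complex \<Rightarrow> (nat \<Rightarrow> real) \<Rightarrow> complex^'n^'n" where
  "Fm z y = PS (Yv y) (Xv y + csc z s)"

definition Gz :: "complex^'n^'n \<Rightarrow> complex \<Rightarrow> (nat \<Rightarrow> real) \<Rightarrow> complex" where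
  "Gz A z y = exp (- mtrace (Fm z y ** Fm z y) - 2 * \<i> * mtrace (Fm z y ** A))"

text \<open>Derivative of exp (- Tr Q^2 - 2 i Tr (Q A)) in the direction of the l-th basis vector of
  \<open>Q\<close>, evaluated at the shifted point.\<close>

definition av :: "complex^'n^'n \<Rightarrow> complex \<Rightarrow> nat \<Rightarrow> (nat \<Rightarrow> real) \<Rightarrow> complex" where
  "av A z l y = - 2 * Gz A z y * mtrace ((Fm z y + csc \<i> A) ** bQ ! l)"

lemma jac_Mz: "jac z y = gdet m (\<lambda>i j. Mz z i j y)"
  by (simp add: jac_def Mz_def)

lemma Gz_integrand: "Gz A z y = integrand s A 0 (PS (Yv y) (Xv y + csc z s))"
  by (simp add: Gz_def Fm_def integrand_eq)

lemma M2z_commute: "M2z z i k l y = M2z z i l k y"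
  by (simp add: M2z_def DD_commute[of k l])

lemma bounded_linear_co: "bounded_linear (co i)"
  using co_linear by (simp add: linear_conv_bounded_linear)

lemma Mz_partial:
  assumes k: "k < m" and l: "l < m"
  shows "((\<lambda>t. Mz z i k (y(l := t))) has_vector_derivative M2z z i k l y) (at (y l))"
proof -
  have E: "E k y = D k y (Xv y + s) - D k y (Xv y)" for y
    using D_add_s[of k y "Xv y" 1] by simp
  have d0: "((\<lambda>t. D k (y(l := t)) (Xv (y(l := t)))) has_vector_derivative DD k l y (Xv y)) (at (y l))"
    using D_partial[OF l k, of y 0] by simp
  have ds: "((\<lambda>t. D k (y(l := t)) (Xv (y(l := t)) + s)) has_vector_derivative DD k l y (Xv y + s)) (at (y l))"
    by (rule D_partial[OF l k])
  show ?thesis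
    unfolding Mz_def M2z_def E
    by (intro has_vector_derivative_add has_vector_derivative_mult_right
      bounded_linear.has_vector_derivative[OF bounded_linear_compose[OF bounded_linear_of_real bounded_linear_co]]
      d0 ds has_vector_derivative_diff)
qed

text \<open>The shifted frame stays in the complex span of the real basis \<open>bQ\<close>.\<close>

lemma frame_expansion:
  assumes k: "k < m"
  shows "D k y (Xv y + csc z s) = (\<Sum>i<m. csc (Mz z i k y) (bQ ! i))"
proof -
  have "D k y (Xv y + csc z s) = D k y (Xv y) + csc z (E k y)" by (rule D_add_csc)
  also have "D k y (Xv y) = (\<Sum>i<m. co i (D k y (Xv y)) *\<^sub>R bQ ! i)" by (rule co_repr[OF D_Q[OF k Xv_Q]])
  also have "E k y = (\<Sum>i<m. co i (E k y) *\<^sub>R bQ ! i)" by (rule co_repr[OF E_Q[OF k]])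
  finally show ?thesis
    by (simp add: csc.sum_right sum.distrib[symmetric] Mz_def csc_add_left csc_of_real csc_csc[symmetric])
qed

lemma Fm_partial:
  assumes k: "k < m"
  shows "((\<lambda>t. Fm z (y(k := t))) has_vector_derivative D k y (Xv y + csc z s)) (at (y k))"
  unfolding Fm_def by (rule PS_partial[OF k])

text \<open>Chain rule through the target space: the gradient \<open>av\<close> applied to column k
  of the Jacobian matrix.\<close>

lemma Gz_partial:
  assumes k: "k < m"
  shows "((\<lambda>t. Gz A z (y(k := t))) has_vector_derivative (\<Sum>l<m. av A z l y * Mz z l k y)) (at (y k))"
proof -
  let ?D = "D k y (Xv y + csc z s)" and ?F = "\<lambda>t. Fm z (y(k := t))"
  note tr = bounded_linear.has_vector_derivative[OF bounded_linear_mtrace]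
  have F: "(?F has_vector_derivative ?D) (at (y k))" by (rule Fm_partial[OF k])
  have "((\<lambda>t. mtrace (?F t ** ?F t)) has_vector_derivative mtrace (?F (y k) ** ?D + ?D ** ?F (y k))) (at (y k))"
    by (intro tr mm.has_vector_derivative F)
  then have 1: "((\<lambda>t. mtrace (?F t ** ?F t)) has_vector_derivative 2 * mtrace (Fm z y ** ?D)) (at (y k))"
    by (simp add: mtrace_add mtrace_commute[of ?D])
  have "((\<lambda>t. mtrace (?F t ** A)) has_vector_derivative mtrace (?F (y k) ** 0 + ?D ** A)) (at (y k))"
    by (intro tr mm.has_vector_derivative F has_vector_derivative_const)
  then have 2: "((\<lambda>t. mtrace (?F t ** A)) has_vector_derivative mtrace (A ** ?D)) (at (y k))"
    by (simp add: mm_simps mtrace_commute[of A])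
  have 3: "((\<lambda>t. - mtrace (?F t ** ?F t) - 2 * \<i> * mtrace (?F t ** A)) has_vector_derivative
      (- (2 * mtrace (Fm z y ** ?D)) - 2 * \<i> * mtrace (A ** ?D))) (at (y k))"
    by (intro has_vector_derivative_diff has_vector_derivative_minus 1 has_vector_derivative_mult_right 2)
  have "((\<lambda>t. Gz A z (y(k := t))) has_derivative (\<lambda>h. (h *\<^sub>R (- (2 * mtrace (Fm z y ** ?D)) - 2 * \<i> * mtrace (A ** ?D))) * Gz A z y)) (at (y k))"
    unfolding Gz_def
    using has_derivative_compose[OF 3[unfolded has_vector_derivative_def] DERIV_exp[unfolded has_field_derivative_def]] by (simp add: mult.commute)
  then have "((\<lambda>t. Gz A z (y(k := t))) has_vector_derivative (- (2 * mtrace (Fm z y ** ?D)) - 2 * \<i> * mtrace (A ** ?D)) * Gz A z y) (at (y k))"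
    by (simp add: has_vector_derivative_def)
  moreover have "(- (2 * mtrace (Fm z y ** ?D)) - 2 * \<i> * mtrace (A ** ?D)) * Gz A z y = (\<Sum>l<m. av A z l y * Mz z l k y)"
  proof -
    have "(- (2 * mtrace (Fm z y ** ?D)) - 2 * \<i> * mtrace (A ** ?D)) * Gz A z y = - 2 * Gz A z y * mtrace ((Fm z y + csc \<i> A) ** ?D)"
      by (simp add: mm.add_left csc_simps mtrace_add mtrace_csc algebra_simps)
    also have "mtrace ((Fm z y + csc \<i> A) ** ?D) = (\<Sum>l<m. Mz z l k y * mtrace ((Fm z y + csc \<i> A) ** bQ ! l))"
      unfolding frame_expansion[OF k] by (simp add: mm.sum_right mtrace_sum csc_mult_right mtrace_csc)
    finally show ?thesis by (simp add: av_def sum_distrib_left mult_ac)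
  qed
  ultimately show ?thesis by simp
qed

text \<open>One growth function for the entries, their derivatives and the map itself. As it is at
  least 1, different powers can be raised to a common one.\<close>

definition \<Gamma> :: "(nat \<Rightarrow> real) \<Rightarrow> real" where "\<Gamma> y = exp (4 * norm (Yv y)) * (1 + norm (Xv y))"

lemma \<Gamma>_ge1: "1 \<le> \<Gamma> y"
proof -
  have "1 * 1 \<le> exp (4 * norm (Yv y)) * (1 + norm (Xv y))" by (intro mult_mono) auto
  then show ?thesis by (simp add: \<Gamma>_def)
qed

text \<open>The rate \<open>a\<close> is fixed before the power \<open>N\<close>. Half of each
  Gaussian is kept for the coordinates, and the other half absorbs the N-th power of
  \<open>\<Gamma>\<close>.\<close>

lemma gaussian_dominates:
  assumes b: "0 < b"
  obtains a where "a > 0" "\<And>N. \<exists>C>0. \<forall>y. \<Gamma> y ^ N * exp (- (norm (Xv y))\<^sup>2 / 2 - b * (norm (Yv y))\<^sup>2) \<le> C * exp (- (a * sqsum II y))"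
proof -
  obtain a1 where a1: "a1 > 0" "\<And>y. a1 * sqsum IJ y \<le> (norm (Xv y))\<^sup>2" using Xv_norm_ge by blast
  obtain a2 where a2: "a2 > 0" "\<And>y. a2 * sqsum {..<dp} y \<le> (norm (Yv y))\<^sup>2" using Yv_norm_ge by blast
  define a where "a = min (a1 / 4) (b * a2 / 2)"
  have a: "a > 0" using a1 a2 b by (simp add: a_def)
  have sq: "sqsum II y = sqsum {..<dp} y + sqsum IJ y" for y
  proof -
    have "II = {..<dp} \<union> IJ" by auto
    then show ?thesis unfolding sqsum_def by (simp add: sum.union_disjoint[symmetric] ivl_disj_int)
  qed
  show ?thesis
  proof (rule that[OF a])
    fix N
    obtain C1 :: real where C1: "C1 > 0" "\<And>x. 0 \<le> x \<Longrightarrow> (1 + x) ^ N * exp (- (1/4 * x\<^sup>2)) \<le> C1"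
      using power_le_exp_sq[of "1/4" N] by auto
    define C2 where "C2 = exp (8 * (real N)\<^sup>2 / b)"
    have "\<Gamma> y ^ N * exp (- (norm (Xv y))\<^sup>2 / 2 - b * (norm (Yv y))\<^sup>2) \<le> (C1 * C2) * exp (- (a * sqsum II y))" for y
    proof -
      define X Y where "X = norm (Xv y)" and "Y = norm (Yv y)"
      have X0: "0 \<le> X" by (simp add: X_def)
      have "4 * real N * Y \<le> 8 * (real N)\<^sup>2 / b + b / 2 * Y\<^sup>2"
      proof -
        have "0 \<le> (4 * real N - b * Y)\<^sup>2 / (2 * b)" using b by simp
        also have "\<dots> = 8 * (real N)\<^sup>2 / b + b / 2 * Y\<^sup>2 - 4 * real N * Y"
          using b by (simp add: power2_diff power_mult_distrib field_simps power2_eq_square)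
        finally show ?thesis by simp
      qed
      then have e1: "exp (4 * real N * Y) * exp (- (b / 2 * Y\<^sup>2)) \<le> C2"
        unfolding C2_def exp_add[symmetric] by simp
      have "a * sqsum II y \<le> X\<^sup>2 / 4 + b / 2 * Y\<^sup>2"
      proof -
        have "a * sqsum IJ y \<le> a1 / 4 * sqsum IJ y" by (intro mult_right_mono) (auto simp: a_def)
        also have "\<dots> \<le> X\<^sup>2 / 4" using a1(2)[of y] by (simp add: X_def)
        finally have 1: "a * sqsum IJ y \<le> X\<^sup>2 / 4" .
        have "a * sqsum {..<dp} y \<le> b * a2 / 2 * sqsum {..<dp} y" by (intro mult_right_mono) (auto simp: a_def)
        also have "\<dots> \<le> b / 2 * Y\<^sup>2" using mult_left_mono[OF a2(2)[of y], of "b / 2"] b by (simp add: Y_def mult_ac)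
        finally show ?thesis using 1 by (simp add: sq distrib_left)
      qed
      then have e2: "exp (- (X\<^sup>2 / 4)) * exp (- (b / 2 * Y\<^sup>2)) \<le> exp (- (a * sqsum II y))"
        unfolding exp_add[symmetric] by simp
      have ge: "\<Gamma> y ^ N = exp (4 * real N * Y) * (1 + X) ^ N"
        by (simp add: \<Gamma>_def X_def Y_def power_mult_distrib exp_of_nat_mult[symmetric] mult_ac)
      have ee: "exp (- X\<^sup>2 / 2 - b * Y\<^sup>2) = exp (- (1/4 * X\<^sup>2)) * exp (- (X\<^sup>2 / 4)) * (exp (- (b / 2 * Y\<^sup>2)) * exp (- (b / 2 * Y\<^sup>2)))"
        unfolding exp_add[symmetric] by (rule arg_cong[of _ _ exp]) (simp add: field_simps)
      have "\<Gamma> y ^ N * exp (- X\<^sup>2 / 2 - b * Y\<^sup>2) = ((1 + X) ^ N * exp (- (1/4 * X\<^sup>2))) * (exp (4 * real N * Y) * exp (- (b / 2 * Y\<^sup>2))) * (exp (- (X\<^sup>2 / 4)) * exp (- (b / 2 * Y\<^sup>2)))"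
        unfolding ge ee by simp
      also have "\<dots> \<le> C1 * C2 * exp (- (a * sqsum II y))"
        using C1(1) C1(2)[OF X0] X0 by (intro mult_mono e1 e2 mult_nonneg_nonneg) (auto simp: C2_def)
      finally show ?thesis by (simp add: X_def Y_def)
    qed
    then show "\<exists>C>0. \<forall>y. \<Gamma> y ^ N * exp (- (norm (Xv y))\<^sup>2 / 2 - b * (norm (Yv y))\<^sup>2) \<le> C * exp (- (a * sqsum II y))"
      using C1(1) by (intro exI[of _ "C1 * C2"]) (auto simp: C2_def)
  qed
qed

lemma entries_bound:
  obtains C where "C > 0" "\<And>i k y. i < m \<Longrightarrow> k < m \<Longrightarrow> norm (Mz z i k y) \<le> C * \<Gamma> y"
    "\<And>i k l y. i < m \<Longrightarrow> k < m \<Longrightarrow> l < m \<Longrightarrow> norm (M2z z i k l y) \<le> C * \<Gamma> y"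
    "\<And>y. norm (Fm z y) \<le> C * \<Gamma> y"
proof -
  obtain C where C: "C > 0"
    "\<And>j y X. j < m \<Longrightarrow> norm (D j y X) \<le> C * exp (4 * norm (Yv y)) * (1 + norm X)"
    "\<And>j y. j < m \<Longrightarrow> norm (E j y) \<le> C * exp (4 * norm (Yv y))"
    "\<And>j k y X. j < m \<Longrightarrow> k < m \<Longrightarrow> norm (DD j k y X) \<le> C * exp (4 * norm (Yv y)) * (1 + norm X)"
    "\<And>Y X :: complex^'n^'n. norm (PS Y X) \<le> C * exp (4 * norm Y) * norm X"
    using frame_bounds by blast
  obtain K where K: "K > 0" "\<And>i v. i < length bQ \<Longrightarrow> \<bar>co i v\<bar> \<le> K * norm v"
    using dual_norm_bound[OF bQ] by blast
  define S where "S = 1 + norm s"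
  define C' where "C' = (1 + K) * C * (S * (2 + 2 * norm z))"
  have S1: "1 \<le> S" by (simp add: S_def)
  have KC: "0 < K * C" using K(1) C(1) by simp
  have g1: "C * exp (4 * norm (Yv y)) * (1 + norm (Xv y)) = C * \<Gamma> y" for y by (simp add: \<Gamma>_def)
  have g2: "C * exp (4 * norm (Yv y)) \<le> C * \<Gamma> y" for y
    using C(1) by (simp add: \<Gamma>_def)
  have g3: "C * exp (4 * norm (Yv y)) * (1 + norm (Xv y + s)) \<le> S * (C * \<Gamma> y)" for y
  proof -
    have "1 + norm (Xv y + s) \<le> S * (1 + norm (Xv y))"
      using norm_triangle_ineq[of "Xv y" s] by (simp add: S_def algebra_simps) (smt (verit) mult_nonneg_nonneg norm_ge_zero)
    then have "C * exp (4 * norm (Yv y)) * (1 + norm (Xv y + s)) \<le> C * exp (4 * norm (Yv y)) * (S * (1 + norm (Xv y)))"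
      using C(1) by (intro mult_left_mono) auto
    then show ?thesis by (simp add: \<Gamma>_def mult_ac)
  qed
  have fin: "K * (u * (C * \<Gamma> y)) \<le> C' * \<Gamma> y" if "0 \<le> u" "u \<le> S * (2 + 2 * norm z)" for u y
  proof -
    have "K * (u * (C * \<Gamma> y)) \<le> (1 + K) * ((S * (2 + 2 * norm z)) * (C * \<Gamma> y))"
      using that C(1) K(1) \<Gamma>_ge1[of y] S1 by (intro mult_mono mult_nonneg_nonneg) auto
    then show ?thesis by (simp add: C'_def mult_ac)
  qed
  have C'0: "C' > 0" using C(1) K(1) S1 by (simp add: C'_def add_pos_nonneg)
  show ?thesis
  proof (rule that[OF C'0])
    fix i k y assume i: "i < m" and k: "k < m"
    have "\<bar>co i (D k y (Xv y))\<bar> \<le> K * (C * \<Gamma> y)"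
      by (rule order_trans[OF K(2) mult_left_mono]) (use C(2)[OF k, of y "Xv y"] K(1) i dim_Q in \<open>auto simp: g1\<close>)
    moreover have "\<bar>co i (E k y)\<bar> \<le> K * (C * \<Gamma> y)"
      by (rule order_trans[OF K(2) mult_left_mono]) (use order_trans[OF C(3)[OF k, of y] g2] K(1) i dim_Q in auto)
    moreover have "norm (Mz z i k y) \<le> \<bar>co i (D k y (Xv y))\<bar> + norm z * \<bar>co i (E k y)\<bar>"
      unfolding Mz_def by (rule order_trans[OF norm_triangle_ineq]) (simp add: norm_mult)
    ultimately have "norm (Mz z i k y) \<le> K * (C * \<Gamma> y) + norm z * (K * (C * \<Gamma> y))"
      by (smt (verit) mult_left_mono norm_ge_zero)
    also have "\<dots> = K * ((1 + norm z) * (C * \<Gamma> y))" by (simp add: algebra_simps)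
    also have "\<dots> \<le> C' * \<Gamma> y"
    proof (rule fin)
      have "1 * (1 + norm z) \<le> S * (2 + 2 * norm z)" using S1 by (intro mult_mono) auto
      then show "1 + norm z \<le> S * (2 + 2 * norm z)" by simp
    qed simp
    finally show "norm (Mz z i k y) \<le> C' * \<Gamma> y" .
  next
    fix i k l y assume i: "i < m" and k: "k < m" and l: "l < m"
    have d1: "norm (DD k l y (Xv y)) \<le> C * \<Gamma> y" using C(4)[OF k l, of y "Xv y"] by (simp add: g1)
    have d2: "norm (DD k l y (Xv y + s)) \<le> S * (C * \<Gamma> y)" by (rule order_trans[OF C(4)[OF k l] g3])
    have c1: "\<bar>co i (DD k l y (Xv y))\<bar> \<le> K * (C * \<Gamma> y)"
      by (rule order_trans[OF K(2) mult_left_mono]) (use d1 K(1) i dim_Q in auto)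
    have "norm (DD k l y (Xv y + s) - DD k l y (Xv y)) \<le> S * (C * \<Gamma> y) + C * \<Gamma> y"
      by (rule order_trans[OF norm_triangle_ineq4 add_mono[OF d2 d1]])
    then have c2: "\<bar>co i (DD k l y (Xv y + s) - DD k l y (Xv y))\<bar> \<le> K * (S * (C * \<Gamma> y) + C * \<Gamma> y)"
      by (intro order_trans[OF K(2) mult_left_mono]) (use K(1) i dim_Q in auto)
    have "norm (M2z z i k l y) \<le> \<bar>co i (DD k l y (Xv y))\<bar> + norm z * \<bar>co i (DD k l y (Xv y + s) - DD k l y (Xv y))\<bar>"
      unfolding M2z_def by (rule order_trans[OF norm_triangle_ineq]) (simp add: norm_mult)
    also have "\<dots> \<le> K * (C * \<Gamma> y) + norm z * (K * (S * (C * \<Gamma> y) + C * \<Gamma> y))"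
      by (intro add_mono c1 mult_left_mono[OF c2]) auto
    also have "\<dots> = K * ((1 + norm z * (S + 1)) * (C * \<Gamma> y))" by (simp add: algebra_simps)
    also have "\<dots> \<le> C' * \<Gamma> y"
    proof (rule fin)
      have "norm z * (S + 1) \<le> norm z * (2 * S)" using S1 by (intro mult_left_mono) auto
      then show "1 + norm z * (S + 1) \<le> S * (2 + 2 * norm z)" using S1 by (simp add: algebra_simps)
    qed (use S1 in auto)
    finally show "norm (M2z z i k l y) \<le> C' * \<Gamma> y" .
  next
    fix y
    have "norm (Fm z y) \<le> C * exp (4 * norm (Yv y)) * norm (Xv y + csc z s)" unfolding Fm_def by (rule C(5))
    also have "\<dots> \<le> C * exp (4 * norm (Yv y)) * ((S * (2 + 2 * norm z)) * (1 + norm (Xv y)))"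
    proof (intro mult_left_mono)
      have "norm (Xv y + csc z s) \<le> norm (Xv y) + norm z * norm s"
        using norm_triangle_ineq[of "Xv y" "csc z s"] by (simp add: norm_csc)
      also have "\<dots> \<le> (S * (2 + 2 * norm z)) * 1 * norm (Xv y) + (S * (2 + 2 * norm z))"
      proof (intro add_mono)
        have "1 * 1 \<le> S * (2 + 2 * norm z)" using S1 by (intro mult_mono) auto
        then show "norm (Xv y) \<le> S * (2 + 2 * norm z) * 1 * norm (Xv y)" by (simp add: mult_le_cancel_right1)
        have "norm s * norm z \<le> S * (2 + 2 * norm z)" by (intro mult_mono) (auto simp: S_def)
        then show "norm z * norm s \<le> S * (2 + 2 * norm z)" by (simp add: mult.commute)
      qed
      finally show "norm (Xv y + csc z s) \<le> (S * (2 + 2 * norm z)) * (1 + norm (Xv y))" by (simp add: algebra_simps)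
    qed (use C(1) in auto)
    also have "\<dots> = 1 * ((S * (2 + 2 * norm z)) * (C * \<Gamma> y))" by (simp add: \<Gamma>_def)
    also have "\<dots> \<le> (1 + K) * ((S * (2 + 2 * norm z)) * (C * \<Gamma> y))"
      using C(1) K(1) \<Gamma>_ge1[of y] S1 by (intro mult_right_mono mult_nonneg_nonneg) auto
    also have "\<dots> = C' * \<Gamma> y" by (simp add: C'_def)
    finally show "norm (Fm z y) \<le> C' * \<Gamma> y" .
  qed
qed

text \<open>The case \<epsilon> = 0 and x = 0 of the uniform bound: the rate is then |e^Y|^2 itself,
  and \<open>tau_ge\<close> makes it Gaussian in \<open>Y\<close>.\<close>

lemma Gz_bound:
  assumes A: "A \<in> Q" and l: "pos_bound A l" and b: "0 < b" "b \<le> l"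
  shows "norm (Gz A (- (of_real b * \<i>)) y) \<le> exp (- (norm (Xv y))\<^sup>2 / 2 - b\<^sup>2 * (norm (Yv y))\<^sup>2)"
proof -
  have e: "Xv y + csc (- (of_real b * \<i>)) s = Xv y - csc (Complex (0 * b) b) s"
    by (simp add: csc_minus_left) (simp add: Complex_eq mult.commute)
  have "norm (Gz A (- (of_real b * \<i>)) y) \<le> exp (- (norm (Xv y))\<^sup>2 / 2 - 0 / 2 * (norm (mpart (PS (Yv y) (Xv y))))\<^sup>2
        - b\<^sup>2 / 2 * ((norm (mexp (Yv y)))\<^sup>2 / (1 + 0 * (norm (mexp (Yv y)))\<^sup>2)))"
    unfolding Gz_integrand e by (rule norm_integrand_shift_le_uniform[OF Yv_p Xv_Qp A _ l b]) auto
  also have "\<dots> \<le> exp (- (norm (Xv y))\<^sup>2 / 2 - b\<^sup>2 * (norm (Yv y))\<^sup>2)"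
  proof -
    have "2 * (norm (Yv y))\<^sup>2 \<le> (norm (mexp (Yv y)))\<^sup>2" using tau_ge[OF Yv_p, of y] by (smt (verit) of_nat_0_le_iff)
    then have "b\<^sup>2 / 2 * (2 * (norm (Yv y))\<^sup>2) \<le> b\<^sup>2 / 2 * (norm (mexp (Yv y)))\<^sup>2" by (intro mult_left_mono) auto
    then show ?thesis by simp
  qed
  finally show ?thesis .
qed

lemma mtrace_measurable: "f \<in> borel_measurable M \<Longrightarrow> (\<lambda>x. mtrace (f x)) \<in> borel_measurable M"
  by (rule borel_measurable_continuous_on[OF linear_continuous_on[OF bounded_linear_mtrace]])

lemma Fm_measurable: "Fm z \<in> borel_measurable (LM II)"
  unfolding Fm_def[abs_def] by (intro measurable_PS borel_measurable_add Yv_measurable Xv_measurable borel_measurable_const)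

lemma Gz_measurable: "Gz A z \<in> borel_measurable (LM II)"
  unfolding Gz_integrand[abs_def] by (intro measurable_integrand measurable_PS borel_measurable_add Yv_measurable Xv_measurable borel_measurable_const)

lemma av_measurable: "av A z l \<in> borel_measurable (LM II)"
  unfolding av_def[abs_def]
  by (intro borel_measurable_times borel_measurable_const Gz_measurable mtrace_measurable measurable_matrix_mult borel_measurable_add Fm_measurable)

lemma Mz_measurable: "Mz z i k \<in> borel_measurable (LM II)"
  unfolding Mz_def[abs_def]
  by (intro borel_measurable_add borel_measurable_times borel_measurable_const of_real_measurable co_measurable D_measurable Xv_measurable E_measurable)

lemma M2z_measurable: "M2z z i k l \<in> borel_measurable (LM II)"
  unfolding M2z_def[abs_def]
  by (intro borel_measurable_add borel_measurable_diff borel_measurable_times borel_measurable_const of_real_measurable co_measurable DD_measurable Xv_measurable)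

lemma av_bound:
  obtains C where "C > 0" "\<And>l y. l < m \<Longrightarrow> norm (av A z l y) \<le> C * \<Gamma> y * norm (Gz A z y)"
proof -
  obtain C where C: "C > 0" "\<And>y. norm (Fm z y) \<le> C * \<Gamma> y" using entries_bound by metis
  define B where "B = (\<Sum>l<m. norm (bQ ! l))"
  have B0: "0 \<le> B" by (simp add: B_def sum_nonneg)
  have Bl: "norm (bQ ! l) \<le> B" if "l < m" for l unfolding B_def using that by (intro member_le_sum) auto
  have "norm (av A z l y) \<le> (2 * (C + norm A) * B + 1) * \<Gamma> y * norm (Gz A z y)" if l: "l < m" for l y
  proof -
    have "norm (mtrace ((Fm z y + csc \<i> A) ** bQ ! l)) \<le> norm (Fm z y + csc \<i> A) * norm (bQ ! l)"
      by (rule norm_mtrace_mult_le)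
    also have "\<dots> \<le> (C * \<Gamma> y + norm A * \<Gamma> y) * B"
    proof (intro mult_mono Bl l)
      have "norm (Fm z y + csc \<i> A) \<le> norm (Fm z y) + norm A" using norm_triangle_ineq[of "Fm z y" "csc \<i> A"] by (simp add: norm_csc)
      also have "\<dots> \<le> C * \<Gamma> y + norm A * \<Gamma> y" using \<Gamma>_ge1[of y] by (intro add_mono C) (simp add: mult_le_cancel_left1)
      finally show "norm (Fm z y + csc \<i> A) \<le> C * \<Gamma> y + norm A * \<Gamma> y" .
    qed (use C(1) \<Gamma>_ge1[of y] in \<open>auto intro!: add_nonneg_nonneg mult_nonneg_nonneg\<close>)
    finally have "2 * norm (Gz A z y) * norm (mtrace ((Fm z y + csc \<i> A) ** bQ ! l)) \<le> 2 * norm (Gz A z y) * ((C * \<Gamma> y + norm A * \<Gamma> y) * B)"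
      by (intro mult_left_mono) auto
    also have "\<dots> = (2 * (C + norm A) * B) * \<Gamma> y * norm (Gz A z y)" by (simp add: algebra_simps)
    also have "\<dots> \<le> (2 * (C + norm A) * B + 1) * \<Gamma> y * norm (Gz A z y)"
      using \<Gamma>_ge1[of y] by (intro mult_right_mono) auto
    finally show ?thesis by (simp add: av_def norm_mult)
  qed
  then show ?thesis using that[of "2 * (C + norm A) * B + 1"] C(1) B0 by (simp add: add_nonneg_pos)
qed

text \<open>The divergence structure of the Jacobian minors makes all second derivatives cancel in pairs.\<close>

lemma stokes:
  assumes A: "A \<in> Q" and l: "pos_bound A l" and b: "0 < b" "b \<le> l" and z: "z = - (of_real b * \<i>)" and r: "r < m"
  shows "(\<integral>y. av A z r y * jac z y \<partial>LM II) = 0" and "integrable (LM II) (\<lambda>y. av A z r y * jac z y)"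
proof -
  obtain C1 where C1: "C1 > 0" "\<And>i k y. i < m \<Longrightarrow> k < m \<Longrightarrow> norm (Mz z i k y) \<le> C1 * \<Gamma> y"
    "\<And>i k l y. i < m \<Longrightarrow> k < m \<Longrightarrow> l < m \<Longrightarrow> norm (M2z z i k l y) \<le> C1 * \<Gamma> y"
    using entries_bound by metis
  obtain C2 where C2: "C2 > 0" "\<And>l y. l < m \<Longrightarrow> norm (av A z l y) \<le> C2 * \<Gamma> y * norm (Gz A z y)"
    using av_bound by metis
  have b2: "0 < b\<^sup>2" using b by simp
  obtain a where a: "a > 0" "\<And>N. \<exists>C>0. \<forall>y. \<Gamma> y ^ N * exp (- (norm (Xv y))\<^sup>2 / 2 - b\<^sup>2 * (norm (Yv y))\<^sup>2) \<le> C * exp (- (a * sqsum II y))"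
    using gaussian_dominates[OF b2] by blast
  obtain C3 where C3: "C3 > 0" "\<And>y. \<Gamma> y ^ (m + 1) * exp (- (norm (Xv y))\<^sup>2 / 2 - b\<^sup>2 * (norm (Yv y))\<^sup>2) \<le> C3 * exp (- (a * sqsum II y))"
    using a(2)[of "m + 1"] by blast
  define B where "B = 1 + C1 + C2"
  have B: "1 \<le> B" "C1 \<le> B" "C2 \<le> B" using C1(1) C2(1) by (simp_all add: B_def)
  have B0: "0 \<le> B" using B by simp
  have G0: "0 \<le> \<Gamma> y" for y using \<Gamma>_ge1[of y] by simp
  have G: "norm (Gz A z y) \<le> exp (- (norm (Xv y))\<^sup>2 / 2 - b\<^sup>2 * (norm (Yv y))\<^sup>2)" for y
    unfolding z by (rule Gz_bound[OF A l b])
  have M: "norm (Mz z i k y) \<le> B * \<Gamma> y" if "i < m" "k < m" for i k y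
    using order_trans[OF C1(2)[OF that] mult_right_mono[OF B(2) G0]] .
  have M2: "norm (M2z z i k l y) \<le> B * \<Gamma> y" if "i < m" "k < m" "l < m" for i k l y
    using order_trans[OF C1(3)[OF that] mult_right_mono[OF B(2) G0]] .
  have BG1: "1 \<le> B * \<Gamma> y" for y using mult_mono[OF B(1) \<Gamma>_ge1[of y]] B0 by simp
  have dom: "(B * \<Gamma> y) ^ N * norm (Gz A z y) \<le> B ^ (m + 1) * C3 * exp (- (a * sqsum II y))" if "N \<le> m + 1" for N y
  proof -
    have "(B * \<Gamma> y) ^ N * norm (Gz A z y) \<le> (B * \<Gamma> y) ^ (m + 1) * exp (- (norm (Xv y))\<^sup>2 / 2 - b\<^sup>2 * (norm (Yv y))\<^sup>2)"
      using that BG1[of y] by (intro mult_mono power_increasing G) (auto intro!: zero_le_power order_trans[OF zero_le_one])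
    also have "\<dots> = B ^ (m + 1) * (\<Gamma> y ^ (m + 1) * exp (- (norm (Xv y))\<^sup>2 / 2 - b\<^sup>2 * (norm (Yv y))\<^sup>2))"
      by (simp only: power_mult_distrib mult.assoc)
    also have "\<dots> \<le> B ^ (m + 1) * (C3 * exp (- (a * sqsum II y)))" using B0 by (intro mult_left_mono C3) auto
    finally show ?thesis by (simp add: mult.assoc)
  qed
  define c where "c = B ^ (m + 1) * C3"
  have c0: "0 \<le> c" using B0 C3(1) by (simp add: c_def)
  have dom': "(B * \<Gamma> y) ^ N * norm (Gz A z y) \<le> c * exp (- (a * sqsum II y))" if "N \<le> m + 1" for N y
    using dom[OF that] by (simp add: c_def)
  define R where "R = {..<m} - {r}"
  have R: "finite R" "card R = m - 1" "R \<subseteq> {..<m}" using r by (auto simp: R_def)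
  have prodM: "norm (\<Prod>i\<in>R'. Mz z i (p i) y) \<le> (B * \<Gamma> y) ^ card R'" if p: "p permutes {..<m}" and R': "R' \<subseteq> {..<m}" for p R' y
  proof -
    have "norm (\<Prod>i\<in>R'. Mz z i (p i) y) = (\<Prod>i\<in>R'. norm (Mz z i (p i) y))" by (rule prod_norm[symmetric])
    also have "\<dots> \<le> (\<Prod>i\<in>R'. B * \<Gamma> y)"
      by (intro prod_mono conjI norm_ge_zero M) (use R' permutes_in_image[OF p] in auto)
    finally show ?thesis by simp
  qed
  \<comment> \<open>In the expansion of the determinant whose row r is the gradient of
    \<open>Gz\<close>, \<open>U p\<close> is the term with that gradient and \<open>V p\<close>
    collects the derivatives of the other factors. Their combination \<open>U p + Gz V p\<close> is
    a total derivative in coordinate \<open>p r\<close>.\<close>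
  define U where "U p y = (\<Sum>l<m. av A z l y * Mz z l (p r) y) * (\<Prod>i\<in>R. Mz z i (p i) y)" for p y
  define V where "V p y = (\<Sum>i\<in>R. M2z z i (p i) (p r) y * (\<Prod>j\<in>R - {i}. Mz z j (p j) y))" for p y
  have part: "(\<integral>y. U p y + Gz A z y * V p y \<partial>LM II) = 0 \<and> integrable (LM II) (\<lambda>y. U p y + Gz A z y * V p y)" if p: "p permutes {..<m}" for p
  proof -
    have pr: "p r < m" and pi: "\<And>i. i \<in> R \<Longrightarrow> p i < m" using r R permutes_in_image[OF p] by auto
    have d: "((\<lambda>t. (\<lambda>y. Gz A z y * (\<Prod>i\<in>R. Mz z i (p i) y)) (y(p r := t))) has_vector_derivative (U p y + Gz A z y * V p y)) (at (y (p r)))" for y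
    proof -
      have "((\<lambda>t. \<Prod>i\<in>R. Mz z i (p i) (y(p r := t))) has_derivative
          (\<lambda>h. \<Sum>i\<in>R. (h *\<^sub>R M2z z i (p i) (p r) y) * (\<Prod>j\<in>R - {i}. Mz z j (p j) (y(p r := y (p r)))))) (at (y (p r)))"
        by (rule has_derivative_prod) (use Mz_partial[OF pi pr] in \<open>simp add: has_vector_derivative_def\<close>)
      then have 1: "((\<lambda>t. \<Prod>i\<in>R. Mz z i (p i) (y(p r := t))) has_vector_derivative V p y) (at (y (p r)))"
        by (simp add: has_vector_derivative_def V_def scaleR_sum_right)
      have "((\<lambda>t. Gz A z (y(p r := t)) * (\<Prod>i\<in>R. Mz z i (p i) (y(p r := t)))) has_vector_derivative
          (Gz A z (y(p r := y (p r))) * V p y + (\<Sum>l<m. av A z l y * Mz z l (p r) y) * (\<Prod>i\<in>R. Mz z i (p i) (y(p r := y (p r)))))) (at (y (p r)))"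
        by (rule has_vector_derivative_mult[OF Gz_partial[OF pr, of A z y] 1])
      then show ?thesis by (simp add: U_def add.commute)
    qed
    have bG: "norm (Gz A z y * (\<Prod>i\<in>R. Mz z i (p i) y)) \<le> c * exp (- (a * sqsum II y))" for y
    proof -
      have "norm (Gz A z y * (\<Prod>i\<in>R. Mz z i (p i) y)) \<le> (B * \<Gamma> y) ^ card R * norm (Gz A z y)"
        unfolding norm_mult using prodM[OF p R(3), of y] by (simp add: mult.commute mult_left_mono)
      also have "\<dots> \<le> c * exp (- (a * sqsum II y))" by (rule dom') (use R in simp)
      finally show ?thesis .
    qed
    have bU: "norm (U p y) \<le> real m * (c * exp (- (a * sqsum II y)))" for y
    proof -
      have "norm (U p y) \<le> (\<Sum>l<m. norm (av A z l y) * norm (Mz z l (p r) y)) * (B * \<Gamma> y) ^ card R"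
        unfolding U_def norm_mult
        by (intro mult_mono prodM[OF p R(3)] sum_norm_le sum_nonneg) (auto simp: norm_mult)
      also have "\<dots> \<le> (\<Sum>l<m. (B * \<Gamma> y * norm (Gz A z y)) * (B * \<Gamma> y)) * (B * \<Gamma> y) ^ card R"
      proof (intro mult_right_mono sum_mono mult_mono M pr)
        fix l assume "l \<in> {..<m}"
        then have "norm (av A z l y) \<le> C2 * \<Gamma> y * norm (Gz A z y)" using C2(2) by simp
        also have "\<dots> \<le> B * \<Gamma> y * norm (Gz A z y)" using B(3) G0[of y] by (intro mult_right_mono) auto
        finally show "norm (av A z l y) \<le> B * \<Gamma> y * norm (Gz A z y)" .
      qed (use B0 G0[of y] in auto)
      also have "\<dots> = real m * ((B * \<Gamma> y) ^ (card R + 2) * norm (Gz A z y))" by (simp add: power_add power2_eq_square)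
      also have "\<dots> \<le> real m * (c * exp (- (a * sqsum II y)))"
        by (intro mult_left_mono dom') (use R r in auto)
      finally show ?thesis .
    qed
    have bV: "norm (Gz A z y * V p y) \<le> real m * (c * exp (- (a * sqsum II y)))" for y
    proof -
      have "norm (V p y) \<le> (\<Sum>i\<in>R. (B * \<Gamma> y) * (B * \<Gamma> y) ^ card (R - {i}))"
        unfolding V_def
      proof (rule sum_norm_le)
        fix i assume i: "i \<in> R"
        show "norm (M2z z i (p i) (p r) y * (\<Prod>j\<in>R - {i}. Mz z j (p j) y)) \<le> (B * \<Gamma> y) * (B * \<Gamma> y) ^ card (R - {i})"
          unfolding norm_mult
          by (intro mult_mono M2 prodM[OF p]) (use i R pi pr B0 G0[of y] in auto)
      qed
      also have "\<dots> = (\<Sum>i\<in>R. (B * \<Gamma> y) ^ card R)"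
      proof (rule sum.cong[OF refl])
        fix i assume i: "i \<in> R"
        then have "card R = Suc (card (R - {i}))" using R(1) by (rule card.remove[rotated])
        then show "(B * \<Gamma> y) * (B * \<Gamma> y) ^ card (R - {i}) = (B * \<Gamma> y) ^ card R" by simp
      qed
      also have "\<dots> = real (card R) * (B * \<Gamma> y) ^ card R" by simp
      also have "\<dots> \<le> real m * (B * \<Gamma> y) ^ card R" using R B0 G0[of y] by (intro mult_right_mono) auto
      finally have "norm (Gz A z y * V p y) \<le> norm (Gz A z y) * (real m * (B * \<Gamma> y) ^ card R)"
        unfolding norm_mult by (rule mult_left_mono) simp
      also have "\<dots> = real m * ((B * \<Gamma> y) ^ card R * norm (Gz A z y))" by simp
      also have "\<dots> \<le> real m * (c * exp (- (a * sqsum II y)))"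
        by (intro mult_left_mono dom') (use R in auto)
      finally show ?thesis .
    qed
    have bUV: "norm (U p y + Gz A z y * V p y) \<le> ((2 * real m + 1) * c) * exp (- (a * sqsum II y))" for y
    proof -
      have "norm (U p y + Gz A z y * V p y) \<le> real m * (c * exp (- (a * sqsum II y))) + real m * (c * exp (- (a * sqsum II y)))"
        by (rule order_trans[OF norm_triangle_ineq add_mono[OF bU bV]])
      also have "\<dots> \<le> ((2 * real m + 1) * c) * exp (- (a * sqsum II y))" using c0 by (simp add: algebra_simps)
      finally show ?thesis .
    qed
    have bG': "norm (Gz A z y * (\<Prod>i\<in>R. Mz z i (p i) y)) \<le> ((2 * real m + 1) * c) * exp (- (a * sqsum II y))" for y
      using bG[of y] by (rule order_trans) (use c0 in \<open>simp add: algebra_simps\<close>)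
    have meas: "(\<lambda>y. U p y + Gz A z y * V p y) \<in> borel_measurable (LM II)"
      unfolding U_def V_def
      by (intro borel_measurable_add borel_measurable_times borel_measurable_sum borel_measurable_prod Gz_measurable av_measurable Mz_measurable M2z_measurable)
    show ?thesis
      using integral_partial_derivative_eq_0[of II "p r" a "\<lambda>y. Gz A z y * (\<Prod>i\<in>R. Mz z i (p i) y)" "\<lambda>y. U p y + Gz A z y * V p y", OF _ _ a(1) d meas bG' bUV]
        integrable_gaussian_bound[OF _ a(1) meas bUV] pr by simp
  qed
  have pr: "(\<Prod>i<m. f i) = f r * (\<Prod>i\<in>R. f i)" for f :: "nat \<Rightarrow> complex"
    using r by (simp add: R_def prod.remove)
  have jacU: "av A z r y * jac z y = (\<Sum>p | p permutes {..<m}. of_int (sign p) * U p y)" for y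
  proof -
    have "av A z r y * jac z y = gdet m (\<lambda>i j. if i = r then \<Sum>l<m. av A z l y * Mz z l j y else Mz z i j y)"
      unfolding jac_Mz by (rule gdet_row_combination[OF r, symmetric])
    also have "\<dots> = (\<Sum>p | p permutes {..<m}. of_int (sign p) * U p y)"
      unfolding gdet_def pr U_def
      by (intro sum.cong refl arg_cong2[of _ _ _ _ times]) (auto simp: R_def intro!: prod.cong)
    finally show ?thesis .
  qed
  \<comment> \<open>The Piola identity: the cofactors of a Jacobian matrix are divergence free.
    Composing p with the transposition of i and r flips the sign and leaves the symmetric second
    derivative unchanged.\<close>
  have V0: "(\<Sum>p | p permutes {..<m}. of_int (sign p) * V p y) = 0" for y
  proof -
    have "(\<Sum>p | p permutes {..<m}. of_int (sign p) * V p y)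
        = (\<Sum>i\<in>R. \<Sum>p | p permutes {..<m}. of_int (sign p) * (M2z z i (p i) (p r) y * (\<Prod>j\<in>R - {i}. Mz z j (p j) y)))"
      unfolding V_def sum_distrib_left by (rule sum.swap)
    also have "\<dots> = (\<Sum>i\<in>R. 0)"
    proof (rule sum.cong[OF refl])
      fix i assume i: "i \<in> R"
      then have im: "i < m" "i \<noteq> r" by (auto simp: R_def)
      show "(\<Sum>p | p permutes {..<m}. of_int (sign p) * (M2z z i (p i) (p r) y * (\<Prod>j\<in>R - {i}. Mz z j (p j) y))) = 0"
      proof (rule sum_permutes_antisym[OF im(1) r])
        fix p assume p: "p permutes {..<m}"
        have "(\<Prod>j\<in>R - {i}. Mz z j ((p \<circ> Transposition.transpose i r) j) y) = (\<Prod>j\<in>R - {i}. Mz z j (p j) y)"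
          by (rule prod.cong) (auto simp: Transposition.transpose_def R_def)
        moreover have "M2z z i ((p \<circ> Transposition.transpose i r) i) ((p \<circ> Transposition.transpose i r) r) y = M2z z i (p i) (p r) y"
          by (simp add: M2z_commute[of z i "p r"])
        ultimately show "of_int (sign (p \<circ> Transposition.transpose i r)) * (M2z z i ((p \<circ> Transposition.transpose i r) i) ((p \<circ> Transposition.transpose i r) r) y
            * (\<Prod>j\<in>R - {i}. Mz z j ((p \<circ> Transposition.transpose i r) j) y))
          = - (of_int (sign p) * (M2z z i (p i) (p r) y * (\<Prod>j\<in>R - {i}. Mz z j (p j) y)))"
          using sign_comp_transpose[OF p im(1) r im(2)] by simp
      qed
    qed
    finally show ?thesis by simp
  qed
  have eq: "av A z r y * jac z y = (\<Sum>p | p permutes {..<m}. of_int (sign p) * (U p y + Gz A z y * V p y))" for y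
  proof -
    have "(\<Sum>p | p permutes {..<m}. of_int (sign p) * (U p y + Gz A z y * V p y))
        = (\<Sum>p | p permutes {..<m}. of_int (sign p) * U p y) + Gz A z y * (\<Sum>p | p permutes {..<m}. of_int (sign p) * V p y)"
      by (simp add: distrib_left sum.distrib sum_distrib_left mult_ac)
    then show ?thesis by (simp add: V0 jacU)
  qed
  show "integrable (LM II) (\<lambda>y. av A z r y * jac z y)"
    unfolding eq by (intro Bochner_Integration.integrable_sum integrable_mult_right) (use part in auto)
  show "(\<integral>y. av A z r y * jac z y \<partial>LM II) = 0"
    unfolding eq
    by (subst Bochner_Integration.integral_sum) (use part in \<open>auto intro!: integrable_mult_right sum.neutral\<close>)
qed


text \<open>On the segment from A0 to A1 the t-derivative of the weighted integrand is i exp (Tr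
  A^2) times a combination of the terms \<open>av\<close> times \<open>jac\<close>, weighted by the
  coordinates of A1 - A0, and each integrates to zero by \<open>stokes\<close>. Convexity of
  \<open>pos_bound\<close> lets one l and one b serve the whole segment.\<close>

lemma weighted_integral_constant:
  assumes A0: "A0 \<in> Q" "pos_bound A0 l" and A1: "A1 \<in> Q" "pos_bound A1 l" and b: "0 < b" "b \<le> l"
  defines "z \<equiv> - (of_real b * \<i>)"
  shows "exp (mtrace (A1 ** A1)) * (\<integral>y. Gz A1 z y * jac z y \<partial>LM II) = exp (mtrace (A0 ** A0)) * (\<integral>y. Gz A0 z y * jac z y \<partial>LM II)"
proof -
  define V where "V = A1 - A0"
  define At where "At t = A0 + t *\<^sub>R V" for t :: real
  have AtQ: "At t \<in> Q" for t
    unfolding At_def V_def by (intro subspace_add[OF subspace_Q] subspace_mul[OF subspace_Q] subspace_diff[OF subspace_Q] A0 A1)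
  have Atl: "pos_bound (At t) l" if "t \<in> {0..1}" for t
  proof -
    have "At t = (1 - t) *\<^sub>R A0 + t *\<^sub>R A1" by (simp add: At_def V_def algebra_simps)
    then show ?thesis using pos_bound_convex[OF A0(2) A1(2), of t] that by simp
  qed
  have VQ: "V \<in> Q" unfolding V_def by (intro subspace_diff[OF subspace_Q] A0 A1)
  define f where "f t y = exp (mtrace (At t ** At t)) * Gz (At t) z y * jac z y" for t y
  define f' where "f' t y = exp (mtrace (At t ** At t)) * \<i> * (\<Sum>r<m. of_real (co r V) * (av (At t) z r y * jac z y))" for t y
  have der: "((\<lambda>t. f t y) has_vector_derivative f' t y) (at t within {0..1})" for t y
  proof -
    have dA: "(At has_vector_derivative V) (at t)"
      unfolding At_def[abs_def] by (auto intro!: derivative_eq_intros)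
    note tr = bounded_linear.has_vector_derivative[OF bounded_linear_mtrace]
    have "((\<lambda>t. mtrace (At t ** At t)) has_vector_derivative mtrace (At t ** V + V ** At t)) (at t)"
      by (intro tr mm.has_vector_derivative dA)
    then have 1: "((\<lambda>t. mtrace (At t ** At t)) has_vector_derivative 2 * mtrace (At t ** V)) (at t)"
      by (simp add: mtrace_add mtrace_commute[of V])
    have "((\<lambda>t. mtrace (Fm z y ** At t)) has_vector_derivative mtrace (Fm z y ** V + 0 ** At t)) (at t)"
      by (intro tr mm.has_vector_derivative dA has_vector_derivative_const)
    then have 2: "((\<lambda>t. mtrace (Fm z y ** At t)) has_vector_derivative mtrace (Fm z y ** V)) (at t)"
      by (simp add: mm_simps)
    let ?g = "\<lambda>t. mtrace (At t ** At t) - mtrace (Fm z y ** Fm z y) - 2 * \<i> * mtrace (Fm z y ** At t)"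
    let ?g' = "2 * mtrace (At t ** V) - 0 - 2 * \<i> * mtrace (Fm z y ** V)"
    have 3: "(?g has_vector_derivative ?g') (at t)"
      by (intro has_vector_derivative_diff has_vector_derivative_const 1 has_vector_derivative_mult_right 2)
    have f: "f u y = exp (?g u) * jac z y" for u
      unfolding f_def Gz_def exp_add[symmetric] by (simp add: algebra_simps)
    have "((\<lambda>t. exp (?g t)) has_vector_derivative ?g' * exp (?g t)) (at t)"
      using has_derivative_compose[OF 3[unfolded has_vector_derivative_def] DERIV_exp[unfolded has_field_derivative_def]]
      by (simp add: has_vector_derivative_def mult.commute)
    then have "((\<lambda>t. f t y) has_vector_derivative ?g' * exp (?g t) * jac z y) (at t)"
      unfolding f by (rule has_vector_derivative_mult_left)
    moreover have "?g' * exp (?g t) * jac z y = f' t y"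
    proof -
      have "?g' = 2 * - (\<i> * mtrace ((Fm z y + csc \<i> (At t)) ** V))"
        by (simp add: mm.add_left csc_simps mtrace_add mtrace_csc algebra_simps)
      also have "mtrace ((Fm z y + csc \<i> (At t)) ** V) = (\<Sum>r<m. of_real (co r V) * mtrace ((Fm z y + csc \<i> (At t)) ** bQ ! r))"
        by (subst co_repr[OF VQ]) (simp add: mm.sum_right mtrace_sum mm.scaleR_right mtrace_scaleR, simp add: scaleR_conv_of_real)
      finally have g': "?g' = 2 * - (\<i> * (\<Sum>r<m. of_real (co r V) * mtrace ((Fm z y + csc \<i> (At t)) ** bQ ! r)))" .
      have e: "exp (?g t) = exp (mtrace (At t ** At t)) * Gz (At t) z y"
        unfolding Gz_def exp_add[symmetric] by (simp add: algebra_simps)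
      show ?thesis
        unfolding g' e f'_def av_def by (simp add: sum_distrib_left sum_distrib_right sum_negf mult_ac)
    qed
    ultimately show ?thesis by (auto intro: has_vector_derivative_at_within)
  qed
  obtain C where C: "C > 0" "\<And>i k y. i < m \<Longrightarrow> k < m \<Longrightarrow> norm (Mz z i k y) \<le> C * \<Gamma> y"
    "\<And>i k l y. i < m \<Longrightarrow> k < m \<Longrightarrow> l < m \<Longrightarrow> norm (M2z z i k l y) \<le> C * \<Gamma> y"
    "\<And>y. norm (Fm z y) \<le> C * \<Gamma> y"
    using entries_bound[of z] by blast
  have b2: "0 < b\<^sup>2" using b by simp
  obtain a where a: "a > 0" "\<And>N. \<exists>C>0. \<forall>y. \<Gamma> y ^ N * exp (- (norm (Xv y))\<^sup>2 / 2 - b\<^sup>2 * (norm (Yv y))\<^sup>2) \<le> C * exp (- (a * sqsum II y))"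
    using gaussian_dominates[OF b2] by blast
  have Gb: "norm (Gz (At t) z y) \<le> exp (- (norm (Xv y))\<^sup>2 / 2 - b\<^sup>2 * (norm (Yv y))\<^sup>2)" if "t \<in> {0..1}" for t y
    unfolding z_def by (rule Gz_bound[OF AtQ Atl[OF that] b])
  have jb: "norm (jac z y) \<le> fact m * (C * \<Gamma> y) ^ m" for y
    unfolding jac_Mz by (rule norm_gdet_le) (use C(2) in auto)
  define L where "L = (norm A0 + norm V) + 1"
  have AL: "norm (At t) \<le> L" if "t \<in> {0..1}" for t
  proof -
    have "norm (At t) \<le> norm A0 + \<bar>t\<bar> * norm V" unfolding At_def by (rule order_trans[OF norm_triangle_ineq]) simp
    also have "\<bar>t\<bar> * norm V \<le> 1 * norm V" by (rule mult_right_mono) (use that in auto)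
    finally show ?thesis by (simp add: L_def)
  qed
  have L0: "0 < L" by (simp add: L_def add_nonneg_pos)
  have eb: "norm (exp (mtrace (At t ** At t))) \<le> exp (L\<^sup>2)" if "t \<in> {0..1}" for t
  proof -
    have "norm (mtrace (At t ** At t)) \<le> L * L"
      by (rule order_trans[OF norm_mtrace_mult_le]) (use AL[OF that] L0 in \<open>auto intro: mult_mono\<close>)
    then show ?thesis by (intro order_trans[OF norm_exp]) (simp add: power2_eq_square)
  qed
  define B where "B = (\<Sum>r<m. \<bar>co r V\<bar> * norm (bQ ! r))"
  have B0: "0 \<le> B" unfolding B_def by (intro sum_nonneg) auto
  have avb: "norm (\<Sum>r<m. of_real (co r V) * (av (At t) z r y * jac z y)) \<le> (2 * (C + L) * B * fact m * C ^ m) * (\<Gamma> y ^ (m + 1) * norm (Gz (At t) z y))"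
    if t: "t \<in> {0..1}" for t y
  proof -
    have F: "norm (Fm z y + csc \<i> (At t)) \<le> (C + L) * \<Gamma> y"
    proof -
      have "norm (Fm z y + csc \<i> (At t)) \<le> C * \<Gamma> y + L * 1"
        by (rule order_trans[OF norm_triangle_ineq add_mono]) (use C(4) AL[OF t] in \<open>auto simp: norm_csc\<close>)
      also have "\<dots> \<le> C * \<Gamma> y + L * \<Gamma> y" using L0 C(1) \<Gamma>_ge1[of y] by (intro add_mono mult_left_mono) auto
      finally show ?thesis by (simp add: algebra_simps)
    qed
    have "norm (\<Sum>r<m. of_real (co r V) * (av (At t) z r y * jac z y))
      \<le> (\<Sum>r<m. (2 * norm (Gz (At t) z y) * ((C + L) * \<Gamma> y) * (fact m * (C * \<Gamma> y) ^ m)) * (\<bar>co r V\<bar> * norm (bQ ! r)))"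
    proof (rule sum_norm_le)
      fix r
      have "norm (mtrace ((Fm z y + csc \<i> (At t)) ** bQ ! r)) \<le> (C + L) * \<Gamma> y * norm (bQ ! r)"
        by (rule order_trans[OF norm_mtrace_mult_le mult_right_mono[OF F]]) simp
      then have "norm (av (At t) z r y) \<le> 2 * norm (Gz (At t) z y) * ((C + L) * \<Gamma> y * norm (bQ ! r))"
        unfolding av_def norm_mult by (intro mult_mono) auto
      then have "norm (of_real (co r V) * (av (At t) z r y * jac z y))
          \<le> \<bar>co r V\<bar> * ((2 * norm (Gz (At t) z y) * ((C + L) * \<Gamma> y * norm (bQ ! r))) * (fact m * (C * \<Gamma> y) ^ m))"
        unfolding norm_mult using C(1) L0 \<Gamma>_ge1[of y]
        by (intro mult_mono jb) (auto intro!: mult_nonneg_nonneg)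
      then show "norm (of_real (co r V) * (av (At t) z r y * jac z y))
          \<le> (2 * norm (Gz (At t) z y) * ((C + L) * \<Gamma> y) * (fact m * (C * \<Gamma> y) ^ m)) * (\<bar>co r V\<bar> * norm (bQ ! r))"
        by (simp add: mult_ac)
    qed
    also have "\<dots> = (2 * (C + L) * B * fact m * C ^ m) * (\<Gamma> y ^ (m + 1) * norm (Gz (At t) z y))"
      unfolding sum_distrib_left[symmetric] B_def[symmetric] by (simp add: power_mult_distrib mult_ac)
    finally show ?thesis .
  qed
  define g where "g y = exp (- (norm (Xv y))\<^sup>2 / 2 - b\<^sup>2 * (norm (Yv y))\<^sup>2)" for y
  obtain c1 where c1: "c1 > 0" "\<And>y. \<Gamma> y ^ (m + 1) * g y \<le> c1 * exp (- (a * sqsum II y))"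
    using a(2)[of "m + 1"] unfolding g_def by blast
  define c2 where "c2 = exp (L\<^sup>2) * (2 * (C + L) * B * fact m * C ^ m)"
  have c20: "0 \<le> c2" unfolding c2_def using B0 C(1) L0 by auto
  have bf': "norm (f' t y) \<le> c2 * c1 * exp (- (a * sqsum II y))" if t: "t \<in> {0..1}" for t y
  proof -
    have "norm (f' t y) \<le> exp (L\<^sup>2) * ((2 * (C + L) * B * fact m * C ^ m) * (\<Gamma> y ^ (m + 1) * norm (Gz (At t) z y)))"
      unfolding f'_def norm_mult norm_ii mult_1_right by (intro mult_mono eb[OF t] avb[OF t]) auto
    also have "\<dots> = c2 * (\<Gamma> y ^ (m + 1) * norm (Gz (At t) z y))" by (simp add: c2_def)
    also have "\<dots> \<le> c2 * (\<Gamma> y ^ (m + 1) * g y)"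
      using Gb[OF t, of y] c20 \<Gamma>_ge1[of y] unfolding g_def by (intro mult_left_mono) auto
    also have "\<dots> \<le> c2 * (c1 * exp (- (a * sqsum II y)))" using c20 c1(2) by (intro mult_left_mono) auto
    finally show ?thesis by simp
  qed
  define c3 where "c3 = exp (L\<^sup>2) * (fact m * C ^ m)"
  have c30: "0 \<le> c3" unfolding c3_def using C(1) by auto
  have bf: "norm (f t y) \<le> c3 * c1 * exp (- (a * sqsum II y))" if t: "t \<in> {0..1}" for t y
  proof -
    have "norm (f t y) \<le> exp (L\<^sup>2) * g y * (fact m * (C * \<Gamma> y) ^ m)"
      unfolding f_def norm_mult using C(1) \<Gamma>_ge1[of y]
      by (intro mult_mono eb[OF t] jb) (use Gb[OF t, of y] in \<open>auto simp: g_def\<close>)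
    also have "\<dots> = c3 * (\<Gamma> y ^ m * g y)" by (simp add: c3_def power_mult_distrib)
    also have "\<dots> \<le> c3 * (\<Gamma> y ^ (m + 1) * g y)"
      using c30 \<Gamma>_ge1[of y] by (intro mult_left_mono mult_right_mono power_increasing) (auto simp: g_def)
    also have "\<dots> \<le> c3 * (c1 * exp (- (a * sqsum II y)))" using c30 c1(2) by (intro mult_left_mono) auto
    finally show ?thesis by simp
  qed
  have fi: "integrable (LM II) (f t)" if t: "t \<in> {0..1}" for t
    by (rule integrable_gaussian_bound[OF _ a(1) _ bf[OF t]])
      (auto simp: f_def[abs_def] intro!: borel_measurable_times Gz_measurable jac_measurable)
  have "(\<integral>y. f 1 y \<partial>LM II) = (\<integral>y. f 0 y \<partial>LM II)"
  proof (rule integral_eq_of_zero_derivative[OF fi der _ bf'])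
    show "integrable (LM II) (\<lambda>y. c2 * c1 * exp (- (a * sqsum II y)))"
      by (intro integrable_mult_right integrable_LM_gaussian a(1)) simp
    show "f' t \<in> borel_measurable (LM II)" for t
      unfolding f'_def[abs_def]
      by (intro borel_measurable_times borel_measurable_const borel_measurable_sum av_measurable jac_measurable)
    show "(\<integral>y. f' t y \<partial>LM II) = 0" if t: "t \<in> {0..1}" for t
    proof -
      have st: "integrable (LM II) (\<lambda>y. av (At t) z r y * jac z y)" "(\<integral>y. av (At t) z r y * jac z y \<partial>LM II) = 0" if "r < m" for r
        using stokes[OF AtQ Atl[OF t] b meta_eq_to_obj_eq[OF z_def] that] by auto
      show ?thesis
        unfolding f'_def
        by (simp, subst Bochner_Integration.integral_sum) (auto intro!: integrable_mult_right sum.neutral simp: st)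
    qed
  qed auto
  then show ?thesis unfolding f_def by (simp add: At_def V_def mult.assoc)
qed

end

subsection \<open>The constant does not vanish\<close>

lemma inverse_Suc_tendsto: "(\<lambda>n. 1 / real (Suc n)) \<longlonglongrightarrow> 0"
  using LIMSEQ_inverse_real_of_nat by (simp add: inverse_eq_divide)

lemma isCont_inverse_Suc_tendsto:
  fixes f :: "real \<Rightarrow> 'a::topological_space"
  shows "isCont f 0 \<Longrightarrow> (\<lambda>n. f (1 / real (Suc n))) \<longlonglongrightarrow> f 0"
  by (rule isCont_tendsto_compose[OF _ inverse_Suc_tendsto])

text \<open>The derivative at 0 taken along 1 / (n + 1); the scaling limit uses the sources (n + 1)
  s.\<close>

lemma has_vector_derivative_inverse_Suc_tendsto:
  assumes "(f has_vector_derivative d) (at (0::real))"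
  shows "(\<lambda>n. real (Suc n) *\<^sub>R (f (1 / real (Suc n)) - f 0)) \<longlonglongrightarrow> d"
proof -
  have "((\<lambda>t. norm ((f t - f 0) /\<^sub>R t - d)) \<longlongrightarrow> 0) (at 0)"
  proof (rule Lim_transform_eventually)
    show "((\<lambda>t. norm (f t - f 0 - t *\<^sub>R d) / \<bar>t\<bar>) \<longlongrightarrow> 0) (at 0)"
      using assms by (simp add: has_vector_derivative_def has_derivative_iff_norm)
    have "norm (f t - f 0 - t *\<^sub>R d) / \<bar>t\<bar> = norm ((f t - f 0) /\<^sub>R t - d)" if "t \<noteq> 0" for t
    proof -
      have "(f t - f 0) /\<^sub>R t - d = (f t - f 0 - t *\<^sub>R d) /\<^sub>R t" using that by (simp add: scaleR_diff_right)
      then show ?thesis by (simp add: divide_inverse mult.commute)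
    qed
    then show "\<forall>\<^sub>F t in at 0. norm (f t - f 0 - t *\<^sub>R d) / \<bar>t\<bar> = norm ((f t - f 0) /\<^sub>R t - d)"
      by (simp add: eventually_at_filter)
  qed
  then have "((\<lambda>t. (f t - f 0) /\<^sub>R t) \<longlongrightarrow> d) (at 0)"
    by (simp add: tendsto_norm_zero_iff Lim_null[symmetric])
  moreover have "filterlim (\<lambda>n. 1 / real (Suc n)) (at 0) sequentially"
    using inverse_Suc_tendsto by (simp add: filterlim_at)
  ultimately have "(\<lambda>n. (f (1 / real (Suc n)) - f 0) /\<^sub>R (1 / real (Suc n))) \<longlonglongrightarrow> d"
    by (rule filterlim_compose)
  then show ?thesis by simp
qed

lemma gdet_tendsto:
  fixes M :: "'x \<Rightarrow> nat \<Rightarrow> nat \<Rightarrow> 'a::real_normed_field"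
  assumes "\<And>i j. i < m \<Longrightarrow> j < m \<Longrightarrow> ((\<lambda>x. M x i j) \<longlongrightarrow> N i j) F"
  shows "((\<lambda>x. gdet m (M x)) \<longlongrightarrow> gdet m N) F"
  unfolding gdet_def
  by (intro tendsto_sum tendsto_mult tendsto_prod tendsto_const assms) (auto dest: permutes_in_image)

context ps_bases
begin

text \<open>Rewrites the excess |e^Y|^2 - n as the square of a quantity whose rescaling has a linear
  limit, see \<open>sinh_rescaled_tendsto\<close>.\<close>

lemma norm_mexp_diff_sq:
  assumes Y: "Y \<in> p"
  shows "(norm (mexp Y - mexp (- Y)))\<^sup>2 = 2 * ((norm (mexp Y))\<^sup>2 - real CARD('n))"
proof -
  have h: "adj (mexp Y) = mexp Y" "adj (mexp (- Y)) = mexp (- Y)"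
    using mexp_p_herm[OF Y] mexp_p_herm[OF p_neg[OF Y]] by auto
  have "complex_of_real ((norm (mexp Y - mexp (- Y)))\<^sup>2) = mtrace ((mexp Y - mexp (- Y)) ** (mexp Y - mexp (- Y)))"
    unfolding mtrace_adj_mult[symmetric] by (simp add: linear_diff[OF linear_adj] h)
  also have "\<dots> = mtrace (adj (mexp Y) ** mexp Y) + mtrace (adj (mexp (- Y)) ** mexp (- Y)) - 2 * of_nat CARD('n)"
    unfolding h mm_simps mtrace_diff mexp_neg_mult mexp_neg_mult' mtrace_one by simp
  also have "\<dots> = complex_of_real (2 * ((norm (mexp Y))\<^sup>2 - real CARD('n)))"
    unfolding mtrace_adj_mult by (simp add: norm_mexp_neg[OF Y])
  finally show ?thesis unfolding of_real_eq_iff .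
qed

text \<open>For A = l s the shift b = l is admissible, and the exponent becomes explicit: the terms
  in l^2 combine to 2 l^2 (n - |e^Y|^2), a negative square by \<open>norm_mexp_diff_sq\<close>, and
  those linear in l to a phase.\<close>

lemma Gz_scaled_s:
  "exp (mtrace ((l *\<^sub>R s) ** (l *\<^sub>R s))) * Gz (l *\<^sub>R s) (- (of_real l * \<i>)) y
    = exp (- of_real ((norm (Xv y))\<^sup>2 + (norm (l *\<^sub>R (mexp (Yv y) - mexp (- Yv y))))\<^sup>2)
        - 2 * \<i> * of_real l * mtrace ((PS (Yv y) (Xv y) - Xv y) ** s))"
proof -
  let ?Y = "Yv y" and ?X = "Xv y"
  define z where "z = - (of_real l * \<i>)"
  define e where "e = complex_of_real ((norm (mexp ?Y))\<^sup>2)"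
  have z2: "z * z = - of_real (l\<^sup>2)" by (simp add: z_def power2_eq_square mult_ac)
  have ss1: "mtrace (s ** s) = of_nat CARD('n)" by (simp add: s_sq mtrace_one)
  have FF: "mtrace (Fm z y ** Fm z y) = of_real ((norm ?X)\<^sup>2) + 2 * z * mtrace (?X ** s) + z * z * of_nat CARD('n)"
    unfolding Fm_def mtrace_PS
    by (simp add: mm_simps csc_simps mtrace_add mtrace_csc mtrace_Qp_sq[OF Xv_Qp] ss1 mtrace_commute[of s ?X] algebra_simps)
  have "PS ?Y s ** s = mexp ?Y ** mexp ?Y" by (simp add: PS_s[OF Yv_p] ss)
  moreover have "mtrace (mexp ?Y ** mexp ?Y) = e"
    using mtrace_adj_mult[of "mexp ?Y"] by (simp add: mexp_p_herm[OF Yv_p] e_def)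
  ultimately have FA: "mtrace (Fm z y ** (l *\<^sub>R s)) = of_real l * (mtrace (PS ?Y ?X ** s) + z * e)"
    by (simp add: Fm_def PS_csc linear_add[OF PS_linear] mm.add_left mm.scaleR_right csc_simps mtrace_add mtrace_csc mtrace_scaleR)
      (simp add: scaleR_conv_of_real algebra_simps)
  have AA: "mtrace ((l *\<^sub>R s) ** (l *\<^sub>R s)) = of_real (l\<^sup>2) * of_nat CARD('n)"
    by (simp add: mm.scaleR_left mm.scaleR_right mtrace_scaleR ss1 power2_eq_square) (simp add: scaleR_conv_of_real)
  have diff: "complex_of_real ((norm (mexp ?Y - mexp (- ?Y)))\<^sup>2) = 2 * (e - of_nat CARD('n))"
    by (simp add: norm_mexp_diff_sq[OF Yv_p] e_def)
  have "exp (mtrace ((l *\<^sub>R s) ** (l *\<^sub>R s))) * Gz (l *\<^sub>R s) z y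
     = exp (of_real (l\<^sup>2) * of_nat CARD('n) - (of_real ((norm ?X)\<^sup>2) + 2 * z * mtrace (?X ** s) + z * z * of_nat CARD('n))
         - 2 * \<i> * (of_real l * (mtrace (PS ?Y ?X ** s) + z * e)))"
    unfolding Gz_def FF FA AA exp_add[symmetric] by (simp add: algebra_simps)
  also have "\<dots> = exp (- of_real ((norm ?X)\<^sup>2) - of_real (l\<^sup>2) * (2 * (e - of_nat CARD('n)))
        - 2 * \<i> * of_real l * mtrace ((PS ?Y ?X - ?X) ** s))"
    unfolding z2 by (rule arg_cong[of _ _ exp]) (simp add: z_def mm_simps mtrace_diff power2_eq_square algebra_simps)
  finally show ?thesis
    unfolding diff[symmetric] z_def by (simp add: power_mult_distrib)
qed

text \<open>The substitution Y -> Y / l in coordinates; the leading \<open>0 +\<close> and the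
  restriction fit the pattern of \<open>integral_LM_affine\<close>.\<close>

definition shrink :: "real \<Rightarrow> (nat \<Rightarrow> real) \<Rightarrow> nat \<Rightarrow> real" where
  "shrink l y = (\<lambda>k\<in>II. 0 + (if k < dp then 1 / l else 1) * y k)"

lemma Yv_shrink: "Yv (shrink l y) = (1 / l) *\<^sub>R Yv y"
  by (simp add: Yv_def shrink_def scaleR_sum_right)

lemma Xv_shrink: "Xv (shrink l y) = Xv y"
  by (simp add: Xv_def shrink_def)

text \<open>Columns of the rescaled Jacobian in the limit, up to factors: a direction Z in
  \<open>p\<close> contributes - i (Z s - s Z) = - 2 i Z s, a direction in Q_+ contributes
  itself.\<close>

definition limit_frame :: "nat \<Rightarrow> complex^'n^'n" where
  "limit_frame j = (if j < dp then bp ! j ** s else bq ! (j - dp))"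

lemma mexp_line_derivative: "((\<lambda>t. mexp (t *\<^sub>R Z)) has_vector_derivative Z) (at (0::real))" for Z :: "complex^'n^'n"
proof -
  have "((\<lambda>t. t *\<^sub>R Z) has_derivative (\<lambda>h. h *\<^sub>R Z)) (at (0::real))" by (auto intro!: derivative_eq_intros)
  then have "((\<lambda>t. mexp (t *\<^sub>R Z)) has_derivative (\<lambda>h. dexp (0 *\<^sub>R Z) (h *\<^sub>R Z))) (at (0::real))"
    by (rule has_derivative_compose) (rule mexp_has_derivative)
  then show ?thesis by (simp add: has_vector_derivative_def dexp_zero)
qed

lemma sinh_rescaled_tendsto:
  "(\<lambda>n. real (Suc n) *\<^sub>R (mexp ((1 / real (Suc n)) *\<^sub>R Z) - mexp (- ((1 / real (Suc n)) *\<^sub>R Z)))) \<longlonglongrightarrow> 2 *\<^sub>R Z"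
  for Z :: "complex^'n^'n"
proof -
  have "((\<lambda>t. mexp (t *\<^sub>R Z) - mexp (t *\<^sub>R (- Z))) has_vector_derivative Z - (- Z)) (at 0)"
    by (intro has_vector_derivative_diff mexp_line_derivative)
  from has_vector_derivative_inverse_Suc_tendsto[OF this]
  show ?thesis by (simp add: scaleR_2)
qed

lemma PS_rescaled_tendsto:
  "(\<lambda>n. real (Suc n) *\<^sub>R (PS ((1 / real (Suc n)) *\<^sub>R Z) X - X)) \<longlonglongrightarrow> Z ** X - X ** Z"
  for Z :: "complex^'n^'n"
proof -
  have "((\<lambda>t. PS (t *\<^sub>R Z) X) has_derivative (\<lambda>h. dPS (0 *\<^sub>R Z) (h *\<^sub>R Z) X + PS (0 *\<^sub>R Z) 0)) (at (0::real))"
    by (intro PS_has_derivative has_derivative_const) (auto intro!: derivative_eq_intros)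
  then have "((\<lambda>t. PS (t *\<^sub>R Z) X) has_vector_derivative Z ** X - X ** Z) (at (0::real))"
    by (simp add: has_vector_derivative_def dPS_zero PS_zero mm.scaleR_left mm.scaleR_right scaleR_diff_right)
  from has_vector_derivative_inverse_Suc_tendsto[OF this]
  show ?thesis by (simp add: PS_zero)
qed

lemma PS_line_isCont: "isCont (\<lambda>t. PS (t *\<^sub>R Z) X) (0::real)" and dPS_line_isCont: "isCont (\<lambda>t. dPS (t *\<^sub>R Z) W X) (0::real)"
  for Z W X :: "complex^'n^'n"
proof -
  have l: "((\<lambda>t. t *\<^sub>R Z) has_derivative (\<lambda>h. h *\<^sub>R Z)) (at (0::real))" by (auto intro!: derivative_eq_intros)
  show "isCont (\<lambda>t. PS (t *\<^sub>R Z) X) (0::real)"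
    by (rule has_derivative_continuous[OF PS_has_derivative[OF l has_derivative_const]])
  show "isCont (\<lambda>t. dPS (t *\<^sub>R Z) W X) (0::real)"
    by (rule has_derivative_continuous[OF dPS_has_derivative[OF l has_derivative_const]])
qed

text \<open>\<open>s\<close> anticommutes with Z and commutes with X, so moving it around the trace
  reverses the sign. Hence the phase of \<open>Gz_scaled_s\<close> disappears in the limit.\<close>

lemma mtrace_bracket_s: "Z \<in> p \<Longrightarrow> X \<in> Qp \<Longrightarrow> mtrace ((Z ** X - X ** Z) ** s) = 0"
proof -
  assume Z: "Z \<in> p" and X: "X \<in> Qp"
  have "mtrace (Z ** X ** s) = mtrace (s ** Z ** X)" by (simp add: mtrace_commute[of _ s] matrix_mul_assoc)
  also have "\<dots> = - mtrace (Z ** (s ** X))" by (simp add: p_anti[OF Z] mm_simps mtrace_neg matrix_mul_assoc)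
  also have "\<dots> = - mtrace (Z ** X ** s)" by (simp add: Qp_comm[OF X] matrix_mul_assoc)
  finally have 1: "mtrace (Z ** X ** s) = 0" by simp
  have "mtrace (X ** Z ** s) = - mtrace (X ** s ** Z)" 
    using p_anti[OF Z] by (simp add: matrix_mul_assoc[symmetric] mm_simps mtrace_neg)
  also have "mtrace (X ** s ** Z) = mtrace (Z ** X ** s)" by (metis matrix_mul_assoc mtrace_commute)
  finally show ?thesis using 1 by (simp add: mm_simps mtrace_diff)
qed

text \<open>The products of \<open>bp\<close> with \<open>s\<close> form a basis of the odd part of
  \<open>Q\<close> and \<open>bq\<close> one of the even part. Expanding \<open>bQ\<close> in this
  frame through \<open>mpart\<close> and \<open>ppart\<close> gives the right inverse
  \<open>R\<close>.\<close>

lemma limit_frame_gdet_nonzero: "gdet m (\<lambda>i j. co i (limit_frame j)) \<noteq> 0"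
proof -
  define R where "R j k = (if j < dp then dual bp j (mpart (bQ ! k) ** s) else dual bq (j - dp) (ppart (bQ ! k)))" for j k
  show ?thesis
  proof (rule gdet_nonzero[OF card_index])
    fix i k assume i: "i < m" and k: "k < m"
    have Qk: "bQ ! k \<in> Q" using ordered_basis_nth[OF bQ] k dim_Q by simp
    have mp: "mpart (bQ ! k) = (\<Sum>j<dp. dual bp j (mpart (bQ ! k) ** s) *\<^sub>R (bp ! j ** s))"
    proof -
      have "mpart (bQ ! k) ** s = (\<Sum>j<dp. dual bp j (mpart (bQ ! k) ** s) *\<^sub>R bp ! j)"
        by (rule dual_repr[OF bp Qm_s[OF mpart_Q[OF Qk]]])
      then have "mpart (bQ ! k) ** s ** s = (\<Sum>j<dp. dual bp j (mpart (bQ ! k) ** s) *\<^sub>R bp ! j) ** s" by simp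
      then show ?thesis by (simp add: ss mm.sum_left mm.scaleR_left)
    qed
    have pp: "ppart (bQ ! k) = (\<Sum>j<dq. dual bq j (ppart (bQ ! k)) *\<^sub>R bq ! j)"
      by (rule dual_repr[OF bq ppart_Q[OF Qk]])
    have "(\<Sum>j<m. R j k *\<^sub>R limit_frame j) = mpart (bQ ! k) + ppart (bQ ! k)"
      by (simp add: sum_lessThan_add R_def limit_frame_def mp[symmetric] pp[symmetric])
    also have "\<dots> = bQ ! k" using parts_sum[of "bQ ! k"] by (simp add: add.commute)
    finally have "co i (\<Sum>j<m. R j k *\<^sub>R limit_frame j) = co i (bQ ! k)" by simp
    then have "(\<Sum>j<m. R j k * co i (limit_frame j)) = co i (bQ ! k)"
      by (simp add: linear_sum[OF co_linear] linear_cmul[OF co_linear])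
    then show "(\<Sum>j<m. co i (limit_frame j) * R j k) = (if i = k then 1 else 0)"
      using dual_nth[OF bQ, of k i] k dim_Q by (simp add: mult.commute)
  qed
qed

text \<open>Dominated convergence along l = n + 1 after shrinking Y by l. The Jacobian factor of the
  shrinking is distributed over the p-columns of the determinant, where it compensates the factor l
  in z = - i l; the limit is a Gaussian integral times a nonzero determinant.\<close>

lemma scaled_integral_nonzero:
  "\<exists>l\<ge>1. exp (mtrace ((l *\<^sub>R s) ** (l *\<^sub>R s))) * (\<integral>y. Gz (l *\<^sub>R s) (- (of_real l * \<i>)) y * jac (- (of_real l * \<i>)) y \<partial>LM II) \<noteq> 0"
proof -
  define l where "l n = real (Suc n)" for n
  have l1: "1 \<le> l n" and l0: "l n > 0" for n by (simp_all add: l_def)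
  define f where "f n y = exp (mtrace ((l n *\<^sub>R s) ** (l n *\<^sub>R s))) * Gz (l n *\<^sub>R s) (- (of_real (l n) * \<i>)) y * jac (- (of_real (l n) * \<i>)) y" for n y
  define c where "c n j = (if j < dp then 1 / l n else 1)" for n and j :: nat
  define N where "N n y i j = complex_of_real (c n j) * Mz (- (of_real (l n) * \<i>)) i j (shrink (l n) y)" for n y i j
  define e where "e n y = exp (- complex_of_real ((norm (Xv y))\<^sup>2 + (norm (l n *\<^sub>R (mexp ((1 / l n) *\<^sub>R Yv y) - mexp (- ((1 / l n) *\<^sub>R Yv y)))))\<^sup>2)
        - 2 * \<i> * mtrace ((l n *\<^sub>R (PS ((1 / l n) *\<^sub>R Yv y) (Xv y) - Xv y)) ** s))" for n y
  define F where "F n y = e n y * gdet m (N n y)" for n y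
  have fm: "f n \<in> borel_measurable (LM II)" for n
    unfolding f_def[abs_def] by (intro borel_measurable_times borel_measurable_const Gz_measurable jac_measurable)
  have Ff: "F n y = (\<Prod>j<m. \<bar>c n j\<bar>) *\<^sub>R f n (shrink (l n) y)" for n y
  proof -
    have "gdet m (N n y) = (\<Prod>j<m. complex_of_real (c n j)) * jac (- (of_real (l n) * \<i>)) (shrink (l n) y)"
      unfolding N_def gdet_col_scale jac_Mz ..
    moreover have "(\<Prod>j<m. \<bar>c n j\<bar>) = (\<Prod>j<m. c n j)"
      using l0[of n] by (intro prod.cong) (auto simp: c_def)
    moreover have "exp (mtrace ((l n *\<^sub>R s) ** (l n *\<^sub>R s))) * Gz (l n *\<^sub>R s) (- (of_real (l n) * \<i>)) (shrink (l n) y) = e n y"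
      unfolding Gz_scaled_s
      by (simp add: Yv_shrink Xv_shrink e_def mm.scaleR_left mtrace_scaleR scaleR_conv_of_real[where 'a = complex] mult.assoc)
    ultimately show ?thesis unfolding F_def f_def by (simp add: scaleR_conv_of_real mult_ac)
  qed
  have shr: "shrink (l n) = (\<lambda>y. \<lambda>i\<in>II. 0 + c n i * y i)" for n
    unfolding shrink_def c_def by (intro ext) simp
  have intF: "(\<integral>y. f n y \<partial>LM II) = (\<integral>y. F n y \<partial>LM II)" for n
    unfolding Ff shr integral_scaleR_right
    by (rule integral_LM_affine[OF _ _ fm]) (use l0[of n] in \<open>auto simp: c_def\<close>)
  obtain C where C: "C > 0"
    "\<And>j y X. j < m \<Longrightarrow> norm (D j y X) \<le> C * exp (4 * norm (Yv y)) * (1 + norm X)"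
    "\<And>j y. j < m \<Longrightarrow> norm (E j y) \<le> C * exp (4 * norm (Yv y))"
    "\<And>j k y X. j < m \<Longrightarrow> k < m \<Longrightarrow> norm (DD j k y X) \<le> C * exp (4 * norm (Yv y)) * (1 + norm X)"
    "\<And>Y X :: complex^'n^'n. norm (PS Y X) \<le> C * exp (4 * norm Y) * norm X"
    using frame_bounds by blast
  obtain K where K: "K > 0" "\<And>i v. i < length bQ \<Longrightarrow> \<bar>co i v\<bar> \<le> K * norm v"
    using dual_norm_bound[OF bQ] by blast
  have expY: "exp (4 * norm (Yv (shrink (l n) y))) \<le> exp (4 * norm (Yv y))" for n y
  proof -
    have "norm (Yv y) / l n \<le> norm (Yv y) / 1" using l1[of n] by (intro divide_left_mono) auto
    then show ?thesis using l0[of n] by (simp add: Yv_shrink)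
  qed
  have Nb: "norm (N n y i j) \<le> 2 * K * C * \<Gamma> y" if i: "i < m" and j: "j < m" for n y i j
  proof -
    let ?y = "shrink (l n) y"
    have dD: "\<bar>co i (D j ?y (Xv ?y))\<bar> \<le> K * (C * \<Gamma> y)"
    proof -
      have "norm (D j ?y (Xv ?y)) \<le> C * exp (4 * norm (Yv ?y)) * (1 + norm (Xv ?y))" by (rule C(2)[OF j])
      also have "\<dots> \<le> C * exp (4 * norm (Yv y)) * (1 + norm (Xv ?y))"
        using C(1) expY[of n y] by (intro mult_right_mono mult_left_mono) auto
      finally have "norm (D j ?y (Xv ?y)) \<le> C * \<Gamma> y" by (simp add: Xv_shrink \<Gamma>_def)
      then show ?thesis using K(1) i dim_Q by (intro order_trans[OF K(2) mult_left_mono]) auto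
    qed
    have dE: "\<bar>co i (E j ?y)\<bar> \<le> K * (C * \<Gamma> y)"
    proof -
      have "norm (E j ?y) \<le> C * exp (4 * norm (Yv ?y))" by (rule C(3)[OF j])
      also have "\<dots> \<le> C * (exp (4 * norm (Yv y)) * (1 + norm (Xv y)))"
        using C(1) expY[of n y] by (intro mult_left_mono order_trans[OF expY]) auto
      finally have "norm (E j ?y) \<le> C * \<Gamma> y" by (simp add: \<Gamma>_def)
      then show ?thesis using K(1) i dim_Q by (intro order_trans[OF K(2) mult_left_mono]) auto
    qed
    have c1: "\<bar>c n j\<bar> \<le> 1" using l1[of n] by (auto simp: c_def)
    \<comment> \<open>The growing factor l appears only together with \<open>E\<close>, which
      vanishes on the Q_+-columns and meets c = 1 / l on the others.\<close>
    have cE: "\<bar>c n j\<bar> * l n * \<bar>co i (E j ?y)\<bar> \<le> K * (C * \<Gamma> y)"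
    proof (cases "j < dp")
      case True then show ?thesis using dE l0[of n] by (simp add: c_def)
    next
      case False then show ?thesis using K C(1) \<Gamma>_ge1[of y] by (simp add: E_def linear_0[OF co_linear])
    qed
    have "norm (N n y i j) \<le> \<bar>c n j\<bar> * \<bar>co i (D j ?y (Xv ?y))\<bar> + \<bar>c n j\<bar> * l n * \<bar>co i (E j ?y)\<bar>"
      unfolding N_def Mz_def distrib_left using l0[of n]
      by (intro order_trans[OF norm_triangle_ineq]) (simp add: norm_mult)
    also have "\<dots> \<le> 1 * (K * (C * \<Gamma> y)) + K * (C * \<Gamma> y)"
      by (intro add_mono mult_mono c1 dD cE) auto
    finally show ?thesis by (simp add: mult_ac)
  qed
  have eb: "norm (e n y) \<le> exp (- (norm (Xv y))\<^sup>2 / 2 - 1 * (norm (Yv y))\<^sup>2)" for n y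
  proof -
    let ?Y = "(1 / l n) *\<^sub>R Yv y"
    have Y: "?Y \<in> p" by (intro subspace_mul[OF subspace_p] Yv_p)
    have "PS ?Y (Xv y) - Xv y \<in> Q" using Y p_sub by (intro subspace_diff[OF subspace_Q] PS_in_Q Xv_Q) auto
    then have r: "Im (mtrace ((l n *\<^sub>R (PS ?Y (Xv y) - Xv y)) ** s)) = 0"
      by (intro mtrace_Q_real subspace_mul[OF subspace_Q] s_in_Q)
    \<comment> \<open>The bound |e^Y|^2 - n >= 2 |Y|^2 is invariant under this rescaling, so the
      decay in Y is uniform in n.\<close>
    have "4 * (norm (Yv y))\<^sup>2 = (l n)\<^sup>2 * (4 * (norm ?Y)\<^sup>2)"
      using l0[of n] by (simp add: power_divide)
    also have "\<dots> \<le> (l n)\<^sup>2 * (norm (mexp ?Y - mexp (- ?Y)))\<^sup>2"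
      unfolding norm_mexp_diff_sq[OF Y] using tau_ge[OF Y] by (intro mult_left_mono) auto
    also have "\<dots> = (norm (l n *\<^sub>R (mexp ?Y - mexp (- ?Y))))\<^sup>2" by (simp add: power_mult_distrib)
    finally have g: "4 * (norm (Yv y))\<^sup>2 \<le> (norm (l n *\<^sub>R (mexp ?Y - mexp (- ?Y))))\<^sup>2" .
    have "norm (e n y) = exp (- ((norm (Xv y))\<^sup>2 + (norm (l n *\<^sub>R (mexp ?Y - mexp (- ?Y))))\<^sup>2))"
      unfolding e_def norm_exp_eq_Re using r by simp
    also have "\<dots> \<le> exp (- (norm (Xv y))\<^sup>2 / 2 - 1 * (norm (Yv y))\<^sup>2)"
      using g zero_le_power2[of "norm (Yv y)"] zero_le_power2[of "norm (Xv y)"] unfolding exp_le_cancel_iff by linarith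
    finally show ?thesis .
  qed
  obtain a where a: "a > 0" "\<And>N. \<exists>C>0. \<forall>y. \<Gamma> y ^ N * exp (- (norm (Xv y))\<^sup>2 / 2 - 1 * (norm (Yv y))\<^sup>2) \<le> C * exp (- (a * sqsum II y))"
    using gaussian_dominates[of 1] by auto
  obtain C1 where C1: "C1 > 0" "\<And>y. \<Gamma> y ^ m * exp (- (norm (Xv y))\<^sup>2 / 2 - 1 * (norm (Yv y))\<^sup>2) \<le> C1 * exp (- (a * sqsum II y))"
    using a(2)[of m] by blast
  define B where "B = fact m * (2 * K * C) ^ m * C1"
  have Fb: "norm (F n y) \<le> B * exp (- (a * sqsum II y))" for n y
  proof -
    have KC: "0 \<le> 2 * K * C" using K(1) C(1) by simp
    have "norm (F n y) \<le> exp (- (norm (Xv y))\<^sup>2 / 2 - 1 * (norm (Yv y))\<^sup>2) * (fact m * (2 * K * C * \<Gamma> y) ^ m)"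
      unfolding F_def norm_mult by (intro mult_mono eb norm_gdet_le Nb) auto
    also have "\<dots> = fact m * (2 * K * C) ^ m * (\<Gamma> y ^ m * exp (- (norm (Xv y))\<^sup>2 / 2 - 1 * (norm (Yv y))\<^sup>2))"
      unfolding power_mult_distrib by (simp only: mult_ac)
    also have "\<dots> \<le> fact m * (2 * K * C) ^ m * (C1 * exp (- (a * sqsum II y)))"
      using KC C1(2)[of y] by (intro mult_left_mono) auto
    finally show ?thesis by (simp add: B_def)
  qed
  define dd where "dd j = (if j < dp then - 2 * \<i> else 1)" for j
  define g where "g y = exp (- ((norm (Xv y))\<^sup>2 + (norm (2 *\<^sub>R Yv y))\<^sup>2))" for y
  define cc where "cc = gdet m (\<lambda>i j. dd j * of_real (co i (limit_frame j)))"
  have elim: "(\<lambda>n. e n y) \<longlonglongrightarrow> of_real (g y)" for y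
  proof -
    have "(\<lambda>n. mtrace ((l n *\<^sub>R (PS ((1 / l n) *\<^sub>R Yv y) (Xv y) - Xv y)) ** s)) \<longlonglongrightarrow> mtrace ((Yv y ** Xv y - Xv y ** Yv y) ** s)"
      unfolding l_def by (intro bounded_linear.tendsto[OF bounded_linear_mtrace] mm.tendsto tendsto_const PS_rescaled_tendsto)
    moreover have "(\<lambda>n. l n *\<^sub>R (mexp ((1 / l n) *\<^sub>R Yv y) - mexp (- ((1 / l n) *\<^sub>R Yv y)))) \<longlonglongrightarrow> 2 *\<^sub>R Yv y"
      unfolding l_def by (rule sinh_rescaled_tendsto)
    moreover have "(\<lambda>n. exp (- complex_of_real (x + (norm (v n))\<^sup>2) - 2 * \<i> * u n)) \<longlonglongrightarrow> exp (- complex_of_real (x + (norm V)\<^sup>2) - 2 * \<i> * U)"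
      if "u \<longlonglongrightarrow> U" "v \<longlonglongrightarrow> V" for u U x and v :: "nat \<Rightarrow> complex^'n^'n" and V
      by (intro tendsto_intros that)
    ultimately have "(\<lambda>n. e n y) \<longlonglongrightarrow> exp (- complex_of_real ((norm (Xv y))\<^sup>2 + (norm (2 *\<^sub>R Yv y))\<^sup>2)
        - 2 * \<i> * mtrace ((Yv y ** Xv y - Xv y ** Yv y) ** s))"
      unfolding e_def by blast
    then show ?thesis
      unfolding mtrace_bracket_s[OF Yv_p Xv_Qp] g_def by (simp add: exp_of_real[symmetric])
  qed
  have Nlim: "(\<lambda>n. N n y i j) \<longlonglongrightarrow> dd j * of_real (co i (limit_frame j))" if i: "i < m" and j: "j < m" for y i j
  proof (cases "j < dp")
    case True
    have "(\<lambda>n. dPS ((1 / l n) *\<^sub>R Yv y) (bp ! j) X) \<longlonglongrightarrow> bp ! j ** X - X ** bp ! j" for X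
      using isCont_inverse_Suc_tendsto[OF dPS_line_isCont, of "Yv y" "bp ! j" X] by (simp add: dPS_zero l_def)
    note T = tendsto_of_real[OF bounded_linear.tendsto[OF bounded_linear_co this], where 'a = complex]
    have "(\<lambda>n. complex_of_real (1 / l n) * of_real (co i (dPS ((1 / l n) *\<^sub>R Yv y) (bp ! j) (Xv y)))
          - \<i> * of_real (co i (dPS ((1 / l n) *\<^sub>R Yv y) (bp ! j) s)))
       \<longlonglongrightarrow> complex_of_real 0 * of_real (co i (bp ! j ** Xv y - Xv y ** bp ! j)) - \<i> * of_real (co i (bp ! j ** s - s ** bp ! j))"
      by (intro tendsto_diff tendsto_mult T tendsto_const tendsto_of_real) (use inverse_Suc_tendsto in \<open>simp add: l_def\<close>)
    moreover have "complex_of_real (1 / l n) * of_real (co i (dPS ((1 / l n) *\<^sub>R Yv y) (bp ! j) (Xv y)))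
          - \<i> * of_real (co i (dPS ((1 / l n) *\<^sub>R Yv y) (bp ! j) s)) = N n y i j" for n
      using True l0[of n] by (simp add: N_def Mz_def D_def E_def c_def Yv_shrink Xv_shrink diff_divide_distrib)
    moreover have "co i (bp ! j ** s - s ** bp ! j) = 2 * co i (bp ! j ** s)"
      unfolding p_anti[OF bp_p[OF True]] diff_minus_eq_add linear_add[OF co_linear] by simp
    ultimately show ?thesis using True by (simp add: dd_def limit_frame_def mult_ac)
  next
    case False
    have "(\<lambda>n. PS ((1 / l n) *\<^sub>R Yv y) (bq ! (j - dp))) \<longlonglongrightarrow> bq ! (j - dp)"
      using isCont_inverse_Suc_tendsto[OF PS_line_isCont, of "Yv y" "bq ! (j - dp)"] by (simp add: PS_zero l_def)
    from tendsto_of_real[OF bounded_linear.tendsto[OF bounded_linear_co this], where 'a = complex, of i]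
    show ?thesis using False
      by (simp add: N_def Mz_def D_def E_def c_def Yv_shrink dd_def limit_frame_def linear_0[OF co_linear])
  qed
  have Flim: "(\<lambda>n. F n y) \<longlonglongrightarrow> of_real (g y) * cc" for y
    unfolding F_def cc_def by (intro tendsto_mult elim gdet_tendsto Nlim)
  have Fm: "F n \<in> borel_measurable (LM II)" for n
  proof -
    have "(\<lambda>y. \<lambda>i\<in>II. 0 + c n i * y i) \<in> measurable (LM II) (LM II)"
      by (intro measurable_restrict) measurable
    then show ?thesis
      unfolding Ff[abs_def] shr by (intro borel_measurable_scaleR borel_measurable_const measurable_compose[OF _ fm])
  qed
  have gm: "g \<in> borel_measurable (LM II)"
    unfolding g_def[abs_def] by measurable
  have int_lim: "(\<lambda>n. \<integral>y. F n y \<partial>LM II) \<longlonglongrightarrow> (\<integral>y. of_real (g y) * cc \<partial>LM II)"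
  proof (rule integral_dominated_convergence[where w = "\<lambda>y. B * exp (- (a * sqsum II y))"])
    show "(\<lambda>y. of_real (g y) * cc) \<in> borel_measurable (LM II)"
      by (intro borel_measurable_times borel_measurable_const of_real_measurable gm)
    show "integrable (LM II) (\<lambda>y. B * exp (- (a * sqsum II y)))"
      by (intro integrable_mult_right integrable_LM_gaussian a(1)) simp
  qed (use Fm Flim Fb in auto)
  have gi: "integrable (LM II) g"
  proof (rule integrable_gaussian_bound[OF _ a(1) gm])
    show "norm (g y) \<le> C1 * exp (- (a * sqsum II y))" for y
    proof -
      have "norm (g y) \<le> 1 * exp (- (norm (Xv y))\<^sup>2 / 2 - 1 * (norm (Yv y))\<^sup>2)"
        using zero_le_power2[of "norm (Yv y)"] zero_le_power2[of "norm (Xv y)"]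
        unfolding g_def norm_scaleR power_mult_distrib real_norm_def abs_exp_cancel mult_1 exp_le_cancel_iff abs_numeral power2_eq_square[of "2::real"] by linarith
      also have "\<dots> \<le> \<Gamma> y ^ m * exp (- (norm (Xv y))\<^sup>2 / 2 - 1 * (norm (Yv y))\<^sup>2)"
        by (intro mult_right_mono one_le_power \<Gamma>_ge1) auto
      also have "\<dots> \<le> C1 * exp (- (a * sqsum II y))" by (rule C1(2))
      finally show ?thesis .
    qed
  qed simp
  have "(\<integral>y. g y \<partial>LM II) \<noteq> 0"
  proof
    assume g0: "(\<integral>y. g y \<partial>LM II) = 0"
    have "AE y in LM II. 0 \<le> g y" by (simp add: g_def)
    then have "AE y in LM II. g y = 0"
      using integral_nonneg_eq_0_iff_AE[OF gi] g0 by blast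
    then have "AE y in LM II. exp (- (a * sqsum II y)) = 0" by (simp add: g_def)
    then have "(\<integral>y. exp (- (a * sqsum II y)) \<partial>LM II) = 0"
      by (subst integral_cong_AE[where g = "\<lambda>_. 0"]) auto
    then show False using integral_LM_gaussian_pos[OF _ a(1), of II] by simp
  qed
  moreover have "cc \<noteq> 0"
    unfolding cc_def gdet_col_scale of_real_gdet[symmetric]
    using limit_frame_gdet_nonzero by (simp add: dd_def)
  ultimately have nz: "(\<integral>y. of_real (g y) * cc \<partial>LM II) \<noteq> 0"
    using gi by simp
  have "\<exists>n. (\<integral>y. F n y \<partial>LM II) \<noteq> 0"
  proof (rule ccontr)
    assume "\<nexists>n. (\<integral>y. F n y \<partial>LM II) \<noteq> 0"
    then have "(\<lambda>n. \<integral>y. F n y \<partial>LM II) \<longlonglongrightarrow> 0" by simp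
    then show False using nz LIMSEQ_unique[OF int_lim] by blast
  qed
  then obtain n where "(\<integral>y. f n y \<partial>LM II) \<noteq> 0" using intF by auto
  then show ?thesis using l1[of n] unfolding f_def by (intro exI[of _ "l n"]) (simp add: mult.assoc)
qed

text \<open>\<open>J A b\<close> does not depend on b, since it is determined by a limit in which b
  does not occur, nor on A among sources sharing a bound. With b = min l L every admissible A is
  compared to L s, whose value at b = L is known to be nonzero.\<close>

lemma limit_regulated_constant:
  obtains c where "c \<noteq> 0" "\<And>A. A \<in> Q \<Longrightarrow> pos_def (A ** s) \<Longrightarrow>
    ((\<lambda>\<epsilon>. integral\<^sup>L (LM II) (PSintegrand s A \<epsilon> bp bq bQ)) \<longlongrightarrow> c * exp (- mtrace (A ** A))) (at_right 0)"
proof -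
  define J where "J A b = exp (mtrace (A ** A)) * (\<integral>y. Gz A (- (of_real b * \<i>)) y * jac (- (of_real b * \<i>)) y \<partial>LM II)" for A b
  have lim: "((\<lambda>\<epsilon>. integral\<^sup>L (LM II) (PSintegrand s A \<epsilon> bp bq bQ)) \<longlongrightarrow> J A b * exp (- mtrace (A ** A))) (at_right 0)"
    if "A \<in> Q" "pos_bound A l" "0 < b" "b \<le> l" for A l b
  proof -
    have "J A b * exp (- mtrace (A ** A)) = (\<integral>y. jac (- (of_real b * \<i>)) y * integrand s A 0 (PS (Yv y) (Xv y - csc (of_real b * \<i>) s)) \<partial>LM II)"
      unfolding J_def Gz_integrand csc_minus_left exp_minus by (simp add: mult.commute[of _ "jac _ _"])
    then show ?thesis using limit_regulated[OF that] by simp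
  qed
  have Jb: "J A b = J A b'" if A: "A \<in> Q" "pos_bound A l" and b: "0 < b" "b \<le> l" "0 < b'" "b' \<le> l" for A l b b'
    using tendsto_unique[OF _ lim[OF A b(1,2)] lim[OF A b(3,4)]] by simp
  have JA: "J A b = J A' b" if "A \<in> Q" "pos_bound A l" "A' \<in> Q" "pos_bound A' l" "0 < b" "b \<le> l" for A A' l b
    unfolding J_def by (rule weighted_integral_constant[OF that(3,4) that(1,2) that(5,6)])
  obtain L where L: "1 \<le> L" "J (L *\<^sub>R s) L \<noteq> 0"
    unfolding J_def using scaled_integral_nonzero by blast
  have LQ: "L *\<^sub>R s \<in> Q" "pos_bound (L *\<^sub>R s) L"
    using L(1) by (auto intro!: subspace_mul[OF subspace_Q] s_in_Q pos_bound_s)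
  show ?thesis
  proof (rule that[OF L(2)])
    fix A assume A: "A \<in> Q" "pos_def (A ** s)"
    obtain l where l: "l > 0" "pos_bound A l" using pos_bound_exists[OF A(2)] by blast
    define b where "b = min l L"
    have b: "0 < b" "b \<le> l" "b \<le> L" using l L by (auto simp: b_def)
    have "J A b = J (L *\<^sub>R s) b"
      by (rule JA[OF A(1) pos_bound_mono[OF l(2) b(2)] LQ(1) pos_bound_mono[OF LQ(2) b(3)] b(1) order_refl])
    also have "\<dots> = J (L *\<^sub>R s) L" by (rule Jb[OF LQ b(1,3)]) (use L in auto)
    finally show "((\<lambda>\<epsilon>. integral\<^sup>L (LM II) (PSintegrand s A \<epsilon> bp bq bQ)) \<longlongrightarrow> J (L *\<^sub>R s) L * exp (- mtrace (A ** A))) (at_right 0)"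
      using lim[OF A(1) l(2) b(1,2)] by simp
  qed
qed

end

theorem theorem2p1:
  fixes s :: "complex^'n^'n"
    and tes :: "((complex^'n^'n \<Rightarrow> complex^'n^'n) \<times> real) list"
    and bp bq bQ :: "(complex^'n^'n) list"
  assumes herm_s: "hermitian s"
    and s_sq: "s ** s = mat 1"
    and taus: "\<forall>(t,e)\<in>set tes. inv_lie_aut t \<and> e \<in> {1, -1} \<and> s = e *\<^sub>R t s"
    and comm_theta_gamma: "theta s \<circ> gamma s = gamma s \<circ> theta s"
    and comm_taus_theta: "\<forall>(t,e)\<in>set tes. t \<circ> theta s = theta s \<circ> t"
    and comm_taus_gamma: "\<forall>(t,e)\<in>set tes. t \<circ> gamma s = gamma s \<circ> t"
    and comm_taus: "\<forall>(t,e)\<in>set tes. \<forall>(t',e')\<in>set tes. t \<circ> t' = t' \<circ> t"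
    and K_closed: "closedin (top_of_set {M. invertible M}) (Kgroup (kset s tes))"
    and bp: "ordered_basis bp (pset s tes)"
    and bq: "ordered_basis bq (Qplus s tes)"
    and bQ: "ordered_basis bQ (Qset s tes)"
  shows "\<exists>c::complex. c \<noteq> 0 \<and>
    (\<forall>A \<in> Qset s tes. pos_def (A ** s) \<longrightarrow>
       (\<forall>\<epsilon>>0. integrable (PSdomain bp bq) (PSintegrand s A \<epsilon> bp bq bQ)) \<and>
       ((\<lambda>\<epsilon>. integral\<^sup>L (PSdomain bp bq) (PSintegrand s A \<epsilon> bp bq bQ))
          \<longlongrightarrow> c * exp (- mtrace (A ** A))) (at_right 0))"
proof -
  interpret ps_bases s tes bp bq bQ
    by unfold_locales (fact herm_s s_sq taus comm_taus_theta bp bq bQ)+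
  show ?thesis
    using limit_regulated_constant regulated_integrable unfolding PSdomain_eq by metis
qed

end
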